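(* Let $G$ be a DAG on $\{1,\dots,K\}$ such that for every $k$ the set $\mathrm{pa}(k)$ is fully connected, and let $\mu\in\mathcal{P}_G$ satisfy the TV-Lipschitz condition with constant $L$ (see context). Let $n\ge1$, $\eta=\lfloor\frac{\log_2(n)}{2+d_{\rm loc}}\rfloor$, let $\mathcal{A}$ be the partition of $\mathcal{X}$ into cubes of side length $2^{-\eta}$, let $\hat\mu$ be the empirical measure of $n$ i.i.d. samples from $\mu$, and let $\hat\mu^{b\mathcal{A}}=(\hat\mu)^{b\mathcal{A}}$ (see context). Then $$\mathbb{E}\left[\mathcal{W}(\mu,\hat\mu^{b\mathcal{A}})\right]\le C\cdot l_n\cdot\left(n^{-2/(2+d_{\rm loc})}+n^{-1/d_{\rm max}}\right),$$ where $C$ is a constant depending only on $L$, $G$ and $(d_k)_{k=1}^K$, and where $$l_n=\begin{cases}\max\{1,\log(n)\}&\text{if }n^{-2/(2+d_{\rm loc})}\ge n^{-1/d_{\rm max}}\text{ and }d_{\rm loc}=d_k+d_{\mathrm{pa}(k)}\text{ for some }k\text{ with }d_k=2,\\ \max\{1,\log(n)\}&\text{if }n^{-2/(2+d_{\rm loc})}\le n^{-1/d_{\rm max}}\text{ and }\max_{k}d_k=2,\\1&\text{otherwise.}\end{cases}$$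
   Context: Setting: $G$ is a directed acyclic graph with nodes $\{1,\dots,K\}$, topologically sorted (every edge $i\to j$ has $i<j$); $\mathrm{pa}(k)$ is the set of parents of $k$ and $\mathrm{pre}(k)=\{1,\dots,k-1\}\setminus\mathrm{pa}(k)$. A set $J$ of nodes is fully connected if there is an edge $k\to\ell$ for all $k,\ell\in J$ with $k<\ell$. $\mathcal{X}=[0,1]^d=\mathcal{X}_1\times\dots\times\mathcal{X}_K$ with $\mathcal{X}_k=[0,1]^{d_k}$, $\mathcal{X}_I=\prod_{i\in I}\mathcal{X}_i$, $x_I=(x_i)_{i\in I}$. $\|\cdot\|$ is the sup-norm. $\mathcal{P}_G$ is the set of Borel probability measures $\mu$ on $\mathcal{X}$ with $\mu(dx)=\prod_{k=1}^K\mu(dx_k\mid x_{\mathrm{pa}(k)})$ (regular conditional distributions; marginal if $\mathrm{pa}(k)=\emptyset$). $\mathcal{W}$ is the first-order Wasserstein distance w.r.t. $\|\cdot\|$; $\mathrm{TV}(\nu,\tilde\nu)=\sup_f(\int f\,d\nu-\int f\,d\tilde\nu)$ over measurable $|f|\le1/2$. TV-Lipschitz condition with constant $L$ for $\mu\in\mathcal{P}_G$: for all $2\le k\le K$, all $x_{\mathrm{pa}(k)},\tilde x_{\mathrm{pa}(k)}\in\mathcal{X}_{\mathrm{pa}(k)}$ and all $x_k,\tilde x_k\in\mathcal{X}_k$: $\mathrm{TV}(\mu(dx_k\mid x_{\mathrm{pa}(k)}),\mu(dx_k\mid\tilde x_{\mathrm{pa}(k)}))\le L\|x_{\mathrm{pa}(k)}-\tilde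 x_{\mathrm{pa}(k)}\|$; $\mathrm{TV}(\mu(dx_{\mathrm{pre}(k)}\mid x_{\mathrm{pa}(k)}),\mu(dx_{\mathrm{pre}(k)}\mid\tilde x_{\mathrm{pa}(k)}))\le L\|x_{\mathrm{pa}(k)}-\tilde x_{\mathrm{pa}(k)}\|$; $\mathrm{TV}(\mu(dx_{\mathrm{pa}(k)}\mid x_k),\mu(dx_{\mathrm{pa}(k)}\mid\tilde x_k))\le L\|x_k-\tilde x_k\|$. (I.e. the conditional distributions admit versions with these properties; conditions involving empty index sets are void.) $d_{\mathrm{pa}(k)}=\sum_{\ell\in\mathrm{pa}(k)}d_\ell$, $d_{\rm loc}=\max_k(\max\{2,d_k\}+d_{\mathrm{pa}(k)})$, $d_{\rm max}=\max_k\max\{2,d_k\}$. Smoothing operation: for $\eta\in\mathbb{N}\cup\{0\}$, $\mathcal{A}$ is the partition of $\mathcal{X}$ into $2^{\eta d}$ (grid) cubes of side length $2^{-\eta}$, $\mathcal{A}_S$ the induced partition of $\mathcal{X}_S$, $\mathcal{A}_k=\mathcal{A}_{\{k\}}$, and $c_S(x_S)$ the cell of $\mathcal{A}_S$ containing $x_S$. For $\nu\in\mathcal{P}(\mathcal{X})$, $\nu_k$ is its $k$-th marginal and $\nu_{k|c_k}$ is $\nu_k$ conditioned on $c_k$ (Dirac at the midpoint of $c_k$ if $\nu_k(c_k)=0$). Set $\nu^{b\mathcal{A}}(dx_k\mid x_{\mathrm{pa}(k)})=\sum_{c_k\in\mathcal{A}_k}\nu(c_k\mid c_{\mathrm{pa}(k)}(x_{\mathrm{pa}(k)}))\,\nu_{k|c_k}(dx_k)$,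 where $\nu(c_k\mid c_{\mathrm{pa}(k)})$ is the conditional probability under $\nu$ that the $k$-th coordinate lies in $c_k$ given that the parent coordinates lie in $c_{\mathrm{pa}(k)}$ (simply $\nu_k(c_k)$ if $\mathrm{pa}(k)=\emptyset$; the choice for parent cells of $\nu$-mass zero is irrelevant), and $\nu^{b\mathcal{A}}(dx)=\prod_{k=1}^K\nu^{b\mathcal{A}}(dx_k\mid x_{\mathrm{pa}(k)})$. *)

theory Defs
  imports "HOL-Probability.Probability"
begin

section \<open>Directed acyclic graphs\<close>

text \<open>A topologically sorted DAG on the nodes \<open>1, \<dots>, K\<close> is given by its edge set \<open>E\<close>.\<close>

definition sorted_dag :: "nat \<Rightarrow> (nat \<times> nat) set \<Rightarrow> bool" where
  "sorted_dag K E \<longleftrightarrow> (\<forall>(i, j) \<in> E. 1 \<le> i \<and> i < j \<and> j \<le> K)"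

definition pa :: "(nat \<times> nat) set \<Rightarrow> nat \<Rightarrow> nat set" where
  "pa E k = {i. (i, k) \<in> E}"

definition pre :: "(nat \<times> nat) set \<Rightarrow> nat \<Rightarrow> nat set" where
  "pre E k = {1..<k} - pa E k"

definition fully_connected :: "(nat \<times> nat) set \<Rightarrow> nat set \<Rightarrow> bool" where
  "fully_connected E J \<longleftrightarrow> (\<forall>k\<in>J. \<forall>l\<in>J. k < l \<longrightarrow> (k, l) \<in> E)"


section \<open>The spaces \<open>X\<^sub>S\<close>\<close>

text \<open>
  A point of the product over \<open>k \<in> S\<close> of the cubes \<open>[0,1]^(d k)\<close> is a function on the pairs
  \<open>(k, j)\<close> with \<open>k \<in> S\<close> and \<open>j < d k\<close>, equal to \<open>undefined\<close> elsewhere. As there are finitely many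
  coordinates, the product sigma-algebra is the Borel one. For \<open>S = {}\<close> the space is a single
  point.
\<close>

type_synonym point = "nat \<times> nat \<Rightarrow> real"

definition coords :: "(nat \<Rightarrow> nat) \<Rightarrow> nat set \<Rightarrow> (nat \<times> nat) set" where
  "coords d S = Sigma S (\<lambda>k. {..<d k})"

definition cube_space :: "(nat \<Rightarrow> nat) \<Rightarrow> nat set \<Rightarrow> point measure" where
  "cube_space d S = PiM (coords d S) (\<lambda>_. restrict_space borel {0..1})"

definition proj :: "(nat \<Rightarrow> nat) \<Rightarrow> nat set \<Rightarrow> point \<Rightarrow> point" where
  "proj d S x = restrict x (coords d S)"

definition marginal :: "(nat \<Rightarrow> nat) \<Rightarrow> nat set \<Rightarrow> point measure \<Rightarrow> point measure" where
  "marginal d S \<nu> = distr \<nu> (cube_space d S) (proj d S)"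

text \<open>The inserted \<open>0\<close> only matters for \<open>S = {}\<close>.\<close>

definition sup_dist :: "(nat \<Rightarrow> nat) \<Rightarrow> nat set \<Rightarrow> point \<Rightarrow> point \<Rightarrow> real" where
  "sup_dist d S x y = Max (insert 0 ((\<lambda>i. \<bar>x i - y i\<bar>) ` coords d S))"


section \<open>Distances between measures\<close>

definition tv_dist :: "'a measure \<Rightarrow> 'a measure \<Rightarrow> real" where
  "tv_dist \<nu> \<nu>' =
     (SUP f\<in>{f \<in> borel_measurable \<nu>. \<forall>x. \<bar>f x\<bar> \<le> 1 / 2}. (\<integral>x. f x \<partial>\<nu>) - (\<integral>x. f x \<partial>\<nu>'))"

definition couplings :: "'a measure \<Rightarrow> 'a measure \<Rightarrow> ('a \<times> 'a) measure set" where
  "couplings \<mu> \<nu> = {\<pi>. sets \<pi> = sets (\<mu> \<Otimes>\<^sub>M \<nu>) \<and> distr \<pi> \<mu> fst = \<mu> \<and> distr \<pi> \<nu> snd = \<nu>}"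

definition wasserstein :: "('a \<Rightarrow> 'a \<Rightarrow> real) \<Rightarrow> 'a measure \<Rightarrow> 'a measure \<Rightarrow> ennreal" where
  "wasserstein D \<mu> \<nu> = (INF \<pi>\<in>couplings \<mu> \<nu>. \<integral>\<^sup>+z. ennreal (D (fst z) (snd z)) \<partial>\<pi>)"


section \<open>Graph-compatible measures and the TV-Lipschitz condition\<close>

text \<open>\<open>\<kappa>\<close> is a version of the regular conditional distribution of \<open>x\<^sub>T\<close> given \<open>x\<^sub>S\<close> under \<open>\<mu>\<close>.\<close>

definition reg_cond_distr ::
  "(nat \<Rightarrow> nat) \<Rightarrow> point measure \<Rightarrow> nat set \<Rightarrow> nat set \<Rightarrow> (point \<Rightarrow> point measure) \<Rightarrow> bool" where
  "reg_cond_distr d \<mu> S T \<kappa> \<longleftrightarrow>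
     \<kappa> \<in> cube_space d S \<rightarrow>\<^sub>M prob_algebra (cube_space d T) \<and>
     (\<forall>A\<in>sets (cube_space d S). \<forall>B\<in>sets (cube_space d T).
        emeasure \<mu> {x \<in> space \<mu>. proj d S x \<in> A \<and> proj d T x \<in> B} =
        (\<integral>\<^sup>+x. indicator A (proj d S x) * emeasure (\<kappa> (proj d S x)) B \<partial>\<mu>))"

text \<open>
  The measure on \<open>X_{1..m}\<close> obtained by drawing, for \<open>k = 1, \<dots>, m\<close> in turn, the component \<open>x\<^sub>k\<close>
  from \<open>\<kappa> k\<close> given the parent components already drawn.
\<close>

primrec kernel_product ::
  "(nat \<Rightarrow> nat) \<Rightarrow> (nat \<times> nat) set \<Rightarrow> (nat \<Rightarrow> point \<Rightarrow> point measure) \<Rightarrow> nat \<Rightarrow> point measure" where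
  "kernel_product d E \<kappa> 0 = return (cube_space d {}) (\<lambda>_. undefined)"
| "kernel_product d E \<kappa> (Suc m) =
     kernel_product d E \<kappa> m \<bind>
       (\<lambda>x. distr (\<kappa> (Suc m) (proj d (pa E (Suc m)) x)) (cube_space d {1..Suc m})
               (\<lambda>y. merge (coords d {1..m}) (coords d {Suc m}) (x, y)))"

definition graph_measures ::
  "nat \<Rightarrow> (nat \<Rightarrow> nat) \<Rightarrow> (nat \<times> nat) set \<Rightarrow> point measure set" where
  "graph_measures K d E =
     {\<mu>. prob_space \<mu> \<and> sets \<mu> = sets (cube_space d {1..K}) \<and>
         (\<exists>\<kappa>. (\<forall>k\<in>{1..K}. reg_cond_distr d \<mu> (pa E k) {k} (\<kappa> k)) \<and>
              \<mu> = kernel_product d E \<kappa> K)}"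

text \<open>
  Some version of the conditional distribution of \<open>x\<^sub>T\<close> given \<open>x\<^sub>S\<close> is Lipschitz in total
  variation; void if \<open>S\<close> or \<open>T\<close> is empty.
\<close>

definition tv_lipschitz_cond ::
  "(nat \<Rightarrow> nat) \<Rightarrow> real \<Rightarrow> point measure \<Rightarrow> nat set \<Rightarrow> nat set \<Rightarrow> bool" where
  "tv_lipschitz_cond d L \<mu> S T \<longleftrightarrow>
     (S \<noteq> {} \<and> T \<noteq> {} \<longrightarrow>
        (\<exists>\<kappa>. reg_cond_distr d \<mu> S T \<kappa> \<and>
             (\<forall>x\<in>space (cube_space d S). \<forall>y\<in>space (cube_space d S).
                tv_dist (\<kappa> x) (\<kappa> y) \<le> L * sup_dist d S x y)))"

definition tv_lipschitz ::
  "nat \<Rightarrow> (nat \<Rightarrow> nat) \<Rightarrow> (nat \<times> nat) set \<Rightarrow> real \<Rightarrow> point measure \<Rightarrow> bool" where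
  "tv_lipschitz K d E L \<mu> \<longleftrightarrow>
     (\<forall>k\<in>{2..K}. tv_lipschitz_cond d L \<mu> (pa E k) {k} \<and>
                 tv_lipschitz_cond d L \<mu> (pa E k) (pre E k) \<and>
                 tv_lipschitz_cond d L \<mu> {k} (pa E k))"


section \<open>Grid cells and the smoothing operation\<close>

text \<open>
  The unit interval is split into \<open>2 ^ \<eta>\<close> intervals of length \<open>2 ^ -\<eta>\<close>, closed on the left and open
  on the right except for the last one, which is closed. Cells of the induced partition of \<open>X\<^sub>S\<close> are
  addressed by their multi-indices \<open>q \<in> cell_indices d S \<eta>\<close>.
\<close>

definition grid_index :: "nat \<Rightarrow> real \<Rightarrow> nat" where
  "grid_index \<eta> t = min (nat \<lfloor>2 ^ \<eta> * t\<rfloor>) (2 ^ \<eta> - 1)"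

definition cell_indices :: "(nat \<Rightarrow> nat) \<Rightarrow> nat set \<Rightarrow> nat \<Rightarrow> (nat \<times> nat \<Rightarrow> nat) set" where
  "cell_indices d S \<eta> = (\<Pi>\<^sub>E i\<in>coords d S. {..<2 ^ \<eta>})"

definition cell :: "(nat \<Rightarrow> nat) \<Rightarrow> nat set \<Rightarrow> nat \<Rightarrow> (nat \<times> nat \<Rightarrow> nat) \<Rightarrow> point set" where
  "cell d S \<eta> q = {x \<in> space (cube_space d S). \<forall>i\<in>coords d S. grid_index \<eta> (x i) = q i}"

definition cell_of :: "(nat \<Rightarrow> nat) \<Rightarrow> nat set \<Rightarrow> nat \<Rightarrow> point \<Rightarrow> point set" where
  "cell_of d S \<eta> x = cell d S \<eta> (\<lambda>i\<in>coords d S. grid_index \<eta> (x i))"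

definition midpoint_of_cell ::
  "(nat \<Rightarrow> nat) \<Rightarrow> nat set \<Rightarrow> nat \<Rightarrow> (nat \<times> nat \<Rightarrow> nat) \<Rightarrow> point" where
  "midpoint_of_cell d S \<eta> q = (\<lambda>i\<in>coords d S. (real (q i) + 1 / 2) / 2 ^ \<eta>)"

text \<open>The \<open>k\<close>-th marginal conditioned on a cell.\<close>

definition marginal_in_cell ::
  "(nat \<Rightarrow> nat) \<Rightarrow> nat \<Rightarrow> point measure \<Rightarrow> nat \<Rightarrow> (nat \<times> nat \<Rightarrow> nat) \<Rightarrow> point measure" where
  "marginal_in_cell d \<eta> \<nu> k q =
     (if emeasure (marginal d {k} \<nu>) (cell d {k} \<eta> q) = 0
      then return (cube_space d {k}) (midpoint_of_cell d {k} \<eta> q)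
      else uniform_measure (marginal d {k} \<nu>) (cell d {k} \<eta> q))"

text \<open>
  The probability that \<open>x\<^sub>k\<close> lies in \<open>c\<close> given that the parent components lie in \<open>c'\<close>. If \<open>c'\<close> has mass
  zero the marginal probability of \<open>c\<close> is used, so that the smoothed kernels below are always
  probability kernels.
\<close>

definition cell_transition ::
  "(nat \<Rightarrow> nat) \<Rightarrow> (nat \<times> nat) set \<Rightarrow> point measure \<Rightarrow> nat \<Rightarrow> point set \<Rightarrow> point set \<Rightarrow> real" where
  "cell_transition d E \<nu> k c c' =
     (if \<P>(x in \<nu>. proj d (pa E k) x \<in> c') = 0
      then \<P>(x in \<nu>. proj d {k} x \<in> c)
      else \<P>(x in \<nu>. proj d {k} x \<in> c \<bar> proj d (pa E k) x \<in> c'))"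

definition smoothed_kernel ::
  "(nat \<Rightarrow> nat) \<Rightarrow> (nat \<times> nat) set \<Rightarrow> nat \<Rightarrow> point measure \<Rightarrow> nat \<Rightarrow> point \<Rightarrow> point measure" where
  "smoothed_kernel d E \<eta> \<nu> k x =
     measure_of (space (cube_space d {k})) (sets (cube_space d {k}))
       (\<lambda>B. \<Sum>q\<in>cell_indices d {k} \<eta>.
          ennreal (cell_transition d E \<nu> k (cell d {k} \<eta> q) (cell_of d (pa E k) \<eta> x)) *
          emeasure (marginal_in_cell d \<eta> \<nu> k q) B)"

definition smoothed ::
  "nat \<Rightarrow> (nat \<Rightarrow> nat) \<Rightarrow> (nat \<times> nat) set \<Rightarrow> nat \<Rightarrow> point measure \<Rightarrow> point measure" where
  "smoothed K d E \<eta> \<nu> = kernel_product d E (smoothed_kernel d E \<eta> \<nu>) K"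


section \<open>Empirical measures, dimensions and the rate\<close>

text \<open>The average of the Dirac measures at \<open>\<omega> 0, \<dots>, \<omega> (n - 1)\<close>.\<close>

definition empirical :: "nat \<Rightarrow> 'a measure \<Rightarrow> (nat \<Rightarrow> 'a) \<Rightarrow> 'a measure" where
  "empirical n X \<omega> = distr (uniform_count_measure {..<n}) X \<omega>"

definition d_pa :: "(nat \<Rightarrow> nat) \<Rightarrow> (nat \<times> nat) set \<Rightarrow> nat \<Rightarrow> nat" where
  "d_pa d E k = (\<Sum>l\<in>pa E k. d l)"

definition d_loc :: "nat \<Rightarrow> (nat \<Rightarrow> nat) \<Rightarrow> (nat \<times> nat) set \<Rightarrow> nat" where
  "d_loc K d E = (MAX k\<in>{1..K}. max 2 (d k) + d_pa d E k)"

definition d_max :: "nat \<Rightarrow> (nat \<Rightarrow> nat) \<Rightarrow> nat" where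
  "d_max K d = (MAX k\<in>{1..K}. max 2 (d k))"

definition grid_level :: "nat \<Rightarrow> (nat \<Rightarrow> nat) \<Rightarrow> (nat \<times> nat) set \<Rightarrow> nat \<Rightarrow> nat" where
  "grid_level K d E n = nat \<lfloor>log 2 (real n) / real (2 + d_loc K d E)\<rfloor>"

definition rate_loc :: "nat \<Rightarrow> (nat \<Rightarrow> nat) \<Rightarrow> (nat \<times> nat) set \<Rightarrow> nat \<Rightarrow> real" where
  "rate_loc K d E n = real n powr (- 2 / (2 + real (d_loc K d E)))"

definition rate_max :: "nat \<Rightarrow> (nat \<Rightarrow> nat) \<Rightarrow> nat \<Rightarrow> real" where
  "rate_max K d n = real n powr (- 1 / real (d_max K d))"

definition log_factor :: "nat \<Rightarrow> (nat \<Rightarrow> nat) \<Rightarrow> (nat \<times> nat) set \<Rightarrow> nat \<Rightarrow> real" where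
  "log_factor K d E n =
     (if rate_loc K d E n \<ge> rate_max K d n \<and>
         (\<exists>k\<in>{1..K}. d k = 2 \<and> d_loc K d E = d k + d_pa d E k)
      then max 1 (ln (real n))
      else if rate_loc K d E n \<le> rate_max K d n \<and> (MAX k\<in>{1..K}. d k) = 2
      then max 1 (ln (real n))
      else 1)"

end

theory Submission
  imports Defs
begin

text \<open>Both measures are discretised at a dyadic level \<open>J\<close> with \<open>2\<^sup>-\<^sup>J \<approx> n powr (-1 / d_max)\<close>. By
  Kantorovich duality on a finite space their distance is at most \<open>O(2\<^sup>-\<^sup>J)\<close> plus a difference of
  expectations of a Lipschitz function \<open>F\<close>. The metric charges an additional \<open>h = 2\<^sup>-\<^sup>\<eta>\<close> for two points
  in different coarse cells. It dominates the original distance, so its Lipschitz functions suffice, and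
  this larger class is preserved by integration against Lipschitz kernels after smoothing, although these
  jump by \<open>O(h)\<close> between neighbouring cells.

  The difference telescopes over the nodes, and each node contributes two terms. The first compares the
  conditional law of \<open>\<mu>\<close> with its smoothed version; it is \<open>O(h\<^sup>2)\<close> because two errors of order \<open>h\<close>
  multiply, one for moving \<open>x\<^sub>k\<close> or its parents within a coarse cell and one from the
  Lipschitz condition on the respective conditional laws. The second compares the smoothed kernels of \<open>\<mu>\<close>
  and of the empirical measure. As the parents form a clique, the smoothed empirical measure gives the coarse
  cells of the parents their empirical frequencies, so these denominators cancel and only deviations of cell
  frequencies remain. They are collected by dyadic chaining, and the deviations of \<open>N\<close> cells sum up to at
  most \<open>\<surd>(N / n)\<close> in expectation.\<close>

section \<open>Finite Kantorovich duality\<close>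

text \<open>The level \<eta> balances bias against deviation. A node together with its parents has
  at most \<open>2 ^ (\<eta> * d_loc)\<close> coarse cells. Chaining weights their deviation by the
  cell side \<open>h\<close>, and \<open>h * sqrt (2 ^ (\<eta> * d_loc) / n) <= h ^ 2\<close> holds
  exactly if \<open>2 ^ (\<eta> * (2 + d_loc)) <= n\<close>. Below level \<eta> the smoothed kernels
  use only the marginals of single blocks, so the joint cells are never refined further. Going down
  to level \<open>J\<close> costs deviations of at most \<open>2 ^ (J * d k)\<close> cells, which
  stay of order \<open>2 ^ -J\<close> (up to a logarithm) as long as
  \<open>2 ^ (J * d_max) <= n\<close>. The chaining sums converge for dimension 1, grow linearly in
  the level for dimension 2 and geometrically above; this is the origin of
  \<open>max 2 (d k)\<close> and of the logarithm. Where the other rate is larger by a power of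
  \<open>n\<close>, that power absorbs the logarithm, at the price of a constant depending on the
  two exponents only. The Lipschitz conditional laws are sampled at midpoints of the finest cells,
  which again costs \<open>O(2 ^ -J)\<close>.\<close>

definition lin_fun :: "(('w \<Rightarrow> real) \<Rightarrow> real) \<Rightarrow> bool" where
  "lin_fun \<alpha> \<longleftrightarrow> (\<forall>f g t. \<alpha> (\<lambda>x. f x + t * g x) = \<alpha> f + t * \<alpha> g)"

lemma lin_funD: "lin_fun \<alpha> \<Longrightarrow> \<alpha> (\<lambda>x. f x + t * g x) = \<alpha> f + t * \<alpha> g"
  by (auto simp: lin_fun_def)

lemma lin_fun_scale: assumes "lin_fun \<alpha>" shows "\<alpha> (\<lambda>x. t * g x) = t * \<alpha> g"
proof -
  have "\<alpha> (\<lambda>x. 0) = 0" using lin_funD[OF assms, of "\<lambda>x. 0" 1 "\<lambda>x. 0"] by simp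
  then show ?thesis using lin_funD[OF assms, of "\<lambda>x. 0" t g] by simp
qed

text \<open>Bartl's induction on the number of constraints.\<close>

lemma farkas:
  fixes \<alpha> :: "'i \<Rightarrow> ('w \<Rightarrow> real) \<Rightarrow> real"
  assumes "finite I" "\<And>i. i \<in> I \<Longrightarrow> lin_fun (\<alpha> i)" "lin_fun \<gamma>"
    and "\<And>f. (\<And>i. i \<in> I \<Longrightarrow> \<alpha> i f \<le> 0) \<Longrightarrow> \<gamma> f \<le> 0"
  shows "\<exists>w. (\<forall>i\<in>I. 0 \<le> w i) \<and> (\<forall>f. \<gamma> f = (\<Sum>i\<in>I. w i * \<alpha> i f))"
  using assms
proof (induction I arbitrary: \<alpha> \<gamma> rule: finite_induct)
  case empty
  have "\<gamma> f = 0" for f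
  proof -
    have "\<gamma> f \<le> 0" "\<gamma> (\<lambda>x. (-1) * f x) \<le> 0" using empty(3) by blast+
    then show ?thesis using lin_fun_scale[OF empty(2), of "-1" f] by simp
  qed
  then show ?case by simp
next
  case (insert j I)
  show ?case
  \<comment> \<open>If the other constraints already imply the conclusion, constraint
    \<open>j\<close> gets weight 0. Otherwise some \<open>g0\<close> obeys them and violates the
    conclusion, so it must violate constraint \<open>j\<close>.\<close>
  proof (cases "\<forall>f. (\<forall>i\<in>I. \<alpha> i f \<le> 0) \<longrightarrow> \<gamma> f \<le> 0")
    case True
    then obtain l where l: "\<forall>i\<in>I. 0 \<le> l i" "\<forall>f. \<gamma> f = (\<Sum>i\<in>I. l i * \<alpha> i f)"
      using insert.IH[of \<alpha> \<gamma>] insert.prems by auto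
    show ?thesis
      by (rule exI[of _ "l(j := 0)"])
        (use l insert.hyps in \<open>auto simp: sum.insert intro!: sum.cong\<close>)
  next
    case False
    then obtain g0 where g0: "\<And>i. i \<in> I \<Longrightarrow> \<alpha> i g0 \<le> 0" "\<gamma> g0 > 0" by (auto simp: not_le)
    have pos: "\<alpha> j g0 > 0"
      using insert.prems(3)[of g0] g0 by (metis insertE not_le)
    define g where "g = (\<lambda>x. (1 / \<alpha> j g0) * g0 x)"
    have lj: "lin_fun (\<alpha> j)" and li: "\<And>i. i \<in> I \<Longrightarrow> lin_fun (\<alpha> i)" using insert.prems by auto
    have gj: "\<alpha> j g = 1" unfolding g_def using lin_fun_scale[OF lj, of "1 / \<alpha> j g0" g0] pos by simp
    have gi: "\<alpha> i g \<le> 0" if "i \<in> I" for i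
      unfolding g_def using lin_fun_scale[OF li[OF that], of "1 / \<alpha> j g0" g0] pos g0(1)[OF that]
      by (simp add: divide_nonpos_pos)
    have gg: "\<gamma> g > 0" unfolding g_def using lin_fun_scale[OF insert.prems(2), of "1 / \<alpha> j g0" g0] pos g0 by simp
    \<comment> \<open>Since \<open>\<alpha> j g = 1\<close>, these are the functionals evaluated at
      \<open>f - \<alpha> j f * g\<close>, a point where constraint \<open>j\<close> holds with
      equality. They therefore satisfy the hypothesis with \<open>j\<close> removed.\<close>
    define \<alpha>' where "\<alpha>' = (\<lambda>i f. \<alpha> i f - \<alpha> j f * \<alpha> i g)"
    define \<gamma>' where "\<gamma>' = (\<lambda>f. \<gamma> f - \<alpha> j f * \<gamma> g)"
    have "\<exists>l. (\<forall>i\<in>I. 0 \<le> l i) \<and> (\<forall>f. \<gamma>' f = (\<Sum>i\<in>I. l i * \<alpha>' i f))"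
    proof (rule insert.IH)
      show "lin_fun (\<alpha>' i)" if "i \<in> I" for i
        using li[OF that] lj by (auto simp: lin_fun_def \<alpha>'_def algebra_simps)
      show "lin_fun \<gamma>'"
        using insert.prems(2) lj by (auto simp: lin_fun_def \<gamma>'_def algebra_simps)
      fix f assume a: "\<And>i. i \<in> I \<Longrightarrow> \<alpha>' i f \<le> 0"
      define f' where "f' = (\<lambda>x. f x + (- \<alpha> j f) * g x)"
      have "\<gamma> f' \<le> 0"
      proof (rule insert.prems(3))
        fix i assume i: "i \<in> insert j I"
        show "\<alpha> i f' \<le> 0"
        proof (cases "i = j")
          case True
          then show ?thesis using lin_funD[OF lj, of f "- \<alpha> j f" g] gj by (simp add: f'_def)
        next
          case False
          then have "i \<in> I" using i by auto
          then show ?thesis using lin_funD[OF li, of i f "- \<alpha> j f" g] a[of i]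
            by (simp add: f'_def \<alpha>'_def)
        qed
      qed
      then show "\<gamma>' f \<le> 0"
        using lin_funD[OF insert.prems(2), of f "- \<alpha> j f" g] by (simp add: f'_def \<gamma>'_def)
    qed
    then obtain l where l: "\<forall>i\<in>I. 0 \<le> l i" "\<forall>f. \<gamma>' f = (\<Sum>i\<in>I. l i * \<alpha>' i f)" by blast
    define l0 where "l0 = \<gamma> g - (\<Sum>i\<in>I. l i * \<alpha> i g)"
    have "(\<Sum>i\<in>I. l i * \<alpha> i g) \<le> 0"
      using l gi by (intro sum_nonpos) (simp add: mult_nonneg_nonpos)
    then have "l0 \<ge> 0" using gg by (simp add: l0_def)
    moreover have "\<gamma> f = l0 * \<alpha> j f + (\<Sum>i\<in>I. l i * \<alpha> i f)" for f
    proof -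
      have "\<gamma> f - \<alpha> j f * \<gamma> g = (\<Sum>i\<in>I. l i * \<alpha> i f) - \<alpha> j f * (\<Sum>i\<in>I. l i * \<alpha> i g)"
        using l(2)[rule_format, of f]
        by (simp add: \<gamma>'_def \<alpha>'_def algebra_simps sum_subtractf sum_distrib_left)
      then show ?thesis by (simp add: l0_def algebra_simps)
    qed
    moreover have "(\<Sum>i\<in>I. (if i = j then l0 else l i) * \<alpha> i f) = (\<Sum>i\<in>I. l i * \<alpha> i f)" for f
      using insert.hyps by (intro sum.cong) auto
    ultimately show ?thesis
      using l(1) insert.hyps by (intro exI[of _ "\<lambda>i. if i = j then l0 else l i"]) auto
  qed
qed

text \<open>Farkas applied to triples of a scale \<open>t\<close> (coordinate \<open>None\<close>)
  and two potentials (\<open>Inl\<close> and \<open>Inr\<close>), constrained by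
  \<open>0 <= t\<close> and \<open>u x - v y <= t * c x y\<close>. The multipliers are the slack in
  the cost and the coupling itself. The scale makes the problem homogeneous, so that the bound
  \<open>b\<close> can enter through a linear functional.\<close>

lemma finite_kantorovich:
  fixes p r :: "'a \<Rightarrow> real" and c :: "'a \<Rightarrow> 'a \<Rightarrow> real"
  assumes fin: "finite X" and ne: "X \<noteq> {}"
    and p0: "\<And>x. x \<in> X \<Longrightarrow> 0 \<le> p x" and r0: "\<And>x. x \<in> X \<Longrightarrow> 0 \<le> r x"
    and c_self: "\<And>x. x \<in> X \<Longrightarrow> c x x = 0"
    and c_tri: "\<And>x y z. x \<in> X \<Longrightarrow> y \<in> X \<Longrightarrow> z \<in> X \<Longrightarrow> c x z \<le> c x y + c y z"
    and c0: "\<And>x y. x \<in> X \<Longrightarrow> y \<in> X \<Longrightarrow> 0 \<le> c x y"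
    and dual: "\<And>f. (\<And>x y. x \<in> X \<Longrightarrow> y \<in> X \<Longrightarrow> f x - f y \<le> c x y) \<Longrightarrow>
                 (\<Sum>x\<in>X. p x * f x) - (\<Sum>x\<in>X. r x * f x) \<le> b"
  shows "\<exists>g. (\<forall>x\<in>X. \<forall>y\<in>X. 0 \<le> g x y) \<and> (\<forall>x\<in>X. (\<Sum>y\<in>X. g x y) = p x) \<and>
             (\<forall>y\<in>X. (\<Sum>x\<in>X. g x y) = r y) \<and> (\<Sum>x\<in>X. \<Sum>y\<in>X. g x y * c x y) \<le> b"
proof -
  define \<alpha> :: "('a \<times> 'a) option \<Rightarrow> (('a + 'a) option \<Rightarrow> real) \<Rightarrow> real" where
    "\<alpha> = (\<lambda>i f. case i of None \<Rightarrow> - f None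
      | Some (x, y) \<Rightarrow> f (Some (Inl x)) - f (Some (Inr y)) - f None * c x y)"
  define \<gamma> :: "(('a + 'a) option \<Rightarrow> real) \<Rightarrow> real" where
    "\<gamma> = (\<lambda>f. (\<Sum>x\<in>X. p x * f (Some (Inl x))) - (\<Sum>x\<in>X. r x * f (Some (Inr x))) - f None * b)"
  define I where "I = insert None (Some ` (X \<times> X))"
  have scaled: "(\<Sum>x\<in>X. p x * f x) - (\<Sum>x\<in>X. r x * f x) \<le> t * b"
    if "t > 0" and f: "\<And>x y. x \<in> X \<Longrightarrow> y \<in> X \<Longrightarrow> f x - f y \<le> t * c x y" for f t
  proof -
    have "(\<Sum>x\<in>X. p x * (f x / t)) - (\<Sum>x\<in>X. r x * (f x / t)) \<le> b"
    proof (rule dual)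
      fix x y assume "x \<in> X" "y \<in> X"
      then have "(f x - f y) / t \<le> c x y"
        using f[of x y] \<open>t > 0\<close> by (simp only: pos_divide_le_eq mult.commute)
      then show "f x / t - f y / t \<le> c x y" by (simp add: diff_divide_distrib)
    qed
    then have "((\<Sum>x\<in>X. p x * f x) - (\<Sum>x\<in>X. r x * f x)) / t \<le> b"
      by (simp add: sum_divide_distrib diff_divide_distrib)
    then show ?thesis using \<open>t > 0\<close> by (simp only: pos_divide_le_eq mult.commute)
  qed
  have scaled': "(\<Sum>x\<in>X. p x * f x) - (\<Sum>x\<in>X. r x * f x) \<le> t * b"
    if "t \<ge> 0" and f: "\<And>x y. x \<in> X \<Longrightarrow> y \<in> X \<Longrightarrow> f x - f y \<le> t * c x y" for f t
  proof (cases "t > 0")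
    case False
    then have t: "t = 0" using that by simp
    \<comment> \<open>For \<open>t = 0\<close> the function is Lipschitz with every constant
      \<open>s > 0\<close>, and the scaled bound is used with \<open>s\<close> tending to 0. In
      particular \<open>dual\<close> forces equal total masses.\<close>
    have "(\<Sum>x\<in>X. p x * f x) - (\<Sum>x\<in>X. r x * f x) \<le> 0 + e" if "e > 0" for e
    proof -
      define s where "s = e / (\<bar>b\<bar> + 1)"
      have s: "s > 0" using that by (simp add: s_def)
      have "(\<Sum>x\<in>X. p x * f x) - (\<Sum>x\<in>X. r x * f x) \<le> s * b"
      proof (rule scaled[OF s])
        fix x y assume "x \<in> X" "y \<in> X"
        then show "f x - f y \<le> s * c x y"
          using f[of x y] t mult_nonneg_nonneg[OF less_imp_le[OF s] c0[of x y]] by simp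
      qed
      also have "s * b \<le> s * (\<bar>b\<bar> + 1)" using s by (intro mult_left_mono) auto
      also have "\<dots> = e" by (simp add: s_def)
      finally show ?thesis by simp
    qed
    then have "(\<Sum>x\<in>X. p x * f x) - (\<Sum>x\<in>X. r x * f x) \<le> 0" by (rule field_le_epsilon)
    then show ?thesis using t by simp
  qed (use scaled f in auto)
  have "\<exists>l. (\<forall>i\<in>I. 0 \<le> l i) \<and> (\<forall>f. \<gamma> f = (\<Sum>i\<in>I. l i * \<alpha> i f))"
  proof (rule farkas)
    show "finite I" using fin by (simp add: I_def)
    show "lin_fun (\<alpha> i)" for i
      by (auto simp: lin_fun_def \<alpha>_def algebra_simps split: option.splits)
    show "lin_fun \<gamma>"
      by (auto simp: lin_fun_def \<gamma>_def algebra_simps sum.distrib sum_distrib_left)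
    fix f assume a: "\<And>i. i \<in> I \<Longrightarrow> \<alpha> i f \<le> 0"
    define t u v where "t = f None" and "u = (\<lambda>x. f (Some (Inl x)))" and "v = (\<lambda>x. f (Some (Inr x)))"
    have t: "t \<ge> 0" using a[of None] by (simp add: I_def \<alpha>_def t_def)
    have uv: "u x \<le> v y + t * c x y" if "x \<in> X" "y \<in> X" for x y
      using a[of "Some (x, y)"] that by (simp add: I_def \<alpha>_def t_def u_def v_def)
    \<comment> \<open>The c-transform of \<open>v\<close>. It is above \<open>u\<close> by the
      constraints and below \<open>v\<close> because \<open>c x x = 0\<close>, and the triangle
      inequality makes it Lipschitz; a pair of potentials is thus reduced to one test
      function.\<close>
    define w where "w = (\<lambda>x. MIN y\<in>X. v y + t * c x y)"
    have w_le: "w x \<le> v y + t * c x y" if "y \<in> X" for x y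
      unfolding w_def using fin that by (intro Min_le) auto
    have uw: "u x \<le> w x" if "x \<in> X" for x
      unfolding w_def using fin ne uv that by (intro Min.boundedI) auto
    have "w x - w y \<le> t * c x y" if "x \<in> X" "y \<in> X" for x y
    proof -
      have "w x - t * c x y \<le> a" if az: "a \<in> (\<lambda>z. v z + t * c y z) ` X" for a
      proof -
        obtain z where z: "z \<in> X" "a = v z + t * c y z" using az by auto
        have "t * c x z \<le> t * (c x y + c y z)"
          using t c_tri \<open>x \<in> X\<close> \<open>y \<in> X\<close> z(1) by (intro mult_left_mono) auto
        then show ?thesis using w_le[OF z(1), of x] z(2) by (simp add: algebra_simps)
      qed
      then have "w x - t * c x y \<le> w y"
        unfolding fun_cong[OF w_def, of y] using fin ne by (intro Min.boundedI) auto
      then show ?thesis by simp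
    qed
    then have "(\<Sum>x\<in>X. p x * w x) - (\<Sum>x\<in>X. r x * w x) \<le> t * b" by (rule scaled'[OF t])
    moreover have "(\<Sum>x\<in>X. p x * u x) \<le> (\<Sum>x\<in>X. p x * w x)"
      using p0 uw by (intro sum_mono mult_left_mono) auto
    moreover have "(\<Sum>x\<in>X. r x * w x) \<le> (\<Sum>x\<in>X. r x * v x)"
      using r0 w_le[of x x for x] c_self by (intro sum_mono mult_left_mono) simp_all
    ultimately show "\<gamma> f \<le> 0" by (simp add: \<gamma>_def u_def v_def t_def)
  qed
  then obtain l where l: "\<And>i. i \<in> I \<Longrightarrow> 0 \<le> l i" "\<And>f. \<gamma> f = (\<Sum>i\<in>I. l i * \<alpha> i f)" by blast
  define g where "g = (\<lambda>x y. l (Some (x, y)))"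
  \<comment> \<open>Evaluated at the indicators of \<open>Inl x\<close>, \<open>Inr y\<close> and
    \<open>None\<close>, this identity yields the two marginals and the cost; the multiplier of
    \<open>None\<close> is the difference between \<open>b\<close> and the cost.\<close>
  have exp: "\<gamma> f = - l None * f None +
      (\<Sum>x\<in>X. \<Sum>y\<in>X. g x y * (f (Some (Inl x)) - f (Some (Inr y)) - f None * c x y))" for f
  proof -
    have "(\<Sum>i\<in>I. l i * \<alpha> i f) = l None * \<alpha> None f + (\<Sum>i\<in>Some ` (X \<times> X). l i * \<alpha> i f)"
      unfolding I_def using fin by (subst sum.insert) auto
    also have "(\<Sum>i\<in>Some ` (X \<times> X). l i * \<alpha> i f) =
        (\<Sum>x\<in>X. \<Sum>y\<in>X. g x y * (f (Some (Inl x)) - f (Some (Inr y)) - f None * c x y))"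
      by (subst sum.reindex) (auto simp: sum.cartesian_product g_def \<alpha>_def intro!: sum.cong)
    finally show ?thesis using l(2)[of f] by (simp add: \<alpha>_def)
  qed
  show ?thesis
  proof (intro exI[of _ g] conjI ballI)
    fix x y assume "x \<in> X" "y \<in> X"
    then show "0 \<le> g x y" unfolding g_def by (intro l) (auto simp: I_def)
  next
    fix x assume x: "x \<in> X"
    have swap: "(\<Sum>z\<in>X. \<Sum>y\<in>X. if z = x then g x y else 0) = (\<Sum>y\<in>X. g x y)"
      using fin x by (subst sum.swap) simp
    show "(\<Sum>y\<in>X. g x y) = p x"
      using swap exp[of "\<lambda>i. if i = Some (Inl x) then 1 else 0"] fin x
      by (simp add: \<gamma>_def if_distrib[of "\<lambda>x. _ * x"] sum.delta sum_distrib_right[symmetric] cong: if_cong)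
  next
    fix y assume y: "y \<in> X"
    show "(\<Sum>x\<in>X. g x y) = r y"
      using exp[of "\<lambda>i. if i = Some (Inr y) then 1 else 0"] fin y
      by (simp add: \<gamma>_def sum_negf if_distrib[of "\<lambda>x. _ * x"] if_distrib[of uminus] sum.delta cong: if_cong)
  next
    have "- b = - l None - (\<Sum>x\<in>X. \<Sum>y\<in>X. g x y * c x y)"
      using exp[of "\<lambda>i. of_bool (i = None)"] by (simp add: \<gamma>_def sum_negf)
    moreover have "l None \<ge> 0" by (intro l) (auto simp: I_def)
    ultimately show "(\<Sum>x\<in>X. \<Sum>y\<in>X. g x y * c x y) \<le> b" by simp
  qed
qed

section \<open>Transport between measures through finitely many cells\<close>

lemma measurable_fibre:
  assumes Z: "Z \<in> M \<rightarrow>\<^sub>M count_space X"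
  shows "{x \<in> space M. Z x = z} \<in> sets M"
proof -
  have "{x \<in> space M. Z x = z} = Z -` ({z} \<inter> X) \<inter> space M"
    using measurable_space[OF Z] by auto
  then show ?thesis using measurable_sets[OF Z, of "{z} \<inter> X"] by simp
qed

lemma nn_integral_finite_range:
  assumes "finite X" and Z: "Z \<in> M \<rightarrow>\<^sub>M count_space X"
  shows "(\<integral>\<^sup>+x. f (Z x) \<partial>M) = (\<Sum>z\<in>X. f z * emeasure M {x \<in> space M. Z x = z})"
proof -
  have "(\<integral>\<^sup>+x. f (Z x) \<partial>M) = (\<integral>\<^sup>+x. (\<Sum>z\<in>X. f z * indicator {x \<in> space M. Z x = z} x) \<partial>M)"
    using measurable_space[OF Z] \<open>finite X\<close>
    by (intro nn_integral_cong) (simp add: indicator_def if_distrib sum.delta cong: if_cong)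
  also have "\<dots> = (\<Sum>z\<in>X. f z * emeasure M {x \<in> space M. Z x = z})"
    using measurable_fibre[OF Z] by (subst nn_integral_sum) (auto simp: nn_integral_cmult_indicator)
  finally show ?thesis .
qed

lemma integral_finite_range:
  fixes F :: "'c \<Rightarrow> real"
  assumes "prob_space M" "finite X" and Z: "Z \<in> M \<rightarrow>\<^sub>M count_space X"
  shows "integrable M (\<lambda>x. F (Z x))"
    and "(\<integral>x. F (Z x) \<partial>M) = (\<Sum>z\<in>X. measure M {x \<in> space M. Z x = z} * F z)"
proof -
  interpret prob_space M by fact
  have eq: "F (Z x) = (\<Sum>z\<in>X. indicator {x \<in> space M. Z x = z} x * F z)" if "x \<in> space M" for x
    using that measurable_space[OF Z that] \<open>finite X\<close>
    by (simp add: indicator_def if_distrib[of "\<lambda>t. t * _"] sum.delta cong: if_cong)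
  have int: "integrable M (\<lambda>x. indicator {x \<in> space M. Z x = z} x * F z)" for z
    using measurable_fibre[OF Z, of z] by (intro integrable_mult_left) (simp add: emeasure_eq_measure)
  show "integrable M (\<lambda>x. F (Z x))"
  proof (rule Bochner_Integration.integrable_cong[OF refl eq, THEN iffD2])
    show "integrable M (\<lambda>x. \<Sum>z\<in>X. indicator {x \<in> space M. Z x = z} x * F z)"
      by (rule Bochner_Integration.integrable_sum) (rule int)
  qed
  have "(\<integral>x. F (Z x) \<partial>M) = (\<integral>x. (\<Sum>z\<in>X. indicator {x \<in> space M. Z x = z} x * F z) \<partial>M)"
    by (intro Bochner_Integration.integral_cong eq refl)
  then show "(\<integral>x. F (Z x) \<partial>M) = (\<Sum>z\<in>X. measure M {x \<in> space M. Z x = z} * F z)"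
    using int measurable_fibre[OF Z] by (subst (asm) Bochner_Integration.integral_sum) auto
qed

text \<open>A coupling of the laws of \<open>Z\<close> lifts to the measures: within the cells of \<open>Z\<close> take the
  independent coupling.\<close>

lemma wasserstein_le_coupling:
  fixes \<mu> \<nu> :: "'a measure" and Z :: "'a \<Rightarrow> 'c" and g c :: "'c \<Rightarrow> 'c \<Rightarrow> real"
  assumes "prob_space \<mu>" "prob_space \<nu>" and sets: "sets \<nu> = sets \<mu>"
    and fin: "finite X" and Z: "Z \<in> \<mu> \<rightarrow>\<^sub>M count_space X"
    and g0: "\<And>x y. x \<in> X \<Longrightarrow> y \<in> X \<Longrightarrow> 0 \<le> g x y"
    and gp: "\<And>x. x \<in> X \<Longrightarrow> (\<Sum>y\<in>X. g x y) = measure \<mu> {a \<in> space \<mu>. Z a = x}"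
    and gr: "\<And>y. y \<in> X \<Longrightarrow> (\<Sum>x\<in>X. g x y) = measure \<nu> {a \<in> space \<nu>. Z a = y}"
    and c0: "\<And>x y. x \<in> X \<Longrightarrow> y \<in> X \<Longrightarrow> 0 \<le> c x y" and "0 \<le> \<delta>"
    and D: "\<And>a b. a \<in> space \<mu> \<Longrightarrow> b \<in> space \<mu> \<Longrightarrow> D a b \<le> c (Z a) (Z b) + \<delta>"
    and cost: "(\<Sum>x\<in>X. \<Sum>y\<in>X. g x y * c x y) \<le> b"
  shows "wasserstein D \<mu> \<nu> \<le> ennreal (b + \<delta>)"
proof -
  interpret \<mu>: prob_space \<mu> by fact
  interpret \<nu>: prob_space \<nu> by fact
  interpret P: pair_sigma_finite \<mu> \<nu> by unfold_locales
  have sp: "space \<nu> = space \<mu>" using sets by (rule sets_eq_imp_space_eq)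
  have Z': "Z \<in> \<nu> \<rightarrow>\<^sub>M count_space X" using Z measurable_cong_sets[OF sets refl] by blast
  define p r where "p = (\<lambda>x. measure \<mu> {a \<in> space \<mu>. Z a = x})"
    and "r = (\<lambda>y. measure \<nu> {a \<in> space \<nu>. Z a = y})"
  have ep: "emeasure \<mu> {a \<in> space \<mu>. Z a = x} = ennreal (p x)" for x
    by (simp add: p_def \<mu>.emeasure_eq_measure)
  have er: "emeasure \<nu> {a \<in> space \<nu>. Z a = x} = ennreal (r x)" for x
    by (simp add: r_def \<nu>.emeasure_eq_measure)
  have p0: "p x \<ge> 0" and r0: "r x \<ge> 0" for x by (auto simp: p_def r_def)
  have g_p: "g x y = 0" if "x \<in> X" "y \<in> X" "p x = 0" for x y
    using sum_nonneg_eq_0_iff[OF fin, of "g x"] g0 gp[of x] that by (simp add: p_def)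
  have g_r: "g x y = 0" if "x \<in> X" "y \<in> X" "r y = 0" for x y
    using sum_nonneg_eq_0_iff[OF fin, of "\<lambda>x. g x y"] g0 gr[of y] that by (simp add: r_def)
  \<comment> \<open>The density of the lifted coupling with respect to the product measure. Where
    \<open>p x * r y = 0\<close> the quotient is 0 by convention, in accordance with
    \<open>g x y = 0\<close> there. Such cells are avoided almost surely, and on the others the
    density integrates to 1 in each variable.\<close>
  define w where "w = (\<lambda>x y. ennreal (g x y / (p x * r y)))"
  have wpr: "w x y * ennreal (p x) * ennreal (r y) = ennreal (g x y)" if "x \<in> X" "y \<in> X" for x y
  proof (cases "p x = 0 \<or> r y = 0")
    case True
    then show ?thesis using g_p g_r that by auto
  next
    case False
    then show ?thesis using p0[of x] r0[of y] g0[OF that]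
      by (simp add: w_def ennreal_mult'[symmetric] mult.assoc)
  qed
  have wr: "(\<Sum>y\<in>X. w x y * ennreal (r y)) = 1" if "x \<in> X" "p x \<noteq> 0" for x
  proof -
    have "w x y * ennreal (r y) = ennreal (g x y / p x)" if "y \<in> X" for y
      using g_r[OF \<open>x \<in> X\<close> that] r0[of y] p0[of x] g0[OF \<open>x \<in> X\<close> that]
      by (cases "r y = 0") (auto simp: w_def ennreal_mult'[symmetric])
    then have "(\<Sum>y\<in>X. w x y * ennreal (r y)) = ennreal (\<Sum>y\<in>X. g x y / p x)"
      using g0 that p0[of x] by (simp add: sum_ennreal)
    also have "(\<Sum>y\<in>X. g x y / p x) = 1"
      using gp[OF that(1)] that(2) by (simp add: sum_divide_distrib[symmetric] p_def)
    finally show ?thesis by simp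
  qed
  have wp: "(\<Sum>x\<in>X. w x y * ennreal (p x)) = 1" if "y \<in> X" "r y \<noteq> 0" for y
  proof -
    have "w x y * ennreal (p x) = ennreal (g x y / r y)" if "x \<in> X" for x
      using g_p[OF that \<open>y \<in> X\<close>] p0[of x] r0[of y] g0[OF that \<open>y \<in> X\<close>]
      by (cases "p x = 0") (auto simp: w_def ennreal_mult'[symmetric])
    then have "(\<Sum>x\<in>X. w x y * ennreal (p x)) = ennreal (\<Sum>x\<in>X. g x y / r y)"
      using g0 that r0[of y] by (simp add: sum_ennreal)
    also have "(\<Sum>x\<in>X. g x y / r y) = 1"
      using gr[OF that(1)] that(2) by (simp add: sum_divide_distrib[symmetric] r_def)
    finally show ?thesis by simp
  qed
  have AEp: "AE a in \<mu>. p (Z a) \<noteq> 0"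
  proof -
    have "AE a in \<mu>. \<forall>x\<in>{x\<in>X. p x = 0}. \<not> (Z a = x)"
      using fin measurable_fibre[OF Z] ep
      by (subst AE_finite_all) (auto simp: AE_iff_measurable[OF _ refl])
    then show ?thesis by (rule AE_mp) (use measurable_space[OF Z] in \<open>auto intro!: AE_I2\<close>)
  qed
  have AEr: "AE a in \<nu>. r (Z a) \<noteq> 0"
  proof -
    have "AE a in \<nu>. \<forall>x\<in>{x\<in>X. r x = 0}. \<not> (Z a = x)"
      using fin measurable_fibre[OF Z'] er
      by (subst AE_finite_all) (auto simp: AE_iff_measurable[OF _ refl])
    then show ?thesis by (rule AE_mp) (use measurable_space[OF Z'] in \<open>auto intro!: AE_I2\<close>)
  qed
  have mw: "(\<lambda>z. f (Z (fst z)) (Z (snd z))) \<in> borel_measurable (\<mu> \<Otimes>\<^sub>M \<nu>)"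
    for f :: "'c \<Rightarrow> 'c \<Rightarrow> ennreal"
  proof -
    have "(\<lambda>z. (Z (fst z), Z (snd z))) \<in> \<mu> \<Otimes>\<^sub>M \<nu> \<rightarrow>\<^sub>M count_space X \<Otimes>\<^sub>M count_space X"
      using Z Z' by measurable
    also have "count_space X \<Otimes>\<^sub>M count_space X = count_space (X \<times> X)"
      using fin by (intro pair_measure_countable) (auto intro: countable_finite)
    finally have "(\<lambda>u. f (fst u) (snd u)) \<circ> (\<lambda>z. (Z (fst z), Z (snd z))) \<in> borel_measurable (\<mu> \<Otimes>\<^sub>M \<nu>)"
      by (rule measurable_comp) simp
    then show ?thesis by (simp add: comp_def)
  qed
  note [measurable] = mw[of w]
  define \<pi> where "\<pi> = density (\<mu> \<Otimes>\<^sub>M \<nu>) (\<lambda>z. w (Z (fst z)) (Z (snd z)))"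
  have [simp]: "sets \<pi> = sets (\<mu> \<Otimes>\<^sub>M \<nu>)" "space \<pi> = space \<mu> \<times> space \<nu>"
    by (auto simp: \<pi>_def space_pair_measure)
  have "distr \<pi> \<mu> fst = \<mu>"
  proof (rule measure_eqI)
    fix A assume "A \<in> sets (distr \<pi> \<mu> fst)"
    then have A[measurable]: "A \<in> sets \<mu>" by simp
    have "emeasure (distr \<pi> \<mu> fst) A = emeasure \<pi> (A \<times> space \<nu>)"
      by (subst emeasure_distr)
        (auto simp: measurable_cong_sets[of \<pi> "\<mu> \<Otimes>\<^sub>M \<nu>" \<mu> \<mu>] intro!: arg_cong[where f="emeasure \<pi>"]
          dest: sets.sets_into_space[OF A, THEN subsetD])
    also have "\<dots> = (\<integral>\<^sup>+z. w (Z (fst z)) (Z (snd z)) * indicator (A \<times> space \<nu>) z \<partial>(\<mu> \<Otimes>\<^sub>M \<nu>))"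
      unfolding \<pi>_def by (subst emeasure_density) auto
    also have "\<dots> = (\<integral>\<^sup>+a. \<integral>\<^sup>+b. w (Z a) (Z b) * indicator (A \<times> space \<nu>) (a, b) \<partial>\<nu> \<partial>\<mu>)"
      by (subst \<nu>.nn_integral_fst[symmetric]) auto
    also have "\<dots> = (\<integral>\<^sup>+a. indicator A a \<partial>\<mu>)"
    proof (rule nn_integral_cong_AE, rule AE_mp[OF AEp], rule AE_I2, intro impI)
      fix a assume a: "a \<in> space \<mu>" "p (Z a) \<noteq> 0"
      have "(\<integral>\<^sup>+b. w (Z a) (Z b) * indicator (A \<times> space \<nu>) (a, b) \<partial>\<nu>) =
            (\<integral>\<^sup>+b. indicator A a * w (Z a) (Z b) \<partial>\<nu>)"
        by (intro nn_integral_cong) (auto simp: indicator_def)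
      also have "\<dots> = indicator A a * (\<Sum>y\<in>X. w (Z a) y * ennreal (r y))"
        by (subst nn_integral_finite_range[OF fin Z', of "\<lambda>y. indicator A a * w (Z a) y"])
          (simp add: er sum_distrib_left mult.assoc)
      finally show "(\<integral>\<^sup>+b. w (Z a) (Z b) * indicator (A \<times> space \<nu>) (a, b) \<partial>\<nu>) = indicator A a"
        using wr[of "Z a"] a measurable_space[OF Z a(1)] by simp
    qed
    finally show "emeasure (distr \<pi> \<mu> fst) A = emeasure \<mu> A" by simp
  qed simp
  moreover have "distr \<pi> \<nu> snd = \<nu>"
  proof (rule measure_eqI)
    fix A assume "A \<in> sets (distr \<pi> \<nu> snd)"
    then have A[measurable]: "A \<in> sets \<nu>" by simp
    have "emeasure (distr \<pi> \<nu> snd) A = emeasure \<pi> (space \<mu> \<times> A)"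
      by (subst emeasure_distr)
        (auto simp: measurable_cong_sets[of \<pi> "\<mu> \<Otimes>\<^sub>M \<nu>" \<nu> \<nu>] intro!: arg_cong[where f="emeasure \<pi>"]
          dest: sets.sets_into_space[OF A, THEN subsetD])
    also have "\<dots> = (\<integral>\<^sup>+z. w (Z (fst z)) (Z (snd z)) * indicator (space \<mu> \<times> A) z \<partial>(\<mu> \<Otimes>\<^sub>M \<nu>))"
      unfolding \<pi>_def by (subst emeasure_density) auto
    also have "\<dots> = (\<integral>\<^sup>+b. \<integral>\<^sup>+a. w (Z a) (Z b) * indicator (space \<mu> \<times> A) (a, b) \<partial>\<mu> \<partial>\<nu>)"
      by (subst P.nn_integral_snd[symmetric]) auto
    also have "\<dots> = (\<integral>\<^sup>+b. indicator A b \<partial>\<nu>)"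
    proof (rule nn_integral_cong_AE, rule AE_mp[OF AEr], rule AE_I2, intro impI)
      fix b assume b: "b \<in> space \<nu>" "r (Z b) \<noteq> 0"
      have "(\<integral>\<^sup>+a. w (Z a) (Z b) * indicator (space \<mu> \<times> A) (a, b) \<partial>\<mu>) =
            (\<integral>\<^sup>+a. indicator A b * w (Z a) (Z b) \<partial>\<mu>)"
        by (intro nn_integral_cong) (auto simp: indicator_def)
      also have "\<dots> = indicator A b * (\<Sum>x\<in>X. w x (Z b) * ennreal (p x))"
        by (subst nn_integral_finite_range[OF fin Z, of "\<lambda>x. indicator A b * w x (Z b)"])
          (simp add: ep sum_distrib_left mult.assoc)
      finally show "(\<integral>\<^sup>+a. w (Z a) (Z b) * indicator (space \<mu> \<times> A) (a, b) \<partial>\<mu>) = indicator A b"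
        using wp[of "Z b"] b measurable_space[OF Z' b(1)] by simp
    qed
    finally show "emeasure (distr \<pi> \<nu> snd) A = emeasure \<nu> A" by simp
  qed simp
  ultimately have "\<pi> \<in> couplings \<mu> \<nu>" by (simp add: couplings_def)
  then have "wasserstein D \<mu> \<nu> \<le> (\<integral>\<^sup>+z. ennreal (D (fst z) (snd z)) \<partial>\<pi>)"
    unfolding wasserstein_def by (rule INF_lower)
  also have "\<dots> \<le> (\<integral>\<^sup>+z. ennreal (c (Z (fst z)) (Z (snd z)) + \<delta>) \<partial>\<pi>)"
    using D sp by (intro nn_integral_mono ennreal_leI) auto
  also have "\<dots> = (\<integral>\<^sup>+z. w (Z (fst z)) (Z (snd z)) * ennreal (c (Z (fst z)) (Z (snd z)) + \<delta>) \<partial>(\<mu> \<Otimes>\<^sub>M \<nu>))"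
    unfolding \<pi>_def using mw[of "\<lambda>x y. ennreal (c x y + \<delta>)"] by (subst nn_integral_density) auto
  also have "\<dots> = (\<integral>\<^sup>+a. \<integral>\<^sup>+b. w (Z a) (Z b) * ennreal (c (Z a) (Z b) + \<delta>) \<partial>\<nu> \<partial>\<mu>)"
    using mw[of "\<lambda>x y. w x y * ennreal (c x y + \<delta>)"] by (subst \<nu>.nn_integral_fst[symmetric]) auto
  also have "\<dots> = (\<integral>\<^sup>+a. (\<Sum>y\<in>X. w (Z a) y * ennreal (c (Z a) y + \<delta>) * ennreal (r y)) \<partial>\<mu>)"
    by (intro nn_integral_cong, subst nn_integral_finite_range[OF fin Z'])  (simp add: er)
  also have "\<dots> = (\<Sum>x\<in>X. (\<Sum>y\<in>X. w x y * ennreal (c x y + \<delta>) * ennreal (r y)) * ennreal (p x))"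
    by (subst nn_integral_finite_range[OF fin Z]) (simp add: ep)
  also have "\<dots> = (\<Sum>x\<in>X. \<Sum>y\<in>X. ennreal (g x y * (c x y + \<delta>)))"
    unfolding sum_distrib_right
  proof (intro sum.cong refl)
    fix x y assume xy: "x \<in> X" "y \<in> X"
    have "w x y * ennreal (c x y + \<delta>) * ennreal (r y) * ennreal (p x) =
          (w x y * ennreal (p x) * ennreal (r y)) * ennreal (c x y + \<delta>)" by (simp add: ac_simps)
    then show "w x y * ennreal (c x y + \<delta>) * ennreal (r y) * ennreal (p x) = ennreal (g x y * (c x y + \<delta>))"
      using wpr[OF xy] g0[OF xy] by (simp add: ennreal_mult')
  qed
  also have "\<dots> = ennreal (\<Sum>x\<in>X. \<Sum>y\<in>X. g x y * (c x y + \<delta>))"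
    using g0 c0 \<open>0 \<le> \<delta>\<close> by (simp add: sum_ennreal sum_nonneg)
  also have "(\<Sum>x\<in>X. \<Sum>y\<in>X. g x y * (c x y + \<delta>)) =
      (\<Sum>x\<in>X. \<Sum>y\<in>X. g x y * c x y) + \<delta> * (\<Sum>x\<in>X. p x)"
    using gp by (simp add: algebra_simps sum.distrib sum_distrib_left p_def flip: gp)
  also have "(\<Sum>x\<in>X. p x) = 1"
  proof -
    have "ennreal (\<Sum>x\<in>X. p x) = 1"
      using nn_integral_finite_range[OF fin Z, of "\<lambda>_. 1"] p0 \<mu>.emeasure_space_1
      by (simp add: ep sum_ennreal)
    then show ?thesis by simp
  qed
  finally show ?thesis using cost by (auto elim!: order_trans intro!: ennreal_leI)
qed

section \<open>Finite block spaces\<close>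

text \<open>\<open>B k\<close> is the set of finest cells of block \<open>k\<close>, \<open>lev k j q\<close> the dyadic cell of level \<open>j\<close>
  that contains \<open>q\<close>, and \<open>\<eta>\<close> the level of the coarse cells. The assumption \<open>par_clique\<close> is the only trace of the
  fully connected parent sets.\<close>

locale blocks =
  fixes K :: nat and B :: "nat \<Rightarrow> 'b set" and lev :: "nat \<Rightarrow> nat \<Rightarrow> 'b \<Rightarrow> 'l"
    and bd :: "nat \<Rightarrow> 'b \<Rightarrow> 'b \<Rightarrow> real" and J \<eta> :: nat and m :: real
    and par :: "nat \<Rightarrow> nat set"
  assumes fin_B [simp]: "k \<in> {1..K} \<Longrightarrow> finite (B k)"
    and ne_B: "k \<in> {1..K} \<Longrightarrow> B k \<noteq> {}"
    and eta_le: "\<eta> \<le> J" and m1: "1 \<le> m"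
    and bd_nonneg: "0 \<le> bd k q q'" and bd_self [simp]: "bd k q q = 0"
    and bd_lev: "\<lbrakk>k \<in> {1..K}; q \<in> B k; q' \<in> B k; j \<le> J; lev k j q = lev k j q'\<rbrakk> \<Longrightarrow> bd k q q' \<le> m / 2 ^ j"
    and lev_mono: "\<lbrakk>k \<in> {1..K}; q \<in> B k; q' \<in> B k; j \<le> i; i \<le> J; lev k i q = lev k i q'\<rbrakk> \<Longrightarrow> lev k j q = lev k j q'"
    and lev_0: "\<lbrakk>k \<in> {1..K}; q \<in> B k; q' \<in> B k\<rbrakk> \<Longrightarrow> lev k 0 q = lev k 0 q'"
    and lev_J: "\<lbrakk>k \<in> {1..K}; q \<in> B k; q' \<in> B k; lev k J q = lev k J q'\<rbrakk> \<Longrightarrow> q = q'"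
    and par_sub: "k \<in> {1..K} \<Longrightarrow> par k \<subseteq> {1..<k}"
    and par_clique: "\<lbrakk>k \<in> {1..K}; par k \<noteq> {}\<rbrakk> \<Longrightarrow> par k \<subseteq> insert (Max (par k)) (par (Max (par k)))"
begin

definition X :: "(nat \<Rightarrow> 'b) set" where "X = PiE {1..K} B"
definition h :: real where "h = 1 / 2 ^ \<eta>"
definition E :: "((nat \<Rightarrow> 'b) \<Rightarrow> real) \<Rightarrow> ((nat \<Rightarrow> 'b) \<Rightarrow> real) \<Rightarrow> real" where
  "E p F = (\<Sum>z\<in>X. p z * F z)"
definition Pr :: "((nat \<Rightarrow> 'b) \<Rightarrow> real) \<Rightarrow> ((nat \<Rightarrow> 'b) \<Rightarrow> bool) \<Rightarrow> real" where
  "Pr p R = (\<Sum>z\<in>{z \<in> X. R z}. p z)"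
definition pmass :: "((nat \<Rightarrow> 'b) \<Rightarrow> real) \<Rightarrow> bool" where
  "pmass p \<longleftrightarrow> (\<forall>z\<in>X. 0 \<le> p z) \<and> sum p X = 1"
abbreviation c :: "nat \<Rightarrow> 'b \<Rightarrow> 'l" where "c k \<equiv> lev k \<eta>"
text \<open>The address of the coarse cell of the parents. It is extensional, so that functions of
  the parent cell can be summed over the finite set of keys.\<close>

definition key :: "nat \<Rightarrow> (nat \<Rightarrow> 'b) \<Rightarrow> nat \<Rightarrow> 'l" where
  "key k z = (\<lambda>i\<in>par k. c i (z i))"
definition T :: "nat \<Rightarrow> ((nat \<Rightarrow> 'b) \<Rightarrow> 'b \<Rightarrow> real) \<Rightarrow> ((nat \<Rightarrow> 'b) \<Rightarrow> real) \<Rightarrow> (nat \<Rightarrow> 'b) \<Rightarrow> real" where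
  "T k \<kappa> F z = (\<Sum>q\<in>B k. \<kappa> z q * F (z(k := q)))"
definition ed :: "nat \<Rightarrow> 'b \<Rightarrow> 'b \<Rightarrow> real" where
  "ed k q q' = bd k q q' + (if c k q = c k q' then 0 else h)"
definition dd :: "nat set \<Rightarrow> (nat \<Rightarrow> 'b) \<Rightarrow> (nat \<Rightarrow> 'b) \<Rightarrow> real" where
  "dd S z z' = (\<Sum>i\<in>S. ed i (z i) (z' i))"
definition lip :: "nat \<Rightarrow> real \<Rightarrow> ((nat \<Rightarrow> 'b) \<Rightarrow> real) \<Rightarrow> bool" where
  "lip k A F \<longleftrightarrow> (\<forall>z\<in>X. \<forall>z'\<in>X. \<bar>F z - F z'\<bar> \<le> A * dd {1..k} z z')"
definition dep :: "nat set \<Rightarrow> ((nat \<Rightarrow> 'b) \<Rightarrow> 'x) \<Rightarrow> bool" where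
  "dep S F \<longleftrightarrow> (\<forall>z\<in>X. \<forall>z'\<in>X. (\<forall>i\<in>S. z i = z' i) \<longrightarrow> F z = F z')"

lemma finite_X [simp]: "finite X" unfolding X_def by (intro finite_PiE) auto

lemma ne_X: "X \<noteq> {}" unfolding X_def by (simp add: PiE_eq_empty_iff ne_B)

lemma X_mem: "z \<in> X \<Longrightarrow> k \<in> {1..K} \<Longrightarrow> z k \<in> B k" by (auto simp: X_def)

lemma X_upd: "z \<in> X \<Longrightarrow> k \<in> {1..K} \<Longrightarrow> q \<in> B k \<Longrightarrow> z(k := q) \<in> X"
  by (auto simp: X_def PiE_iff extensional_def)

lemma h_pos: "0 < h" and h_le1: "h \<le> 1" by (auto simp: h_def)

lemma ed_nonneg: "0 \<le> ed k q q'" using bd_nonneg[of k q q'] h_pos by (auto simp: ed_def)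
lemma ed_self [simp]: "ed k q q = 0" by (simp add: ed_def)
lemma bd_le_ed: "bd k q q' \<le> ed k q q'" using h_pos by (auto simp: ed_def)

lemma bd_le: "k \<in> {1..K} \<Longrightarrow> q \<in> B k \<Longrightarrow> q' \<in> B k \<Longrightarrow> bd k q q' \<le> m"
  using bd_lev[of k q q' 0] lev_0[of k q q'] by simp

lemma ed_le: "k \<in> {1..K} \<Longrightarrow> q \<in> B k \<Longrightarrow> q' \<in> B k \<Longrightarrow> ed k q q' \<le> m + 1"
  using bd_le[of k q q'] h_le1 h_pos by (auto simp: ed_def)

lemma ed_same: "k \<in> {1..K} \<Longrightarrow> q \<in> B k \<Longrightarrow> q' \<in> B k \<Longrightarrow> c k q = c k q' \<Longrightarrow> ed k q q' \<le> m * h"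
  using bd_lev[of k q q' \<eta>] eta_le by (simp add: ed_def h_def)

lemma dd_nonneg: "0 \<le> dd S z z'" unfolding dd_def by (intro sum_nonneg ed_nonneg)

lemma dd_mono: "finite S' \<Longrightarrow> S \<subseteq> S' \<Longrightarrow> dd S z z' \<le> dd S' z z'"
  unfolding dd_def by (intro sum_mono2) (auto simp: ed_nonneg)

lemma dd_le: "S \<subseteq> {1..K} \<Longrightarrow> z \<in> X \<Longrightarrow> z' \<in> X \<Longrightarrow> dd S z z' \<le> K * (m + 1)"
proof -
  assume S: "S \<subseteq> {1..K}" and z: "z \<in> X" "z' \<in> X"
  have "dd S z z' \<le> dd {1..K} z z'" using S by (intro dd_mono) auto
  also have "\<dots> \<le> (\<Sum>i\<in>{1..K}. m + 1)"
    unfolding dd_def using z by (intro sum_mono ed_le) (auto simp: X_mem)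
  finally show ?thesis by simp
qed

lemma dd_same:
  assumes S: "S \<subseteq> {1..K}" and z: "z \<in> X" "z' \<in> X" and "\<And>i. i \<in> S \<Longrightarrow> c i (z i) = c i (z' i)"
  shows "dd S z z' \<le> K * m * h"
proof -
  have "dd S z z' \<le> (\<Sum>i\<in>S. m * h)"
    unfolding dd_def using assms by (intro sum_mono ed_same) (auto simp: X_mem)
  also have "\<dots> \<le> (\<Sum>i\<in>{1..K}. m * h)"
    using S m1 h_pos by (intro sum_mono2) auto
  finally show ?thesis by simp
qed

section \<open>Expectations and probabilities under mass functions\<close>

lemma E_add: "E p (\<lambda>z. F z + G z) = E p F + E p G"
  by (simp add: E_def algebra_simps sum.distrib)
lemma E_diff: "E p (\<lambda>z. F z - G z) = E p F - E p G"
  by (simp add: E_def algebra_simps sum_subtractf)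
lemma E_cmult: "E p (\<lambda>z. a * F z) = a * E p F"
  by (simp add: E_def algebra_simps sum_distrib_left)
lemma E_sum: "E p (\<lambda>z. \<Sum>i\<in>I. F i z) = (\<Sum>i\<in>I. E p (F i))"
  unfolding E_def sum_distrib_left by (rule sum.swap)
lemma E_cong: "(\<And>z. z \<in> X \<Longrightarrow> F z = G z) \<Longrightarrow> E p F = E p G"
  by (simp add: E_def)
lemma E_mono: "pmass p \<Longrightarrow> (\<And>z. z \<in> X \<Longrightarrow> F z \<le> G z) \<Longrightarrow> E p F \<le> E p G"
  unfolding E_def pmass_def by (intro sum_mono mult_left_mono) auto
lemma E_const: "pmass p \<Longrightarrow> E p (\<lambda>z. a) = a"
  by (simp add: E_def pmass_def flip: sum_distrib_right)
lemma E_abs: "pmass p \<Longrightarrow> \<bar>E p F\<bar> \<le> E p (\<lambda>z. \<bar>F z\<bar>)"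
  unfolding E_def pmass_def by (rule order_trans[OF sum_abs]) (auto simp: abs_mult intro!: sum_mono)
lemma E_abs_le: "pmass p \<Longrightarrow> (\<And>z. z \<in> X \<Longrightarrow> \<bar>F z\<bar> \<le> b) \<Longrightarrow> \<bar>E p F\<bar> \<le> b"
  using E_abs[of p F] E_mono[of p "\<lambda>z. \<bar>F z\<bar>" "\<lambda>z. b"] E_const[of p b] by force
lemma E_diff_le:
  "pmass p \<Longrightarrow> (\<And>z. z \<in> X \<Longrightarrow> \<bar>F z - G z\<bar> \<le> b) \<Longrightarrow> \<bar>E p F - E p G\<bar> \<le> b"
  using E_abs_le[of p "\<lambda>z. F z - G z" b] by (simp add: E_diff)

lemma Pr_nonneg: "pmass p \<Longrightarrow> 0 \<le> Pr p R"
  unfolding Pr_def pmass_def by (intro sum_nonneg) auto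
lemma Pr_E: "Pr p R = E p (\<lambda>z. of_bool (R z))"
  by (simp add: Pr_def E_def sum.If_cases Int_def of_bool_def if_distrib cong: if_cong)
lemma Pr_cong: "(\<And>z. z \<in> X \<Longrightarrow> R z \<longleftrightarrow> R' z) \<Longrightarrow> Pr p R = Pr p R'"
  unfolding Pr_def by (intro sum.cong) auto
lemma Pr_mono: "pmass p \<Longrightarrow> (\<And>z. z \<in> X \<Longrightarrow> R z \<Longrightarrow> R' z) \<Longrightarrow> Pr p R \<le> Pr p R'"
  unfolding Pr_def pmass_def by (intro sum_mono2) auto

lemma Pr_split:
  assumes "finite D" "\<And>z. z \<in> X \<Longrightarrow> R z \<Longrightarrow> g z \<in> D"
  shows "Pr p R = (\<Sum>s\<in>D. Pr p (\<lambda>z. R z \<and> g z = s))"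
proof -
  have "(\<Sum>s\<in>D. Pr p (\<lambda>z. R z \<and> g z = s)) = (\<Sum>s\<in>D. \<Sum>z\<in>{z \<in> {z \<in> X. R z}. g z = s}. p z)"
    unfolding Pr_def by (intro sum.cong) auto
  also have "\<dots> = Pr p R" unfolding Pr_def using assms by (intro sum.group) auto
  finally show ?thesis by simp
qed

lemma E_group:
  assumes "finite D" "\<And>z. z \<in> X \<Longrightarrow> g z \<in> D"
  shows "E p (\<lambda>z. F (g z)) = (\<Sum>s\<in>D. Pr p (\<lambda>z. g z = s) * F s)"
proof -
  have "(\<Sum>s\<in>D. Pr p (\<lambda>z. g z = s) * F s) = (\<Sum>s\<in>D. \<Sum>z\<in>{z \<in> X. g z = s}. p z * F (g z))"
    unfolding Pr_def sum_distrib_right by (intro sum.cong) auto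
  also have "\<dots> = E p (\<lambda>z. F (g z))" unfolding E_def using assms by (intro sum.group) auto
  finally show ?thesis by simp
qed

lemma sum_group_image:
  "k \<in> {1..K} \<Longrightarrow> (\<Sum>q\<in>B k. f q) = (\<Sum>s\<in>g ` B k. \<Sum>q\<in>{q \<in> B k. g q = s}. f q)"
  by (intro sum.image_gen) auto

lemma dep_lip: assumes "lip k A F" shows "dep {1..k} F"
  unfolding dep_def
proof (intro ballI impI)
  fix z z' assume z: "z \<in> X" "z' \<in> X" and eq: "\<forall>i\<in>{1..k}. z i = z' i"
  have "dd {1..k} z z' = 0" unfolding dd_def using eq by (intro sum.neutral) auto
  then show "F z = F z'" using assms z unfolding lip_def by force
qed

lemma dep_mono: "dep S F \<Longrightarrow> S \<subseteq> S' \<Longrightarrow> dep S' F" unfolding dep_def by blast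
lemma depD: "dep S F \<Longrightarrow> z \<in> X \<Longrightarrow> z' \<in> X \<Longrightarrow> (\<And>i. i \<in> S \<Longrightarrow> z i = z' i) \<Longrightarrow> F z = F z'"
  unfolding dep_def by blast

lemma finite_par: "k \<in> {1..K} \<Longrightarrow> finite (par k)"
  using par_sub[of k] finite_subset by blast
lemma par_K: "k \<in> {1..K} \<Longrightarrow> par k \<subseteq> {1..K}" using par_sub[of k] by force

lemma key_eq: "key k z = key k z' \<longleftrightarrow> (\<forall>i\<in>par k. c i (z i) = c i (z' i))"
  unfolding key_def by (auto simp: restrict_def fun_eq_iff)

lemma key_upd: "k \<in> {1..K} \<Longrightarrow> key k (z(k := q)) = key k z"
  using par_sub[of k] by (auto simp: key_eq)

text \<open>\<open>cond p k \<kappa>\<close>: \<open>\<kappa>\<close> is a stochastic kernel for block \<open>k\<close> that only depends on the coarse cells of the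
  parents, and induces on the coarse cells of block \<open>k\<close> the conditional law under \<open>p\<close>.\<close>

definition cond :: "((nat \<Rightarrow> 'b) \<Rightarrow> real) \<Rightarrow> nat \<Rightarrow> ((nat \<Rightarrow> 'b) \<Rightarrow> 'b \<Rightarrow> real) \<Rightarrow> bool" where
  "cond p k \<kappa> \<longleftrightarrow>
     (\<forall>z\<in>X. (\<forall>q\<in>B k. 0 \<le> \<kappa> z q) \<and> (\<Sum>q\<in>B k. \<kappa> z q) = 1) \<and>
     (\<forall>z\<in>X. \<forall>z'\<in>X. key k z = key k z' \<longrightarrow> (\<forall>q\<in>B k. \<kappa> z q = \<kappa> z' q)) \<and>
     (\<forall>z\<in>X. \<forall>s\<in>c k ` B k. Pr p (\<lambda>z'. key k z' = key k z) * (\<Sum>q\<in>{q \<in> B k. c k q = s}. \<kappa> z q) =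
        Pr p (\<lambda>z'. key k z' = key k z \<and> c k (z' k) = s))"

lemma condD:
  assumes "cond p k \<kappa>" "z \<in> X"
  shows "q \<in> B k \<Longrightarrow> 0 \<le> \<kappa> z q" "(\<Sum>q\<in>B k. \<kappa> z q) = 1"
    "z' \<in> X \<Longrightarrow> key k z = key k z' \<Longrightarrow> q \<in> B k \<Longrightarrow> \<kappa> z q = \<kappa> z' q"
    "s \<in> c k ` B k \<Longrightarrow> Pr p (\<lambda>z'. key k z' = key k z) * (\<Sum>q\<in>{q \<in> B k. c k q = s}. \<kappa> z q) =
        Pr p (\<lambda>z'. key k z' = key k z \<and> c k (z' k) = s)"
proof -
  note * = assms(1)[unfolded cond_def]
  show "q \<in> B k \<Longrightarrow> 0 \<le> \<kappa> z q" "(\<Sum>q\<in>B k. \<kappa> z q) = 1"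
    using conjunct1[OF *] assms(2) by auto
  show "z' \<in> X \<Longrightarrow> key k z = key k z' \<Longrightarrow> q \<in> B k \<Longrightarrow> \<kappa> z q = \<kappa> z' q"
    by (rule conjunct1[OF conjunct2[OF *], THEN bspec, OF assms(2), THEN bspec, THEN mp, THEN bspec])
  show "s \<in> c k ` B k \<Longrightarrow> Pr p (\<lambda>z'. key k z' = key k z) * (\<Sum>q\<in>{q \<in> B k. c k q = s}. \<kappa> z q) =
        Pr p (\<lambda>z'. key k z' = key k z \<and> c k (z' k) = s)"
    by (rule conjunct2[OF conjunct2[OF *], THEN bspec, OF assms(2), THEN bspec])
qed

text \<open>Cells of a level up to \<eta> are unions of coarse cells, so the identity in
  \<open>cond\<close> can be summed over them. This serves the low levels of the chaining.\<close>

lemma cond_level: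
  assumes \<kappa>: "cond p k \<kappa>" and z: "z \<in> X" and k: "k \<in> {1..K}" and j: "j \<le> \<eta>"
  shows "Pr p (\<lambda>z'. key k z' = key k z) * (\<Sum>q\<in>{q \<in> B k. lev k j q = a}. \<kappa> z q) =
         Pr p (\<lambda>z'. key k z' = key k z \<and> lev k j (z' k) = a)"
proof -
  define D where "D = c k ` {q \<in> B k. lev k j q = a}"
  have fD: "finite D" using k by (simp add: D_def)
  have D: "c k q \<in> D \<longleftrightarrow> lev k j q = a" if "q \<in> B k" for q
  proof
    assume "c k q \<in> D"
    then obtain q' where "q' \<in> B k" "lev k j q' = a" "c k q = c k q'" by (auto simp: D_def)
    then show "lev k j q = a" using lev_mono[OF k that _ j eta_le, of q'] by simp
  qed (use that in \<open>auto simp: D_def\<close>)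
  have "(\<Sum>q\<in>{q \<in> B k. lev k j q = a}. \<kappa> z q) = (\<Sum>s\<in>D. \<Sum>q\<in>{q \<in> B k. c k q = s}. \<kappa> z q)"
  proof -
    have "(\<Sum>q\<in>{q \<in> B k. lev k j q = a}. \<kappa> z q) =
        (\<Sum>s\<in>D. \<Sum>q\<in>{q \<in> {q \<in> B k. lev k j q = a}. c k q = s}. \<kappa> z q)"
      unfolding D_def using k by (intro sum.image_gen) auto
    then show ?thesis using D by (auto intro!: sum.cong)
  qed
  then have "Pr p (\<lambda>z'. key k z' = key k z) * (\<Sum>q\<in>{q \<in> B k. lev k j q = a}. \<kappa> z q) =
      (\<Sum>s\<in>D. Pr p (\<lambda>z'. key k z' = key k z \<and> c k (z' k) = s))"
    using condD(4)[OF \<kappa> z] by (auto simp: sum_distrib_left D_def intro!: sum.cong)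
  also have "\<dots> = (\<Sum>s\<in>D. Pr p (\<lambda>z'. (key k z' = key k z \<and> lev k j (z' k) = a) \<and> c k (z' k) = s))"
    using D X_mem[OF _ k] by (intro sum.cong Pr_cong) auto
  also have "\<dots> = Pr p (\<lambda>z'. key k z' = key k z \<and> lev k j (z' k) = a)"
    using fD D X_mem[OF _ k] by (intro Pr_split[symmetric]) auto
  finally show ?thesis .
qed

lemma E_key:
  assumes "k \<in> {1..K}" and F: "\<And>z z'. z \<in> X \<Longrightarrow> z' \<in> X \<Longrightarrow> key k z = key k z' \<Longrightarrow> F z = F z'"
    and rep: "\<And>u. u \<in> key k ` X \<Longrightarrow> r u \<in> X \<and> key k (r u) = u"
  shows "E p F = (\<Sum>u\<in>key k ` X. Pr p (\<lambda>z. key k z = u) * F (r u))"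
proof -
  have "E p F = E p (\<lambda>z. F (r (key k z)))"
    by (intro E_cong F) (use rep in auto)
  also have "\<dots> = (\<Sum>u\<in>key k ` X. Pr p (\<lambda>z. key k z = u) * F (r u))"
    by (rule E_group) auto
  finally show ?thesis .
qed

definition krep :: "nat \<Rightarrow> (nat \<Rightarrow> 'l) \<Rightarrow> nat \<Rightarrow> 'b" where
  "krep k u = (SOME z. z \<in> X \<and> key k z = u)"

lemma krep: assumes "u \<in> key k ` X" shows "krep k u \<in> X \<and> key k (krep k u) = u"
proof -
  have "\<exists>z. z \<in> X \<and> key k z = u" using assms by auto
  then show ?thesis unfolding krep_def by (rule someI_ex)
qed

text \<open>The tower property for coarse functions: such an \<open>F\<close> sees of the kernel
  only the masses of the coarse cells of block \<open>k\<close>, and these are the conditional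
  probabilities prescribed by \<open>cond\<close>.\<close>

lemma tower:
  assumes \<kappa>: "cond p k \<kappa>" and k: "k \<in> {1..K}"
    and F: "\<And>z z'. z \<in> X \<Longrightarrow> z' \<in> X \<Longrightarrow> key k z = key k z' \<Longrightarrow> c k (z k) = c k (z' k) \<Longrightarrow> F z = F z'"
  shows "E p (T k \<kappa> F) = E p F"
proof -
  define rp where "rp = (\<lambda>s. SOME q. q \<in> B k \<and> c k q = s)"
  have rp: "rp s \<in> B k \<and> c k (rp s) = s" if "s \<in> c k ` B k" for s
    unfolding rp_def by (rule someI_ex) (use that in auto)
  define G where "G = (\<lambda>u s. F ((krep k u)(k := rp s)))"
  have FG: "F (z(k := q)) = G (key k z) (c k q)" if "z \<in> X" "q \<in> B k" for z q
    unfolding G_def using that krep[of "key k z" k] rp[of "c k q"] k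
    by (intro F) (auto simp: X_upd key_upd)
  have TG: "T k \<kappa> F z = (\<Sum>s\<in>c k ` B k. (\<Sum>q\<in>{q \<in> B k. c k q = s}. \<kappa> z q) * G (key k z) s)" if "z \<in> X" for z
    unfolding T_def sum_distrib_right
    by (subst sum_group_image[OF k, where g="c k"]) (auto intro!: sum.cong simp: FG that)
  have "E p (T k \<kappa> F) = (\<Sum>u\<in>key k ` X. Pr p (\<lambda>z. key k z = u) * T k \<kappa> F (krep k u))"
  proof (rule E_key[OF k])
    fix z z' assume "z \<in> X" "z' \<in> X" "key k z = key k z'"
    then have "(\<Sum>q\<in>{q \<in> B k. c k q = s}. \<kappa> z q) = (\<Sum>q\<in>{q \<in> B k. c k q = s}. \<kappa> z' q)" for s
      by (intro sum.cong condD(3)[OF \<kappa>]) auto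
    then show "T k \<kappa> F z = T k \<kappa> F z'" using \<open>z \<in> X\<close> \<open>z' \<in> X\<close> \<open>key k z = key k z'\<close>
      by (simp add: TG)
  qed (rule krep)
  also have "\<dots> = (\<Sum>u\<in>key k ` X. \<Sum>s\<in>c k ` B k. Pr p (\<lambda>z. key k z = u \<and> c k (z k) = s) * G u s)"
  proof (intro sum.cong refl)
    fix u assume u: "u \<in> key k ` X"
    have "Pr p (\<lambda>z. key k z = u) * (\<Sum>q\<in>{q \<in> B k. c k q = s}. \<kappa> (krep k u) q) =
        Pr p (\<lambda>z. key k z = u \<and> c k (z k) = s)" if "s \<in> c k ` B k" for s
      using condD(4)[OF \<kappa>, of "krep k u" s] that krep[OF u] by simp
    then show "Pr p (\<lambda>z. key k z = u) * T k \<kappa> F (krep k u) =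
        (\<Sum>s\<in>c k ` B k. Pr p (\<lambda>z. key k z = u \<and> c k (z k) = s) * G u s)"
      using krep[OF u] by (simp add: TG sum_distrib_left flip: mult.assoc)
  qed
  also have "\<dots> = (\<Sum>(u, s)\<in>key k ` X \<times> c k ` B k. Pr p (\<lambda>z. (key k z, c k (z k)) = (u, s)) * G u s)"
    by (simp add: sum.cartesian_product)
  also have "\<dots> = E p (\<lambda>z. G (key k z) (c k (z k)))"
    using k X_mem by (subst E_group[of "key k ` X \<times> c k ` B k" "\<lambda>z. (key k z, c k (z k))" p "\<lambda>(u, s). G u s", simplified])
      (auto simp: case_prod_unfold prod_eq_iff)
  also have "\<dots> = E p F"
  proof (rule E_cong)
    fix z assume "z \<in> X"
    then show "G (key k z) (c k (z k)) = F z" using FG[of z "z k"] X_mem k by simp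
  qed
  finally show ?thesis .
qed

lemma T_const: "cond p k \<kappa> \<Longrightarrow> z \<in> X \<Longrightarrow> T k \<kappa> (\<lambda>_. a) z = a"
  unfolding T_def by (simp add: condD(2) flip: sum_distrib_right)

section \<open>Functions of coarse cells and iterated kernels\<close>

definition coarse :: "nat set \<Rightarrow> ((nat \<Rightarrow> 'b) \<Rightarrow> real) \<Rightarrow> bool" where
  "coarse S F \<longleftrightarrow> (\<forall>z\<in>X. \<forall>z'\<in>X. (\<forall>i\<in>S. c i (z i) = c i (z' i)) \<longrightarrow> F z = F z')"

lemma coarseD: "coarse S F \<Longrightarrow> z \<in> X \<Longrightarrow> z' \<in> X \<Longrightarrow> (\<And>i. i \<in> S \<Longrightarrow> c i (z i) = c i (z' i)) \<Longrightarrow> F z = F z'"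
  unfolding coarse_def by blast

lemma coarse_mono: "coarse S F \<Longrightarrow> S \<subseteq> S' \<Longrightarrow> coarse S' F" unfolding coarse_def by blast

text \<open>The expectation of \<open>F\<close> when blocks 1 to \<open>k\<close> are drawn in turn
  from the kernels and all other blocks are those of \<open>z0\<close>. The last draw is integrated
  out first.\<close>

primrec N :: "(nat \<Rightarrow> (nat \<Rightarrow> 'b) \<Rightarrow> 'b \<Rightarrow> real) \<Rightarrow> (nat \<Rightarrow> 'b) \<Rightarrow> nat \<Rightarrow> ((nat \<Rightarrow> 'b) \<Rightarrow> real) \<Rightarrow> real" where
  "N \<kappa> z0 0 F = F z0"
| "N \<kappa> z0 (Suc k) F = N \<kappa> z0 k (T (Suc k) (\<kappa> (Suc k)) F)"

lemma T_diff: "T k \<kappa> (\<lambda>z. F z - G z) z = T k \<kappa> F z - T k \<kappa> G z"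
  by (simp add: T_def algebra_simps sum_subtractf)

lemma N_diff: "N \<kappa> z0 k (\<lambda>z. F z - G z) = N \<kappa> z0 k F - N \<kappa> z0 k G"
proof (induction k arbitrary: F G)
  case (Suc k)
  have "T (Suc k) (\<kappa> (Suc k)) (\<lambda>z. F z - G z) = (\<lambda>z. T (Suc k) (\<kappa> (Suc k)) F z - T (Suc k) (\<kappa> (Suc k)) G z)"
    by (rule ext) (rule T_diff)
  then show ?case by (simp add: Suc.IH)
qed simp

lemma X_upd_Suc: "z \<in> X \<Longrightarrow> Suc k \<le> K \<Longrightarrow> q \<in> B (Suc k) \<Longrightarrow> z(Suc k := q) \<in> X"
  by (rule X_upd) auto

lemma T_cong: "k \<in> {1..K} \<Longrightarrow> (\<And>z. z \<in> X \<Longrightarrow> F z = G z) \<Longrightarrow> z \<in> X \<Longrightarrow> T k \<kappa> F z = T k \<kappa> G z"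
  unfolding T_def using X_upd by (intro sum.cong) auto

lemma N_cong:
  assumes "z0 \<in> X" "k \<le> K" "\<And>z. z \<in> X \<Longrightarrow> F z = G z"
  shows "N \<kappa> z0 k F = N \<kappa> z0 k G"
  using assms
proof (induction k arbitrary: F G)
  case (Suc k)
  show ?case unfolding N.simps
    by (rule Suc.IH) (use Suc.prems in \<open>auto intro!: T_cong\<close>)
qed simp

lemma N_mono:
  assumes "z0 \<in> X" "k \<le> K" and \<kappa>: "\<And>k. k \<in> {1..K} \<Longrightarrow> cond r k (\<kappa> k)"
    and "\<And>z. z \<in> X \<Longrightarrow> F z \<le> G z"
  shows "N \<kappa> z0 k F \<le> N \<kappa> z0 k G"
  using assms(2,4)
proof (induction k arbitrary: F G)
  case 0
  then show ?case using \<open>z0 \<in> X\<close> by simp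
next
  case (Suc k)
  have "T (Suc k) (\<kappa> (Suc k)) F z \<le> T (Suc k) (\<kappa> (Suc k)) G z" if z: "z \<in> X" for z
    unfolding T_def
  proof (intro sum_mono mult_left_mono Suc.prems(2) X_upd_Suc[OF z Suc.prems(1)])
    show "0 \<le> \<kappa> (Suc k) z q" if "q \<in> B (Suc k)" for q
      using that Suc.prems(1) by (intro condD(1)[OF \<kappa> z]) auto
  qed
  then show ?case unfolding N.simps using Suc.prems by (intro Suc.IH) auto
qed

lemma N_const:
  assumes "z0 \<in> X" "k \<le> K" and \<kappa>: "\<And>k. k \<in> {1..K} \<Longrightarrow> cond r k (\<kappa> k)"
  shows "N \<kappa> z0 k (\<lambda>_. a) = a"
  using assms(2)
proof (induction k)
  case (Suc k)
  have "N \<kappa> z0 (Suc k) (\<lambda>_. a) = N \<kappa> z0 k (\<lambda>_. a)" unfolding N.simps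
    by (rule N_cong) (use assms(1) Suc.prems in \<open>auto intro!: T_const[OF \<kappa>]\<close>)
  then show ?case using Suc by simp
qed simp

lemma coarse_T:
  assumes k: "k \<in> {1..K}" and \<kappa>: "cond r k \<kappa>" and F: "coarse (insert k (par k)) F"
  shows "coarse (par k) (T k \<kappa> F)"
  unfolding coarse_def
proof (intro ballI impI)
  fix z z' assume z: "z \<in> X" "z' \<in> X" and eq: "\<forall>i\<in>par k. c i (z i) = c i (z' i)"
  have "\<kappa> z q * F (z(k := q)) = \<kappa> z' q * F (z'(k := q))" if "q \<in> B k" for q
  proof -
    have "\<kappa> z q = \<kappa> z' q" using condD(3)[OF \<kappa> z _ that] eq by (simp add: key_eq)
    moreover have "F (z(k := q)) = F (z'(k := q))"
      using k z that eq by (intro coarseD[OF F]) (auto simp: X_upd)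
    ultimately show ?thesis by simp
  qed
  then show "T k \<kappa> F z = T k \<kappa> F z'" unfolding T_def by (intro sum.cong) auto
qed

text \<open>By \<open>par_clique\<close> the parents lie in the family of the largest parent, a
  family that was completed earlier. Agreement on earlier families is the hypothesis
  \<open>fam\<close>, so that the lemma can be used both inside the induction over families and
  after it.\<close>

lemma N_parents:
  assumes z0: "z0 \<in> X" and \<kappa>: "\<And>k. k \<in> {1..K} \<Longrightarrow> cond r k (\<kappa> k)" and r: "pmass r"
    and n: "Suc n \<in> {1..K}" and G: "coarse (par (Suc n)) G"
    and fam: "\<And>l. l \<in> {1..n} \<Longrightarrow> coarse (insert l (par l)) G \<Longrightarrow> N \<kappa> z0 n G = E r G"
  shows "N \<kappa> z0 n G = E r G"
proof (cases "par (Suc n) = {}")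
  case True
  have G': "G z = G z0" if "z \<in> X" for z
    by (rule coarseD[OF G that z0]) (simp add: True)
  have "N \<kappa> z0 n G = N \<kappa> z0 n (\<lambda>_. G z0)" using n by (intro N_cong[OF z0 _ G']) auto
  also have "\<dots> = G z0" using n by (intro N_const[OF z0 _ \<kappa>]) auto
  also have "\<dots> = E r (\<lambda>_. G z0)" using E_const[OF r] by simp
  also have "\<dots> = E r G" using G' by (intro E_cong) auto
  finally show ?thesis .
next
  case False
  have "Max (par (Suc n)) \<in> par (Suc n)" using False finite_par[OF n] by simp
  then have "Max (par (Suc n)) \<in> {1..n}" using par_sub[OF n] by force
  then show ?thesis by (rule fam) (rule coarse_mono[OF G par_clique[OF n False]])
qed

text \<open>Since \<open>par k\<close> lies in a family \<open>{l} \<union> par l\<close>, the smoothed measure and the measure \<open>r\<close> it is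
  built from agree on the coarse cells of each family.\<close>

lemma N_family:
  assumes z0: "z0 \<in> X" and \<kappa>: "\<And>k. k \<in> {1..K} \<Longrightarrow> cond r k (\<kappa> k)" and r: "pmass r"
  shows "n \<le> K \<Longrightarrow> l \<in> {1..n} \<Longrightarrow> coarse (insert l (par l)) F \<Longrightarrow> N \<kappa> z0 n F = E r F"
proof (induction n arbitrary: l F)
  case (Suc n)
  have n: "Suc n \<in> {1..K}" using Suc.prems by auto
  show ?case
  proof (cases "l = Suc n")
    case False
    then have l: "l \<in> {1..n}" "l \<in> {1..K}" using Suc.prems by auto
    \<comment> \<open>A family completed before \<open>Suc n\<close> is not touched by the last
      draw.\<close>
    have "T (Suc n) (\<kappa> (Suc n)) F z = F z" if z: "z \<in> X" for z
    proof -
      have "F (z(Suc n := q)) = F z" if "q \<in> B (Suc n)" for q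
      proof (rule coarseD[OF Suc.prems(3) X_upd[OF z n that] z])
        fix i assume "i \<in> insert l (par l)"
        then have "i \<noteq> Suc n" using par_sub[OF l(2)] l(1) by auto
        then show "c i ((z(Suc n := q)) i) = c i (z i)" by simp
      qed
      then have "T (Suc n) (\<kappa> (Suc n)) F z = T (Suc n) (\<kappa> (Suc n)) (\<lambda>_. F z) z"
        unfolding T_def by (intro sum.cong) auto
      then show ?thesis using T_const[OF \<kappa>[OF n] z] by simp
    qed
    then have "N \<kappa> z0 (Suc n) F = N \<kappa> z0 n F"
      unfolding N.simps using z0 Suc.prems by (intro N_cong) auto
    then show ?thesis using Suc.IH[of l F] l Suc.prems by simp
  next
    case True
    \<comment> \<open>Integrating out the newest node leaves a function of the coarse parent cells.
      \<open>N_parents\<close> transfers it to \<open>r\<close>, and \<open>tower\<close> puts the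
      node back.\<close>
    define G where "G = T (Suc n) (\<kappa> (Suc n)) F"
    have G: "coarse (par (Suc n)) G"
      unfolding G_def using Suc.prems True by (intro coarse_T[OF n \<kappa>[OF n]]) auto
    have "N \<kappa> z0 n G = E r G"
    proof (rule N_parents[OF z0 \<kappa> r n G])
      fix l assume "l \<in> {1..n}" "coarse (insert l (par l)) G"
      then show "N \<kappa> z0 n G = E r G" using Suc.prems(1) by (intro Suc.IH) auto
    qed
    moreover have "E r G = E r F"
      unfolding G_def
    proof (rule tower[OF \<kappa>[OF n] n])
      fix z z' assume *: "z \<in> X" "z' \<in> X" "key (Suc n) z = key (Suc n) z'" "c (Suc n) (z (Suc n)) = c (Suc n) (z' (Suc n))"
      show "F z = F z'"
        by (rule coarseD[OF Suc.prems(3) *(1,2)]) (use *(3,4) True in \<open>auto simp: key_eq\<close>)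
    qed
    ultimately show ?thesis by (simp add: G_def)
  qed
qed simp

section \<open>Dyadic chaining and cell deviations\<close>

definition rep :: "nat \<Rightarrow> nat \<Rightarrow> 'b \<Rightarrow> 'b" where
  "rep k j q = (SOME q'. q' \<in> B k \<and> lev k j q' = lev k j q)"

lemma rep: assumes "q \<in> B k" shows "rep k j q \<in> B k" "lev k j (rep k j q) = lev k j q"
proof -
  have "\<exists>q'. q' \<in> B k \<and> lev k j q' = lev k j q" using assms by blast
  from someI_ex[OF this] have *: "rep k j q \<in> B k \<and> lev k j (rep k j q) = lev k j q"
    unfolding rep_def .
  then show "rep k j q \<in> B k" by (rule conjunct1)
  show "lev k j (rep k j q) = lev k j q" using * by (rule conjunct2)
qed

lemma rep_cong: "lev k j q = lev k j q' \<Longrightarrow> rep k j q = rep k j q'"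
  unfolding rep_def by simp

text \<open>The l1 norm of the signed weights \<Delta> after aggregation to level-\<open>j\<close>
  cells.\<close>

definition gap :: "nat \<Rightarrow> nat \<Rightarrow> ('b \<Rightarrow> real) \<Rightarrow> real" where
  "gap k j \<Delta> = (\<Sum>a\<in>lev k j ` B k. \<bar>\<Sum>q\<in>{q \<in> B k. lev k j q = a}. \<Delta> q\<bar>)"

lemma gap_bound:
  assumes k: "k \<in> {1..K}" and "\<And>q q'. q \<in> B k \<Longrightarrow> q' \<in> B k \<Longrightarrow> lev k j q = lev k j q' \<Longrightarrow> \<phi> q = \<phi> q'"
    and "\<And>q. q \<in> B k \<Longrightarrow> \<bar>\<phi> q\<bar> \<le> b"
  shows "(\<Sum>q\<in>B k. \<Delta> q * \<phi> q) \<le> b * gap k j \<Delta>"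
proof -
  have "(\<Sum>q\<in>B k. \<Delta> q * \<phi> q) = (\<Sum>a\<in>lev k j ` B k. \<Sum>q\<in>{q \<in> B k. lev k j q = a}. \<Delta> q * \<phi> q)"
    by (rule sum_group_image[OF k])
  also have "\<dots> \<le> (\<Sum>a\<in>lev k j ` B k. b * \<bar>\<Sum>q\<in>{q \<in> B k. lev k j q = a}. \<Delta> q\<bar>)"
  proof (rule sum_mono)
    fix a assume "a \<in> lev k j ` B k"
    then obtain q0 where q0: "q0 \<in> B k" "lev k j q0 = a" by auto
    have "(\<Sum>q\<in>{q \<in> B k. lev k j q = a}. \<Delta> q * \<phi> q) = (\<Sum>q\<in>{q \<in> B k. lev k j q = a}. \<Delta> q * \<phi> q0)"
    proof (rule sum.cong[OF refl])
      fix q assume "q \<in> {q \<in> B k. lev k j q = a}"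
      then show "\<Delta> q * \<phi> q = \<Delta> q * \<phi> q0" using assms(2)[of q q0] q0 by simp
    qed
    also have "\<dots> = (\<Sum>q\<in>{q \<in> B k. lev k j q = a}. \<Delta> q) * \<phi> q0" by (simp add: sum_distrib_right)
    also have "\<dots> \<le> \<bar>\<Sum>q\<in>{q \<in> B k. lev k j q = a}. \<Delta> q\<bar> * \<bar>\<phi> q0\<bar>"
      by (simp add: abs_mult[symmetric])
    also have "\<dots> \<le> \<bar>\<Sum>q\<in>{q \<in> B k. lev k j q = a}. \<Delta> q\<bar> * b"
      using assms(3)[OF q0(1)] by (intro mult_left_mono) auto
    finally show "(\<Sum>q\<in>{q \<in> B k. lev k j q = a}. \<Delta> q * \<phi> q) \<le> b * \<bar>\<Sum>q\<in>{q \<in> B k. lev k j q = a}. \<Delta> q\<bar>"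
      by (simp add: mult.commute)
  qed
  also have "\<dots> = b * gap k j \<Delta>" by (simp add: gap_def sum_distrib_left)
  finally show ?thesis .
qed

text \<open>\<open>f\<close> is telescoped along the representatives of its cells. The increment
  from level \<open>j\<close> to \<open>Suc j\<close> is constant on cells of level
  \<open>Suc j\<close> and of the size of a level-\<open>j\<close> cell. The level-0 term is
  constant and vanishes against \<Delta>; at level \<open>J\<close> the representative is the point
  itself.\<close>

lemma chaining:
  assumes k: "k \<in> {1..K}" and A: "0 \<le> A" and \<Delta>: "(\<Sum>q\<in>B k. \<Delta> q) = 0"
    and f: "\<And>q q'. q \<in> B k \<Longrightarrow> q' \<in> B k \<Longrightarrow> \<bar>f q - f q'\<bar> \<le> A * ed k q q'"
  shows "(\<Sum>q\<in>B k. \<Delta> q * f q) \<le> A * (\<Sum>j\<in>{1..J}. 4 * m / 2 ^ j * gap k j \<Delta>)"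
proof -
  obtain q0 where q0: "q0 \<in> B k" using ne_B[OF k] by auto
  define g where "g = (\<lambda>j q. f (rep k j q))"
  have g0: "g 0 q = g 0 q0" if "q \<in> B k" for q
    unfolding g_def using rep_cong[of k 0 q q0] lev_0[OF k that q0] by simp
  have gJ: "g J q = f q" if "q \<in> B k" for q
    unfolding g_def using rep[OF that, of J] lev_J[OF k, of "rep k J q" q] that by simp
  have tel: "f q = g 0 q0 + (\<Sum>j<J. g (Suc j) q - g j q)" if "q \<in> B k" for q
    using sum_lessThan_telescope[of "\<lambda>j. g j q" J] g0[OF that] gJ[OF that] by simp
  have step: "(\<Sum>q\<in>B k. \<Delta> q * (g (Suc j) q - g j q)) \<le> (A * (4 * m / 2 ^ Suc j)) * gap k (Suc j) \<Delta>" if "j < J" for j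
  proof (rule gap_bound[OF k])
    fix q q' assume q: "q \<in> B k" "q' \<in> B k" and eq: "lev k (Suc j) q = lev k (Suc j) q'"
    have "lev k j q = lev k j q'" using lev_mono[OF k q _ _ eq, of j] that by simp
    then show "g (Suc j) q - g j q = g (Suc j) q' - g j q'"
      unfolding g_def using rep_cong eq by metis
  next
    fix q assume q: "q \<in> B k"
    let ?a = "rep k (Suc j) q" and ?b = "rep k j q"
    have ab: "?a \<in> B k" "?b \<in> B k" using rep[OF q] by auto
    have "lev k j ?a = lev k j q"
      using lev_mono[OF k ab(1) q, of j "Suc j"] rep(2)[OF q, of "Suc j"] that by simp
    then have eq: "lev k j ?a = lev k j ?b" using rep(2)[OF q, of j] by simp
    have bd: "bd k ?a ?b \<le> m / 2 ^ j" using bd_lev[OF k ab _ eq] that by simp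
    have "ed k ?a ?b \<le> m / 2 ^ j + m / 2 ^ j"
    proof (cases "c k ?a = c k ?b")
      case True
      moreover have "0 \<le> m / 2 ^ j" using m1 by simp
      ultimately show ?thesis using bd True by (simp only: ed_def if_True refl)
    next
      case False
      \<comment> \<open>The surcharge \<open>h\<close> is paid only between different coarse cells.
        Two representatives in a common level-\<open>j\<close> cell can be so separated only if
        \<open>j < \<eta>\<close>, and then \<open>h\<close> is at most the side of that cell. This
        gives \<open>2 * m / 2 ^ j = 4 * m / 2 ^ Suc j\<close>.\<close>
      then have "j < \<eta>" using lev_mono[OF k ab, of \<eta> j] eq that by (meson not_le less_imp_le)
      then have "(2::real) ^ j \<le> 2 ^ \<eta>" by (intro power_increasing) auto
      then have "h \<le> 1 / 2 ^ j" unfolding h_def by (intro divide_left_mono) auto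
      also have "\<dots> \<le> m / 2 ^ j" using m1 by (intro divide_right_mono) auto
      finally show ?thesis using bd False by (simp add: ed_def)
    qed
    then have "A * ed k ?a ?b \<le> A * (4 * m / 2 ^ Suc j)" using A by (intro mult_left_mono) auto
    then show "\<bar>g (Suc j) q - g j q\<bar> \<le> A * (4 * m / 2 ^ Suc j)"
      unfolding g_def using f[OF ab] by linarith
  qed
  have "(\<Sum>q\<in>B k. \<Delta> q * f q) = (\<Sum>q\<in>B k. \<Delta> q * g 0 q0 + (\<Sum>j<J. \<Delta> q * (g (Suc j) q - g j q)))"
    using tel by (intro sum.cong) (auto simp: distrib_left sum_distrib_left)
  also have "\<dots> = (\<Sum>j<J. \<Sum>q\<in>B k. \<Delta> q * (g (Suc j) q - g j q))"
    unfolding sum.distrib using \<Delta> by (subst (2) sum.swap) (simp flip: sum_distrib_right)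
  also have "\<dots> \<le> (\<Sum>j<J. (A * (4 * m / 2 ^ Suc j)) * gap k (Suc j) \<Delta>)"
    using step by (intro sum_mono) auto
  also have "\<dots> = A * (\<Sum>j<J. 4 * m / 2 ^ Suc j * gap k (Suc j) \<Delta>)"
    unfolding sum_distrib_left by (intro sum.cong) auto
  also have "(\<Sum>j<J. 4 * m / 2 ^ Suc j * gap k (Suc j) \<Delta>) = (\<Sum>j\<in>{1..J}. 4 * m / 2 ^ j * gap k j \<Delta>)"
    by (rule sum.reindex_bij_witness[of _ "\<lambda>j. j - 1" Suc]) auto
  finally show ?thesis .
qed

text \<open>The l1 deviation of \<open>p\<close> from \<open>r\<close> on the joint partition by the
  coarse cells of the parents and the level-\<open>j\<close> cells of block \<open>k\<close>;
  \<open>Y\<close> below is its counterpart for the marginal of block \<open>k\<close>.\<close>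

definition V where
  "V p r k j = (\<Sum>u\<in>key k ` X. \<Sum>a\<in>lev k j ` B k.
     \<bar>Pr p (\<lambda>z. key k z = u \<and> lev k j (z k) = a) - Pr r (\<lambda>z. key k z = u \<and> lev k j (z k) = a)\<bar>)"

definition Y where
  "Y p r k j = (\<Sum>a\<in>lev k j ` B k. \<bar>Pr p (\<lambda>z. lev k j (z k) = a) - Pr r (\<lambda>z. lev k j (z k) = a)\<bar>)"

text \<open>Averaging over the parents with \<open>r\<close> multiplies the conditional
  probabilities under \<open>r\<close> by their own denominators. What remains is the deviation of
  the joint cells plus that of the parent cells, and the latter is at most the former; hence the
  factor 2.\<close>

lemma gap_low:
  assumes k: "k \<in> {1..K}" and p: "pmass p" and r: "pmass r" and \<kappa>: "cond p k \<kappa>" and \<kappa>': "cond r k \<kappa>'" and j: "j \<le> \<eta>"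
  shows "E r (\<lambda>z. gap k j (\<lambda>q. \<kappa> z q - \<kappa>' z q)) \<le> 2 * V p r k j"
proof -
  define M where "M = (\<lambda>u a. \<Sum>q\<in>{q \<in> B k. lev k j q = a}. \<kappa> (krep k u) q)"
  define P where "P = (\<lambda>u a. Pr p (\<lambda>z. key k z = u \<and> lev k j (z k) = a))"
  define R where "R = (\<lambda>u a. Pr r (\<lambda>z. key k z = u \<and> lev k j (z k) = a))"
  define P' where "P' = (\<lambda>u. Pr p (\<lambda>z. key k z = u))"
  define R' where "R' = (\<lambda>u. Pr r (\<lambda>z. key k z = u))"
  let ?U = "key k ` X" and ?A = "lev k j ` B k"
  have P': "P' u = (\<Sum>a\<in>?A. P u a)" and R': "R' u = (\<Sum>a\<in>?A. R u a)" for u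
    unfolding P'_def P_def R'_def R_def using k X_mem by (auto intro!: Pr_split)
  have "E r (\<lambda>z. gap k j (\<lambda>q. \<kappa> z q - \<kappa>' z q)) =
     (\<Sum>u\<in>?U. R' u * gap k j (\<lambda>q. \<kappa> (krep k u) q - \<kappa>' (krep k u) q))"
    unfolding R'_def
  proof (rule E_key[OF k])
    fix z z' assume "z \<in> X" "z' \<in> X" "key k z = key k z'"
    then have "(\<Sum>q\<in>{q \<in> B k. lev k j q = a}. \<kappa> z q - \<kappa>' z q) = (\<Sum>q\<in>{q \<in> B k. lev k j q = a}. \<kappa> z' q - \<kappa>' z' q)" for a
      by (intro sum.cong refl arg_cong2[where f="(-)"] condD(3)[OF \<kappa>] condD(3)[OF \<kappa>']) auto
    then show "gap k j (\<lambda>q. \<kappa> z q - \<kappa>' z q) = gap k j (\<lambda>q. \<kappa> z' q - \<kappa>' z' q)" unfolding gap_def by simp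
  qed (rule krep)
  also have "\<dots> \<le> (\<Sum>u\<in>?U. \<Sum>a\<in>?A. \<bar>P u a - R u a\<bar> + \<bar>P u a - R u a\<bar>)"
  proof (rule sum_mono)
    fix u assume u: "u \<in> ?U"
    have z: "krep k u \<in> X" "key k (krep k u) = u" using krep[OF u] by auto
    have M0: "M u a \<ge> 0" for a unfolding M_def using condD(1)[OF \<kappa> z(1)] by (intro sum_nonneg) auto
    have M1: "(\<Sum>a\<in>?A. M u a) = 1"
      unfolding M_def using sum_group_image[OF k, of "\<kappa> (krep k u)" "lev k j"] condD(2)[OF \<kappa> z(1)] by simp
    have PM: "P' u * M u a = P u a" for a
      unfolding P'_def M_def P_def using cond_level[OF \<kappa> z(1) k j] z by simp
    have RM: "R' u * (\<Sum>q\<in>{q \<in> B k. lev k j q = a}. \<kappa>' (krep k u) q) = R u a" for a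
      unfolding R'_def R_def using cond_level[OF \<kappa>' z(1) k j] z by simp
    have R0: "R' u \<ge> 0" unfolding R'_def by (rule Pr_nonneg[OF r])
    have "R' u * gap k j (\<lambda>q. \<kappa> (krep k u) q - \<kappa>' (krep k u) q) =
       (\<Sum>a\<in>?A. \<bar>R' u * (M u a - (\<Sum>q\<in>{q \<in> B k. lev k j q = a}. \<kappa>' (krep k u) q))\<bar>)"
      unfolding gap_def sum_distrib_left using R0 by (simp add: abs_mult M_def sum_subtractf)
    \<comment> \<open>\<open>R' u\<close> times the second kernel is \<open>R u a\<close>. For the
      first kernel the matching factor is \<open>P' u\<close>, so \<open>R' u\<close> is replaced by
      it at the cost of \<open>\<bar>R' u - P' u\<bar>\<close>.\<close>
    also have "\<dots> = (\<Sum>a\<in>?A. \<bar>(R' u - P' u) * M u a + (P u a - R u a)\<bar>)"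
      by (intro sum.cong refl arg_cong[where f=abs]) (simp add: algebra_simps RM PM)
    also have "\<dots> \<le> (\<Sum>a\<in>?A. \<bar>R' u - P' u\<bar> * M u a + \<bar>P u a - R u a\<bar>)"
      using M0 by (intro sum_mono order_trans[OF abs_triangle_ineq]) (simp add: abs_mult)
    also have "\<dots> = \<bar>R' u - P' u\<bar> + (\<Sum>a\<in>?A. \<bar>P u a - R u a\<bar>)"
      by (simp add: sum.distrib M1 flip: sum_distrib_left)
    also have "\<bar>R' u - P' u\<bar> \<le> (\<Sum>a\<in>?A. \<bar>P u a - R u a\<bar>)"
      unfolding P' R' sum_subtractf[symmetric]
      by (rule order_trans[OF sum_abs]) (simp add: abs_minus_commute)
    finally show "R' u * gap k j (\<lambda>q. \<kappa> (krep k u) q - \<kappa>' (krep k u) q) \<le>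
        (\<Sum>a\<in>?A. \<bar>P u a - R u a\<bar> + \<bar>P u a - R u a\<bar>)" by (simp only: sum.distrib)
  qed
  also have "\<dots> = 2 * V p r k j"
    unfolding V_def P_def R_def by (simp add: sum.distrib flip: sum_distrib_left)
  finally show ?thesis .
qed

end

section \<open>Conditional kernels and chaining\<close>

context blocks
begin

text \<open>Kernels of this type choose a coarse cell with weights \<open>w\<close> and then a point
  in it with law \<open>mm\<close>. In the form of \<open>wm\<close> the law may be degenerate on
  cells of weight zero, as happens when it is a quotient by a vanishing cell mass.\<close>

lemma cond_mix:
  assumes p: "pmass p" and k: "k \<in> {1..K}"
    and w0: "\<And>u s. u \<in> key k ` X \<Longrightarrow> s \<in> c k ` B k \<Longrightarrow> 0 \<le> w u s"
    and w1: "\<And>u. u \<in> key k ` X \<Longrightarrow> (\<Sum>s\<in>c k ` B k. w u s) = 1"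
    and wP: "\<And>u s. u \<in> key k ` X \<Longrightarrow> s \<in> c k ` B k \<Longrightarrow>
       Pr p (\<lambda>z. key k z = u) * w u s = Pr p (\<lambda>z. key k z = u \<and> c k (z k) = s)"
    and mm0: "\<And>q. q \<in> B k \<Longrightarrow> 0 \<le> mm q"
    and wm: "\<And>u s. u \<in> key k ` X \<Longrightarrow> s \<in> c k ` B k \<Longrightarrow> w u s * (\<Sum>q\<in>{q \<in> B k. c k q = s}. mm q) = w u s"
  shows "cond p k (\<lambda>z q. w (key k z) (c k q) * mm q)"
    and "\<And>u s. u \<in> key k ` X \<Longrightarrow> s \<in> c k ` B k \<Longrightarrow> (\<Sum>q\<in>{q \<in> B k. c k q = s}. w u (c k q) * mm q) = w u s"
proof -
  show cell: "(\<Sum>q\<in>{q \<in> B k. c k q = s}. w u (c k q) * mm q) = w u s" if "u \<in> key k ` X" "s \<in> c k ` B k" for u s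
  proof -
    have "(\<Sum>q\<in>{q \<in> B k. c k q = s}. w u (c k q) * mm q) = (\<Sum>q\<in>{q \<in> B k. c k q = s}. w u s * mm q)"
      by (intro sum.cong) auto
    then show ?thesis using wm[OF that] by (simp add: sum_distrib_left)
  qed
  show "cond p k (\<lambda>z q. w (key k z) (c k q) * mm q)"
    unfolding cond_def
  proof (intro conjI ballI impI)
    fix z assume z: "z \<in> X"
    then have u: "key k z \<in> key k ` X" by auto
    show "0 \<le> w (key k z) (c k q) * mm q" if "q \<in> B k" for q
      using w0[OF u] mm0 that by auto
    show "(\<Sum>q\<in>B k. w (key k z) (c k q) * mm q) = 1"
    proof -
      have "(\<Sum>q\<in>B k. w (key k z) (c k q) * mm q) =
          (\<Sum>s\<in>c k ` B k. \<Sum>q\<in>{q \<in> B k. c k q = s}. w (key k z) (c k q) * mm q)"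
        by (rule sum_group_image[OF k])
      also have "\<dots> = (\<Sum>s\<in>c k ` B k. w (key k z) s)" by (intro sum.cong cell[OF u] refl)
      finally show ?thesis using w1[OF u] by simp
    qed
    show "Pr p (\<lambda>z'. key k z' = key k z) * (\<Sum>q\<in>{q \<in> B k. c k q = s}. w (key k z) (c k q) * mm q) =
        Pr p (\<lambda>z'. key k z' = key k z \<and> c k (z' k) = s)" if "s \<in> c k ` B k" for s
      using cell[OF u that] wP[OF u that] by simp
  qed auto
qed

text \<open>\<open>smk p k\<close> is the smoothed kernel of \<open>p\<close>; the fallback for parent cells of mass zero is the marginal.\<close>

definition wt :: "((nat \<Rightarrow> 'b) \<Rightarrow> real) \<Rightarrow> nat \<Rightarrow> (nat \<Rightarrow> 'l) \<Rightarrow> 'l \<Rightarrow> real" where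
  "wt p k u s = (if Pr p (\<lambda>z. key k z = u) = 0 then Pr p (\<lambda>z. c k (z k) = s)
     else Pr p (\<lambda>z. key k z = u \<and> c k (z k) = s) / Pr p (\<lambda>z. key k z = u))"

definition mm :: "((nat \<Rightarrow> 'b) \<Rightarrow> real) \<Rightarrow> nat \<Rightarrow> 'b \<Rightarrow> real" where
  "mm p k q = Pr p (\<lambda>z. z k = q) / Pr p (\<lambda>z. c k (z k) = c k q)"

definition smk :: "((nat \<Rightarrow> 'b) \<Rightarrow> real) \<Rightarrow> nat \<Rightarrow> (nat \<Rightarrow> 'b) \<Rightarrow> 'b \<Rightarrow> real" where
  "smk p k z q = wt p k (key k z) (c k q) * mm p k q"

lemma E_cmult_right: "E p (\<lambda>z. F z * a) = E p F * a"
  by (simp add: E_def algebra_simps sum_distrib_left)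

lemma Pr_UNIV: "pmass p \<Longrightarrow> Pr p (\<lambda>_. True) = 1" by (simp add: Pr_def pmass_def)

lemma Pr_zero_mono: "pmass p \<Longrightarrow> Pr p R' = 0 \<Longrightarrow> (\<And>z. z \<in> X \<Longrightarrow> R z \<Longrightarrow> R' z) \<Longrightarrow> Pr p R = 0"
  using Pr_mono[of p R R'] Pr_nonneg[of p R] by simp

lemma Pr_cells:
  assumes k: "k \<in> {1..K}" and s: "\<And>q. q \<in> B k \<Longrightarrow> g q = s \<Longrightarrow> q \<in> D" "D \<subseteq> B k" "\<And>q. q \<in> D \<Longrightarrow> g q = s"
  shows "Pr p (\<lambda>z. g (z k) = s) = (\<Sum>q\<in>D. Pr p (\<lambda>z. z k = q))"
proof -
  have "finite D" using s(2) k finite_subset fin_B by blast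
  then have "Pr p (\<lambda>z. g (z k) = s) = (\<Sum>q\<in>D. Pr p (\<lambda>z. g (z k) = s \<and> z k = q))"
    using s X_mem[OF _ k] by (intro Pr_split) auto
  also have "\<dots> = (\<Sum>q\<in>D. Pr p (\<lambda>z. z k = q))" using s by (intro sum.cong Pr_cong) auto
  finally show ?thesis .
qed

lemma mm_nonneg: "pmass p \<Longrightarrow> 0 \<le> mm p k q" by (simp add: mm_def Pr_nonneg)

lemma mm_cell:
  assumes "k \<in> {1..K}" "Pr p (\<lambda>z. c k (z k) = s) \<noteq> 0"
  shows "(\<Sum>q\<in>{q \<in> B k. c k q = s}. mm p k q) = 1"
proof -
  have "(\<Sum>q\<in>{q \<in> B k. c k q = s}. mm p k q) = (\<Sum>q\<in>{q \<in> B k. c k q = s}. Pr p (\<lambda>z. z k = q) / Pr p (\<lambda>z. c k (z k) = s))"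
    by (intro sum.cong) (auto simp: mm_def)
  also have "\<dots> = (\<Sum>q\<in>{q \<in> B k. c k q = s}. Pr p (\<lambda>z. z k = q)) / Pr p (\<lambda>z. c k (z k) = s)"
    by (rule sum_divide_distrib[symmetric])
  also have "(\<Sum>q\<in>{q \<in> B k. c k q = s}. Pr p (\<lambda>z. z k = q)) = Pr p (\<lambda>z. c k (z k) = s)"
    by (rule Pr_cells[OF assms(1), symmetric]) auto
  finally have "(\<Sum>q\<in>{q \<in> B k. c k q = s}. mm p k q) = Pr p (\<lambda>z. c k (z k) = s) / Pr p (\<lambda>z. c k (z k) = s)" .
  also have "\<dots> = 1" using assms(2) by simp
  finally show ?thesis .
qed

lemma mm_mass: "pmass p \<Longrightarrow> Pr p (\<lambda>z. c k (z k) = c k q) * mm p k q = Pr p (\<lambda>z. z k = q)"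
proof -
  assume p: "pmass p"
  have "Pr p (\<lambda>z. z k = q) = 0" if "Pr p (\<lambda>z. c k (z k) = c k q) = 0" by (rule Pr_zero_mono[OF p that]) simp
  then show ?thesis by (simp add: mm_def)
qed

lemma wt_zero: "pmass p \<Longrightarrow> Pr p (\<lambda>z. c k (z k) = s) = 0 \<Longrightarrow> wt p k u s = 0"
proof -
  assume *: "pmass p" "Pr p (\<lambda>z. c k (z k) = s) = 0"
  have "Pr p (\<lambda>z. key k z = u \<and> c k (z k) = s) = 0" by (rule Pr_zero_mono[OF *]) simp
  then show ?thesis using *(2) by (simp add: wt_def)
qed

lemma wt_sum:
  assumes "pmass p" and k: "k \<in> {1..K}" shows "(\<Sum>s\<in>c k ` B k. wt p k u s) = 1"
proof (cases "Pr p (\<lambda>z. key k z = u) = 0")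
  case True
  then show ?thesis
    using Pr_split[of "c k ` B k" "\<lambda>_. True" "\<lambda>z. c k (z k)" p] Pr_UNIV[OF assms(1)] X_mem[OF _ k] k
    by (simp add: wt_def)
next
  case False
  then show ?thesis
    using Pr_split[of "c k ` B k" "\<lambda>z. key k z = u" "\<lambda>z. c k (z k)" p] X_mem[OF _ k] k
    by (simp add: wt_def flip: sum_divide_distrib)
qed

lemma
  assumes p: "pmass p" and k: "k \<in> {1..K}"
  shows cond_smk: "cond p k (smk p k)"
    and smk_cell: "\<And>u s. u \<in> key k ` X \<Longrightarrow> s \<in> c k ` B k \<Longrightarrow> (\<Sum>q\<in>{q \<in> B k. c k q = s}. wt p k u (c k q) * mm p k q) = wt p k u s"
proof -
  have *: "0 \<le> wt p k u s"
    "Pr p (\<lambda>z. key k z = u) * wt p k u s = Pr p (\<lambda>z. key k z = u \<and> c k (z k) = s)"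
    "wt p k u s * (\<Sum>q\<in>{q \<in> B k. c k q = s}. mm p k q) = wt p k u s" for u s
  proof -
    show "0 \<le> wt p k u s" by (simp add: wt_def Pr_nonneg[OF p])
    show "Pr p (\<lambda>z. key k z = u) * wt p k u s = Pr p (\<lambda>z. key k z = u \<and> c k (z k) = s)"
      using Pr_zero_mono[OF p, of "\<lambda>z. key k z = u" "\<lambda>z. key k z = u \<and> c k (z k) = s"] by (auto simp: wt_def)
    show "wt p k u s * (\<Sum>q\<in>{q \<in> B k. c k q = s}. mm p k q) = wt p k u s"
      by (cases "Pr p (\<lambda>z. c k (z k) = s) = 0") (simp_all add: wt_zero[OF p] mm_cell[OF k])
  qed
  show "cond p k (smk p k)"
    using cond_mix(1)[OF p k, of "wt p k" "mm p k"] * wt_sum[OF p k] mm_nonneg[OF p]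
    by (simp add: smk_def[abs_def])
  show "(\<Sum>q\<in>{q \<in> B k. c k q = s}. wt p k u (c k q) * mm p k q) = wt p k u s"
    if "u \<in> key k ` X" "s \<in> c k ` B k" for u s
    using cond_mix(2)[OF p k, of "wt p k" "mm p k", OF *(1) wt_sum[OF p k] *(2) mm_nonneg[OF p] *(3) that] .
qed

text \<open>A coarser level merges cells, and merging can only cancel signed deviations.\<close>

lemma Y_mono:
  assumes k: "k \<in> {1..K}" and j: "j \<le> i" "i \<le> J"
  shows "Y p r k j \<le> Y p r k i"
proof -
  obtain g where g: "\<And>q. q \<in> B k \<Longrightarrow> lev k j q = g (lev k i q)"
  proof
    fix q assume q: "q \<in> B k"
    have "\<exists>q'. q' \<in> B k \<and> lev k i q' = lev k i q" using q by blast
    from someI_ex[OF this]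
    show "lev k j q = (\<lambda>a. lev k j (SOME q'. q' \<in> B k \<and> lev k i q' = a)) (lev k i q)"
      using lev_mono[OF k q _ j, of "SOME q'. q' \<in> B k \<and> lev k i q' = lev k i q"] by simp
  qed
  let ?D = "\<lambda>a. Pr p (\<lambda>z. lev k i (z k) = a) - Pr r (\<lambda>z. lev k i (z k) = a)"
  have split: "Pr p (\<lambda>z. lev k j (z k) = a) = (\<Sum>b\<in>{b \<in> lev k i ` B k. g b = a}. Pr p (\<lambda>z. lev k i (z k) = b))" for p a
  proof -
    have "Pr p (\<lambda>z. lev k j (z k) = a) = (\<Sum>b\<in>{b \<in> lev k i ` B k. g b = a}. Pr p (\<lambda>z. lev k j (z k) = a \<and> lev k i (z k) = b))"
      using k g X_mem[OF _ k] by (intro Pr_split) auto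
    also have "\<dots> = (\<Sum>b\<in>{b \<in> lev k i ` B k. g b = a}. Pr p (\<lambda>z. lev k i (z k) = b))"
      using g X_mem[OF _ k] by (intro sum.cong Pr_cong) auto
    finally show ?thesis .
  qed
  have "Y p r k j = (\<Sum>a\<in>lev k j ` B k. \<bar>\<Sum>b\<in>{b \<in> lev k i ` B k. g b = a}. ?D b\<bar>)"
    unfolding Y_def by (simp add: split sum_subtractf)
  also have "\<dots> \<le> (\<Sum>a\<in>lev k j ` B k. \<Sum>b\<in>{b \<in> lev k i ` B k. g b = a}. \<bar>?D b\<bar>)"
    by (intro sum_mono sum_abs)
  also have "\<dots> = Y p r k i"
    unfolding Y_def using k g by (intro sum.group) auto
  finally show ?thesis .
qed

text \<open>Both kernels are a coarse weight times a law inside the coarse cell that ignores the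
  parents. The error therefore splits into that of the weights, already controlled at level \<eta>
  by \<open>gap_low\<close>, and that of the inner laws, which involves only the marginal of block
  \<open>k\<close>. The joint deviation thus enters at level \<eta> and at no finer one.\<close>

lemma gap_high:
  assumes k: "k \<in> {1..K}" and p: "pmass p" and r: "pmass r" and j: "\<eta> \<le> j" "j \<le> J"
    and \<kappa>: "cond p k \<kappa>" "\<And>z q. z \<in> X \<Longrightarrow> q \<in> B k \<Longrightarrow> \<kappa> z q = w (key k z) (c k q) * mu q"
    and mu0: "\<And>q. q \<in> B k \<Longrightarrow> 0 \<le> mu q"
    and mu1: "\<And>s. s \<in> c k ` B k \<Longrightarrow> (\<Sum>q\<in>{q \<in> B k. c k q = s}. mu q) = 1"
    and muP: "\<And>q. q \<in> B k \<Longrightarrow> Pr p (\<lambda>z. c k (z k) = c k q) * mu q = Pr p (\<lambda>z. z k = q)"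
  shows "E r (\<lambda>z. gap k j (\<lambda>q. \<kappa> z q - smk r k z q)) \<le> 2 * V p r k \<eta> + 2 * Y p r k j"
proof -
  let ?A = "lev k j ` B k" and ?S = "c k ` B k"
  let ?C = "\<lambda>a. {q \<in> B k. lev k j q = a}"
  define M where "M = (\<lambda>a. \<Sum>q\<in>?C a. mu q)"
  define M' where "M' = (\<lambda>a. \<Sum>q\<in>?C a. mm r k q)"
  \<comment> \<open>The coarse cell that contains the level-\<open>j\<close> cell \<open>a\<close>;
    well defined because the levels are nested.\<close>
  define sa where "sa = (\<lambda>a. c k (SOME q. q \<in> B k \<and> lev k j q = a))"
  have sa: "c k q = sa (lev k j q)" if q: "q \<in> B k" for q
  proof -
    have "\<exists>q'. q' \<in> B k \<and> lev k j q' = lev k j q" using q by blast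
    from someI_ex[OF this] show ?thesis unfolding sa_def
      using lev_mono[OF k q _ j(1,2), of "SOME q'. q' \<in> B k \<and> lev k j q' = lev k j q"] by simp
  qed
  have M0: "M a \<ge> 0" for a unfolding M_def using mu0 by (intro sum_nonneg) auto
  have sumM: "(\<Sum>a\<in>?A. \<phi> (sa a) * M a) = (\<Sum>s\<in>?S. \<phi> s)" for \<phi>
  proof -
    have "(\<Sum>a\<in>?A. \<phi> (sa a) * M a) = (\<Sum>a\<in>?A. \<Sum>q\<in>?C a. \<phi> (c k q) * mu q)"
      unfolding M_def sum_distrib_left using sa by (intro sum.cong) auto
    also have "\<dots> = (\<Sum>q\<in>B k. \<phi> (c k q) * mu q)" by (rule sum_group_image[OF k, symmetric])
    also have "\<dots> = (\<Sum>s\<in>?S. \<Sum>q\<in>{q \<in> B k. c k q = s}. \<phi> (c k q) * mu q)" by (rule sum_group_image[OF k])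
    also have "\<dots> = (\<Sum>s\<in>?S. \<phi> s * (\<Sum>q\<in>{q \<in> B k. c k q = s}. mu q))"
      unfolding sum_distrib_left by (intro sum.cong) auto
    finally show ?thesis using mu1 by simp
  qed
  have massp: "Pr p (\<lambda>z. lev k j (z k) = a) = Pr p (\<lambda>z. c k (z k) = sa a) * M a" for a
  proof -
    have "Pr p (\<lambda>z. lev k j (z k) = a) = (\<Sum>q\<in>?C a. Pr p (\<lambda>z. z k = q))" by (intro Pr_cells[OF k]) auto
    also have "\<dots> = (\<Sum>q\<in>?C a. Pr p (\<lambda>z. c k (z k) = sa a) * mu q)"
      using sa muP by (intro sum.cong) auto
    finally show ?thesis by (simp add: M_def sum_distrib_left)
  qed
  have massr: "Pr r (\<lambda>z. lev k j (z k) = a) = Pr r (\<lambda>z. c k (z k) = sa a) * M' a" for a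
  proof -
    have "Pr r (\<lambda>z. lev k j (z k) = a) = (\<Sum>q\<in>?C a. Pr r (\<lambda>z. z k = q))" by (intro Pr_cells[OF k]) auto
    also have "\<dots> = (\<Sum>q\<in>?C a. Pr r (\<lambda>z. c k (z k) = sa a) * mm r k q)"
      using sa mm_mass[OF r] by (intro sum.cong) (auto, metis)
    finally show ?thesis by (simp add: M'_def sum_distrib_left)
  qed
  have saS: "sa a \<in> ?S" if "a \<in> ?A" for a using that sa by force
  have cellk: "(\<Sum>q\<in>{q \<in> B k. c k q = s}. \<kappa> z q - smk r k z q) = w (key k z) s - wt r k (key k z) s"
    if z: "z \<in> X" and s: "s \<in> ?S" for z s
  proof -
    have "(\<Sum>q\<in>{q \<in> B k. c k q = s}. \<kappa> z q) = (\<Sum>q\<in>{q \<in> B k. c k q = s}. w (key k z) s * mu q)"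
      using \<kappa>(2)[OF z] by (intro sum.cong) auto
    also have "\<dots> = w (key k z) s" using mu1[OF s] by (simp flip: sum_distrib_left)
    finally show ?thesis using smk_cell[OF r k _ s, of "key k z"] z by (simp add: sum_subtractf smk_def)
  qed
  have gap_le: "gap k j (\<lambda>q. \<kappa> z q - smk r k z q) \<le>
      gap k \<eta> (\<lambda>q. \<kappa> z q - smk r k z q) + (\<Sum>a\<in>?A. wt r k (key k z) (sa a) * \<bar>M a - M' a\<bar>)" if z: "z \<in> X" for z
  proof -
    have w0: "wt r k (key k z) s \<ge> 0" for s by (simp add: wt_def Pr_nonneg[OF r])
    have "gap k j (\<lambda>q. \<kappa> z q - smk r k z q) = (\<Sum>a\<in>?A. \<bar>w (key k z) (sa a) * M a - wt r k (key k z) (sa a) * M' a\<bar>)"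
      unfolding gap_def M_def M'_def sum_distrib_left sum_subtractf[symmetric]
      using \<kappa>(2)[OF z] sa by (intro sum.cong refl arg_cong[where f=abs]) (auto simp: smk_def)
    also have "\<dots> = (\<Sum>a\<in>?A. \<bar>(w (key k z) (sa a) - wt r k (key k z) (sa a)) * M a + wt r k (key k z) (sa a) * (M a - M' a)\<bar>)"
      by (simp add: algebra_simps)
    also have "\<dots> \<le> (\<Sum>a\<in>?A. \<bar>w (key k z) (sa a) - wt r k (key k z) (sa a)\<bar> * M a + wt r k (key k z) (sa a) * \<bar>M a - M' a\<bar>)"
      using M0 w0 by (intro sum_mono order_trans[OF abs_triangle_ineq]) (simp add: abs_mult)
    also have "\<dots> = (\<Sum>s\<in>?S. \<bar>w (key k z) s - wt r k (key k z) s\<bar>) + (\<Sum>a\<in>?A. wt r k (key k z) (sa a) * \<bar>M a - M' a\<bar>)"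
      unfolding sum.distrib by (simp add: sumM[of "\<lambda>s. \<bar>w (key k z) s - wt r k (key k z) s\<bar>"])
    also have "(\<Sum>s\<in>?S. \<bar>w (key k z) s - wt r k (key k z) s\<bar>) = gap k \<eta> (\<lambda>q. \<kappa> z q - smk r k z q)"
      unfolding gap_def using cellk[OF z] by (intro sum.cong) auto
    finally show ?thesis .
  qed
  \<comment> \<open>The mean weight of a coarse cell is its marginal mass under \<open>r\<close>,
    which is the denominator of the inner law \<open>mm r k\<close>.\<close>
  have Ewt: "E r (\<lambda>z. wt r k (key k z) s) = Pr r (\<lambda>z. c k (z k) = s)" if s: "s \<in> ?S" for s
  proof -
    have "T k (smk r k) (\<lambda>z. of_bool (c k (z k) = s)) z = wt r k (key k z) s" if z: "z \<in> X" for z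
    proof -
      have "T k (smk r k) (\<lambda>z. of_bool (c k (z k) = s)) z = (\<Sum>q\<in>{q \<in> B k. c k q = s}. smk r k z q)"
        unfolding T_def using k by (intro sum.mono_neutral_cong_right) auto
      then show ?thesis using smk_cell[OF r k _ s, of "key k z"] z by (simp add: smk_def)
    qed
    then have "E r (\<lambda>z. wt r k (key k z) s) = E r (T k (smk r k) (\<lambda>z. of_bool (c k (z k) = s)))"
      by (intro E_cong) simp
    also have "\<dots> = E r (\<lambda>z. of_bool (c k (z k) = s))"
      by (rule tower[OF cond_smk[OF r k] k]) simp
    finally show ?thesis by (simp add: Pr_E)
  qed
  have "E r (\<lambda>z. gap k j (\<lambda>q. \<kappa> z q - smk r k z q)) \<le>
      E r (\<lambda>z. gap k \<eta> (\<lambda>q. \<kappa> z q - smk r k z q)) + E r (\<lambda>z. \<Sum>a\<in>?A. wt r k (key k z) (sa a) * \<bar>M a - M' a\<bar>)"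
    unfolding E_add[symmetric] by (rule E_mono[OF r gap_le])
  also have "E r (\<lambda>z. gap k \<eta> (\<lambda>q. \<kappa> z q - smk r k z q)) \<le> 2 * V p r k \<eta>"
    by (rule gap_low[OF k p r \<kappa>(1) cond_smk[OF r k]]) simp
  also have "E r (\<lambda>z. \<Sum>a\<in>?A. wt r k (key k z) (sa a) * \<bar>M a - M' a\<bar>) =
      (\<Sum>a\<in>?A. Pr r (\<lambda>z. c k (z k) = sa a) * \<bar>M a - M' a\<bar>)"
    unfolding E_sum E_cmult_right using Ewt saS by (intro sum.cong refl) simp
  also have "\<dots> = (\<Sum>a\<in>?A. \<bar>Pr r (\<lambda>z. c k (z k) = sa a) * (M a - M' a)\<bar>)"
    using Pr_nonneg[OF r] by (simp add: abs_mult)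
  \<comment> \<open>The splitting of \<open>gap_low\<close> once more, now for the marginal: the
    mass under \<open>r\<close> is exchanged for the mass under \<open>p\<close> to clear the other
    denominator.\<close>
  also have "\<dots> = (\<Sum>a\<in>?A. \<bar>(Pr r (\<lambda>z. c k (z k) = sa a) - Pr p (\<lambda>z. c k (z k) = sa a)) * M a +
      (Pr p (\<lambda>z. lev k j (z k) = a) - Pr r (\<lambda>z. lev k j (z k) = a))\<bar>)"
    unfolding massp massr by (intro sum.cong refl arg_cong[where f=abs]) (simp add: algebra_simps)
  also have "\<dots> \<le> (\<Sum>a\<in>?A. \<bar>Pr r (\<lambda>z. c k (z k) = sa a) - Pr p (\<lambda>z. c k (z k) = sa a)\<bar> * M a +
      \<bar>Pr p (\<lambda>z. lev k j (z k) = a) - Pr r (\<lambda>z. lev k j (z k) = a)\<bar>)"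
    using M0 by (intro sum_mono order_trans[OF abs_triangle_ineq]) (simp add: abs_mult)
  also have "\<dots> = Y p r k \<eta> + Y p r k j"
    unfolding sum.distrib sumM[of "\<lambda>s. \<bar>Pr r (\<lambda>z. c k (z k) = s) - Pr p (\<lambda>z. c k (z k) = s)\<bar>"]
    by (simp add: Y_def abs_minus_commute)
  also have "Y p r k \<eta> \<le> Y p r k j" by (rule Y_mono[OF k j])
  finally show ?thesis by simp
qed

text \<open>The chaining sum with the mean gap of each level replaced by its bound, from
  \<open>gap_low\<close> up to level \<eta> and from \<open>gap_high\<close> beyond.\<close>

definition err :: "((nat \<Rightarrow> 'b) \<Rightarrow> real) \<Rightarrow> ((nat \<Rightarrow> 'b) \<Rightarrow> real) \<Rightarrow> nat \<Rightarrow> real" where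
  "err p r k = (\<Sum>j\<in>{1..J}. 4 * m / 2 ^ j * (if j \<le> \<eta> then 2 * V p r k j else 2 * V p r k \<eta> + 2 * Y p r k j))"

lemma V_nonneg: "0 \<le> V p r k j" and Y_nonneg: "0 \<le> Y p r k j"
  unfolding V_def Y_def by (intro sum_nonneg; simp)+

lemma err_nonneg: "0 \<le> err p r k"
  unfolding err_def using m1 V_nonneg Y_nonneg by (intro sum_nonneg mult_nonneg_nonneg) auto

text \<open>After chaining, the difference of the kernels is bounded by a function \<open>H\<close>
  of the coarse parent cells. On these the smoothed measure agrees with \<open>r\<close>, so the
  mean of \<open>H\<close> can be taken under \<open>r\<close>, where the denominators
  cancel.\<close>

lemma kernel_error:
  assumes k: "Suc n \<in> {1..K}" and p: "pmass p" and r: "pmass r" and z0: "z0 \<in> X"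
    and \<kappa>: "cond p (Suc n) \<kappa>" "\<And>z q. z \<in> X \<Longrightarrow> q \<in> B (Suc n) \<Longrightarrow> \<kappa> z q = w (key (Suc n) z) (c (Suc n) q) * mu q"
    and mu0: "\<And>q. q \<in> B (Suc n) \<Longrightarrow> 0 \<le> mu q"
    and mu1: "\<And>s. s \<in> c (Suc n) ` B (Suc n) \<Longrightarrow> (\<Sum>q\<in>{q \<in> B (Suc n). c (Suc n) q = s}. mu q) = 1"
    and muP: "\<And>q. q \<in> B (Suc n) \<Longrightarrow> Pr p (\<lambda>z. c (Suc n) (z (Suc n)) = c (Suc n) q) * mu q = Pr p (\<lambda>z. z (Suc n) = q)"
    and F: "lip (Suc n) A F" and A: "0 \<le> A"
  shows "N (smk r) z0 n (\<lambda>z. T (Suc n) \<kappa> F z - T (Suc n) (smk r (Suc n)) F z) \<le> A * err p r (Suc n)"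
proof -
  define k where "k = Suc n"
  note defs = k_def[symmetric]
  define H where "H = (\<lambda>z. A * (\<Sum>j\<in>{1..J}. 4 * m / 2 ^ j * gap k j (\<lambda>q. \<kappa> z q - smk r k z q)))"
  have kK: "k \<in> {1..K}" using k by (simp add: k_def)
  have Tdiff: "T k \<kappa> F z - T k (smk r k) F z \<le> H z" if z: "z \<in> X" for z
  proof -
    have "T k \<kappa> F z - T k (smk r k) F z = (\<Sum>q\<in>B k. (\<kappa> z q - smk r k z q) * F (z(k := q)))"
      by (simp add: T_def algebra_simps sum_subtractf)
    also have "\<dots> \<le> H z"
      unfolding H_def
    proof (rule chaining[OF kK A])
      show "(\<Sum>q\<in>B k. \<kappa> z q - smk r k z q) = 0"
        using condD(2)[OF \<kappa>(1) z] condD(2)[OF cond_smk[OF r kK] z] by (simp add: sum_subtractf k_def)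
      fix q q' assume q: "q \<in> B k" "q' \<in> B k"
      have "dd {1..k} (z(k := q)) (z(k := q')) = ed k q q'"
        unfolding dd_def using kK by (subst sum.remove[of _ k]) auto
      then show "\<bar>F (z(k := q)) - F (z(k := q'))\<bar> \<le> A * ed k q q'"
        using F X_upd[OF z kK] q unfolding lip_def k_def by metis
    qed
    finally show ?thesis .
  qed
  have "coarse (par k) H"
    unfolding coarse_def
  proof (intro ballI impI)
    fix z z' assume z: "z \<in> X" "z' \<in> X" and "\<forall>i\<in>par k. c i (z i) = c i (z' i)"
    then have key: "key k z = key k z'" by (simp add: key_eq)
    have "(\<Sum>q\<in>{q \<in> B k. lev k j q = a}. \<kappa> z q - smk r k z q) = (\<Sum>q\<in>{q \<in> B k. lev k j q = a}. \<kappa> z' q - smk r k z' q)" for j a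
      using key \<kappa>(2) z by (intro sum.cong) (auto simp: smk_def k_def)
    then show "H z = H z'" unfolding H_def gap_def by simp
  qed
  then have coarse: "coarse (par (Suc n)) H" by (simp add: k_def)
  have "N (smk r) z0 n (\<lambda>z. T k \<kappa> F z - T k (smk r k) F z) \<le> N (smk r) z0 n H"
    using k by (intro N_mono[OF z0 _ cond_smk[OF r]] Tdiff) auto
  also have "\<dots> = E r H"
  proof (rule N_parents[OF z0 cond_smk[OF r] r k coarse])
    fix l assume "l \<in> {1..n}" "coarse (insert l (par l)) H"
    then show "N (smk r) z0 n H = E r H" using k by (intro N_family[OF z0 cond_smk[OF r] r]) auto
  qed
  also have "\<dots> = A * (\<Sum>j\<in>{1..J}. 4 * m / 2 ^ j * E r (\<lambda>z. gap k j (\<lambda>q. \<kappa> z q - smk r k z q)))"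
    unfolding H_def E_cmult E_sum ..
  also have "\<dots> \<le> A * err p r k"
    unfolding err_def
  proof (intro mult_left_mono[OF _ A] sum_mono)
    fix j assume j: "j \<in> {1..J}"
    show "4 * m / 2 ^ j * E r (\<lambda>z. gap k j (\<lambda>q. \<kappa> z q - smk r k z q)) \<le>
      4 * m / 2 ^ j * (if j \<le> \<eta> then 2 * V p r k j else 2 * V p r k \<eta> + 2 * Y p r k j)"
    proof (intro mult_left_mono)
      show "E r (\<lambda>z. gap k j (\<lambda>q. \<kappa> z q - smk r k z q)) \<le>
          (if j \<le> \<eta> then 2 * V p r k j else 2 * V p r k \<eta> + 2 * Y p r k j)"
        using gap_low[OF kK p r _ cond_smk[OF r kK], of \<kappa> j] gap_high[OF kK p r, of j \<kappa> w mu] j \<kappa> mu0 mu1 muP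
        by (auto simp: k_def)
    qed (use m1 in auto)
  qed
  finally show ?thesis by (simp add: k_def)
qed

end

section \<open>Measures with Lipschitz conditional laws\<close>

definition override :: "nat set \<Rightarrow> (nat \<Rightarrow> 'b) \<Rightarrow> (nat \<Rightarrow> 'b) \<Rightarrow> nat \<Rightarrow> 'b" where
  "override S y z = (\<lambda>i. if i \<in> S then y i else z i)"

context blocks
begin

definition TS :: "nat set \<Rightarrow> ((nat \<Rightarrow> 'b) \<Rightarrow> (nat \<Rightarrow> 'b) \<Rightarrow> real) \<Rightarrow> ((nat \<Rightarrow> 'b) \<Rightarrow> real) \<Rightarrow> (nat \<Rightarrow> 'b) \<Rightarrow> real" where
  "TS S \<kappa> F z = (\<Sum>y\<in>PiE S B. \<kappa> z y * F (override S y z))"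

definition pred :: "nat \<Rightarrow> nat set" where "pred k = {1..<k} - par k"

lemma finite_PiE_B: "S \<subseteq> {1..K} \<Longrightarrow> finite (PiE S B)"
  using finite_subset[of S "{1..K}"] by (intro finite_PiE) auto

lemma X_override: "z \<in> X \<Longrightarrow> S \<subseteq> {1..K} \<Longrightarrow> y \<in> PiE S B \<Longrightarrow> override S y z \<in> X"
  by (auto simp: X_def PiE_iff override_def extensional_def)

lemma pred_K: "k \<in> {1..K} \<Longrightarrow> pred k \<subseteq> {1..K}" by (auto simp: pred_def)

end

text \<open>Three conditional laws on the finest cells: \<open>kap\<close> for a block given its
  parents, \<pi> for the other predecessors given the parents, \<rho> for the parents given the
  block. They are sampled at single points of the cells, so the conditioning identities hold up to
  \<open>L / 2 ^ J\<close>. In \<open>kap_cond\<close> the error is proportional to the mean of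
  \<psi>, not to a supremum, because it is applied on a single parent cell and afterwards divided by
  the mass of that cell.\<close>

locale blocks_law = blocks K B lev bd J \<eta> m par
  for K :: nat and B :: "nat \<Rightarrow> 'b set" and lev :: "nat \<Rightarrow> nat \<Rightarrow> 'b \<Rightarrow> 'l"
    and bd :: "nat \<Rightarrow> 'b \<Rightarrow> 'b \<Rightarrow> real" and J \<eta> :: nat and m :: real and par :: "nat \<Rightarrow> nat set" +
  fixes p :: "(nat \<Rightarrow> 'b) \<Rightarrow> real" and L :: real
    and kap :: "nat \<Rightarrow> (nat \<Rightarrow> 'b) \<Rightarrow> 'b \<Rightarrow> real"
    and \<pi> \<rho> :: "nat \<Rightarrow> (nat \<Rightarrow> 'b) \<Rightarrow> (nat \<Rightarrow> 'b) \<Rightarrow> real"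
  assumes p: "pmass p" and L0: "0 \<le> L"
    and kap_nonneg: "\<lbrakk>k \<in> {1..K}; z \<in> X; q \<in> B k\<rbrakk> \<Longrightarrow> 0 \<le> kap k z q"
    and kap_sum: "\<lbrakk>k \<in> {1..K}; z \<in> X\<rbrakk> \<Longrightarrow> (\<Sum>q\<in>B k. kap k z q) = 1"
    and kap_lip: "\<lbrakk>k \<in> {1..K}; z \<in> X; z' \<in> X\<rbrakk> \<Longrightarrow>
      (\<Sum>q\<in>B k. \<bar>kap k z q - kap k z' q\<bar>) \<le> L * (\<Sum>i\<in>par k. bd i (z i) (z' i))"
    and kap_cond: "\<lbrakk>k \<in> {1..K}; dep {1..k} \<phi>; dep {1..<k} \<psi>; \<And>z. z \<in> X \<Longrightarrow> \<bar>\<phi> z\<bar> \<le> \<psi> z\<rbrakk> \<Longrightarrow>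
      \<bar>E p \<phi> - E p (T k (kap k) \<phi>)\<bar> \<le> L / 2 ^ J * E p \<psi>"
    and \<pi>_nonneg: "\<lbrakk>k \<in> {1..K}; z \<in> X; y \<in> PiE (pred k) B\<rbrakk> \<Longrightarrow> 0 \<le> \<pi> k z y"
    and \<pi>_sum: "\<lbrakk>k \<in> {1..K}; z \<in> X\<rbrakk> \<Longrightarrow> (\<Sum>y\<in>PiE (pred k) B. \<pi> k z y) = 1"
    and \<pi>_lip: "\<lbrakk>k \<in> {1..K}; z \<in> X; z' \<in> X\<rbrakk> \<Longrightarrow>
      (\<Sum>y\<in>PiE (pred k) B. \<bar>\<pi> k z y - \<pi> k z' y\<bar>) \<le> L * (\<Sum>i\<in>par k. bd i (z i) (z' i))"
    and \<pi>_cond: "\<lbrakk>k \<in> {1..K}; dep {1..<k} \<phi>; \<And>z. z \<in> X \<Longrightarrow> \<bar>\<phi> z\<bar> \<le> b\<rbrakk> \<Longrightarrow>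
      \<bar>E p \<phi> - E p (TS (pred k) (\<pi> k) \<phi>)\<bar> \<le> L / 2 ^ J * b"
    and \<rho>_nonneg: "\<lbrakk>k \<in> {1..K}; z \<in> X; y \<in> PiE (par k) B\<rbrakk> \<Longrightarrow> 0 \<le> \<rho> k z y"
    and \<rho>_sum: "\<lbrakk>k \<in> {1..K}; z \<in> X\<rbrakk> \<Longrightarrow> (\<Sum>y\<in>PiE (par k) B. \<rho> k z y) = 1"
    and \<rho>_lip: "\<lbrakk>k \<in> {1..K}; z \<in> X; z' \<in> X\<rbrakk> \<Longrightarrow>
      (\<Sum>y\<in>PiE (par k) B. \<bar>\<rho> k z y - \<rho> k z' y\<bar>) \<le> L * bd k (z k) (z' k)"
    and \<rho>_cond: "\<lbrakk>k \<in> {1..K}; dep (insert k (par k)) \<phi>; \<And>z. z \<in> X \<Longrightarrow> \<bar>\<phi> z\<bar> \<le> b\<rbrakk> \<Longrightarrow>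
      \<bar>E p \<phi> - E p (TS (par k) (\<rho> k) \<phi>)\<bar> \<le> L / 2 ^ J * b"
begin

text \<open>\<open>kbar\<close> is the smoothed kernel of \<open>p\<close> with another fallback on parent cells of mass zero:
  taking it from \<open>kap\<close> makes the kernel Lipschitz on all of \<open>X\<close>.\<close>

definition w :: "nat \<Rightarrow> (nat \<Rightarrow> 'l) \<Rightarrow> 'l \<Rightarrow> real" where
  "w k u s = (if Pr p (\<lambda>z. key k z = u) = 0 then \<Sum>q\<in>{q \<in> B k. c k q = s}. kap k (krep k u) q
     else Pr p (\<lambda>z. key k z = u \<and> c k (z k) = s) / Pr p (\<lambda>z. key k z = u))"

text \<open>On coarse cells without mass this is the point mass at the representative, so that
  \<open>mu\<close> is a probability on every coarse cell.\<close>

definition mu :: "nat \<Rightarrow> 'b \<Rightarrow> real" where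
  "mu k q = (if Pr p (\<lambda>z. c k (z k) = c k q) = 0 then of_bool (q = rep k \<eta> q) else mm p k q)"

definition kbar :: "nat \<Rightarrow> (nat \<Rightarrow> 'b) \<Rightarrow> 'b \<Rightarrow> real" where
  "kbar k z q = w k (key k z) (c k q) * mu k q"

lemma mu_nonneg: "0 \<le> mu k q" by (simp add: mu_def mm_nonneg[OF p])

lemma mu_cell:
  assumes k: "k \<in> {1..K}" and s: "s \<in> c k ` B k"
  shows "(\<Sum>q\<in>{q \<in> B k. c k q = s}. mu k q) = 1"
proof (cases "Pr p (\<lambda>z. c k (z k) = s) = 0")
  case False
  have "(\<Sum>q\<in>{q \<in> B k. c k q = s}. mu k q) = (\<Sum>q\<in>{q \<in> B k. c k q = s}. mm p k q)"
    using False by (intro sum.cong) (auto simp: mu_def)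
  then show ?thesis using mm_cell[OF k False] by simp
next
  case True
  obtain q0 where q0: "q0 \<in> B k" "s = c k q0" using s by auto
  let ?r = "rep k \<eta> q0"
  have r: "?r \<in> B k" "c k ?r = s" using rep[OF q0(1), of \<eta>] q0 by auto
  have "mu k q = (if q = ?r then 1 else 0)" if "q \<in> {q \<in> B k. c k q = s}" for q
  proof -
    have "rep k \<eta> q = ?r" by (rule rep_cong) (use that q0 in auto)
    then show ?thesis using that True by (auto simp: mu_def)
  qed
  then have "(\<Sum>q\<in>{q \<in> B k. c k q = s}. mu k q) = (\<Sum>q\<in>{q \<in> B k. c k q = s}. if q = ?r then 1 else 0)"
    by (intro sum.cong) auto
  also have "\<dots> = 1" using r k by (subst sum.delta) auto
  finally show ?thesis .
qed

lemma mu_mass: assumes "q \<in> B k" shows "Pr p (\<lambda>z. c k (z k) = c k q) * mu k q = Pr p (\<lambda>z. z k = q)"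
proof (cases "Pr p (\<lambda>z. c k (z k) = c k q) = 0")
  case True
  have "Pr p (\<lambda>z. z k = q) = 0" by (rule Pr_zero_mono[OF p True]) simp
  then show ?thesis using True by simp
qed (use mm_mass[OF p, of k q] in \<open>simp add: mu_def\<close>)

lemma w_nonneg: "k \<in> {1..K} \<Longrightarrow> u \<in> key k ` X \<Longrightarrow> 0 \<le> w k u s"
  using krep[of u k] by (auto simp: w_def Pr_nonneg[OF p] intro!: sum_nonneg kap_nonneg)

lemma w_sum: assumes k: "k \<in> {1..K}" and u: "u \<in> key k ` X" shows "(\<Sum>s\<in>c k ` B k. w k u s) = 1"
proof (cases "Pr p (\<lambda>z. key k z = u) = 0")
  case True
  then show ?thesis
    using sum_group_image[OF k, of "kap k (krep k u)" "c k"] kap_sum[OF k, of "krep k u"] krep[OF u] by (simp add: w_def)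
next
  case False
  have "Pr p (\<lambda>z. key k z = u) = (\<Sum>s\<in>c k ` B k. Pr p (\<lambda>z. key k z = u \<and> c k (z k) = s))"
    using k X_mem[OF _ k] by (intro Pr_split) auto
  then show ?thesis using False by (simp add: w_def flip: sum_divide_distrib)
qed

lemma w_mass: "Pr p (\<lambda>z. key k z = u) * w k u s = Pr p (\<lambda>z. key k z = u \<and> c k (z k) = s)"
proof (cases "Pr p (\<lambda>z. key k z = u) = 0")
  case True
  have "Pr p (\<lambda>z. key k z = u \<and> c k (z k) = s) = 0" by (rule Pr_zero_mono[OF p True]) simp
  then show ?thesis using True by simp
qed (simp add: w_def)

lemma cond_kbar:
  assumes k: "k \<in> {1..K}" shows "cond p k (kbar k)"
  using cond_mix(1)[OF p k, of "w k" "mu k"] w_nonneg[OF k] w_sum[OF k] w_mass mu_nonneg mu_cell[OF k]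
  by (simp add: kbar_def[abs_def])

lemma bd_same:
  assumes k: "k \<in> {1..K}" and z: "z \<in> X" "z' \<in> X" "key k z = key k z'"
  shows "(\<Sum>i\<in>par k. bd i (z i) (z' i)) \<le> K * m * h"
proof -
  have "(\<Sum>i\<in>par k. bd i (z i) (z' i)) \<le> dd (par k) z z'"
    unfolding dd_def by (intro sum_mono bd_le_ed)
  also have "\<dots> \<le> K * m * h" using z par_K[OF k] by (intro dd_same) (auto simp: key_eq)
  finally show ?thesis .
qed

lemma delta_le: "1 / 2 ^ J \<le> h"
  unfolding h_def using eta_le by (intro divide_left_mono power_increasing) auto

text \<open>Up to the discretisation error, the weight of a coarse cell is the average of
  \<open>kap\<close> over the parent cell, and \<open>kap\<close> varies there by at most
  \<open>L * (K * m * h)\<close>. On parent cells without mass the fallback is a value of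
  \<open>kap\<close> in the same cell.\<close>

lemma w_kap:
  assumes k: "k \<in> {1..K}" and z: "z \<in> X"
  shows "(\<Sum>s\<in>c k ` B k. \<bar>w k (key k z) s - (\<Sum>q\<in>{q \<in> B k. c k q = s}. kap k z q)\<bar>) \<le> L * (1 + K * m) * h"
proof -
  define u where "u = key k z"
  have u: "u \<in> key k ` X" using z by (auto simp: u_def)
  have Lh: "L / 2 ^ J \<le> L * h" using mult_left_mono[OF delta_le L0] by simp
  have kdiff: "(\<Sum>q\<in>B k. \<bar>kap k z' q - kap k z q\<bar>) \<le> L * (K * m * h)" if "z' \<in> X" "key k z' = u" for z'
    using kap_lip[OF k that(1) z] mult_left_mono[OF bd_same[OF k that(1) z] L0] that(2) by (simp add: u_def)
  define b where "b = (\<lambda>s. \<Sum>q\<in>{q \<in> B k. c k q = s}. kap k z q)"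
  show ?thesis
  proof (cases "Pr p (\<lambda>z. key k z = u) = 0")
    case True
    have "(\<Sum>s\<in>c k ` B k. \<bar>w k u s - b s\<bar>) = (\<Sum>s\<in>c k ` B k. \<bar>\<Sum>q\<in>{q \<in> B k. c k q = s}. kap k (krep k u) q - kap k z q\<bar>)"
      using True by (simp add: w_def b_def sum_subtractf)
    also have "\<dots> \<le> (\<Sum>s\<in>c k ` B k. \<Sum>q\<in>{q \<in> B k. c k q = s}. \<bar>kap k (krep k u) q - kap k z q\<bar>)"
      by (intro sum_mono sum_abs)
    also have "\<dots> = (\<Sum>q\<in>B k. \<bar>kap k (krep k u) q - kap k z q\<bar>)" by (rule sum_group_image[OF k, symmetric])
    also have "\<dots> \<le> L * (K * m * h)" using krep[OF u] by (intro kdiff) auto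
    also have "\<dots> \<le> L * (1 + K * m) * h" using L0 h_pos by (simp add: algebra_simps)
    finally show ?thesis by (simp add: u_def b_def)
  next
    case False
    define P where "P = Pr p (\<lambda>z. key k z = u)"
    have P: "P > 0" using False Pr_nonneg[OF p, of "\<lambda>z. key k z = u"] by (simp add: P_def)
    define a where "a = (\<lambda>s. Pr p (\<lambda>z. key k z = u \<and> c k (z k) = s))"
    \<comment> \<open>Testing with these signs on the event that the key is \<open>u\<close> turns
      the l1 distance, multiplied by \<open>P\<close>, into one expectation. The indicator \<psi> of
      the event serves as the bound in \<open>kap_cond\<close>, so the error also carries the factor
      \<open>P\<close>.\<close>
    define \<sigma> where "\<sigma> = (\<lambda>s. sgn (a s - P * b s))"
    define \<psi> :: "(nat \<Rightarrow> 'b) \<Rightarrow> real" where "\<psi> = (\<lambda>z. of_bool (key k z = u))"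
    define \<phi> where "\<phi> = (\<lambda>z. \<psi> z * \<sigma> (c k (z k)))"
    have s1: "\<bar>\<sigma> s\<bar> \<le> 1" for s by (simp add: \<sigma>_def sgn_if)
    have E\<psi>: "E p \<psi> = P" by (simp add: P_def Pr_E \<psi>_def)
    have E\<phi>: "E p \<phi> = (\<Sum>s\<in>c k ` B k. a s * \<sigma> s)"
    proof -
      have "E p \<phi> = (\<Sum>s\<in>c k ` B k. E p (\<lambda>z. \<psi> z * of_bool (c k (z k) = s) * \<sigma> s))"
        unfolding E_sum[symmetric]
      proof (rule E_cong)
        fix z assume z: "z \<in> X"
        have "(\<Sum>s\<in>c k ` B k. \<psi> z * of_bool (c k (z k) = s) * \<sigma> s) = (\<Sum>s\<in>{c k (z k)}. \<psi> z * \<sigma> s)"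
          using X_mem[OF z k] k by (intro sum.mono_neutral_cong_right) auto
        then show "\<phi> z = (\<Sum>s\<in>c k ` B k. \<psi> z * of_bool (c k (z k) = s) * \<sigma> s)" by (simp add: \<phi>_def)
      qed
      also have "\<dots> = (\<Sum>s\<in>c k ` B k. a s * \<sigma> s)"
        unfolding E_cmult_right a_def Pr_E \<psi>_def by (simp add: of_bool_conj)
      finally show ?thesis .
    qed
    have dpsi: "dep {1..<k} \<psi>"
      unfolding dep_def
    proof (intro ballI impI)
      fix z z' assume "z \<in> X" "z' \<in> X" "\<forall>i\<in>{1..<k}. z i = z' i"
      then have "key k z = key k z'" using par_sub[OF k] by (auto simp: key_eq)
      then show "\<psi> z = \<psi> z'" by (simp add: \<psi>_def)
    qed
    have dphi: "dep {1..k} \<phi>"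
      unfolding dep_def
    proof (intro ballI impI)
      fix z z' assume *: "z \<in> X" "z' \<in> X" "\<forall>i\<in>{1..k}. z i = z' i"
      then have "\<psi> z = \<psi> z'" by (intro depD[OF dpsi]) auto
      then show "\<phi> z = \<phi> z'" using * k by (simp add: \<phi>_def)
    qed
    have T\<phi>: "T k (kap k) \<phi> z' = \<psi> z' * (\<Sum>q\<in>B k. kap k z' q * \<sigma> (c k q))" if "z' \<in> X" for z'
      unfolding T_def \<phi>_def \<psi>_def using key_upd[OF k] by (simp add: sum_distrib_left mult_ac)
    have bs: "(\<Sum>q\<in>B k. kap k z q * \<sigma> (c k q)) = (\<Sum>s\<in>c k ` B k. b s * \<sigma> s)"
      unfolding b_def sum_distrib_right
      by (subst sum_group_image[OF k, where g="c k"]) (auto intro!: sum.cong)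
    have "E p (T k (kap k) \<phi>) \<le> E p (\<lambda>z'. \<psi> z' * ((\<Sum>s\<in>c k ` B k. b s * \<sigma> s) + L * (K * m * h)))"
    proof (rule E_mono[OF p])
      fix z' assume z': "z' \<in> X"
      show "T k (kap k) \<phi> z' \<le> \<psi> z' * ((\<Sum>s\<in>c k ` B k. b s * \<sigma> s) + L * (K * m * h))"
      proof (cases "key k z' = u")
        case True
        have "(\<Sum>q\<in>B k. kap k z' q * \<sigma> (c k q)) - (\<Sum>q\<in>B k. kap k z q * \<sigma> (c k q)) =
            (\<Sum>q\<in>B k. (kap k z' q - kap k z q) * \<sigma> (c k q))" by (simp add: sum_subtractf algebra_simps)
        also have "\<dots> \<le> (\<Sum>q\<in>B k. \<bar>kap k z' q - kap k z q\<bar>)"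
        proof (rule sum_mono)
          fix q
          have "(kap k z' q - kap k z q) * \<sigma> (c k q) \<le> \<bar>kap k z' q - kap k z q\<bar> * \<bar>\<sigma> (c k q)\<bar>"
            by (simp add: abs_mult[symmetric])
          also have "\<dots> \<le> \<bar>kap k z' q - kap k z q\<bar> * 1" using s1 by (intro mult_left_mono) auto
          finally show "(kap k z' q - kap k z q) * \<sigma> (c k q) \<le> \<bar>kap k z' q - kap k z q\<bar>" by simp
        qed
        also have "\<dots> \<le> L * (K * m * h)" by (rule kdiff[OF z' True])
        finally show ?thesis using True z' by (simp add: T\<phi> \<psi>_def bs)
      qed (use z' in \<open>simp add: T\<phi> \<psi>_def\<close>)
    qed
    also have "\<dots> = P * ((\<Sum>s\<in>c k ` B k. b s * \<sigma> s) + L * (K * m * h))"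
      unfolding E_cmult_right E\<psi> ..
    finally have "E p (T k (kap k) \<phi>) \<le> P * (\<Sum>s\<in>c k ` B k. b s * \<sigma> s) + P * (L * (K * m * h))"
      by (simp add: distrib_left)
    moreover have "\<bar>E p \<phi> - E p (T k (kap k) \<phi>)\<bar> \<le> L / 2 ^ J * P"
      unfolding E\<psi>[symmetric]
    proof (rule kap_cond[OF k dphi dpsi])
      fix z
      show "\<bar>\<phi> z\<bar> \<le> \<psi> z" using s1 by (simp add: \<phi>_def \<psi>_def)
    qed
    ultimately have "E p \<phi> - P * (\<Sum>s\<in>c k ` B k. b s * \<sigma> s) \<le> L / 2 ^ J * P + P * (L * (K * m * h))" by linarith
    also have "\<dots> \<le> L * h * P + P * (L * (K * m * h))" using mult_right_mono[OF Lh, of P] P by simp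
    finally have le: "E p \<phi> - P * (\<Sum>s\<in>c k ` B k. b s * \<sigma> s) \<le> P * (L * (1 + K * m) * h)" by (simp add: algebra_simps)
    have "(\<Sum>s\<in>c k ` B k. P * \<bar>w k u s - b s\<bar>) = (\<Sum>s\<in>c k ` B k. \<bar>a s - P * b s\<bar>)"
    proof (rule sum.cong[OF refl])
      fix s
      have "w k u s = a s / P" using False by (simp add: w_def a_def P_def)
      then have "P * (w k u s - b s) = a s - P * b s" using P by (simp add: right_diff_distrib)
      then show "P * \<bar>w k u s - b s\<bar> = \<bar>a s - P * b s\<bar>" using P by (metis abs_mult abs_of_pos)
    qed
    also have "\<dots> = (\<Sum>s\<in>c k ` B k. (a s - P * b s) * \<sigma> s)" by (simp add: \<sigma>_def abs_sgn)
    also have "\<dots> = E p \<phi> - P * (\<Sum>s\<in>c k ` B k. b s * \<sigma> s)"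
      by (simp add: E\<phi> left_diff_distrib sum_subtractf sum_distrib_left mult.assoc)
    finally have "P * (\<Sum>s\<in>c k ` B k. \<bar>w k u s - b s\<bar>) \<le> P * (L * (1 + K * m) * h)" using le by (simp add: sum_distrib_left)
    then show ?thesis using P by (simp add: u_def b_def)
  qed
qed

text \<open>The kernel is constant on coarse parent cells. Between different ones \<open>dd\<close>
  is at least \<open>h\<close>, which pays for the two errors of \<open>w_kap\<close>; the third
  contribution is the Lipschitz constant of \<open>kap\<close>.\<close>

lemma kbar_lip:
  assumes k: "k \<in> {1..K}" and z: "z \<in> X" "z' \<in> X"
  shows "(\<Sum>q\<in>B k. \<bar>kbar k z q - kbar k z' q\<bar>) \<le> L * (3 + 2 * K * m) * dd (par k) z z'"
proof (cases "key k z = key k z'")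
  case True
  then show ?thesis using dd_nonneg[of "par k" z z'] L0 m1 by (simp add: kbar_def)
next
  case False
  then obtain i where i: "i \<in> par k" "c i (z i) \<noteq> c i (z' i)" by (auto simp: key_eq)
  have "h \<le> ed i (z i) (z' i)" using i bd_nonneg[of i "z i" "z' i"] by (simp add: ed_def)
  also have "\<dots> \<le> dd (par k) z z'" unfolding dd_def
    using i finite_par[OF k] ed_nonneg by (intro member_le_sum) auto
  finally have h_dd: "h \<le> dd (par k) z z'" .
  let ?b = "\<lambda>z s. \<Sum>q\<in>{q \<in> B k. c k q = s}. kap k z q" and ?S = "c k ` B k"
  have "(\<Sum>q\<in>B k. \<bar>kbar k z q - kbar k z' q\<bar>) = (\<Sum>q\<in>B k. \<bar>w k (key k z) (c k q) - w k (key k z') (c k q)\<bar> * mu k q)"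
    unfolding kbar_def left_diff_distrib[symmetric] abs_mult using mu_nonneg by simp
  also have "\<dots> = (\<Sum>s\<in>?S. \<Sum>q\<in>{q \<in> B k. c k q = s}. \<bar>w k (key k z) (c k q) - w k (key k z') (c k q)\<bar> * mu k q)"
    by (rule sum_group_image[OF k])
  also have "\<dots> = (\<Sum>s\<in>?S. \<bar>w k (key k z) s - w k (key k z') s\<bar>)"
  proof (rule sum.cong[OF refl])
    fix s assume s: "s \<in> ?S"
    have "(\<Sum>q\<in>{q \<in> B k. c k q = s}. \<bar>w k (key k z) (c k q) - w k (key k z') (c k q)\<bar> * mu k q) =
        (\<Sum>q\<in>{q \<in> B k. c k q = s}. \<bar>w k (key k z) s - w k (key k z') s\<bar> * mu k q)" by (intro sum.cong) auto
    then show "(\<Sum>q\<in>{q \<in> B k. c k q = s}. \<bar>w k (key k z) (c k q) - w k (key k z') (c k q)\<bar> * mu k q) = \<bar>w k (key k z) s - w k (key k z') s\<bar>"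
      using mu_cell[OF k s] by (simp flip: sum_distrib_left)
  qed
  also have "\<dots> \<le> (\<Sum>s\<in>?S. \<bar>w k (key k z) s - ?b z s\<bar> + \<bar>w k (key k z') s - ?b z' s\<bar> + \<bar>?b z s - ?b z' s\<bar>)"
    by (intro sum_mono) linarith
  also have "\<dots> \<le> L * (1 + K * m) * h + L * (1 + K * m) * h + L * dd (par k) z z'"
    unfolding sum.distrib
  proof (intro add_mono w_kap[OF k] z)
    have "(\<Sum>s\<in>?S. \<bar>?b z s - ?b z' s\<bar>) \<le> (\<Sum>s\<in>?S. \<Sum>q\<in>{q \<in> B k. c k q = s}. \<bar>kap k z q - kap k z' q\<bar>)"
      unfolding sum_subtractf[symmetric] by (intro sum_mono sum_abs)
    also have "\<dots> = (\<Sum>q\<in>B k. \<bar>kap k z q - kap k z' q\<bar>)" by (rule sum_group_image[OF k, symmetric])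
    also have "\<dots> \<le> L * (\<Sum>i\<in>par k. bd i (z i) (z' i))" by (rule kap_lip[OF k z])
    also have "\<dots> \<le> L * dd (par k) z z'" unfolding dd_def using L0 by (intro mult_left_mono sum_mono bd_le_ed)
    finally show "(\<Sum>s\<in>?S. \<bar>?b z s - ?b z' s\<bar>) \<le> L * dd (par k) z z'" .
  qed
  also have "\<dots> \<le> L * (1 + K * m) * dd (par k) z z' + L * (1 + K * m) * dd (par k) z z' + L * dd (par k) z z'"
    using h_dd L0 m1 by (intro add_mono mult_left_mono order_refl) auto
  also have "\<dots> = L * (3 + 2 * K * m) * dd (par k) z z'" by (simp add: algebra_simps)
  finally show ?thesis .
qed

text \<open>The growth of the Lipschitz constant when one block is integrated out: 1 for the direct
  dependence of \<open>F\<close>, plus the diameter bound \<open>m + 1\<close> of a block times the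
  Lipschitz constant from \<open>kbar_lip\<close>.\<close>

definition \<Gamma> :: real where "\<Gamma> = 1 + (m + 1) * (L * (3 + 2 * K * m))"

lemma lip_T:
  assumes k: "Suc n \<in> {1..K}" and A: "0 \<le> A" and F: "lip (Suc n) A F"
  shows "lip n (A * \<Gamma>) (T (Suc n) (kbar (Suc n)) F)"
  unfolding lip_def
proof (intro ballI)
  fix z z' assume z: "z \<in> X" "z' \<in> X"
  let ?k = "Suc n"
  obtain q0 where q0: "q0 \<in> B ?k" using ne_B[OF k] by auto
  have F': "\<bar>F y - F y'\<bar> \<le> A * dd {1..?k} y y'" if "y \<in> X" "y' \<in> X" for y y'
    using F that unfolding lip_def by blast
  have dn: "dd {1..?k} (z(?k := q)) (z'(?k := q')) = dd {1..n} z z' + ed ?k q q'" for z z' q q'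
    unfolding dd_def by (simp add: sum.atLeast_Suc_atMost_Suc_shift flip: atLeastAtMost_insertL) 
  \<comment> \<open>Both kernels have mass 1, so \<open>F\<close> may be centred at
    \<open>q0\<close>. The change of the kernel is then multiplied by the oscillation of
    \<open>F\<close> over one block instead of its size.\<close>
  have "T ?k (kbar ?k) F z - T ?k (kbar ?k) F z' =
      (\<Sum>q\<in>B ?k. kbar ?k z q * (F (z(?k := q)) - F (z'(?k := q)))) +
      (\<Sum>q\<in>B ?k. (kbar ?k z q - kbar ?k z' q) * (F (z'(?k := q)) - F (z'(?k := q0)))) +
      ((\<Sum>q\<in>B ?k. kbar ?k z q) - (\<Sum>q\<in>B ?k. kbar ?k z' q)) * F (z'(?k := q0))"
    unfolding T_def sum_distrib_right sum_subtractf[symmetric] sum.distrib[symmetric]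
    by (intro sum.cong refl) (simp add: algebra_simps)
  also have "(\<Sum>q\<in>B ?k. kbar ?k z q) - (\<Sum>q\<in>B ?k. kbar ?k z' q) = 0"
    using condD(2)[OF cond_kbar[OF k]] z by simp
  finally have eq: "T ?k (kbar ?k) F z - T ?k (kbar ?k) F z' =
      (\<Sum>q\<in>B ?k. kbar ?k z q * (F (z(?k := q)) - F (z'(?k := q)))) +
      (\<Sum>q\<in>B ?k. (kbar ?k z q - kbar ?k z' q) * (F (z'(?k := q)) - F (z'(?k := q0))))" by (simp only: mult_zero_left add_0_right)
  have "\<bar>\<Sum>q\<in>B ?k. kbar ?k z q * (F (z(?k := q)) - F (z'(?k := q)))\<bar> \<le> (\<Sum>q\<in>B ?k. kbar ?k z q * (A * dd {1..n} z z'))"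
  proof (rule order_trans[OF sum_abs], rule sum_mono)
    fix q assume q: "q \<in> B ?k"
    show "\<bar>kbar ?k z q * (F (z(?k := q)) - F (z'(?k := q)))\<bar> \<le> kbar ?k z q * (A * dd {1..n} z z')"
      using F'[OF X_upd[OF z(1) k q] X_upd[OF z(2) k q], unfolded dn] condD(1)[OF cond_kbar[OF k] z(1) q]
      by (simp add: abs_mult mult_left_mono)
  qed
  also have "\<dots> = A * dd {1..n} z z'"
    using condD(2)[OF cond_kbar[OF k] z(1)] by (simp flip: sum_distrib_right)
  finally have 1: "\<bar>\<Sum>q\<in>B ?k. kbar ?k z q * (F (z(?k := q)) - F (z'(?k := q)))\<bar> \<le> A * dd {1..n} z z'" .
  have "\<bar>\<Sum>q\<in>B ?k. (kbar ?k z q - kbar ?k z' q) * (F (z'(?k := q)) - F (z'(?k := q0)))\<bar> \<le>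
      (\<Sum>q\<in>B ?k. \<bar>kbar ?k z q - kbar ?k z' q\<bar> * (A * (m + 1)))"
  proof (rule order_trans[OF sum_abs], rule sum_mono)
    fix q assume q: "q \<in> B ?k"
    have "dd {1..n} z' z' = 0" by (simp add: dd_def)
    then have "\<bar>F (z'(?k := q)) - F (z'(?k := q0))\<bar> \<le> A * ed ?k q q0"
      using F'[OF X_upd[OF z(2) k q] X_upd[OF z(2) k q0], unfolded dn] by simp
    also have "\<dots> \<le> A * (m + 1)" using A by (intro mult_left_mono ed_le[OF k q q0])
    finally show "\<bar>(kbar ?k z q - kbar ?k z' q) * (F (z'(?k := q)) - F (z'(?k := q0)))\<bar> \<le>
        \<bar>kbar ?k z q - kbar ?k z' q\<bar> * (A * (m + 1))" by (simp add: abs_mult mult_left_mono)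
  qed
  also have "\<dots> \<le> (L * (3 + 2 * K * m) * dd (par ?k) z z') * (A * (m + 1))"
    unfolding sum_distrib_right[symmetric] using A m1 by (intro mult_right_mono kbar_lip[OF k z]) auto
  also have "\<dots> \<le> (L * (3 + 2 * K * m) * dd {1..n} z z') * (A * (m + 1))"
    using A m1 L0 par_sub[OF k] by (intro mult_right_mono mult_left_mono dd_mono) auto
  finally have 2: "\<bar>\<Sum>q\<in>B ?k. (kbar ?k z q - kbar ?k z' q) * (F (z'(?k := q)) - F (z'(?k := q0)))\<bar> \<le>
      (L * (3 + 2 * K * m) * dd {1..n} z z') * (A * (m + 1))" .
  have "A * \<Gamma> * dd {1..n} z z' = A * dd {1..n} z z' + (L * (3 + 2 * K * m) * dd {1..n} z z') * (A * (m + 1))"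
    by (simp add: \<Gamma>_def algebra_simps)
  then show "\<bar>T ?k (kbar ?k) F z - T ?k (kbar ?k) F z'\<bar> \<le> A * \<Gamma> * dd {1..n} z z'"
    using eq 1 2 by linarith
qed

section \<open>Dependence on coordinates, commutation and averaging\<close>

lemma T_bound:
  assumes "k \<in> {1..K}" "z \<in> X" "\<And>q. q \<in> B k \<Longrightarrow> 0 \<le> \<kappa> z q" "(\<Sum>q\<in>B k. \<kappa> z q) = 1" "\<And>z. z \<in> X \<Longrightarrow> \<bar>F z\<bar> \<le> b"
  shows "\<bar>T k \<kappa> F z\<bar> \<le> b"
proof -
  have "\<bar>T k \<kappa> F z\<bar> \<le> (\<Sum>q\<in>B k. \<kappa> z q * b)"
    unfolding T_def by (rule order_trans[OF sum_abs], rule sum_mono)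
      (use assms in \<open>auto simp: abs_mult X_upd intro!: mult_left_mono\<close>)
  then show ?thesis using assms(4) by (simp flip: sum_distrib_right)
qed

lemma TS_bound:
  assumes "S \<subseteq> {1..K}" "z \<in> X" "\<And>y. y \<in> PiE S B \<Longrightarrow> 0 \<le> \<kappa> z y" "(\<Sum>y\<in>PiE S B. \<kappa> z y) = 1" "\<And>z. z \<in> X \<Longrightarrow> \<bar>F z\<bar> \<le> b"
  shows "\<bar>TS S \<kappa> F z\<bar> \<le> b"
proof -
  have "\<bar>TS S \<kappa> F z\<bar> \<le> (\<Sum>y\<in>PiE S B. \<kappa> z y * b)"
    unfolding TS_def by (rule order_trans[OF sum_abs], rule sum_mono)
      (use assms in \<open>auto simp: abs_mult X_override intro!: mult_left_mono\<close>)
  then show ?thesis using assms(4) by (simp flip: sum_distrib_right)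
qed

lemma sum_abs_zeroD:
  fixes f :: "'x \<Rightarrow> real"
  assumes "finite S" "(\<Sum>y\<in>S. \<bar>f y\<bar>) \<le> 0" "y \<in> S" shows "f y = 0"
  using member_le_sum[of y S "\<lambda>y. \<bar>f y\<bar>"] assms by force

text \<open>The Lipschitz bound at distance zero.\<close>

lemma kap_dep:
  assumes k: "k \<in> {1..K}" and z: "z \<in> X" "z' \<in> X" and eq: "\<And>i. i \<in> par k \<Longrightarrow> z i = z' i" and q: "q \<in> B k"
  shows "kap k z q = kap k z' q"
proof -
  have "(\<Sum>i\<in>par k. bd i (z i) (z' i)) = 0" using eq by (intro sum.neutral) auto
  then show ?thesis using sum_abs_zeroD[OF _ _ q, of "\<lambda>q. kap k z q - kap k z' q"] kap_lip[OF k z] k by simp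
qed

lemma \<pi>_dep:
  assumes k: "k \<in> {1..K}" and z: "z \<in> X" "z' \<in> X" and eq: "\<And>i. i \<in> par k \<Longrightarrow> z i = z' i" and y: "y \<in> PiE (pred k) B"
  shows "\<pi> k z y = \<pi> k z' y"
proof -
  have "(\<Sum>i\<in>par k. bd i (z i) (z' i)) = 0" using eq by (intro sum.neutral) auto
  then show ?thesis using sum_abs_zeroD[OF finite_PiE_B[OF pred_K[OF k]] _ y, of "\<lambda>y. \<pi> k z y - \<pi> k z' y"] \<pi>_lip[OF k z] by simp
qed

lemma \<rho>_dep:
  assumes k: "k \<in> {1..K}" and z: "z \<in> X" "z' \<in> X" and eq: "z k = z' k" and y: "y \<in> PiE (par k) B"
  shows "\<rho> k z y = \<rho> k z' y"
  using sum_abs_zeroD[OF finite_PiE_B[OF par_K[OF k]] _ y, of "\<lambda>y. \<rho> k z y - \<rho> k z' y"] \<rho>_lip[OF k z] eq by simp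

lemma kbar_dep:
  assumes k: "k \<in> {1..K}" and z: "z \<in> X" "z' \<in> X" and eq: "\<And>i. i \<in> par k \<Longrightarrow> z i = z' i"
  shows "kbar k z q = kbar k z' q"
  using eq by (simp add: kbar_def key_def cong: restrict_cong)

lemma T_dep:
  assumes k: "k \<in> {1..K}" and F: "dep {1..k} F"
    and \<kappa>: "\<And>z z' q. z \<in> X \<Longrightarrow> z' \<in> X \<Longrightarrow> (\<And>i. i \<in> par k \<Longrightarrow> z i = z' i) \<Longrightarrow> q \<in> B k \<Longrightarrow> \<kappa> z q = \<kappa> z' q"
  shows "dep {1..<k} (T k \<kappa> F)"
  unfolding dep_def T_def
proof (intro ballI impI sum.cong refl arg_cong2[where f="(*)"])
  fix z z' q assume z: "z \<in> X" "z' \<in> X" and eq: "\<forall>i\<in>{1..<k}. z i = z' i" and q: "q \<in> B k"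
  show "\<kappa> z q = \<kappa> z' q" using eq par_sub[OF k] by (intro \<kappa> z q) auto
  show "F (z(k := q)) = F (z'(k := q))" using eq by (intro depD[OF F] X_upd z k q) auto
qed

text \<open>Both kernels look at the parents only and neither changes them. Drawing block
  \<open>k\<close> and redrawing its other predecessors are thus conditionally independent
  operations.\<close>

lemma TS_T_commute:
  assumes k: "k \<in> {1..K}" and z: "z \<in> X"
    and \<kappa>: "\<And>z z' q. z \<in> X \<Longrightarrow> z' \<in> X \<Longrightarrow> (\<And>i. i \<in> par k \<Longrightarrow> z i = z' i) \<Longrightarrow> q \<in> B k \<Longrightarrow> \<kappa> z q = \<kappa> z' q"
  shows "TS (pred k) (\<pi> k) (T k \<kappa> F) z = T k \<kappa> (TS (pred k) (\<pi> k) F) z"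
proof -
  have kp: "k \<notin> pred k" "par k \<inter> pred k = {}" "k \<notin> par k" using par_sub[OF k] by (auto simp: pred_def)
  have "TS (pred k) (\<pi> k) (T k \<kappa> F) z = (\<Sum>y\<in>PiE (pred k) B. \<Sum>q\<in>B k. \<kappa> z q * (\<pi> k (z(k := q)) y * F (override (pred k) y (z(k := q)))))"
    unfolding TS_def T_def sum_distrib_left
  proof (intro sum.cong refl)
    fix y q assume y: "y \<in> PiE (pred k) B" and q: "q \<in> B k"
    have o: "override (pred k) y z \<in> X" by (rule X_override[OF z pred_K[OF k] y])
    have "(override (pred k) y z)(k := q) = override (pred k) y (z(k := q))"
      using kp by (auto simp: override_def fun_eq_iff)
    moreover have "\<kappa> (override (pred k) y z) q = \<kappa> z q"
      using kp by (intro \<kappa> o z q) (auto simp: override_def)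
    moreover have "\<pi> k (z(k := q)) y = \<pi> k z y"
      using kp by (intro \<pi>_dep k X_upd z q y) auto
    ultimately show "\<pi> k z y * (\<kappa> (override (pred k) y z) q * F ((override (pred k) y z)(k := q))) =
        \<kappa> z q * (\<pi> k (z(k := q)) y * F (override (pred k) y (z(k := q))))" by simp
  qed
  also have "\<dots> = T k \<kappa> (TS (pred k) (\<pi> k) F) z"
    unfolding TS_def T_def sum_distrib_left by (rule sum.swap)
  finally show ?thesis .
qed

text \<open>Resampling \<open>x\<^sub>k\<close> within its coarse cell replaces \<open>r\<close> by \<open>avg k r\<close>.\<close>

definition avg :: "nat \<Rightarrow> ((nat \<Rightarrow> 'b) \<Rightarrow> real) \<Rightarrow> (nat \<Rightarrow> 'b) \<Rightarrow> real" where
  "avg k r z = (\<Sum>q\<in>{q \<in> B k. c k q = c k (z k)}. mu k q * r (z(k := q)))"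

lemma avg_bound:
  assumes k: "k \<in> {1..K}" and z: "z \<in> X" and r: "\<And>z. z \<in> X \<Longrightarrow> \<bar>r z\<bar> \<le> b"
  shows "\<bar>avg k r z\<bar> \<le> b"
proof -
  have "\<bar>avg k r z\<bar> \<le> (\<Sum>q\<in>{q \<in> B k. c k q = c k (z k)}. mu k q * b)"
    unfolding avg_def by (rule order_trans[OF sum_abs], rule sum_mono)
      (use r X_upd[OF z k] mu_nonneg in \<open>auto simp: abs_mult intro!: mult_left_mono\<close>)
  then show ?thesis using mu_cell[OF k, of "c k (z k)"] X_mem[OF z k] by (simp flip: sum_distrib_right)
qed

lemma avg_dep:
  assumes k: "k \<in> {1..K}" and r: "dep (insert k (par k)) r" shows "dep (insert k (par k)) (avg k r)"
  unfolding dep_def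
proof (intro ballI impI)
  fix z z' assume z: "z \<in> X" "z' \<in> X" and eq: "\<forall>i\<in>insert k (par k). z i = z' i"
  have "mu k q * r (z(k := q)) = mu k q * r (z'(k := q))" if "q \<in> B k" for q
    using eq that by (intro arg_cong2[where f="(*)"] refl depD[OF r] X_upd z k) auto
  then show "avg k r z = avg k r z'" unfolding avg_def using eq by (intro sum.cong) auto
qed

text \<open>Averaging with \<open>mu\<close> inside the cells before applying \<open>kap\<close>
  leaves the same inner law as in \<open>kbar\<close>. Only the coarse weights differ, and
  \<open>w_kap\<close> compares them.\<close>

lemma T_avg:
  assumes k: "k \<in> {1..K}" and z: "z \<in> X" and r: "\<And>z. z \<in> X \<Longrightarrow> \<bar>r z\<bar> \<le> b"
  shows "\<bar>T k (kap k) (avg k r) z - T k (kbar k) r z\<bar> \<le> L * (1 + K * m) * h * b"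
proof -
  let ?S = "c k ` B k" and ?C = "\<lambda>s. {q \<in> B k. c k q = s}"
  define a where "a = (\<lambda>s. \<Sum>q\<in>?C s. mu k q * r (z(k := q)))"
  obtain q0 where q0: "q0 \<in> B k" using ne_B[OF k] by auto
  have b0: "0 \<le> b" using r[OF z] by linarith
  have a: "\<bar>a s\<bar> \<le> b" if s: "s \<in> ?S" for s
  proof -
    obtain q where q: "q \<in> B k" "s = c k q" using s by auto
    have "a s = avg k r (z(k := q))" by (simp add: a_def avg_def q)
    then show ?thesis using avg_bound[OF k X_upd[OF z k q(1)] r] by simp
  qed
  have "T k (kap k) (avg k r) z = (\<Sum>q\<in>B k. kap k z q * a (c k q))" unfolding T_def avg_def a_def by simp
  also have "\<dots> = (\<Sum>s\<in>?S. \<Sum>q\<in>?C s. kap k z q * a (c k q))" by (rule sum_group_image[OF k])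
  also have "\<dots> = (\<Sum>s\<in>?S. (\<Sum>q\<in>?C s. kap k z q) * a s)" unfolding sum_distrib_right by (intro sum.cong) auto
  finally have 1: "T k (kap k) (avg k r) z = (\<Sum>s\<in>?S. (\<Sum>q\<in>?C s. kap k z q) * a s)" .
  have "T k (kbar k) r z = (\<Sum>s\<in>?S. \<Sum>q\<in>?C s. kbar k z q * r (z(k := q)))"
    unfolding T_def by (rule sum_group_image[OF k])
  also have "\<dots> = (\<Sum>s\<in>?S. w k (key k z) s * a s)"
    unfolding a_def sum_distrib_left by (intro sum.cong refl) (auto simp: kbar_def)
  finally have 2: "T k (kbar k) r z = (\<Sum>s\<in>?S. w k (key k z) s * a s)" .
  have "\<bar>T k (kap k) (avg k r) z - T k (kbar k) r z\<bar> \<le> (\<Sum>s\<in>?S. \<bar>((\<Sum>q\<in>?C s. kap k z q) - w k (key k z) s) * a s\<bar>)"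
    unfolding 1 2 sum_subtractf[symmetric] left_diff_distrib[symmetric] by (rule sum_abs)
  also have "\<dots> \<le> (\<Sum>s\<in>?S. \<bar>w k (key k z) s - (\<Sum>q\<in>?C s. kap k z q)\<bar> * b)"
  proof (rule sum_mono)
    fix s assume "s \<in> ?S"
    then show "\<bar>((\<Sum>q\<in>?C s. kap k z q) - w k (key k z) s) * a s\<bar> \<le> \<bar>w k (key k z) s - (\<Sum>q\<in>?C s. kap k z q)\<bar> * b"
      using a[of s] by (simp add: abs_mult abs_minus_commute mult_left_mono)
  qed
  also have "\<dots> \<le> L * (1 + K * m) * h * b"
    unfolding sum_distrib_right[symmetric] using b0 by (intro mult_right_mono w_kap[OF k z])
  finally show ?thesis .
qed

text \<open>Exchanging \<open>x\<^sub>k\<close> with an independent copy from the same coarse cell only changes the law of the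
  parents given \<open>x\<^sub>k\<close>, by \<open>O(h)\<close>.\<close>

lemma \<rho>_avg:
  assumes k: "k \<in> {1..K}" and rd: "dep (insert k (par k)) r" and r: "\<And>z. z \<in> X \<Longrightarrow> \<bar>r z\<bar> \<le> b"
  shows "\<bar>E p (TS (par k) (\<rho> k) r) - E p (TS (par k) (\<rho> k) (avg k r))\<bar> \<le> L * m * h * b"
proof -
  obtain z1 where z1: "z1 \<in> X" using ne_X by auto
  have b0: "0 \<le> b" using r[OF z1] by linarith
  have kp: "k \<notin> par k" using par_sub[OF k] by auto
  let ?Y = "PiE (par k) B"
  \<comment> \<open>The parents are drawn as if block \<open>k\<close> were at \<open>q\<close>,
    while \<open>r\<close> is evaluated with block \<open>k\<close> at \<open>q'\<close>;
    \<open>z1\<close> fills the other coordinates.\<close>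
  define \<Phi> where "\<Phi> = (\<lambda>q q'. \<Sum>y\<in>?Y. \<rho> k (z1(k := q)) y * r (override (par k) y (z1(k := q'))))"
  let ?C = "\<lambda>q. {q' \<in> B k. c k q' = c k q}"
  define P where "P = (\<lambda>q. Pr p (\<lambda>z. z k = q))"
  have oX: "override (par k) y z \<in> X" if "z \<in> X" "y \<in> ?Y" for y z using X_override par_K[OF k] that by blast
  have \<rho>z: "\<rho> k z y = \<rho> k (z1(k := z k)) y" if "z \<in> X" "y \<in> ?Y" for z y
    using X_upd[OF z1 k X_mem[OF that(1) k]] by (intro \<rho>_dep[OF k that(1) _ _ that(2)]) auto
  have rz: "r (override (par k) y (z(k := q))) = r (override (par k) y (z1(k := q)))" if "z \<in> X" "y \<in> ?Y" "q \<in> B k" for z y q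
    using that by (intro depD[OF rd] oX X_upd z1 k) (auto simp: override_def)
  have TSr: "TS (par k) (\<rho> k) r z = \<Phi> (z k) (z k)" if z: "z \<in> X" for z
    unfolding TS_def \<Phi>_def using \<rho>z[OF z] rz[OF z _ X_mem[OF z k]] by (intro sum.cong) auto
  have TSa: "TS (par k) (\<rho> k) (avg k r) z = (\<Sum>q\<in>?C (z k). mu k q * \<Phi> (z k) q)" if z: "z \<in> X" for z
  proof -
    have "TS (par k) (\<rho> k) (avg k r) z = (\<Sum>y\<in>?Y. \<Sum>q\<in>?C (z k). mu k q * (\<rho> k (z1(k := z k)) y * r (override (par k) y (z1(k := q)))))"
      unfolding TS_def avg_def sum_distrib_left
    proof (intro sum.cong refl)
      show "{q \<in> B k. c k q = c k (override (par k) y z k)} = ?C (z k)" for y using kp by (simp add: override_def)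
    next
      fix y q assume y: "y \<in> ?Y" and q: "q \<in> ?C (z k)"
      have "(override (par k) y z)(k := q) = override (par k) y (z(k := q))"
        using kp by (auto simp: override_def fun_eq_iff)
      then show "\<rho> k z y * (mu k q * r ((override (par k) y z)(k := q))) =
          mu k q * (\<rho> k (z1(k := z k)) y * r (override (par k) y (z1(k := q))))"
        using \<rho>z[OF z y] rz[OF z y, of q] q by simp
    qed
    also have "\<dots> = (\<Sum>q\<in>?C (z k). mu k q * \<Phi> (z k) q)"
      unfolding \<Phi>_def sum_distrib_left by (rule sum.swap)
    finally show ?thesis .
  qed
  have grp: "E p (\<lambda>z. f (z k)) = (\<Sum>q\<in>B k. P q * f q)" for f
    unfolding P_def using k X_mem[OF _ k] by (intro E_group) auto
  have P0: "P q \<ge> 0" for q by (simp add: P_def Pr_nonneg[OF p])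
  have filt: "(\<Sum>q'\<in>?C q. f q') = (\<Sum>q'\<in>B k. if c k q' = c k q then f q' else 0)" for f :: "'b \<Rightarrow> real" and q
    using k by (intro sum.inter_filter) auto
  have "E p (TS (par k) (\<rho> k) r) = E p (\<lambda>z. \<Phi> (z k) (z k))" by (rule E_cong) (rule TSr)
  also have "\<dots> = (\<Sum>q\<in>B k. P q * \<Phi> q q)" by (rule grp)
  also have "\<dots> = (\<Sum>q\<in>B k. P q * (\<Sum>q'\<in>?C q. mu k q' * \<Phi> q q))"
    using mu_cell[OF k] by (intro sum.cong refl) (simp flip: sum_distrib_right)
  finally have I: "E p (TS (par k) (\<rho> k) r) = (\<Sum>q\<in>B k. P q * (\<Sum>q'\<in>?C q. mu k q' * \<Phi> q q))" .
  have "E p (TS (par k) (\<rho> k) (avg k r)) = E p (\<lambda>z. \<Sum>q\<in>?C (z k). mu k q * \<Phi> (z k) q)" by (rule E_cong) (rule TSa)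
  also have "\<dots> = (\<Sum>q\<in>B k. P q * (\<Sum>q'\<in>?C q. mu k q' * \<Phi> q q'))" by (rule grp)
  also have "\<dots> = (\<Sum>q\<in>B k. \<Sum>q'\<in>B k. if c k q' = c k q then P q * mu k q' * \<Phi> q q' else 0)"
    by (simp add: filt sum_distrib_left mult.assoc if_distrib[of "\<lambda>x. _ * x"] cong: if_cong)
  \<comment> \<open>Inside one coarse cell \<open>P\<close> is a multiple of \<open>mu\<close>. The
    block and its copy are hence exchangeable, and \<Phi> can be compared in its first argument
    alone.\<close>
  also have "\<dots> = (\<Sum>q\<in>B k. \<Sum>q'\<in>B k. if c k q' = c k q then P q' * mu k q * \<Phi> q q' else 0)"
  proof (intro sum.cong refl if_cong)
    fix q q' assume q: "q \<in> B k" "q' \<in> B k" and eq: "c k q' = c k q"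
    define a where "a = Pr p (\<lambda>z. c k (z k) = c k q)"
    have "P q = a * mu k q" using mu_mass[OF q(1)] by (simp add: P_def a_def)
    moreover have "P q' = a * mu k q'" using mu_mass[OF q(2)] by (simp add: P_def a_def eq)
    ultimately show "P q * mu k q' * \<Phi> q q' = P q' * mu k q * \<Phi> q q'" by simp
  qed
  also have "\<dots> = (\<Sum>q\<in>B k. \<Sum>q'\<in>B k. if c k q' = c k q then P q * mu k q' * \<Phi> q' q else 0)"
    by (subst sum.swap) (intro sum.cong refl if_cong, auto)
  also have "\<dots> = (\<Sum>q\<in>B k. P q * (\<Sum>q'\<in>?C q. mu k q' * \<Phi> q' q))"
    by (simp add: filt sum_distrib_left mult.assoc if_distrib[of "\<lambda>x. _ * x"] cong: if_cong)
  finally have II: "E p (TS (par k) (\<rho> k) (avg k r)) = (\<Sum>q\<in>B k. P q * (\<Sum>q'\<in>?C q. mu k q' * \<Phi> q' q))" .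
  have \<Phi>d: "\<bar>\<Phi> q q - \<Phi> q' q\<bar> \<le> L * m * h * b" if q: "q \<in> B k" "q' \<in> ?C q" for q q'
  proof -
    have zq: "z1(k := q) \<in> X" "z1(k := q') \<in> X" using X_upd[OF z1 k] q by auto
    have "\<bar>\<Phi> q q - \<Phi> q' q\<bar> \<le> (\<Sum>y\<in>?Y. \<bar>\<rho> k (z1(k := q)) y - \<rho> k (z1(k := q')) y\<bar> * b)"
      unfolding \<Phi>_def sum_subtractf[symmetric] left_diff_distrib[symmetric]
      by (rule order_trans[OF sum_abs], rule sum_mono)
        (use r oX[OF zq(1)] in \<open>auto simp: abs_mult intro!: mult_left_mono\<close>)
    also have "\<dots> \<le> (L * bd k q q') * b"
      unfolding sum_distrib_right[symmetric] using \<rho>_lip[OF k zq] b0 by (intro mult_right_mono) auto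
    also have "\<dots> \<le> (L * (m * h)) * b"
      using bd_lev[OF k q(1), of q' \<eta>] q eta_le b0 L0 by (intro mult_right_mono mult_left_mono) (auto simp: h_def)
    finally show ?thesis by simp
  qed
  have "\<bar>E p (TS (par k) (\<rho> k) r) - E p (TS (par k) (\<rho> k) (avg k r))\<bar> \<le>
      (\<Sum>q\<in>B k. \<bar>P q * (\<Sum>q'\<in>?C q. mu k q' * (\<Phi> q q - \<Phi> q' q))\<bar>)"
    unfolding I II sum_subtractf[symmetric] right_diff_distrib[symmetric] by (rule sum_abs)
  also have "\<dots> \<le> (\<Sum>q\<in>B k. P q * (L * m * h * b))"
  proof (rule sum_mono)
    fix q assume q: "q \<in> B k"
    have "\<bar>\<Sum>q'\<in>?C q. mu k q' * (\<Phi> q q - \<Phi> q' q)\<bar> \<le> (\<Sum>q'\<in>?C q. mu k q' * (L * m * h * b))"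
    proof (rule order_trans[OF sum_abs], rule sum_mono)
      fix q' assume q': "q' \<in> ?C q"
      show "\<bar>mu k q' * (\<Phi> q q - \<Phi> q' q)\<bar> \<le> mu k q' * (L * m * h * b)"
        using mult_left_mono[OF \<Phi>d[OF q q'] mu_nonneg[of k q']] mu_nonneg[of k q'] by (simp add: abs_mult)
    qed
    also have "\<dots> = L * m * h * b" using mu_cell[OF k, of "c k q"] q by (simp flip: sum_distrib_right)
    finally have "P q * \<bar>\<Sum>q'\<in>?C q. mu k q' * (\<Phi> q q - \<Phi> q' q)\<bar> \<le> P q * (L * m * h * b)"
      by (rule mult_left_mono[OF _ P0])
    then show "\<bar>P q * (\<Sum>q'\<in>?C q. mu k q' * (\<Phi> q q - \<Phi> q' q))\<bar> \<le> P q * (L * m * h * b)"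
      using P0[of q] by (simp add: abs_mult)
  qed
  also have "\<dots> = L * m * h * b"
    using grp[of "\<lambda>_. 1"] E_const[OF p, of 1] by (simp flip: sum_distrib_right)
  finally show ?thesis .
qed

text \<open>The first summand collects the four discretisation errors \<open>s1\<close> to
  \<open>s4\<close> of \<open>bias\<close>, each \<open>L / 2 ^ J\<close> times the oscillation
  bound. The second is the bound on the remainder, \<open>K * m * (1 + L * (K * (m + 1)))\<close>
  per unit of \<open>A * h\<close>, times the total \<open>L * (4 + m + K * m)\<close> of
  \<open>s5\<close> to \<open>s9\<close>.\<close>

definition Cb :: real where
  "Cb = 4 * L * (K * (m + 1)) + K * m * (1 + L * (K * (m + 1))) * (L * (4 + m + K * m))"

text \<open>Integrating out the predecessors that are not parents turns \<open>F\<close> into a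
  function \<open>G\<close> of block \<open>k\<close> and its parents. The values of
  \<open>G\<close> at coarse representatives have the same mean before and after the smoothed
  kernel, by \<open>tower\<close>. The remainder \<open>r\<close> is of order \<open>h\<close>, and
  its two means differ by another factor of order \<open>h\<close>: block \<open>k\<close> is first
  averaged inside its cell, using \<rho>, and then \<open>kap\<close> is compared with
  \<open>kbar\<close>.\<close>

lemma bias:
  assumes k: "k \<in> {1..K}" and F: "lip k A F" and A: "0 \<le> A"
  shows "\<bar>E p F - E p (T k (kbar k) F)\<bar> \<le> A * Cb * (h\<^sup>2 + 1 / 2 ^ J)"
proof -
  obtain z1 where z1: "z1 \<in> X" using ne_X by auto
  define M where "M = K * (m + 1)"
  define b where "b = A * M"
  \<comment> \<open>Centring bounds the function by its oscillation. The errors of the conditional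
    laws are multiplied by a supremum norm and so stay proportional to \<open>A\<close>.\<close>
  define F0 where "F0 = (\<lambda>z. F z - F z1)"
  define G where "G = TS (pred k) (\<pi> k) F0"
  \<comment> \<open>Every block is moved to the representative of its coarse cell, so
    \<open>G (ref z)\<close> depends on coarse cells only and \<open>r\<close> is the variation of
    \<open>G\<close> inside them.\<close>
  define ref where "ref = (\<lambda>z. \<lambda>i\<in>{1..K}. rep i \<eta> (z i))"
  define r where "r = (\<lambda>z. G z - G (ref z))"
  define Rh where "Rh = A * (K * m) * (1 + L * M) * h"
  define \<delta> :: real where "\<delta> = L / 2 ^ J"
  have M0: "0 \<le> M" using m1 by (simp add: M_def)
  have b0: "0 \<le> b" using A M0 by (simp add: b_def)
  have kp: "k \<notin> pred k" "par k \<inter> pred k = {}" "k \<notin> par k" using par_sub[OF k] by (auto simp: pred_def)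
  have fam: "insert k (par k) \<subseteq> {1..k}" "{1..k} - insert k (par k) = pred k" using par_sub[OF k] k by (auto simp: pred_def)
  have F_lip: "\<bar>F0 z - F0 z'\<bar> \<le> A * dd {1..k} z z'" if "z \<in> X" "z' \<in> X" for z z'
    using F that unfolding lip_def F0_def by auto
  have F0_dep: "dep {1..k} F0" using dep_lip[OF F] unfolding dep_def F0_def by metis
  have F0_b: "\<bar>F0 z\<bar> \<le> b" if "z \<in> X" for z
  proof -
    have "\<bar>F0 z - F0 z1\<bar> \<le> A * dd {1..k} z z1" by (rule F_lip[OF that z1])
    also have "\<dots> \<le> A * M" unfolding M_def using k A by (intro mult_left_mono dd_le that z1) auto
    finally show ?thesis by (simp add: b_def F0_def)
  qed
  have G_diff: "\<bar>G z - G z'\<bar> \<le> A * dd (insert k (par k)) z z' + L * (\<Sum>i\<in>par k. bd i (z i) (z' i)) * b"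
    if z: "z \<in> X" "z' \<in> X" for z z'
  proof -
    let ?Y = "PiE (pred k) B"
    have o: "override (pred k) y z \<in> X" "override (pred k) y z' \<in> X" if "y \<in> ?Y" for y
      using X_override[OF _ pred_K[OF k] that] z by auto
    have "dd {1..k} (override (pred k) y z) (override (pred k) y z') = dd (insert k (par k)) z z'" for y
      unfolding dd_def
    proof (rule sum.mono_neutral_cong_right)
      show "\<forall>i\<in>{1..k} - insert k (par k). ed i (override (pred k) y z i) (override (pred k) y z' i) = 0"
        unfolding fam(2) by (auto simp: override_def)
    qed (use fam(1) kp in \<open>auto simp: override_def\<close>)
    then have d: "\<bar>F0 (override (pred k) y z) - F0 (override (pred k) y z')\<bar> \<le> A * dd (insert k (par k)) z z'" if "y \<in> ?Y" for y
      using F_lip[OF o[OF that]] by simp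
    have "G z - G z' = (\<Sum>y\<in>?Y. \<pi> k z y * (F0 (override (pred k) y z) - F0 (override (pred k) y z'))) +
        (\<Sum>y\<in>?Y. (\<pi> k z y - \<pi> k z' y) * F0 (override (pred k) y z'))"
      unfolding G_def TS_def sum_subtractf[symmetric] sum.distrib[symmetric] by (simp add: algebra_simps)
    moreover have "\<bar>\<Sum>y\<in>?Y. \<pi> k z y * (F0 (override (pred k) y z) - F0 (override (pred k) y z'))\<bar> \<le>
        (\<Sum>y\<in>?Y. \<pi> k z y * (A * dd (insert k (par k)) z z'))"
      by (rule order_trans[OF sum_abs], rule sum_mono)
        (use d \<pi>_nonneg[OF k z(1)] in \<open>auto simp: abs_mult intro!: mult_left_mono\<close>)
    moreover have "\<dots> = A * dd (insert k (par k)) z z'" using \<pi>_sum[OF k z(1)] by (simp flip: sum_distrib_right)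
    moreover have "\<bar>\<Sum>y\<in>?Y. (\<pi> k z y - \<pi> k z' y) * F0 (override (pred k) y z')\<bar> \<le> (\<Sum>y\<in>?Y. \<bar>\<pi> k z y - \<pi> k z' y\<bar> * b)"
      by (rule order_trans[OF sum_abs], rule sum_mono)
        (use F0_b o(2) in \<open>auto simp: abs_mult intro!: mult_left_mono\<close>)
    moreover have "\<dots> \<le> L * (\<Sum>i\<in>par k. bd i (z i) (z' i)) * b"
      unfolding sum_distrib_right[symmetric] by (rule mult_right_mono[OF \<pi>_lip[OF k z] b0])
    ultimately show ?thesis by linarith
  qed
  have G_dep: "dep (insert k (par k)) G"
    unfolding dep_def
  proof (intro ballI impI)
    fix z z' assume z: "z \<in> X" "z' \<in> X" and eq: "\<forall>i\<in>insert k (par k). z i = z' i"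
    have "dd (insert k (par k)) z z' = 0" "(\<Sum>i\<in>par k. bd i (z i) (z' i)) = 0"
      using eq by (auto simp: dd_def intro!: sum.neutral)
    then show "G z = G z'" using G_diff[OF z] by simp
  qed
  have G_b: "\<bar>G z\<bar> \<le> b" if "z \<in> X" for z
    unfolding G_def by (rule TS_bound[where \<kappa>="\<pi> k" and F=F0, OF pred_K[OF k] that \<pi>_nonneg[OF k that] \<pi>_sum[OF k that] F0_b])
  have refX: "ref z \<in> X" if "z \<in> X" for z
    using rep(1) X_mem[OF that] by (auto simp: ref_def X_def)
  have refc: "c i (ref z i) = c i (z i)" if "z \<in> X" "i \<in> {1..K}" for z i
    using rep(2)[OF X_mem[OF that], of \<eta>] that by (simp add: ref_def)
  have r_b: "\<bar>r z\<bar> \<le> Rh" if z: "z \<in> X" for z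
  proof -
    have famK: "insert k (par k) \<subseteq> {1..K}" using par_K[OF k] k by auto
    have "\<bar>r z\<bar> \<le> A * dd (insert k (par k)) z (ref z) + L * (\<Sum>i\<in>par k. bd i (z i) (ref z i)) * b"
      unfolding r_def by (rule G_diff[OF z refX[OF z]])
    also have "\<dots> \<le> A * (K * m * h) + L * (K * m * h) * b"
    proof (intro add_mono mult_left_mono mult_right_mono A L0 b0)
      show "dd (insert k (par k)) z (ref z) \<le> K * m * h"
        using refc[OF z] famK by (intro dd_same refX z) auto
      show "(\<Sum>i\<in>par k. bd i (z i) (ref z i)) \<le> K * m * h"
        using refc[OF z] famK by (intro bd_same k refX z) (auto simp: key_eq)
    qed
    also have "\<dots> = Rh" by (simp add: Rh_def b_def algebra_simps)
    finally show ?thesis .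
  qed
  have Rh0: "0 \<le> Rh" using r_b[OF z1] by linarith
  have refG: "G (ref z) = G (ref z')" if "z \<in> X" "z' \<in> X" "key k z = key k z'" "c k (z k) = c k (z' k)" for z z'
  proof (intro depD[OF G_dep] refX that)
    fix i assume "i \<in> insert k (par k)"
    then have "c i (z i) = c i (z' i)" using that by (auto simp: key_eq)
    then show "ref z i = ref z' i" using rep_cong[of i \<eta> "z i" "z' i"] by (simp add: ref_def)
  qed
  have r_dep: "dep (insert k (par k)) r"
    unfolding dep_def
  proof (intro ballI impI)
    fix z z' assume z: "z \<in> X" "z' \<in> X" and eq: "\<forall>i\<in>insert k (par k). z i = z' i"
    have "G z = G z'" using eq by (intro depD[OF G_dep] z) auto
    moreover have "G (ref z) = G (ref z')" using eq by (intro refG z) (auto simp: key_eq)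
    ultimately show "r z = r z'" by (simp add: r_def)
  qed
  have towerG: "E p (T k (kbar k) (\<lambda>z. G (ref z))) = E p (\<lambda>z. G (ref z))"
    by (rule tower[OF cond_kbar[OF k] k refG])
  have Er: "E p G - E p (T k (kbar k) G) = E p r - E p (T k (kbar k) r)"
  proof -
    have "E p (T k (kbar k) r) = E p (T k (kbar k) G) - E p (T k (kbar k) (\<lambda>z. G (ref z)))"
      unfolding r_def E_diff[symmetric] by (intro E_cong T_diff)
    then show ?thesis by (simp add: r_def E_diff towerG)
  qed
  note kapT = kap_nonneg[OF k] kap_sum[OF k]
  have condT: "\<And>z q. z \<in> X \<Longrightarrow> q \<in> B k \<Longrightarrow> 0 \<le> kbar k z q" "\<And>z. z \<in> X \<Longrightarrow> (\<Sum>q\<in>B k. kbar k z q) = 1"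
    using condD(1,2)[OF cond_kbar[OF k]] by auto
  have cdep: "dep S (\<lambda>_. a)" for S and a :: real by (simp add: dep_def)
  \<comment> \<open>\<open>s1\<close>, \<open>s2\<close> and \<open>s4\<close> lead from
    \<open>F0\<close> to \<open>G\<close> under \<open>p\<close>, through the kernel
    \<open>kap\<close>; \<open>s3\<close> does the same after \<open>kbar\<close>.\<close>
  have s1: "\<bar>E p F0 - E p (T k (kap k) F0)\<bar> \<le> \<delta> * b"
    using kap_cond[OF k F0_dep cdep F0_b] E_const[OF p] by (simp add: \<delta>_def)
  have dT1: "dep {1..<k} (T k (kap k) F0)" by (rule T_dep[OF k F0_dep kap_dep[OF k]])
  have dT2: "dep {1..<k} (T k (kbar k) F0)" by (rule T_dep[OF k F0_dep kbar_dep[OF k]])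
  have s2: "\<bar>E p (T k (kap k) F0) - E p (T k (kap k) G)\<bar> \<le> \<delta> * b"
  proof -
    have "E p (TS (pred k) (\<pi> k) (T k (kap k) F0)) = E p (T k (kap k) G)"
      unfolding G_def by (intro E_cong TS_T_commute[OF k _ kap_dep[OF k]])
    then show ?thesis
      using \<pi>_cond[OF k dT1, of b] T_bound[where F=F0 and \<kappa>="kap k", OF k _ kapT F0_b] by (simp add: \<delta>_def)
  qed
  have s3: "\<bar>E p (T k (kbar k) F0) - E p (T k (kbar k) G)\<bar> \<le> \<delta> * b"
  proof -
    have "E p (TS (pred k) (\<pi> k) (T k (kbar k) F0)) = E p (T k (kbar k) G)"
      unfolding G_def by (intro E_cong TS_T_commute[OF k _ kbar_dep[OF k]])
    then show ?thesis
      using \<pi>_cond[OF k dT2, of b] T_bound[where F=F0 and \<kappa>="kbar k", OF k _ condT F0_b] by (simp add: \<delta>_def)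
  qed
  have s4: "\<bar>E p G - E p (T k (kap k) G)\<bar> \<le> \<delta> * b"
    using kap_cond[OF k dep_mono[OF G_dep fam(1)] cdep G_b] E_const[OF p] by (simp add: \<delta>_def)
  \<comment> \<open>The chain from \<open>r\<close> to its smoothed version: \<open>s5\<close>,
    \<open>s6\<close> and \<open>s7\<close> replace \<open>r\<close> by \<open>avg k r\<close>,
    \<open>s8\<close> inserts \<open>kap\<close>, and \<open>s9\<close> exchanges \<open>kap\<close>
    for \<open>kbar\<close>.\<close>
  have s5: "\<bar>E p r - E p (TS (par k) (\<rho> k) r)\<bar> \<le> \<delta> * Rh"
    unfolding \<delta>_def by (rule \<rho>_cond[OF k r_dep r_b])
  have s6: "\<bar>E p (TS (par k) (\<rho> k) r) - E p (TS (par k) (\<rho> k) (avg k r))\<bar> \<le> L * m * h * Rh"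
    by (rule \<rho>_avg[OF k r_dep r_b])
  have s7: "\<bar>E p (avg k r) - E p (TS (par k) (\<rho> k) (avg k r))\<bar> \<le> \<delta> * Rh"
    unfolding \<delta>_def by (rule \<rho>_cond[OF k avg_dep[OF k r_dep] avg_bound[OF k _ r_b]])
  have s8: "\<bar>E p (avg k r) - E p (T k (kap k) (avg k r))\<bar> \<le> \<delta> * Rh"
    using kap_cond[OF k dep_mono[OF avg_dep[OF k r_dep] fam(1)] cdep avg_bound[OF k _ r_b]] E_const[OF p] by (simp add: \<delta>_def)
  have s9: "\<bar>E p (T k (kap k) (avg k r)) - E p (T k (kbar k) r)\<bar> \<le> L * (1 + K * m) * h * Rh"
    by (rule E_diff_le[OF p T_avg[OF k _ r_b]])
  have "\<bar>E p r - E p (T k (kbar k) r)\<bar> \<le> 3 * (\<delta> * Rh) + L * m * h * Rh + L * (1 + K * m) * h * Rh"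
    using s5 s6 s7 s8 s9 by linarith
  moreover have "\<delta> * Rh \<le> L * h * Rh"
    using mult_left_mono[OF delta_le L0] Rh0 by (intro mult_right_mono) (auto simp: \<delta>_def)
  ultimately have rr: "\<bar>E p r - E p (T k (kbar k) r)\<bar> \<le> L * (4 + m + K * m) * h * Rh"
    by (simp add: algebra_simps)
  have EF: "E p F - E p (T k (kbar k) F) = E p F0 - E p (T k (kbar k) F0)"
  proof -
    have "E p (T k (kbar k) F0) = E p (T k (kbar k) F) - E p (T k (kbar k) (\<lambda>_. F z1))"
      unfolding F0_def E_diff[symmetric] by (intro E_cong T_diff)
    also have "E p (T k (kbar k) (\<lambda>_. F z1)) = E p (\<lambda>_. F z1)"
      by (intro E_cong T_const[OF cond_kbar[OF k]])
    finally show ?thesis by (simp add: F0_def E_diff)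
  qed
  have "\<bar>E p F - E p (T k (kbar k) F)\<bar> \<le> 4 * (\<delta> * b) + L * (4 + m + K * m) * h * Rh"
    using s1 s2 s3 s4 rr unfolding EF Er[symmetric] by linarith
  also have "\<dots> = A * (4 * L * M * (1 / 2 ^ J) + K * m * (1 + L * M) * (L * (4 + m + K * m)) * h\<^sup>2)"
    by (simp add: \<delta>_def b_def Rh_def power2_eq_square algebra_simps)
  also have "\<dots> \<le> A * (Cb * (1 / 2 ^ J) + Cb * h\<^sup>2)"
  proof -
    define a1 where "a1 = 4 * L * M"
    define a2 where "a2 = K * m * (1 + L * M) * (L * (4 + m + K * m))"
    have "0 \<le> a1" using L0 M0 by (simp add: a1_def)
    moreover have "0 \<le> a2" unfolding a2_def using L0 M0 m1 by (intro mult_nonneg_nonneg add_nonneg_nonneg) auto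
    moreover have "Cb = a1 + a2" by (simp add: Cb_def a1_def a2_def M_def)
    ultimately have "a1 * (1 / 2 ^ J) + a2 * h\<^sup>2 \<le> Cb * (1 / 2 ^ J) + Cb * h\<^sup>2"
      by (intro add_mono mult_right_mono) auto
    then show ?thesis using A unfolding a1_def a2_def by (rule mult_left_mono)
  qed
  finally show ?thesis by (simp add: algebra_simps)
qed

lemma Cb_nonneg: "0 \<le> Cb"
  unfolding Cb_def using L0 m1 by (intro add_nonneg_nonneg mult_nonneg_nonneg) auto

lemma Gamma_ge1: "1 \<le> \<Gamma>"
  unfolding \<Gamma>_def using L0 m1 by simp

text \<open>The blocks are integrated out from the last to the first. Each step costs one
  \<open>bias\<close> and one \<open>kernel_error\<close>, and passes on a function whose Lipschitz
  constant has grown by \<Gamma>.\<close>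

lemma law_difference:
  assumes r: "pmass r" and z0: "z0 \<in> X"
  shows "n \<le> K \<Longrightarrow> lip n A F \<Longrightarrow> 0 \<le> A \<Longrightarrow>
    E p F - N (smk r) z0 n F \<le> A * n * \<Gamma> ^ n * (Cb * (h\<^sup>2 + 1 / 2 ^ J) + (\<Sum>k\<in>{1..K}. err p r k))"
proof (induction n arbitrary: A F)
  case 0
  have "F z = F z0" if "z \<in> X" for z
  proof -
    have "\<bar>F z - F z0\<bar> \<le> A * dd {1..0} z z0" using "0.prems"(2) that z0 unfolding lip_def by blast
    then show ?thesis by (simp add: dd_def)
  qed
  then have "E p F = E p (\<lambda>_. F z0)" by (rule E_cong)
  then show ?case using E_const[OF p] by simp
next
  case (Suc n)
  define W where "W = Cb * (h\<^sup>2 + 1 / 2 ^ J) + (\<Sum>k\<in>{1..K}. err p r k)"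
  have k: "Suc n \<in> {1..K}" using Suc.prems by auto
  let ?TF = "T (Suc n) (kbar (Suc n)) F"
  have 1: "E p F - E p ?TF \<le> A * (Cb * (h\<^sup>2 + 1 / 2 ^ J))"
    using bias[OF k Suc.prems(2,3)] by (simp add: mult.assoc)
  have 2: "E p ?TF - N (smk r) z0 n ?TF \<le> A * \<Gamma> * n * \<Gamma> ^ n * W"
    unfolding W_def using Suc.prems(1,3) lip_T[OF k Suc.prems(3,2)] Gamma_ge1 by (intro Suc.IH) auto
  have 3: "N (smk r) z0 n ?TF - N (smk r) z0 n (T (Suc n) (smk r (Suc n)) F) \<le> A * err p r (Suc n)"
    unfolding N_diff[symmetric]
    by (rule kernel_error[OF k p r z0 cond_kbar[OF k] kbar_def mu_nonneg mu_cell[OF k] mu_mass Suc.prems(2,3)])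
  have "err p r (Suc n) \<le> (\<Sum>k\<in>{1..K}. err p r k)"
    using k err_nonneg by (intro member_le_sum) auto
  then have "A * (Cb * (h\<^sup>2 + 1 / 2 ^ J)) + A * err p r (Suc n) \<le> A * W"
    unfolding W_def distrib_left[symmetric] using Suc.prems(3) by (intro mult_left_mono) auto
  then have "E p F - N (smk r) z0 (Suc n) F \<le> A * W + A * \<Gamma> * n * \<Gamma> ^ n * W"
    using 1 2 3 by simp
  also have "A * W \<le> A * \<Gamma> ^ Suc n * W"
  proof -
    have "0 \<le> W" unfolding W_def using Cb_nonneg err_nonneg h_pos by (auto intro!: add_nonneg_nonneg mult_nonneg_nonneg sum_nonneg)
    moreover have "1 \<le> \<Gamma> ^ Suc n" using Gamma_ge1 by (rule one_le_power)
    ultimately show ?thesis using Suc.prems(3) mult_left_mono[of 1 "\<Gamma> ^ Suc n" "A * W"] by (simp add: mult_ac)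
  qed
  finally show ?case unfolding W_def[symmetric] by (simp add: algebra_simps)
qed

end

section \<open>Deviations of the empirical measure\<close>

lemma empirical_square:
  fixes \<mu> :: "'a measure" and f :: "'a \<Rightarrow> real"
  assumes "prob_space \<mu>" and f: "f \<in> borel_measurable \<mu>" and b: "\<And>x. x \<in> space \<mu> \<Longrightarrow> \<bar>f x\<bar> \<le> b"
    and f0: "(\<integral>x. f x \<partial>\<mu>) = 0"
  shows "(\<integral>\<omega>. (\<Sum>i<n. f (\<omega> i))\<^sup>2 \<partial>(\<Pi>\<^sub>M i\<in>{..<n}. \<mu>)) = real n * (\<integral>x. (f x)\<^sup>2 \<partial>\<mu>)"
proof -
  interpret prob_space \<mu> by fact
  interpret P: product_prob_space "\<lambda>_. \<mu>" "{..<n::nat}" by unfold_locales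
  let ?P = "\<Pi>\<^sub>M i\<in>{..<n}. \<mu>"
  have int: "integrable \<mu> g" if "g \<in> borel_measurable \<mu>" "\<And>x. x \<in> space \<mu> \<Longrightarrow> \<bar>g x\<bar> \<le> c" for g :: "'a \<Rightarrow> real" and c
    by (rule integrable_const_bound[of _ c]) (use that in auto)
  have bb: "\<bar>f x * f y\<bar> \<le> b * b" if "x \<in> space \<mu>" "y \<in> space \<mu>" for x y
    unfolding abs_mult using b[OF that(1)] b[OF that(2)] by (intro mult_mono) auto
  have comp[measurable]: "(\<lambda>\<omega>. \<omega> i) \<in> ?P \<rightarrow>\<^sub>M \<mu>" if "i < n" for i
    using that by (intro measurable_component_singleton) auto
  have sp: "\<omega> i \<in> space \<mu>" if "\<omega> \<in> space ?P" "i < n" for \<omega> i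
    using measurable_space[OF comp[OF that(2)] that(1)] .
  have intP: "integrable ?P (\<lambda>\<omega>. f (\<omega> i) * f (\<omega> l))" if "i < n" "l < n" for i l
  proof (rule P.integrable_const_bound[of _ "b * b"])
    show "AE \<omega> in ?P. norm (f (\<omega> i) * f (\<omega> l)) \<le> b * b"
      using bb sp that by (intro AE_I2) auto
    show "(\<lambda>\<omega>. f (\<omega> i) * f (\<omega> l)) \<in> borel_measurable ?P"
      using measurable_compose[OF comp[OF that(1)] f] measurable_compose[OF comp[OF that(2)] f] by measurable
  qed
  have cross: "(\<integral>\<omega>. f (\<omega> i) * f (\<omega> l) \<partial>?P) = (if i = l then \<integral>x. (f x)\<^sup>2 \<partial>\<mu> else 0)" if il: "i < n" "l < n" for i l
  proof (cases "i = l")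
    case True
    have "(\<integral>\<omega>. f (\<omega> i) * f (\<omega> i) \<partial>?P) = (\<integral>x. f x * f x \<partial>distr ?P \<mu> (\<lambda>\<omega>. \<omega> i))"
      using f by (subst integral_distr[OF comp[OF il(1)]]) auto
    also have "distr ?P \<mu> (\<lambda>\<omega>. \<omega> i) = \<mu>"
      using il by (subst distr_PiM_component) (auto simp: prob_space_axioms)
    finally show ?thesis using True by (simp add: power2_eq_square)
  next
    case False
    \<comment> \<open>The factors 1 at all other indices turn the mixed moment into a product over
      all coordinates, two of whose factors are the vanishing mean.\<close>
    define g where "g = (\<lambda>t. if t = i \<or> t = l then f else (\<lambda>_. 1))"
    have "(\<integral>\<omega>. (\<Prod>t\<in>{..<n}. g t (\<omega> t)) \<partial>?P) = (\<Prod>t\<in>{..<n}. \<integral>x. g t x \<partial>\<mu>)"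
      using int[OF f b] by (intro P.product_integral_prod) (auto simp: g_def)
    also have "\<dots> = 0" using il f0 by (intro prod_zero) (auto simp: g_def)
    also have "(\<lambda>\<omega>. \<Prod>t\<in>{..<n}. g t (\<omega> t)) = (\<lambda>\<omega>. f (\<omega> i) * f (\<omega> l))"
    proof
      fix \<omega> :: "nat \<Rightarrow> 'a"
      have "(\<Prod>t\<in>{..<n}. g t (\<omega> t)) = (\<Prod>t\<in>{i, l}. g t (\<omega> t))"
        using il by (intro prod.mono_neutral_right) (auto simp: g_def)
      then show "(\<Prod>t\<in>{..<n}. g t (\<omega> t)) = f (\<omega> i) * f (\<omega> l)" using False by (simp add: g_def)
    qed
    finally show ?thesis using False by simp
  qed
  have "(\<integral>\<omega>. (\<Sum>i<n. f (\<omega> i))\<^sup>2 \<partial>?P) = (\<integral>\<omega>. (\<Sum>i<n. \<Sum>l<n. f (\<omega> i) * f (\<omega> l)) \<partial>?P)"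
    by (simp add: power2_eq_square sum_product)
  also have "\<dots> = (\<Sum>i<n. \<Sum>l<n. \<integral>\<omega>. f (\<omega> i) * f (\<omega> l) \<partial>?P)"
    using intP by (subst Bochner_Integration.integral_sum, force, intro sum.cong Bochner_Integration.integral_sum) auto
  also have "\<dots> = (\<Sum>i<n. \<Sum>l<n. if i = l then \<integral>x. (f x)\<^sup>2 \<partial>\<mu> else 0)"
    using cross by (intro sum.cong) auto
  also have "\<dots> = real n * (\<integral>x. (f x)\<^sup>2 \<partial>\<mu>)" by simp
  finally show ?thesis .
qed

lemma empirical_deviation:
  fixes \<mu> :: "'a measure" and A :: "'c \<Rightarrow> 'a set"
  assumes "prob_space \<mu>" and fin: "finite C" and A: "\<And>a. a \<in> C \<Longrightarrow> A a \<in> sets \<mu>"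
    and le1: "(\<Sum>a\<in>C. measure \<mu> (A a)) \<le> 1" and n: "1 \<le> n"
  defines "S \<equiv> (\<lambda>\<omega>. \<Sum>a\<in>C. \<bar>measure \<mu> (A a) - (\<Sum>i<n. indicator (A a) (\<omega> i)) / real n\<bar>)"
  shows "integrable (\<Pi>\<^sub>M i\<in>{..<n}. \<mu>) S"
    and "(\<integral>\<omega>. S \<omega> \<partial>(\<Pi>\<^sub>M i\<in>{..<n}. \<mu>)) \<le> sqrt (real (card C) / real n)"
proof -
  interpret prob_space \<mu> by fact
  interpret P: product_prob_space "\<lambda>_. \<mu>" "{..<n::nat}" by unfold_locales
  let ?P = "\<Pi>\<^sub>M i\<in>{..<n}. \<mu>"
  have comp[measurable]: "(\<lambda>\<omega>. \<omega> i) \<in> ?P \<rightarrow>\<^sub>M \<mu>" if "i < n" for i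
    using that by (intro measurable_component_singleton) auto
  define f where "f = (\<lambda>a x. indicator (A a) x - measure \<mu> (A a) :: real)"
  define D where "D = (\<lambda>a \<omega>. (\<Sum>i<n. f a (\<omega> i)) / real n)"
  have D: "\<bar>measure \<mu> (A a) - (\<Sum>i<n. indicator (A a) (\<omega> i)) / real n\<bar> = \<bar>D a \<omega>\<bar>" for a \<omega>
    using n by (simp add: D_def f_def sum_subtractf diff_divide_distrib)
  have fm: "f a \<in> borel_measurable \<mu>" if "a \<in> C" for a
    unfolding f_def using A[OF that] by measurable
  have f1: "\<bar>f a x\<bar> \<le> 1" for a x
    unfolding f_def using prob_le_1[of "A a"] by (auto simp: indicator_def)
  have D1: "\<bar>D a \<omega>\<bar> \<le> 1" for a \<omega>
  proof -
    have "\<bar>\<Sum>i<n. f a (\<omega> i)\<bar> \<le> (\<Sum>i<n. 1)" by (rule order_trans[OF sum_abs sum_mono]) (rule f1)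
    then show ?thesis unfolding D_def using n by (simp add: divide_le_eq)
  qed
  have Dm: "D a \<in> borel_measurable ?P" if "a \<in> C" for a
    unfolding D_def using measurable_compose[OF comp fm[OF that]]
    by (intro borel_measurable_divide borel_measurable_sum) auto
  have Di: "integrable ?P (\<lambda>\<omega>. \<bar>D a \<omega>\<bar>)" if "a \<in> C" for a
    by (rule P.integrable_const_bound[of _ 1]) (use D1 Dm[OF that] in auto)
  have D2i: "integrable ?P (\<lambda>\<omega>. (D a \<omega>)\<^sup>2)" if "a \<in> C" for a
    by (rule P.integrable_const_bound[of _ 1]) (use D1 Dm[OF that] in \<open>auto simp: abs_square_le_1\<close>)
  have D2: "(\<integral>\<omega>. (D a \<omega>)\<^sup>2 \<partial>?P) \<le> measure \<mu> (A a) / real n" if a: "a \<in> C" for a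
  proof -
    have iA: "integrable \<mu> (indicator (A a) :: 'a \<Rightarrow> real)" using A[OF a] by (simp add: emeasure_eq_measure)
    have f0: "(\<integral>x. f a x \<partial>\<mu>) = 0"
      unfolding f_def using A[OF a] iA by (simp add: prob_space)
    have ff: "(f a x)\<^sup>2 = (1 - 2 * measure \<mu> (A a)) * indicator (A a) x + (measure \<mu> (A a))\<^sup>2" for x
      by (auto simp: f_def indicator_def power2_eq_square algebra_simps)
    have "(\<integral>x. (f a x)\<^sup>2 \<partial>\<mu>) = measure \<mu> (A a) - (measure \<mu> (A a))\<^sup>2"
      unfolding ff using A[OF a] iA by (simp add: prob_space power2_eq_square algebra_simps)
    then have f2: "(\<integral>x. (f a x)\<^sup>2 \<partial>\<mu>) \<le> measure \<mu> (A a)" by simp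
    have "(\<integral>\<omega>. (D a \<omega>)\<^sup>2 \<partial>?P) = (\<integral>\<omega>. (\<Sum>i<n. f a (\<omega> i))\<^sup>2 \<partial>?P) / (real n)\<^sup>2"
      by (simp add: D_def power_divide)
    also have "\<dots> = real n * (\<integral>x. (f a x)\<^sup>2 \<partial>\<mu>) / (real n)\<^sup>2"
      by (subst empirical_square[OF \<open>prob_space \<mu>\<close> fm[OF a] f1 f0]) auto
    also have "\<dots> = (\<integral>x. (f a x)\<^sup>2 \<partial>\<mu>) / real n" using n by (simp add: power2_eq_square)
    also have "\<dots> \<le> measure \<mu> (A a) / real n" using f2 by (intro divide_right_mono) auto
    finally show ?thesis .
  qed
  have S: "S = (\<lambda>\<omega>. \<Sum>a\<in>C. \<bar>D a \<omega>\<bar>)" by (simp add: S_def D)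
  show "integrable ?P S" unfolding S using Di by (intro Bochner_Integration.integrable_sum) auto
  show "(\<integral>\<omega>. S \<omega> \<partial>?P) \<le> sqrt (real (card C) / real n)"
  proof (cases "C = {}")
    case False
    define N where "N = real (card C)"
    have N: "N > 0" using False fin by (simp add: N_def card_gt_0_iff)
    \<comment> \<open>In \<open>\<bar>x\<bar> \<le> (t * x\<^sup>2 + 1 / t) / 2\<close> the second
      moments add up to at most \<open>1 / n\<close> and contribute \<open>t / n\<close>, while the
      constants contribute \<open>N / t\<close>. This \<open>t\<close> makes the two equal, so that
      no separate Cauchy-Schwarz step over the cells is made.\<close>
    define t where "t = sqrt (real n * N)"
    have t: "t > 0" "t * t = real n * N" using N n by (auto simp: t_def)
    have ineq: "\<bar>x\<bar> \<le> (t * x\<^sup>2 + 1 / t) / 2" for x :: real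
    proof -
      have "0 \<le> (t * \<bar>x\<bar> - 1)\<^sup>2 / t" using t by simp
      also have "(t * \<bar>x\<bar> - 1)\<^sup>2 / t = t * x\<^sup>2 + 1 / t - 2 * \<bar>x\<bar>"
        using t by (simp add: field_simps power2_eq_square)
      finally show ?thesis by simp
    qed
    have "(\<integral>\<omega>. S \<omega> \<partial>?P) = (\<Sum>a\<in>C. \<integral>\<omega>. \<bar>D a \<omega>\<bar> \<partial>?P)"
      unfolding S using Di by (intro Bochner_Integration.integral_sum) auto
    also have "\<dots> \<le> (\<Sum>a\<in>C. (t * (measure \<mu> (A a) / real n) + 1 / t) / 2)"
    proof (rule sum_mono)
      fix a assume a: "a \<in> C"
      have "(\<integral>\<omega>. \<bar>D a \<omega>\<bar> \<partial>?P) \<le> (\<integral>\<omega>. (t * (D a \<omega>)\<^sup>2 + 1 / t) / 2 \<partial>?P)"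
        using D2i[OF a] by (intro integral_mono Di a ineq) auto
      also have "\<dots> = (t * (\<integral>\<omega>. (D a \<omega>)\<^sup>2 \<partial>?P) + 1 / t) / 2"
        using D2i[OF a] by (simp add: P.P.prob_space)
      also have "\<dots> \<le> (t * (measure \<mu> (A a) / real n) + 1 / t) / 2"
        using D2[OF a] t by (intro divide_right_mono add_right_mono mult_left_mono) auto
      finally show "(\<integral>\<omega>. \<bar>D a \<omega>\<bar> \<partial>?P) \<le> (t * (measure \<mu> (A a) / real n) + 1 / t) / 2" .
    qed
    also have "\<dots> = (t * (\<Sum>a\<in>C. measure \<mu> (A a)) / real n + N / t) / 2"
      by (simp add: N_def sum.distrib flip: sum_divide_distrib sum_distrib_left)
    also have "\<dots> \<le> (t * 1 / real n + N / t) / 2"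
      using le1 t by (intro divide_right_mono add_right_mono mult_left_mono) auto
    also have "N / t = t / real n" using t n by (simp add: field_simps)
    also have "(t * 1 / real n + t / real n) / 2 = sqrt (N / real n)"
    proof -
      have "t / real n = sqrt (N / real n)"
        using n by (simp add: t_def real_sqrt_mult real_sqrt_divide field_simps)
      then show ?thesis by simp
    qed
    finally show ?thesis by (simp add: N_def)
  qed (simp add: S)
qed

section \<open>Rates\<close>

text \<open>The chaining sum of a block of dimension \<open>d\<close>: a deviation proportional to
  the root of the number of level-\<open>j\<close> cells, weighted by the cell side. It is bounded
  for dimension 1, linear in \<open>e\<close> for 2, and dominated by its last term from 3
  on.\<close>

definition geo :: "nat \<Rightarrow> nat \<Rightarrow> real" where
  "geo d e = (\<Sum>j\<le>e. sqrt (2 ^ (j * d)) / 2 ^ j)"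

lemma geo_step: "sqrt (2 ^ (Suc e * d)) / 2 ^ Suc e = (sqrt (2 ^ d) / 2) * (sqrt (2 ^ (e * d)) / (2::real) ^ e)"
  by (simp add: power_add real_sqrt_mult)

lemma geo_1: "geo 1 e \<le> 4"
proof -
  \<comment> \<open>The subtracted multiple of the last term makes the claim inductive; consecutive
    terms have ratio \<open>sqrt 2 / 2\<close>, which is at most \<open>3 / 4\<close>.\<close>
  have "geo 1 e \<le> 4 - 3 * (sqrt (2 ^ (e * 1)) / 2 ^ e)"
  proof (induction e)
    case (Suc e)
    define t :: real where "t = sqrt (2 ^ (e * 1)) / 2 ^ e"
    have "sqrt 2 \<le> (3 / 2 :: real)" by (rule real_le_lsqrt) (auto simp: power2_eq_square)
    then have "4 * (sqrt 2 / 2 * t) \<le> 3 * t" using mult_right_mono[of "4 * (sqrt 2 / 2)" 3 t] by (simp add: t_def)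
    then show ?case using Suc geo_step[of e 1] by (simp add: geo_def t_def)
  qed (simp add: geo_def)
  moreover have "0 \<le> sqrt (2 ^ (e * 1)) / (2::real) ^ e" by simp
  ultimately show ?thesis by linarith
qed

lemma geo_2: "geo 2 e = real e + 1"
proof -
  have "sqrt (2 ^ (j * 2)) / 2 ^ j = (1::real)" for j by (simp add: power_mult)
  then have "geo 2 e = (\<Sum>j\<le>e. 1)" unfolding geo_def by (intro sum.cong) (rule refl)
  then show ?thesis by simp
qed

lemma geo_3: "3 \<le> d \<Longrightarrow> geo d e \<le> 4 * (sqrt (2 ^ (e * d)) / 2 ^ e)"
proof (induction e)
  case (Suc e)
  define t :: real where "t = sqrt (2 ^ (e * d)) / 2 ^ e"
  define s :: real where "s = sqrt (2 ^ d) / 2"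
  have "(2::real) ^ 3 \<le> 2 ^ d" using Suc.prems by (intro power_increasing) auto
  \<comment> \<open>A rational lower bound for the root of 8. Consecutive terms then grow by at
    least \<open>4 / 3\<close>, the ratio at which the factor 4 reproduces itself.\<close>
  then have "(8 / 3 :: real) \<le> sqrt (2 ^ d)" by (intro real_le_rsqrt) (auto simp: power2_eq_square)
  then have "4 * t \<le> (3 * s) * t" by (intro mult_right_mono) (auto simp: s_def t_def)
  then show ?case using Suc geo_step[of e d] by (simp add: geo_def t_def[symmetric] s_def[symmetric])
qed (simp add: geo_def)

lemma floor_log_bounds:
  fixes n D :: nat
  assumes n: "1 \<le> n" and D: "1 \<le> D"
  defines "e \<equiv> nat \<lfloor>log 2 (real n) / real D\<rfloor>"
  shows "2 ^ (e * D) \<le> real n" and "1 / 2 ^ e \<le> 2 * real n powr (- 1 / real D)" and "real e \<le> log 2 (real n)"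
proof -
  have l0: "0 \<le> log 2 (real n) / real D" using n by simp
  have e1: "real e \<le> log 2 (real n) / real D" "log 2 (real n) / real D < real e + 1"
    unfolding e_def using l0 by linarith+
  have "real (e * D) \<le> log 2 (real n)" using e1(1) D by (simp add: field_simps)
  then have "2 powr real (e * D) \<le> real n" using n by (simp add: le_log_iff)
  then show "2 ^ (e * D) \<le> real n" by (simp only: powr_realpow zero_less_numeral)
  have "2 powr (real e + 1) = 2 * 2 ^ e" by (simp add: powr_add powr_realpow)
  then have "1 / 2 ^ e = 2 * 2 powr (- (real e + 1))"
    by (simp only: powr_minus) (simp add: inverse_eq_divide)
  also have "\<dots> \<le> 2 * 2 powr (- (log 2 (real n) / real D))" using e1(2) by simp
  also have "2 powr (- (log 2 (real n) / real D)) = (2 powr log 2 (real n)) powr (- 1 / real D)"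
    by (simp add: powr_powr)
  also have "2 powr log 2 (real n) = real n" using n by (subst powr_log_cancel) auto
  finally show "1 / 2 ^ e \<le> 2 * real n powr (- 1 / real D)" .
  have "log 2 (real n) / real D \<le> log 2 (real n)" using n D by (simp add: divide_le_eq mult_le_cancel_left1)
  then show "real e \<le> log 2 (real n)" using e1 by simp
qed

lemma log_absorb:
  fixes n :: nat and a b :: real
  assumes n: "1 \<le> n" and ab: "b < a"
  shows "max 1 (ln (real n)) * real n powr (- a) \<le> (1 + 1 / \<bar>a - b\<bar>) * real n powr (- b)"
proof -
  have "ln (real n) \<le> real n powr (a - b) / (a - b)" using n ab by (intro ln_powr_bound) auto
  moreover have "1 \<le> real n powr (a - b)" using n ab by (intro ge_one_powr_ge_zero) auto
  moreover have "0 \<le> real n powr (a - b) / (a - b)" using ab by simp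
  ultimately have "max 1 (ln (real n)) \<le> real n powr (a - b) + real n powr (a - b) / (a - b)" by linarith
  also have "\<dots> = (1 + 1 / \<bar>a - b\<bar>) * real n powr (a - b)" using ab by (simp add: algebra_simps)
  finally have "max 1 (ln (real n)) * real n powr (- a) \<le> (1 + 1 / \<bar>a - b\<bar>) * real n powr (a - b) * real n powr (- a)"
    by (rule mult_right_mono) simp
  also have "\<dots> = (1 + 1 / \<bar>a - b\<bar>) * real n powr (- b)" by (simp add: mult.assoc flip: powr_add)
  finally show ?thesis .
qed

lemma sqrt_pow_le:
  assumes "a + 2 * b \<le> e" "(2::real) ^ e \<le> x"
  shows "sqrt (2 ^ a / x) \<le> 1 / 2 ^ b"
proof -
  have "(2::real) ^ a * (2 ^ b)\<^sup>2 = 2 ^ (a + 2 * b)" by (simp add: power_add power_mult[symmetric] mult.commute)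
  also have "\<dots> \<le> 2 ^ e" using assms(1) by (intro power_increasing) auto
  also have "\<dots> \<le> x" by fact
  finally have *: "2 ^ a * (2 ^ b)\<^sup>2 \<le> x" .
  have "x > 0" by (rule less_le_trans[OF _ assms(2)]) simp
  then have "2 ^ a / x \<le> (1 / 2 ^ b)\<^sup>2" using * by (simp add: field_simps)
  then show ?thesis by (intro real_le_lsqrt) auto
qed

section \<open>Comparison of the deviations with the two rates\<close>

context
  fixes K :: nat and d :: "nat \<Rightarrow> nat" and E :: "(nat \<times> nat) set"
  assumes K: "K \<ge> 1" and d1: "\<forall>k\<in>{1..K}. 1 \<le> d k"
begin

text \<open>The level of the finest cells, with \<open>d_max\<close> in the place of
  \<open>2 + d_loc\<close>: the largest \<open>J\<close> for which a block has at most about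
  \<open>n\<close> cells, \<open>2 ^ (J * d_max) <= n\<close>.\<close>

definition fine_level :: "nat \<Rightarrow> nat" where
  "fine_level n = nat \<lfloor>log 2 (real n) / real (d_max K d)\<rfloor>"

text \<open>16 covers the cases without a surplus logarithm. The next two summands absorb the
  logarithm into the larger of the two rates, and the last absorbs it when \<open>d_max > 2\<close>.
  The absolute values and the convention \<open>1 / 0 = 0\<close> keep all summands nonnegative
  whatever the order of the exponents, so the sum bounds each of them.\<close>

definition rate_const :: real where
  "rate_const = 16 + 12 * (1 + 1 / \<bar>2 / (2 + real (d_loc K d E)) - 1 / real (d_max K d)\<bar>)
     + 12 * (1 + 1 / \<bar>1 / (real (d_max K d)) - 2 / (2 + real (d_loc K d E))\<bar>)
     + 3 * (1 + 1 / \<bar>1 / 2 - 1 / real (d_max K d)\<bar>)"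

lemma d_le_max: "k \<in> {1..K} \<Longrightarrow> max 2 (d k) \<le> d_max K d"
  unfolding d_max_def by (intro Max_ge) auto

lemma d_max_ge2: "2 \<le> d_max K d" using d_le_max[of 1] K by auto

lemma d_le_loc: "k \<in> {1..K} \<Longrightarrow> max 2 (d k) + d_pa d E k \<le> d_loc K d E"
  unfolding d_loc_def by (intro Max_ge) auto

lemma d_max_le_loc: "d_max K d \<le> d_loc K d E"
proof -
  have "max 2 (d k) \<le> d_loc K d E" if "k \<in> {1..K}" for k by (rule add_leD1[OF d_le_loc[OF that]])
  then show ?thesis unfolding d_max_def using K by (intro Max.boundedI) auto
qed

lemma grid_le_fine: "1 \<le> n \<Longrightarrow> grid_level K d E n \<le> fine_level n"
  unfolding grid_level_def fine_level_def using d_max_le_loc d_max_ge2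
  by (intro nat_mono floor_mono divide_left_mono) auto

lemma rate_bounds:
  assumes n: "1 \<le> n"
  defines "\<eta> \<equiv> grid_level K d E n" and "J \<equiv> fine_level n"
    and "R \<equiv> log_factor K d E n * (rate_loc K d E n + rate_max K d n)"
  shows "(1 / 2 ^ \<eta>)\<^sup>2 \<le> rate_const * R" and "1 / 2 ^ J \<le> rate_const * R"
    and "\<And>k. k \<in> {1..K} \<Longrightarrow> sqrt (2 ^ (\<eta> * d_pa d E k) / real n) * geo (d k) \<eta> \<le> rate_const * R"
    and "\<And>k. k \<in> {1..K} \<Longrightarrow> sqrt (1 / real n) * geo (d k) J \<le> rate_const * R"
proof -
  define rl rm l where "rl = rate_loc K d E n" and "rm = rate_max K d n" and "l = log_factor K d E n"
  define lg where "lg = max 1 (ln (real n))"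
  define a where "a = 2 / (2 + real (d_loc K d E))"
  define b where "b = 1 / real (d_max K d)"
  have rl: "rl = real n powr (- a)" by (simp add: rl_def rate_loc_def a_def)
  have rm: "rm = real n powr (- b)" by (simp add: rm_def rate_max_def b_def)
  have pos: "0 \<le> rl" "0 \<le> rm" by (auto simp: rl rm)
  have lg1: "1 \<le> lg" by (simp add: lg_def)
  have l1: "1 \<le> l" by (simp add: l_def log_factor_def)
  have R: "R = l * (rl + rm)" by (simp add: R_def l_def rl_def rm_def)
  have le_R: "x * rl + y * rm \<le> (max x y) * R" if "0 \<le> x" "0 \<le> y" for x y
  proof -
    have "x * rl + y * rm \<le> max x y * rl + max x y * rm" using pos by (intro add_mono mult_right_mono) auto
    also have "\<dots> = max x y * (1 * (rl + rm))" by (simp add: algebra_simps)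
    also have "\<dots> \<le> max x y * (l * (rl + rm))" using pos that l1 by (intro mult_left_mono mult_right_mono) auto
    finally show ?thesis by (simp add: R)
  qed
  have R0: "0 \<le> R" using pos l1 by (simp add: R)
  have up: "x \<le> rate_const * R" if "x \<le> y * R" "y \<le> rate_const" for x y
    using that R0 mult_right_mono[of y rate_const R] by linarith
  have inv0: "0 \<le> 1 / \<bar>x\<bar>" for x :: real by simp
  define x1 x2 x3 where "x1 = 1 / \<bar>a - b\<bar>" and "x2 = 1 / \<bar>b - a\<bar>" and "x3 = 1 / \<bar>1 / 2 - b\<bar>"
  have "rate_const = 16 + 12 * (1 + x1) + 12 * (1 + x2) + 3 * (1 + x3)"
    by (simp only: rate_const_def a_def[symmetric] b_def[symmetric] x1_def x2_def x3_def)
  moreover have "0 \<le> x1" "0 \<le> x2" "0 \<le> x3" unfolding x1_def x2_def x3_def by (rule inv0)+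
  ultimately have rc1: "16 \<le> rate_const" and rc2: "12 * (1 + x1) \<le> rate_const"
    and rc3: "12 * (1 + x2) \<le> rate_const" and rc4: "3 * (1 + x3) \<le> rate_const" by simp_all
  note rc2 = rc2[unfolded x1_def] and rc3 = rc3[unfolded x2_def] and rc4 = rc4[unfolded x3_def]
  have \<eta>: "2 ^ (\<eta> * (2 + d_loc K d E)) \<le> real n" "1 / 2 ^ \<eta> \<le> 2 * real n powr (- 1 / real (2 + d_loc K d E))" "real \<eta> \<le> log 2 (real n)"
    using floor_log_bounds[OF n, of "2 + d_loc K d E"] by (simp_all add: \<eta>_def grid_level_def)
  have J: "2 ^ (J * d_max K d) \<le> real n" "1 / 2 ^ J \<le> 2 * real n powr (- 1 / real (d_max K d))" "real J \<le> log 2 (real n)"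
    using floor_log_bounds[OF n, of "d_max K d"] d_max_ge2 by (simp_all add: J_def fine_level_def)
  have h2: "(1 / 2 ^ \<eta>)\<^sup>2 \<le> 4 * rl"
  proof -
    have "(1 / 2 ^ \<eta>)\<^sup>2 \<le> (2 * real n powr (- 1 / real (2 + d_loc K d E)))\<^sup>2" using \<eta>(2) by (intro power_mono) auto
    also have "\<dots> = 4 * rl" by (simp add: rl a_def power2_eq_square flip: powr_add)
    finally show ?thesis .
  qed
  have \<delta>: "1 / 2 ^ J \<le> 2 * rm" using J(2) by (simp add: rm b_def)
  have log3: "real e + 1 \<le> 3 * lg" if "real e \<le> log 2 (real n)" for e
  proof -
    have "(1 / 2 :: real) \<le> ln 2" using ln2_ge_two_thirds by linarith
    then have "ln (real n) / ln 2 \<le> ln (real n) / (1 / 2)" using n by (intro divide_left_mono) auto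
    then have "real e \<le> 2 * ln (real n)" using that by (simp add: log_def)
    moreover have "ln (real n) \<le> lg" by (simp add: lg_def)
    ultimately show ?thesis using lg1 by linarith
  qed
  show "(1 / 2 ^ \<eta>)\<^sup>2 \<le> rate_const * R" using le_R[of 4 0] h2 rc1 by (intro up[of _ 4]) auto
  show "1 / 2 ^ J \<le> rate_const * R" using le_R[of 0 2] \<delta> rc1 by (intro up[of _ 2]) auto
  fix k assume k: "k \<in> {1..K}"
  have dk: "max 2 (d k) + d_pa d E k \<le> d_loc K d E" "max 2 (d k) \<le> d_max K d" "1 \<le> d k"
    using d_le_loc[OF k] d_le_max[OF k] d1 k by auto
  show "sqrt (2 ^ (\<eta> * d_pa d E k) / real n) * geo (d k) \<eta> \<le> rate_const * R"
  proof -
    consider "d k = 1" | "d k = 2" | "3 \<le> d k" using dk(3) by linarith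
    then show ?thesis
    proof cases
      case 1
      \<comment> \<open>Here \<open>max 2 (d k) = 2\<close>, so the choice of \<eta> already makes
        the root at most \<open>h\<^sup>2\<close>, and the chaining sum is bounded by 4.\<close>
      have "sqrt (2 ^ (\<eta> * d_pa d E k) / real n) \<le> 1 / 2 ^ (2 * \<eta>)"
      proof (rule sqrt_pow_le[OF _ \<eta>(1)])
        have "\<eta> * (d_pa d E k + 4) \<le> \<eta> * (2 + d_loc K d E)" using dk by (intro mult_left_mono) auto
        then show "\<eta> * d_pa d E k + 2 * (2 * \<eta>) \<le> \<eta> * (2 + d_loc K d E)" by (simp add: algebra_simps)
      qed
      also have "1 / 2 ^ (2 * \<eta>) = ((1 / 2 ^ \<eta>)\<^sup>2 :: real)" by (simp add: power_mult power_divide mult.commute flip: power_mult)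
      finally have "sqrt (2 ^ (\<eta> * d_pa d E k) / real n) * geo (d k) \<eta> \<le> (1 / 2 ^ \<eta>)\<^sup>2 * 4"
        using geo_1[of \<eta>] 1 by (intro mult_mono) (auto simp: geo_def intro!: sum_nonneg)
      also have "\<dots> \<le> 16 * rl" using h2 by simp
      finally show ?thesis using le_R[of 16 0] rc1 by (intro up[of _ 16]) auto
    next
      case 3
      have "sqrt (2 ^ (\<eta> * d_pa d E k) / real n) * geo (d k) \<eta> \<le> sqrt (2 ^ (\<eta> * d_pa d E k) / real n) * (4 * (sqrt (2 ^ (\<eta> * d k)) / 2 ^ \<eta>))"
        using geo_3[OF 3] by (intro mult_left_mono) auto
      also have "\<dots> = 4 * (sqrt (2 ^ (\<eta> * d_pa d E k + \<eta> * d k) / real n) / 2 ^ \<eta>)"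
        by (simp add: power_add real_sqrt_mult real_sqrt_divide)
      also have "\<dots> \<le> 4 * (1 / 2 ^ \<eta> / 2 ^ \<eta>)"
      proof (intro mult_left_mono divide_right_mono sqrt_pow_le[OF _ \<eta>(1)])
        have "\<eta> * (d_pa d E k + d k + 2) \<le> \<eta> * (2 + d_loc K d E)" using dk by (intro mult_left_mono) auto
        then show "\<eta> * d_pa d E k + \<eta> * d k + 2 * \<eta> \<le> \<eta> * (2 + d_loc K d E)" by (simp add: algebra_simps)
      qed auto
      also have "\<dots> = 4 * (1 / 2 ^ \<eta>)\<^sup>2" by (simp add: power2_eq_square)
      also have "\<dots> \<le> 16 * rl" using h2 by simp
      finally show ?thesis using le_R[of 16 0] rc1 by (intro up[of _ 16]) auto
    next
      case 2
      show ?thesis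
      \<comment> \<open>The chaining sum is now linear in \<eta>. A node that attains
        \<open>d_loc\<close> keeps this as a logarithm; any other node has a dimension to
        spare.\<close>
      proof (cases "d_loc K d E = d k + d_pa d E k")
        case True
        have "sqrt (2 ^ (\<eta> * d_pa d E k) / real n) \<le> 1 / 2 ^ (2 * \<eta>)"
        proof (rule sqrt_pow_le[OF _ \<eta>(1)])
          have "\<eta> * (d_pa d E k + 4) \<le> \<eta> * (2 + d_loc K d E)" using dk by (intro mult_left_mono) auto
          then show "\<eta> * d_pa d E k + 2 * (2 * \<eta>) \<le> \<eta> * (2 + d_loc K d E)" by (simp add: algebra_simps)
        qed
        also have "1 / 2 ^ (2 * \<eta>) = ((1 / 2 ^ \<eta>)\<^sup>2 :: real)" by (simp add: power_mult power_divide mult.commute flip: power_mult)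
        also have "\<dots> \<le> 4 * rl" by (rule h2)
        finally have "sqrt (2 ^ (\<eta> * d_pa d E k) / real n) * geo (d k) \<eta> \<le> (4 * rl) * (3 * lg)"
          unfolding 2 geo_2 using log3[OF \<eta>(3)] pos by (intro mult_mono) auto
        then have le: "sqrt (2 ^ (\<eta> * d_pa d E k) / real n) * geo (d k) \<eta> \<le> 12 * (lg * rl)" by (simp add: mult_ac)
        show ?thesis
        proof (cases "rm \<le> rl")
          case rmrl: True
          have "l = lg" using rmrl True 2 k unfolding l_def log_factor_def rl_def rm_def lg_def by auto
          then have "12 * (lg * rl) \<le> 12 * R" using pos lg1 by (simp add: R algebra_simps)
          then show ?thesis using le rc1 by (intro up[of _ 12]) auto
        next
          case False
          \<comment> \<open>The local rate is now smaller than the other one by a positive power of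
            \<open>n\<close>, and that power absorbs the logarithm.\<close>
          then have "b < a" using n unfolding rl rm by (metis linorder_not_le neg_le_iff_le of_nat_1 of_nat_mono powr_mono)
          then have "lg * rl \<le> (1 + 1 / \<bar>a - b\<bar>) * rm" unfolding rl rm lg_def by (rule log_absorb[OF n])
          then have "12 * (lg * rl) \<le> 12 * ((1 + 1 / \<bar>a - b\<bar>) * rm)" by (rule mult_left_mono) simp
          also have "\<dots> = 12 * (1 + 1 / \<bar>a - b\<bar>) * rm" by (simp only: mult.assoc)
          also have "\<dots> \<le> 12 * (1 + 1 / \<bar>a - b\<bar>) * R" using le_R[of 0 "12 * (1 + 1 / \<bar>a - b\<bar>)"] by simp
          finally show ?thesis using le rc2 by (intro up[of _ "12 * (1 + 1 / \<bar>a - b\<bar>)"]) auto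
        qed
      next
        case False
        then have lt: "3 + d_pa d E k \<le> d_loc K d E" using dk 2 by linarith
        \<comment> \<open>The spare dimension provides a factor
          \<open>2 powr (- \<eta> / 2)\<close>, against which the linear growth is bounded.\<close>
        have sq: "(real e + 1)\<^sup>2 \<le> 9 * 2 ^ e" for e
        proof (induction e)
          case (Suc e)
          show ?case
          proof (cases "e \<le> 2")
            case True
            then have "e = 0 \<or> e = 1 \<or> e = 2" by auto
            then show ?thesis by (auto simp: power2_eq_square)
          next
            case False
            then have "real e \<ge> 3" by simp
            then have "2 * real e + 3 \<le> (real e + 1)\<^sup>2" using mult_mono[of 3 "real e" 3 "real e"] by (simp add: power2_eq_square algebra_simps)
            then have "(real (Suc e) + 1)\<^sup>2 \<le> 2 * (real e + 1)\<^sup>2" by (simp add: power2_eq_square algebra_simps)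
            then show ?thesis using Suc by simp
          qed
        qed simp
        have "real \<eta> + 1 \<le> sqrt (9 * 2 ^ \<eta>)" using sq[of \<eta>] by (intro real_le_rsqrt)
        then have g: "real \<eta> + 1 \<le> 3 * sqrt (2 ^ \<eta>)" by (simp add: real_sqrt_mult)
        have "sqrt (2 ^ (\<eta> * d_pa d E k) / real n) * geo (d k) \<eta> \<le> sqrt (2 ^ (\<eta> * d_pa d E k) / real n) * (3 * sqrt (2 ^ \<eta>))"
          unfolding 2 geo_2 using g by (intro mult_left_mono) auto
        also have "\<dots> = 3 * sqrt (2 ^ (\<eta> * d_pa d E k + \<eta>) / real n)"
          by (simp add: power_add real_sqrt_mult real_sqrt_divide)
        also have "\<dots> \<le> 3 * (1 / 2 ^ (2 * \<eta>))"
        proof (intro mult_left_mono sqrt_pow_le[OF _ \<eta>(1)])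
          have "\<eta> * (d_pa d E k + 1 + 4) \<le> \<eta> * (2 + d_loc K d E)" using lt by (intro mult_left_mono) auto
          then show "\<eta> * d_pa d E k + \<eta> + 2 * (2 * \<eta>) \<le> \<eta> * (2 + d_loc K d E)" by (simp add: algebra_simps)
        qed auto
        also have "1 / 2 ^ (2 * \<eta>) = ((1 / 2 ^ \<eta>)\<^sup>2 :: real)" by (simp add: power_mult power_divide mult.commute flip: power_mult)
        also have "3 * (1 / 2 ^ \<eta>)\<^sup>2 \<le> 12 * rl" using h2 by simp
        finally show ?thesis using le_R[of 12 0] rc1 by (intro up[of _ 12]) auto
      qed
    qed
  qed
  have half: "sqrt (1 / real n) = real n powr (- (1 / 2))"
    using n by (simp add: powr_minus powr_half_sqrt real_sqrt_divide inverse_eq_divide)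
  show "sqrt (1 / real n) * geo (d k) J \<le> rate_const * R"
  proof -
    consider "d k = 1" | "d k = 2" | "3 \<le> d k" using dk(3) by linarith
    then show ?thesis
    proof cases
      case 1
      have "sqrt (1 / real n) \<le> rm" unfolding half rm b_def using n d_max_ge2 by (intro powr_mono) (auto simp: field_simps)
      then have "sqrt (1 / real n) * geo (d k) J \<le> rm * 4"
        using geo_1[of J] 1 pos by (intro mult_mono) (auto simp: geo_def intro!: sum_nonneg)
      then show ?thesis using le_R[of 0 4] rc1 by (intro up[of _ 4]) auto
    next
      case 3
      have "sqrt (1 / real n) * geo (d k) J \<le> sqrt (1 / real n) * (4 * (sqrt (2 ^ (J * d k)) / 2 ^ J))"
        using geo_3[OF 3] by (intro mult_left_mono) auto
      also have "\<dots> = 4 * (sqrt (2 ^ (J * d k) / real n) / 2 ^ J)" by (simp add: real_sqrt_divide)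
      also have "\<dots> \<le> 4 * (1 / 2 ^ 0 / 2 ^ J)"
        using dk by (intro mult_left_mono divide_right_mono sqrt_pow_le[OF _ J(1)]) auto
      also have "\<dots> \<le> 8 * rm" using \<delta> by simp
      finally show ?thesis using le_R[of 0 8] rc1 by (intro up[of _ 8]) auto
    next
      case 2
      have le: "sqrt (1 / real n) * geo (d k) J \<le> 3 * (lg * real n powr (- (1 / 2)))"
        unfolding 2 geo_2 half using mult_left_mono[OF log3[OF J(3)], of "real n powr (- (1 / 2))"] by (simp add: mult_ac)
      show ?thesis
      \<comment> \<open>A block of dimension 2 is critical only if no block is larger. Otherwise
        \<open>rate_max\<close> decays more slowly than \<open>n powr (- (1 / 2))\<close>, and the
        logarithm fits into the gap.\<close>
      proof (cases "d_max K d = 2")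
        case False
        then have "b < 1 / 2" using d_max_ge2 by (simp add: b_def field_simps)
        then have "lg * real n powr (- (1 / 2)) \<le> (1 + 1 / \<bar>1 / 2 - b\<bar>) * rm"
          unfolding rm lg_def by (rule log_absorb[OF n])
        then have "3 * (lg * real n powr (- (1 / 2))) \<le> 3 * ((1 + 1 / \<bar>1 / 2 - b\<bar>) * rm)" by (rule mult_left_mono) simp
        also have "\<dots> = 3 * (1 + 1 / \<bar>1 / 2 - b\<bar>) * rm" by (simp only: mult.assoc)
        also have "\<dots> \<le> 3 * (1 + 1 / \<bar>1 / 2 - b\<bar>) * R" using le_R[of 0 "3 * (1 + 1 / \<bar>1 / 2 - b\<bar>)"] by simp
        finally show ?thesis using le rc4 by (intro up[of _ "3 * (1 + 1 / \<bar>1 / 2 - b\<bar>)"]) auto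
      next
        case True
        then have b2: "b = 1 / 2" by (simp add: b_def)
        have le': "sqrt (1 / real n) * geo (d k) J \<le> 3 * (lg * rm)" using le by (simp add: rm b2)
        show ?thesis
        proof (cases "rl \<le> rm")
          case rlrm: True
          have "(MAX k\<in>{1..K}. d k) = 2"
          proof (rule antisym)
            show "(MAX k\<in>{1..K}. d k) \<le> 2"
              using order_trans[OF max.cobounded2 d_le_max] True K by (intro Max.boundedI) auto
            show "2 \<le> (MAX k\<in>{1..K}. d k)" using k 2 by (metis Max_ge finite_atLeastAtMost finite_imageI imageI)
          qed
          then have "l = lg" using rlrm unfolding l_def log_factor_def rl_def rm_def lg_def by auto
          then have "3 * (lg * rm) \<le> 3 * R" using pos lg1 by (simp add: R algebra_simps)
          then show ?thesis using le' rc1 by (intro up[of _ 3]) auto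
        next
          case False
          then have "a < b" using n unfolding rl rm by (metis linorder_not_le neg_le_iff_le of_nat_1 of_nat_mono powr_mono)
          then have "lg * rm \<le> (1 + 1 / \<bar>b - a\<bar>) * rl" unfolding rl rm lg_def by (rule log_absorb[OF n])
          then have "3 * (lg * rm) \<le> 3 * ((1 + 1 / \<bar>b - a\<bar>) * rl)" by (rule mult_left_mono) simp
          also have "\<dots> = 3 * (1 + 1 / \<bar>b - a\<bar>) * rl" by (simp only: mult.assoc)
          also have "\<dots> \<le> 12 * (1 + 1 / \<bar>b - a\<bar>) * rl" using pos by (intro mult_right_mono) auto
          also have "\<dots> \<le> 12 * (1 + 1 / \<bar>b - a\<bar>) * R" using le_R[of "12 * (1 + 1 / \<bar>b - a\<bar>)" 0] by simp
          finally show ?thesis using le' rc3 by (intro up[of _ "12 * (1 + 1 / \<bar>b - a\<bar>)"]) auto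
        qed
      qed
    qed
  qed
qed

end

section \<open>Discretisation of the cube\<close>

lemma grid_index_less: "grid_index \<eta> t < 2 ^ \<eta>"
  unfolding grid_index_def by (simp add: min_less_iff_disj)

text \<open>Dyadic nesting of the cells. Besides floor arithmetic it rests on the compatibility of
  the truncations at the right end point, \<open>(P * M - 1) div M = P - 1\<close>. It is proved for
  every real \<open>t\<close> because it will be applied to arbitrary functions, whose coordinates
  may be \<open>undefined\<close>.\<close>

lemma grid_index_div:
  assumes "\<eta> \<le> J" shows "grid_index J t div 2 ^ (J - \<eta>) = grid_index \<eta> t"
proof -
  define a b M P where "a = nat \<lfloor>2 ^ J * t\<rfloor>" and "b = nat \<lfloor>2 ^ \<eta> * t\<rfloor>"
    and "M = (2::nat) ^ (J - \<eta>)" and "P = (2::nat) ^ \<eta>"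
  have J: "(2::nat) ^ J = P * M" "(2::real) ^ J = 2 ^ \<eta> * real M" using assms by (simp_all add: M_def P_def flip: power_add)
  have M: "M > 0" and P: "P > 0" by (simp_all add: M_def P_def)
  have div: "a div M = b"
  proof (cases "0 \<le> t")
    case True
    have "\<lfloor>2 ^ J * t\<rfloor> div int M = \<lfloor>2 ^ J * t / of_int (int M)\<rfloor>"
      using M by (intro floor_divide_real_eq_div[symmetric]) simp
    also have "2 ^ J * t / of_int (int M) = 2 ^ \<eta> * t"
      using M by (simp add: J)
    finally have "\<lfloor>2 ^ J * t\<rfloor> div int M = \<lfloor>2 ^ \<eta> * t\<rfloor>" .
    moreover have "nat (\<lfloor>2 ^ J * t\<rfloor> div int M) = nat \<lfloor>2 ^ J * t\<rfloor> div nat (int M)"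
      using True by (intro nat_div_distrib) auto
    ultimately show ?thesis by (simp add: a_def b_def)
  next
    case False
    then have "2 ^ J * t < 0" "2 ^ \<eta> * t < 0" by (simp_all add: mult_less_0_iff)
    then have "\<lfloor>2 ^ J * t\<rfloor> \<le> 0" "\<lfloor>2 ^ \<eta> * t\<rfloor> \<le> 0" by linarith+
    then show ?thesis by (simp add: a_def b_def)
  qed
  have "min a (P * M - 1) div M = min b (P - 1)"
  proof (cases "a < P * M")
    case True
    then have "b < P" using div M by (metis div_less_iff_less_mult)
    then have "min b (P - 1) = b" by simp
    moreover have "min a (P * M - 1) = a" using True by simp
    ultimately show ?thesis using div by simp
  next
    case False
    then have "P \<le> b" using div M by (metis div_less_iff_less_mult not_le)
    moreover have "(P * M - 1) div M = P - 1"
    proof -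
      obtain r where r: "P = Suc r" using P gr0_implies_Suc by blast
      have "P * M - 1 = r * M + (M - 1)" using M by (simp add: r)
      then have "(P * M - 1) div M = (r * M + (M - 1)) div M" by (simp only:)
      also have "\<dots> = r + (M - 1) div M" using M by (intro div_mult_self3) simp
      finally show ?thesis using M by (simp add: r)
    qed
    ultimately show ?thesis using False by simp
  qed
  then show ?thesis by (simp only: grid_index_def a_def b_def P_def[symmetric] M_def[symmetric] J)
qed

lemma grid_index_bounds:
  assumes "0 \<le> t" "t \<le> 1"
  shows "real (grid_index J t) / 2 ^ J \<le> t" "t \<le> (real (grid_index J t) + 1) / 2 ^ J"
proof -
  have f: "real (nat \<lfloor>2 ^ J * t\<rfloor>) \<le> 2 ^ J * t" "2 ^ J * t < real (nat \<lfloor>2 ^ J * t\<rfloor>) + 1"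
    using assms by (auto simp: of_nat_nat)
  have "real (grid_index J t) \<le> 2 ^ J * t" unfolding grid_index_def using f(1) by (simp add: of_nat_min min_le_iff_disj)
  then show "real (grid_index J t) / 2 ^ J \<le> t" by (simp add: field_simps)
  have "2 ^ J * t \<le> real (grid_index J t) + 1"
  proof (cases "nat \<lfloor>2 ^ J * t\<rfloor> \<le> 2 ^ J - 1")
    case True
    then show ?thesis using f(2) by (simp add: grid_index_def)
  next
    case False
    then have "real (grid_index J t) + 1 = 2 ^ J" by (simp add: grid_index_def of_nat_diff)
    then show ?thesis using assms by simp
  qed
  then show "t \<le> (real (grid_index J t) + 1) / 2 ^ J" by (simp add: field_simps)
qed

lemma measurable_grid_index [measurable]: "grid_index J \<in> borel \<rightarrow>\<^sub>M count_space UNIV"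
  unfolding grid_index_def[abs_def] by measurable

lemma space_cube: "space (cube_space d S) = PiE (coords d S) (\<lambda>_. {0..1})"
  by (simp add: cube_space_def space_PiM space_restrict_space)

lemma measurable_proj [measurable]: "S \<subseteq> S' \<Longrightarrow> proj d S \<in> cube_space d S' \<rightarrow>\<^sub>M cube_space d S"
proof -
  assume "S \<subseteq> S'"
  then have "coords d S \<subseteq> coords d S'" by (auto simp: coords_def)
  then show ?thesis unfolding proj_def[abs_def] cube_space_def by (rule measurable_restrict_subset)
qed

lemma measurable_coord:
  "(\<lambda>x. x i) \<in> cube_space d S \<rightarrow>\<^sub>M borel"
proof (cases "i \<in> coords d S")
  case True
  have "(\<lambda>x. x i) \<in> cube_space d S \<rightarrow>\<^sub>M restrict_space borel {0..1}"
    unfolding cube_space_def using True by (rule measurable_component_singleton)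
  then show ?thesis by (simp add: measurable_restrict_space2_iff)
next
  case False
  then have "x i = undefined" if "x \<in> space (cube_space d S)" for x
    using that by (cases i) (auto simp: space_cube PiE_def extensional_def)
  then show ?thesis by (subst measurable_cong[where g="\<lambda>_. undefined"]) auto
qed

locale grid =
  fixes K :: nat and d :: "nat \<Rightarrow> nat" and G :: "(nat \<times> nat) set" and J \<eta> :: nat
  assumes dag: "sorted_dag K G" and fc: "\<And>k. k \<in> {1..K} \<Longrightarrow> fully_connected G (pa G k)"
    and level_le: "\<eta> \<le> J"
begin

definition B :: "nat \<Rightarrow> (nat \<Rightarrow> nat) set" where "B k = PiE {..<d k} (\<lambda>_. {..<2 ^ J})"
definition lev :: "nat \<Rightarrow> nat \<Rightarrow> (nat \<Rightarrow> nat) \<Rightarrow> nat \<Rightarrow> nat" where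
  "lev k j q = (\<lambda>i\<in>{..<d k}. q i div 2 ^ (J - j))"
text \<open>An l1 distance, since it bounds the sup-norm and adds up over blocks and coordinates.
  Two indices in one level-\<open>j\<close> cell can then be \<open>d k / 2 ^ j\<close> apart, which
  the constant \<open>m\<close> accommodates.\<close>

definition bd :: "nat \<Rightarrow> (nat \<Rightarrow> nat) \<Rightarrow> (nat \<Rightarrow> nat) \<Rightarrow> real" where
  "bd k q q' = (\<Sum>i<d k. \<bar>real (q i) - real (q' i)\<bar> / 2 ^ J)"
definition m :: real where "m = 1 + (\<Sum>k\<in>{1..K}. real (d k))"

lemma lev_eq: "lev k j q = lev k j q' \<longleftrightarrow> (\<forall>i<d k. q i div 2 ^ (J - j) = q' i div 2 ^ (J - j))"
  unfolding lev_def by (auto simp: restrict_def fun_eq_iff)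

lemma pa_sub: "pa G k \<subseteq> {1..<k}" using dag unfolding sorted_dag_def pa_def by auto

sublocale blocks K B lev bd J \<eta> m "pa G"
proof
  fix k assume k: "k \<in> {1..K}"
  show "finite (B k)" "B k \<noteq> {}" by (auto simp: B_def PiE_eq_empty_iff lessThan_empty_iff intro!: finite_PiE)
  show "pa G k \<subseteq> {1..<k}" by (rule pa_sub)
  assume ne: "pa G k \<noteq> {}"
  have "finite (pa G k)" using pa_sub[of k] finite_subset by blast
  then have Max: "Max (pa G k) \<in> pa G k" "\<And>i. i \<in> pa G k \<Longrightarrow> i \<le> Max (pa G k)" using ne by auto
  show "pa G k \<subseteq> insert (Max (pa G k)) (pa G (Max (pa G k)))"
  proof
    fix i assume i: "i \<in> pa G k"
    show "i \<in> insert (Max (pa G k)) (pa G (Max (pa G k)))"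
    proof (cases "i = Max (pa G k)")
      case False
      then have "i < Max (pa G k)" using Max(2)[OF i] by simp
      then have "(i, Max (pa G k)) \<in> G"
        using fc[OF k] i Max(1) unfolding fully_connected_def by blast
      then show ?thesis by (simp add: pa_def)
    qed simp
  qed
next
  fix k q q' assume k: "k \<in> {1..K}" and q: "q \<in> B k" "q' \<in> B k"
  show "lev k 0 q = lev k 0 q'" unfolding lev_eq using q by (auto simp: B_def PiE_iff)
  show "q = q'" if "lev k J q = lev k J q'"
  proof -
    have "\<forall>i<d k. q i = q' i" using that by (simp add: lev_eq)
    then show ?thesis using q unfolding B_def by (intro PiE_ext[of q _ _ q']) auto
  qed
  fix j assume j: "j \<le> J" "lev k j q = lev k j q'"
  have "\<bar>real (q i) - real (q' i)\<bar> / 2 ^ J \<le> 1 / 2 ^ j" if i: "i < d k" for i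
  proof -
    have "q i div 2 ^ (J - j) = q' i div 2 ^ (J - j)" using j(2) i unfolding lev_eq by auto
    then have "q i = 2 ^ (J - j) * (q i div 2 ^ (J - j)) + q i mod 2 ^ (J - j)"
      "q' i = 2 ^ (J - j) * (q i div 2 ^ (J - j)) + q' i mod 2 ^ (J - j)" by (metis mult_div_mod_eq)+
    moreover have "q i mod 2 ^ (J - j) < 2 ^ (J - j)" "q' i mod 2 ^ (J - j) < 2 ^ (J - j)" by auto
    ultimately have "q i < q' i + 2 ^ (J - j)" "q' i < q i + 2 ^ (J - j)" by linarith+
    then have "real (q i) < real (q' i + 2 ^ (J - j))" "real (q' i) < real (q i + 2 ^ (J - j))"
      by (simp_all only: of_nat_less_iff)
    then have "\<bar>real (q i) - real (q' i)\<bar> \<le> 2 ^ (J - j)" by (simp add: abs_le_iff)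
    also have "\<dots> = 2 ^ J / 2 ^ j" using j(1) by (simp add: power_diff)
    finally show ?thesis by (simp add: field_simps)
  qed
  then have "bd k q q' \<le> (\<Sum>i<d k. 1 / 2 ^ j)" unfolding bd_def by (intro sum_mono) auto
  also have "\<dots> = real (d k) / 2 ^ j" by simp
  also have "real (d k) / 2 ^ j \<le> m / 2 ^ j"
    unfolding m_def using member_le_sum[OF k, of "\<lambda>k. real (d k)"] by (intro divide_right_mono) auto
  finally show "bd k q q' \<le> m / 2 ^ j" .
next
  fix k q q' j i assume ij: "j \<le> i" "i \<le> J" and eq: "lev k i q = lev k i q'"
  have "(2::nat) ^ (J - j) = 2 ^ (J - i) * 2 ^ (i - j)" using ij by (simp flip: power_add)
  then show "lev k j q = lev k j q'" using eq unfolding lev_eq by (simp add: div_mult2_eq)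
next
  show "\<eta> \<le> J" by (rule level_le)
  show "1 \<le> m" by (simp add: m_def sum_nonneg)
  show "0 \<le> bd k q q'" "bd k q q = 0" for k q q' by (auto simp: bd_def intro!: sum_nonneg)
qed

definition Zb :: "nat \<Rightarrow> point \<Rightarrow> nat \<Rightarrow> nat" where "Zb k x = (\<lambda>i\<in>{..<d k}. grid_index J (x (k, i)))"
text \<open>The truncation in \<open>grid_index\<close> makes this total: every function is sent
  into \<open>X\<close>, even with \<open>undefined\<close> coordinates. One map therefore serves
  all the spaces \<open>cube_space d S\<close> during the successive draws.\<close>

definition Z :: "point \<Rightarrow> nat \<Rightarrow> nat \<Rightarrow> nat" where "Z x = (\<lambda>k\<in>{1..K}. Zb k x)"

lemma Zb_B: "Zb k x \<in> B k" by (auto simp: Zb_def B_def grid_index_less)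
lemma Z_X: "Z x \<in> X" by (auto simp: Z_def X_def Zb_B)

lemma measurable_Zb: "Zb k \<in> cube_space d S \<rightarrow>\<^sub>M count_space (B k)"
proof (rule measurable_count_space_eq2[THEN iffD2])
  show "finite (B k)" by (auto simp: B_def intro!: finite_PiE)
  have "Zb k -` {q} \<inter> space (cube_space d S) \<in> sets (cube_space d S)" if q: "q \<in> B k" for q
  proof -
    have "Zb k -` {q} \<inter> space (cube_space d S) = {x \<in> space (cube_space d S). \<forall>i\<in>{..<d k}. grid_index J (x (k, i)) = q i}"
      using q by (auto simp: Zb_def B_def PiE_iff extensional_def fun_eq_iff)
    also have "\<dots> \<in> sets (cube_space d S)"
    proof (intro sets.sets_Collect_finite_All)
      fix i
      have "(\<lambda>x. grid_index J (x (k, i))) \<in> cube_space d S \<rightarrow>\<^sub>M count_space UNIV"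
        by (rule measurable_compose[OF measurable_coord measurable_grid_index])
      then show "{x \<in> space (cube_space d S). grid_index J (x (k, i)) = q i} \<in> sets (cube_space d S)"
        by (rule measurable_fibre)
    qed simp
    finally show ?thesis .
  qed
  then show "Zb k \<in> space (cube_space d S) \<rightarrow> B k \<and> (\<forall>q\<in>B k. Zb k -` {q} \<inter> space (cube_space d S) \<in> sets (cube_space d S))"
    using Zb_B by auto
qed

lemma measurable_Z: "Z \<in> cube_space d S \<rightarrow>\<^sub>M count_space X"
proof (rule measurable_count_space_eq2[THEN iffD2])
  show "finite X" by simp
  have "Z -` {z} \<inter> space (cube_space d S) \<in> sets (cube_space d S)" if z: "z \<in> X" for z
  proof -
    have "Z -` {z} \<inter> space (cube_space d S) = {x \<in> space (cube_space d S). \<forall>k\<in>{1..K}. Zb k x = z k}"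
      using z by (auto simp: Z_def X_def PiE_iff extensional_def fun_eq_iff)
    also have "\<dots> \<in> sets (cube_space d S)"
      by (intro sets.sets_Collect_finite_All) (auto simp: measurable_fibre[OF measurable_Zb])
    finally show ?thesis .
  qed
  then show "Z \<in> space (cube_space d S) \<rightarrow> X \<and> (\<forall>z\<in>X. Z -` {z} \<inter> space (cube_space d S) \<in> sets (cube_space d S))"
    using Z_X by auto
qed

definition law :: "point measure \<Rightarrow> (nat \<Rightarrow> nat \<Rightarrow> nat) \<Rightarrow> real" where
  "law \<mu> z = measure \<mu> {x \<in> space \<mu>. Z x = z}"

lemma law_integral:
  assumes "prob_space \<mu>" and Z: "Z \<in> \<mu> \<rightarrow>\<^sub>M count_space X"
  shows "integrable \<mu> (\<lambda>x. F (Z x))" and "E (law \<mu>) F = (\<integral>x. F (Z x) \<partial>\<mu>)"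
  using integral_finite_range[OF assms(1) finite_X Z, of F] by (simp_all add: E_def law_def)

lemma pmass_law:
  assumes "prob_space \<mu>" and Z: "Z \<in> \<mu> \<rightarrow>\<^sub>M count_space X"
  shows "pmass (law \<mu>)"
proof -
  interpret prob_space \<mu> by fact
  have "sum (law \<mu>) X = 1" using law_integral(2)[OF assms, of "\<lambda>_. 1"] by (simp add: E_def prob_space)
  then show ?thesis by (simp add: pmass_def law_def)
qed

lemma Pr_law:
  assumes "prob_space \<mu>" and Z: "Z \<in> \<mu> \<rightarrow>\<^sub>M count_space X"
  shows "{x \<in> space \<mu>. R (Z x)} \<in> sets \<mu>" and "Pr (law \<mu>) R = measure \<mu> {x \<in> space \<mu>. R (Z x)}"
proof -
  interpret prob_space \<mu> by fact
  have "{x \<in> space \<mu>. R (Z x)} = Z -` {z \<in> X. R z} \<inter> space \<mu>" using Z_X by auto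
  then show *: "{x \<in> space \<mu>. R (Z x)} \<in> sets \<mu>" using measurable_sets[OF Z, of "{z \<in> X. R z}"] by (simp only:) simp
  have "Pr (law \<mu>) R = (\<integral>x. indicator {x \<in> space \<mu>. R (Z x)} x \<partial>\<mu>)"
    unfolding Pr_E law_integral(2)[OF assms] by (intro Bochner_Integration.integral_cong) (auto simp: indicator_def)
  then show "Pr (law \<mu>) R = measure \<mu> {x \<in> space \<mu>. R (Z x)}" using * by simp
qed

end

section \<open>Kernel products\<close>

lemma proj_proj: "S \<subseteq> S' \<Longrightarrow> proj d S (proj d S' x) = proj d S x"
  by (auto simp: proj_def coords_def restrict_def fun_eq_iff)

lemma proj_space: "x \<in> space (cube_space d S) \<Longrightarrow> proj d S x = x"
  unfolding proj_def space_cube by (rule PiE_restrict)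

lemma coords_Un: "coords d (S \<union> S') = coords d S \<union> coords d S'" by (auto simp: coords_def)

lemma space_cube_empty: "space (cube_space d {}) = {\<lambda>_. undefined}"
  by (simp add: space_cube coords_def)

definition kstep :: "(nat \<Rightarrow> nat) \<Rightarrow> (nat \<times> nat) set \<Rightarrow> (nat \<Rightarrow> point \<Rightarrow> point measure) \<Rightarrow> nat \<Rightarrow> point \<Rightarrow> point measure" where
  "kstep d E \<kappa> m x = distr (\<kappa> (Suc m) (proj d (pa E (Suc m)) x)) (cube_space d {1..Suc m})
     (\<lambda>y. merge (coords d {1..m}) (coords d {Suc m}) (x, y))"

lemma atLeastAtMostSuc: "{1..Suc m} = {1..m} \<union> {Suc m}" by auto

lemma measurable_merge_cube:
  "(\<lambda>(x, y). merge (coords d {1..m}) (coords d {Suc m}) (x, y)) \<in>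
    cube_space d {1..m} \<Otimes>\<^sub>M cube_space d {Suc m} \<rightarrow>\<^sub>M cube_space d {1..Suc m}"
  using measurable_merge[of "coords d {1..m}" "coords d {Suc m}" "\<lambda>_. restrict_space borel {0..1}"]
  unfolding cube_space_def atLeastAtMostSuc coords_Un by simp

locale kernels =
  fixes K :: nat and d :: "nat \<Rightarrow> nat" and E :: "(nat \<times> nat) set" and \<kappa> :: "nat \<Rightarrow> point \<Rightarrow> point measure"
  assumes pa_less: "\<And>k. pa E k \<subseteq> {1..<k}"
    and \<kappa>_meas: "\<And>k. k \<in> {1..K} \<Longrightarrow> \<kappa> k \<in> cube_space d (pa E k) \<rightarrow>\<^sub>M prob_algebra (cube_space d {k})"
begin

lemma pa_le: "pa E (Suc m) \<subseteq> {1..m}" using pa_less[of "Suc m"] by auto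

lemma \<kappa>_proj_meas:
  "Suc m \<le> K \<Longrightarrow> (\<lambda>x. \<kappa> (Suc m) (proj d (pa E (Suc m)) x)) \<in> cube_space d {1..m} \<rightarrow>\<^sub>M prob_algebra (cube_space d {Suc m})"
  by (rule measurable_compose[OF measurable_proj[OF pa_le] \<kappa>_meas]) auto

lemma kstep_meas:
  "Suc m \<le> K \<Longrightarrow> kstep d E \<kappa> m \<in> cube_space d {1..m} \<rightarrow>\<^sub>M prob_algebra (cube_space d {1..Suc m})"
  unfolding kstep_def[abs_def]
  by (rule measurable_distr_prob_space2[OF \<kappa>_proj_meas measurable_merge_cube])

lemma kernel_product_Suc: "kernel_product d E \<kappa> (Suc m) = kernel_product d E \<kappa> m \<bind> kstep d E \<kappa> m"
  by (simp add: kstep_def[abs_def])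

lemma kernel_product_space: "m \<le> K \<Longrightarrow> kernel_product d E \<kappa> m \<in> space (prob_algebra (cube_space d {1..m}))"
proof (induction m)
  case 0
  then show ?case using prob_space_return[of "\<lambda>_. undefined" "cube_space d {}"]
    by (simp add: space_prob_algebra space_cube_empty)
next
  case (Suc m)
  then have P: "kernel_product d E \<kappa> m \<in> space (prob_algebra (cube_space d {1..m}))" by simp
  show ?case unfolding kernel_product_Suc
    using prob_space_bind'[OF P kstep_meas[OF Suc.prems]] sets_bind'[OF P kstep_meas[OF Suc.prems]]
    by (simp add: space_prob_algebra)
qed

lemma kp_prob: "m \<le> K \<Longrightarrow> prob_space (kernel_product d E \<kappa> m)"
  and kp_sets: "m \<le> K \<Longrightarrow> sets (kernel_product d E \<kappa> m) = sets (cube_space d {1..m})"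
  using kernel_product_space by (auto simp: space_prob_algebra)

lemma kp_measI: "m \<le> K \<Longrightarrow> f \<in> cube_space d {1..m} \<rightarrow>\<^sub>M M \<Longrightarrow> f \<in> kernel_product d E \<kappa> m \<rightarrow>\<^sub>M M"
  using measurable_cong_sets[OF kp_sets refl] by blast

lemma \<kappa>_at:
  assumes "Suc m \<le> K" "x \<in> space (cube_space d {1..m})"
  shows "prob_space (\<kappa> (Suc m) (proj d (pa E (Suc m)) x))"
    and "sets (\<kappa> (Suc m) (proj d (pa E (Suc m)) x)) = sets (cube_space d {Suc m})"
  using measurable_space[OF \<kappa>_proj_meas[OF assms(1)] assms(2)] by (auto simp: space_prob_algebra)

lemma merge_meas:
  assumes "Suc m \<le> K" "x \<in> space (cube_space d {1..m})"
  shows "(\<lambda>y. merge (coords d {1..m}) (coords d {Suc m}) (x, y)) \<in> \<kappa> (Suc m) (proj d (pa E (Suc m)) x) \<rightarrow>\<^sub>M cube_space d {1..Suc m}"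
proof -
  have "(\<lambda>y. (x, y)) \<in> cube_space d {Suc m} \<rightarrow>\<^sub>M cube_space d {1..m} \<Otimes>\<^sub>M cube_space d {Suc m}"
    using assms(2) by (rule measurable_Pair1')
  from measurable_compose[OF this measurable_merge_cube] show ?thesis
    unfolding measurable_cong_sets[OF \<kappa>_at(2)[OF assms] refl] by simp
qed

lemma proj_merge:
  assumes "x \<in> space (cube_space d {1..m})"
  shows "proj d {1..m} (merge (coords d {1..m}) (coords d {Suc m}) (x, y)) = x"
proof
  fix i
  show "proj d {1..m} (merge (coords d {1..m}) (coords d {Suc m}) (x, y)) i = x i"
    using PiE_arb[OF assms[unfolded space_cube], of i]
    by (cases "i \<in> coords d {1..m}") (simp_all add: proj_def merge_def)
qed

lemma proj_merge':
  assumes "y \<in> space (cube_space d {Suc m})"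
  shows "proj d {Suc m} (merge (coords d {1..m}) (coords d {Suc m}) (x, y)) = y"
proof
  fix i
  have "i \<in> coords d {Suc m} \<Longrightarrow> i \<notin> coords d {1..m}" by (auto simp: coords_def)
  moreover have "i \<notin> coords d {Suc m} \<Longrightarrow> y i = undefined"
    by (rule PiE_arb[OF assms[unfolded space_cube]])
  ultimately show "proj d {Suc m} (merge (coords d {1..m}) (coords d {Suc m}) (x, y)) i = y i"
    unfolding proj_def merge_def restrict_def by auto
qed

lemma marginal_Suc:
  assumes m: "Suc m \<le> K"
  shows "distr (kernel_product d E \<kappa> (Suc m)) (cube_space d {1..m}) (proj d {1..m}) = kernel_product d E \<kappa> m"
proof -
  let ?P = "kernel_product d E \<kappa> m"
  have sp: "space ?P = space (cube_space d {1..m})" by (rule sets_eq_imp_space_eq[OF kp_sets]) (use m in simp)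
  have pr: "proj d {1..m} \<in> cube_space d {1..Suc m} \<rightarrow>\<^sub>M cube_space d {1..m}" by (rule measurable_proj) auto
  have "distr (?P \<bind> kstep d E \<kappa> m) (cube_space d {1..m}) (proj d {1..m}) =
      ?P \<bind> (\<lambda>x. distr (kstep d E \<kappa> m x) (cube_space d {1..m}) (proj d {1..m}))"
  proof (rule distr_bind[OF _ _ pr])
    show "kstep d E \<kappa> m \<in> ?P \<rightarrow>\<^sub>M subprob_algebra (cube_space d {1..Suc m})"
      using m by (intro kp_measI measurable_prob_algebraD kstep_meas) auto
    show "space ?P \<noteq> {}" using m by (intro prob_space.not_empty kp_prob) simp
  qed
  also have "\<dots> = ?P \<bind> return (cube_space d {1..m})"
  proof (rule bind_cong[OF refl])
    fix x assume "x \<in> space ?P"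
    then have x: "x \<in> space (cube_space d {1..m})" by (simp add: sp)
    interpret prob_space "\<kappa> (Suc m) (proj d (pa E (Suc m)) x)" by (rule \<kappa>_at[OF m x])
    show "distr (kstep d E \<kappa> m x) (cube_space d {1..m}) (proj d {1..m}) = return (cube_space d {1..m}) x"
      unfolding kstep_def using x
      by (subst distr_distr[OF pr merge_meas[OF m x]]) (simp only: comp_def proj_merge[OF x] distr_const[OF x])
  qed
  also have "\<dots> = ?P" using m by (intro bind_return'' kp_sets) simp
  finally show ?thesis by (simp only: kernel_product_Suc)
qed

lemma marginal_le:
  assumes "m \<le> n" "n \<le> K"
  shows "distr (kernel_product d E \<kappa> n) (cube_space d {1..m}) (proj d {1..m}) = kernel_product d E \<kappa> m"
  using assms
proof (induction n rule: dec_induct)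
  case base
  have "distr (kernel_product d E \<kappa> m) (cube_space d {1..m}) (proj d {1..m}) =
      distr (kernel_product d E \<kappa> m) (kernel_product d E \<kappa> m) (\<lambda>x. x)"
    using kp_sets[OF base] sets_eq_imp_space_eq[OF kp_sets[OF base]]
    by (intro distr_cong) (auto simp: proj_space)
  then show ?case by (simp add: distr_id2)
next
  case (step n)
  have "distr (kernel_product d E \<kappa> n) (cube_space d {1..m}) (proj d {1..m}) =
     distr (distr (kernel_product d E \<kappa> (Suc n)) (cube_space d {1..n}) (proj d {1..n})) (cube_space d {1..m}) (proj d {1..m})"
    using marginal_Suc[of n] step by simp
  also have "\<dots> = distr (kernel_product d E \<kappa> (Suc n)) (cube_space d {1..m}) (proj d {1..m} \<circ> proj d {1..n})"
    using step by (intro distr_distr kp_measI measurable_proj) auto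
  also have "proj d {1..m} \<circ> proj d {1..n} = proj d {1..m}" using step by (auto simp: proj_proj fun_eq_iff)
  finally show ?case using step by simp
qed

text \<open>By \<open>marginal_le\<close> the event may be evaluated right after block
  \<open>Suc m\<close> has been drawn, and that draw is from the kernel at the parents, whatever the
  rest of the past.\<close>

lemma reg_cond_past:
  assumes k: "Suc m \<le> K" and A: "A \<in> sets (cube_space d {1..m})" and B: "B \<in> sets (cube_space d {Suc m})"
  defines "\<mu> \<equiv> kernel_product d E \<kappa> K"
  shows "emeasure \<mu> {x \<in> space \<mu>. proj d {1..m} x \<in> A \<and> proj d {Suc m} x \<in> B} =
    (\<integral>\<^sup>+x. indicator A (proj d {1..m} x) * emeasure (\<kappa> (Suc m) (proj d (pa E (Suc m)) x)) B \<partial>\<mu>)"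
proof -
  let ?P = "kernel_product d E \<kappa>"
  define S where "S = {x \<in> space (cube_space d {1..Suc m}). proj d {1..m} x \<in> A \<and> proj d {Suc m} x \<in> B}"
  have sp: "space (?P n) = space (cube_space d {1..n})" if "n \<le> K" for n
    by (rule sets_eq_imp_space_eq[OF kp_sets[OF that]])
  have pr: "proj d {1..m} \<in> cube_space d {1..Suc m} \<rightarrow>\<^sub>M cube_space d {1..m}"
    "proj d {Suc m} \<in> cube_space d {1..Suc m} \<rightarrow>\<^sub>M cube_space d {Suc m}" by (rule measurable_proj; auto)+
  have prK: "proj d {1..n} \<in> \<mu> \<rightarrow>\<^sub>M cube_space d {1..n}" if "n \<le> K" for n
    unfolding \<mu>_def using that by (intro kp_measI measurable_proj) auto
  have S: "S \<in> sets (cube_space d {1..Suc m})"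
  proof -
    have "S = (proj d {1..m} -` A \<inter> space (cube_space d {1..Suc m})) \<inter> (proj d {Suc m} -` B \<inter> space (cube_space d {1..Suc m}))"
      by (auto simp: S_def)
    then show ?thesis using measurable_sets[OF pr(1) A] measurable_sets[OF pr(2) B] by simp
  qed
  have "{x \<in> space \<mu>. proj d {1..m} x \<in> A \<and> proj d {Suc m} x \<in> B} = proj d {1..Suc m} -` S \<inter> space \<mu>"
    using measurable_space[OF prK[OF k]] by (auto simp: S_def proj_proj)
  then have "emeasure \<mu> {x \<in> space \<mu>. proj d {1..m} x \<in> A \<and> proj d {Suc m} x \<in> B} = emeasure (distr \<mu> (cube_space d {1..Suc m}) (proj d {1..Suc m})) S"
    by (simp only: emeasure_distr[OF prK[OF k] S])
  also have "\<dots> = emeasure (?P m \<bind> kstep d E \<kappa> m) S"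
    unfolding \<mu>_def using marginal_le[OF k order_refl] by (simp only: kernel_product_Suc)
  also have "\<dots> = (\<integral>\<^sup>+x. emeasure (kstep d E \<kappa> m x) S \<partial>?P m)"
    using k kernel_product_space[of m] by (intro emeasure_bind_prob_algebra[OF _ kstep_meas S]) auto
  also have "\<dots> = (\<integral>\<^sup>+x. indicator A x * emeasure (\<kappa> (Suc m) (proj d (pa E (Suc m)) x)) B \<partial>?P m)"
  proof (rule nn_integral_cong)
    fix x assume "x \<in> space (?P m)"
    then have x: "x \<in> space (cube_space d {1..m})" using sp k by simp
    let ?\<kappa> = "\<kappa> (Suc m) (proj d (pa E (Suc m)) x)"
    let ?mg = "\<lambda>y. merge (coords d {1..m}) (coords d {Suc m}) (x, y)"
    have sk: "space ?\<kappa> = space (cube_space d {Suc m})" by (rule sets_eq_imp_space_eq[OF \<kappa>_at(2)[OF k x]])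
    have "?mg -` S \<inter> space ?\<kappa> = (if x \<in> A then B else {})"
      using measurable_space[OF merge_meas[OF k x]] sk proj_merge[OF x] proj_merge' sets.sets_into_space[OF B]
      by (auto simp: S_def)
    then show "emeasure (kstep d E \<kappa> m x) S = indicator A x * emeasure ?\<kappa> B"
      unfolding kstep_def using emeasure_distr[OF merge_meas[OF k x] S] by (simp add: indicator_def)
  qed
  also have "\<dots> = (\<integral>\<^sup>+x. indicator A x * emeasure (\<kappa> (Suc m) (proj d (pa E (Suc m)) x)) B \<partial>distr \<mu> (cube_space d {1..m}) (proj d {1..m}))"
    unfolding \<mu>_def using marginal_le[of m K] k by simp
  also have "\<dots> = (\<integral>\<^sup>+x. indicator A (proj d {1..m} x) * emeasure (\<kappa> (Suc m) (proj d (pa E (Suc m)) (proj d {1..m} x))) B \<partial>\<mu>)"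
  proof (rule nn_integral_distr[OF prK, where f="\<lambda>x. indicator A x * emeasure (\<kappa> (Suc m) (proj d (pa E (Suc m)) x)) B"])
    have "(\<lambda>x. emeasure (\<kappa> (Suc m) (proj d (pa E (Suc m)) x)) B) \<in> borel_measurable (cube_space d {1..m})"
      using measurable_compose[OF measurable_prob_algebraD[OF \<kappa>_proj_meas[OF k]] measurable_emeasure_subprob_algebra[OF B]] .
    then have "(\<lambda>x. indicator A x * emeasure (\<kappa> (Suc m) (proj d (pa E (Suc m)) x)) B) \<in> borel_measurable (cube_space d {1..m})"
      using A by measurable
    then show "(\<lambda>x. indicator A x * emeasure (\<kappa> (Suc m) (proj d (pa E (Suc m)) x)) B)
        \<in> borel_measurable (distr \<mu> (cube_space d {1..m}) (proj d {1..m}))" by simp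
  qed (use k in simp)
  finally show ?thesis using pa_le by (simp add: proj_proj)
qed

text \<open>The Lipschitz version \<kappa>' may differ from the kernel that builds the measure. Both
  are versions of the same conditional law given the parents, hence agree almost surely on each
  event, and \<kappa>' inherits the independence of the further past.\<close>

lemma reg_cond_markov:
  assumes k: "k \<in> {1..K}" and \<kappa>: "reg_cond_distr d (kernel_product d E \<kappa> K) (pa E k) {k} (\<kappa> k)"
    and \<kappa>': "reg_cond_distr d (kernel_product d E \<kappa> K) (pa E k) {k} \<kappa>'"
  shows "reg_cond_distr d (kernel_product d E \<kappa> K) {1..<k} {k} (\<lambda>x. \<kappa>' (proj d (pa E k) x))"
proof -
  obtain m where m: "k = Suc m" "Suc m \<le> K" using k by (cases k) auto
  define \<mu> where "\<mu> = kernel_product d E \<kappa> K"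
  interpret \<mu>: prob_space \<mu> unfolding \<mu>_def by (rule kp_prob) simp
  have \<kappa>'m: "\<kappa>' \<in> cube_space d (pa E k) \<rightarrow>\<^sub>M prob_algebra (cube_space d {k})" using \<kappa>' by (simp add: reg_cond_distr_def)
  have \<kappa>m: "\<kappa> k \<in> cube_space d (pa E k) \<rightarrow>\<^sub>M prob_algebra (cube_space d {k})" by (rule \<kappa>_meas[OF k])
  have "pa E k \<subseteq> {1..K}" using pa_less[of k] k by force
  then have pp: "proj d (pa E k) \<in> \<mu> \<rightarrow>\<^sub>M cube_space d (pa E k)" unfolding \<mu>_def by (intro kp_measI measurable_proj) auto
  define D where "D = distr \<mu> (cube_space d (pa E k)) (proj d (pa E k))"
  interpret D: prob_space D unfolding D_def by (rule \<mu>.prob_space_distr[OF pp])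
  \<comment> \<open>The exceptional null set may depend on \<open>C\<close>; this suffices, as
    conditioning is verified one event at a time.\<close>
  have AE: "AE x in \<mu>. emeasure (\<kappa> k (proj d (pa E k) x)) C = emeasure (\<kappa>' (proj d (pa E k) x)) C" if C: "C \<in> sets (cube_space d {k})" for C
  proof -
    have me: "(\<lambda>u. emeasure (\<kappa> k u) C) \<in> borel_measurable (cube_space d (pa E k))" "(\<lambda>u. emeasure (\<kappa>' u) C) \<in> borel_measurable (cube_space d (pa E k))"
      using measurable_compose[OF measurable_prob_algebraD[OF \<kappa>m] measurable_emeasure_subprob_algebra[OF C]]
        measurable_compose[OF measurable_prob_algebraD[OF \<kappa>'m] measurable_emeasure_subprob_algebra[OF C]] by auto
    have "AE u in D. emeasure (\<kappa> k u) C = emeasure (\<kappa>' u) C"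
    proof (rule D.density_unique)
      show "density D (\<lambda>u. emeasure (\<kappa> k u) C) = density D (\<lambda>u. emeasure (\<kappa>' u) C)"
      proof (rule measure_eqI)
        fix A assume "A \<in> sets (density D (\<lambda>u. emeasure (\<kappa> k u) C))"
        then have A: "A \<in> sets (cube_space d (pa E k))" by (simp add: D_def)
        have "(\<integral>\<^sup>+u. emeasure (f u) C * indicator A u \<partial>D) = emeasure \<mu> {x \<in> space \<mu>. proj d (pa E k) x \<in> A \<and> proj d {k} x \<in> C}"
          if f: "reg_cond_distr d \<mu> (pa E k) {k} f" and fm: "(\<lambda>u. emeasure (f u) C) \<in> borel_measurable (cube_space d (pa E k))" for f
          unfolding D_def using f A C fm by (subst nn_integral_distr[OF pp]) (auto simp: reg_cond_distr_def mult.commute)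
        then show "emeasure (density D (\<lambda>u. emeasure (\<kappa> k u) C)) A = emeasure (density D (\<lambda>u. emeasure (\<kappa>' u) C)) A"
          using me A \<kappa> \<kappa>' by (subst (1 2) emeasure_density) (auto simp: D_def \<mu>_def)
      qed simp
    qed (use me in \<open>simp_all add: D_def\<close>)
    then show ?thesis unfolding D_def by (rule AE_distrD[OF pp])
  qed
  show ?thesis
    unfolding reg_cond_distr_def
  proof (intro conjI ballI)
    show "(\<lambda>x. \<kappa>' (proj d (pa E k) x)) \<in> cube_space d {1..<k} \<rightarrow>\<^sub>M prob_algebra (cube_space d {k})"
      by (rule measurable_compose[OF measurable_proj[OF pa_less] \<kappa>'m])
    fix A C assume A: "A \<in> sets (cube_space d {1..<k})" and C: "C \<in> sets (cube_space d {k})"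
    have k': "{1..<k} = {1..m}" using m by auto
    have "emeasure \<mu> {x \<in> space \<mu>. proj d {1..<k} x \<in> A \<and> proj d {k} x \<in> C} =
        (\<integral>\<^sup>+x. indicator A (proj d {1..<k} x) * emeasure (\<kappa> k (proj d (pa E k) x)) C \<partial>\<mu>)"
      unfolding k'
    proof -
      have "A \<in> sets (cube_space d {1..m})" using A unfolding k' .
      moreover have "C \<in> sets (cube_space d {Suc m})" using C unfolding m(1) .
      ultimately show "emeasure \<mu> {x \<in> space \<mu>. proj d {1..m} x \<in> A \<and> proj d {k} x \<in> C} =
        (\<integral>\<^sup>+x. indicator A (proj d {1..m} x) * emeasure (\<kappa> k (proj d (pa E k) x)) C \<partial>\<mu>)"
        unfolding \<mu>_def m(1) by (rule reg_cond_past[OF m(2)])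
    qed
    also have "\<dots> = (\<integral>\<^sup>+x. indicator A (proj d {1..<k} x) * emeasure (\<kappa>' (proj d (pa E k) x)) C \<partial>\<mu>)"
      by (rule nn_integral_cong_AE, rule AE_mp[OF AE[OF C]]) simp
    finally show "emeasure (kernel_product d E \<kappa> K) {x \<in> space (kernel_product d E \<kappa> K). proj d {1..<k} x \<in> A \<and> proj d {k} x \<in> C} =
        (\<integral>\<^sup>+x. indicator A (proj d {1..<k} x) * emeasure (\<kappa>' (proj d (pa E k) (proj d {1..<k} x))) C \<partial>kernel_product d E \<kappa> K)"
      using pa_less by (simp add: proj_proj \<mu>_def)
  qed
qed

end

section \<open>Disintegration on the cells\<close>

text \<open>\<open>tv_dist\<close> is a supremum of reals, so its family must be bounded before a
  member can be compared with it.\<close>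

lemma tv_dist_bdd:
  fixes f :: "'a \<Rightarrow> real"
  assumes "prob_space \<nu>" "prob_space \<nu>'" and sets: "sets \<nu>' = sets \<nu>"
    and f: "f \<in> borel_measurable \<nu>" "\<forall>x. \<bar>f x\<bar> \<le> 1 / 2"
  shows "(\<integral>x. f x \<partial>\<nu>) - (\<integral>x. f x \<partial>\<nu>') \<le> 1"
proof -
  have *: "\<bar>\<integral>x. f x \<partial>M\<bar> \<le> 1 / 2" if "prob_space M" "f \<in> borel_measurable M" for M
  proof -
    interpret prob_space M by fact
    have "integrable M f" by (rule integrable_const_bound[of _ "1 / 2"]) (use f that in auto)
    have "\<bar>f x\<bar> \<le> 1 / 2" for x using f(2) by blast
    then have "f x \<le> 1 / 2" "- (1 / 2) \<le> f x" for x by (simp_all only: abs_le_iff minus_le_iff)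
    then have "(\<integral>x. f x \<partial>M) \<le> (\<integral>x. 1 / 2 \<partial>M)" "(\<integral>x. - (1 / 2) \<partial>M) \<le> (\<integral>x. f x \<partial>M)"
      using \<open>integrable M f\<close> by (intro integral_mono; simp)+
    then show ?thesis by (simp add: prob_space abs_le_iff)
  qed
  have "f \<in> borel_measurable \<nu>'" using f(1) measurable_cong_sets[OF sets refl] by blast
  then show ?thesis using *[OF assms(1) f(1)] *[OF assms(2)] by linarith
qed

lemma tv_dist_le:
  fixes f :: "'a \<Rightarrow> real"
  assumes "prob_space \<nu>" "prob_space \<nu>'" and sets: "sets \<nu>' = sets \<nu>"
    and f: "f \<in> borel_measurable \<nu>" "\<forall>x. \<bar>f x\<bar> \<le> 1 / 2"
  shows "(\<integral>x. f x \<partial>\<nu>) - (\<integral>x. f x \<partial>\<nu>') \<le> tv_dist \<nu> \<nu>'"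
  unfolding tv_dist_def using f tv_dist_bdd[OF assms(1-3)]
  by (intro cSUP_upper bdd_aboveI[of _ 1]) auto

lemma tv_dist_self: "tv_dist \<nu> \<nu> = 0"
proof -
  have "(\<lambda>_. 0 :: real) \<in> {f \<in> borel_measurable \<nu>. \<forall>x. \<bar>f x\<bar> \<le> 1 / 2}" by simp
  then have "{f \<in> borel_measurable \<nu>. \<forall>x. \<bar>f x\<bar> \<le> 1 / (2 :: real)} \<noteq> {}" by blast
  then show ?thesis unfolding tv_dist_def by simp
qed

text \<open>The test function is half the sign of the difference on each set. The half comes from
  the normalisation \<open>\<bar>f x\<bar> \<le> 1 / 2\<close> and returns as the factor 2.\<close>

lemma tv_dist_partition:
  assumes P: "prob_space \<nu>" "prob_space \<nu>'" and sets: "sets \<nu>' = sets \<nu>"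
    and fin: "finite Y" and C: "\<And>y. y \<in> Y \<Longrightarrow> C y \<in> sets \<nu>" and disj: "disjoint_family_on C Y"
  shows "(\<Sum>y\<in>Y. \<bar>measure \<nu> (C y) - measure \<nu>' (C y)\<bar>) \<le> 2 * tv_dist \<nu> \<nu>'"
proof -
  interpret \<nu>: prob_space \<nu> by fact
  interpret \<nu>': prob_space \<nu>' by fact
  define s where "s = (\<lambda>y. sgn (measure \<nu> (C y) - measure \<nu>' (C y)))"
  define f where "f = (\<lambda>x. \<Sum>y\<in>Y. s y / 2 * indicator (C y) x)"
  have f_le: "\<bar>f x\<bar> \<le> 1 / 2" for x
  proof (cases "\<exists>y\<in>Y. x \<in> C y")
    case True
    then obtain y where y: "y \<in> Y" "x \<in> C y" by auto
    have "f x = (\<Sum>y'\<in>{y}. s y' / 2 * indicator (C y') x)"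
      unfolding f_def using fin y disj
      by (intro sum.mono_neutral_right) (auto simp: disjoint_family_on_def indicator_def)
    then have "f x = s y / 2" using y by simp
    moreover have "\<bar>s y\<bar> \<le> 1" by (simp add: s_def sgn_if)
    ultimately show ?thesis by simp
  next
    case False
    then have "f x = 0" unfolding f_def by (intro sum.neutral) auto
    then show ?thesis by simp
  qed
  have fm: "f \<in> borel_measurable \<nu>" unfolding f_def using C by measurable
  have int: "(\<integral>x. f x \<partial>M) = (\<Sum>y\<in>Y. s y / 2 * measure M (C y))"
    if "prob_space M" "\<And>y. y \<in> Y \<Longrightarrow> C y \<in> sets M" for M
  proof -
    interpret prob_space M by fact
    have "integrable M (\<lambda>x. s y / 2 * indicator (C y) x)" if "y \<in> Y" for y
      using \<open>\<And>y. y \<in> Y \<Longrightarrow> C y \<in> sets M\<close>[OF that] by (intro integrable_mult_right) (simp add: emeasure_eq_measure)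
    then show ?thesis unfolding f_def using that(2)
      by (subst Bochner_Integration.integral_sum) (auto intro!: sum.cong)
  qed
  have "(\<Sum>y\<in>Y. \<bar>measure \<nu> (C y) - measure \<nu>' (C y)\<bar>) = 2 * ((\<integral>x. f x \<partial>\<nu>) - (\<integral>x. f x \<partial>\<nu>'))"
    using int[OF P(1) C] int[OF P(2)] C sets
    by (simp add: sum_subtractf[symmetric] sum_distrib_left s_def abs_sgn algebra_simps)
  also have "\<dots> \<le> 2 * tv_dist \<nu> \<nu>'" using tv_dist_le[OF P sets fm] f_le by simp
  finally show ?thesis .
qed

section \<open>Conditional laws on the finest cells\<close>

context grid
begin

definition pcell :: "nat set \<Rightarrow> (nat \<Rightarrow> nat \<Rightarrow> nat) \<Rightarrow> point set" where
  "pcell S y = {x \<in> space (cube_space d S). \<forall>k\<in>S. Zb k x = y k}"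

lemma pcell_sets: "S \<subseteq> {1..K} \<Longrightarrow> pcell S y \<in> sets (cube_space d S)"
  unfolding pcell_def
  by (intro sets.sets_Collect_finite_All measurable_fibre[OF measurable_Zb]) (auto intro: finite_subset)

lemma Zb_proj: "k \<in> S \<Longrightarrow> Zb k (proj d S x) = Zb k x"
  by (auto simp: Zb_def proj_def coords_def restrict_def fun_eq_iff)

lemma Z_apply: "k \<in> {1..K} \<Longrightarrow> Z x k = Zb k x" by (simp add: Z_def)

lemma proj_pcell:
  assumes "S \<subseteq> {1..K}" "x \<in> space (cube_space d {1..K})"
  shows "proj d S x \<in> pcell S y \<longleftrightarrow> (\<forall>k\<in>S. Z x k = y k)"
  using measurable_space[OF measurable_proj[OF assms(1)] assms(2)] assms(1)
  by (auto simp: pcell_def Zb_proj Z_apply subset_iff)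

lemma disjoint_pcell: "disjoint_family_on (pcell S) (PiE S B)"
  unfolding disjoint_family_on_def
proof (intro ballI impI)
  fix y y' assume y: "y \<in> PiE S B" "y' \<in> PiE S B" "y \<noteq> y'"
  then obtain k where "k \<in> S" "y k \<noteq> y' k" using PiE_ext by metis
  then show "pcell S y \<inter> pcell S y' = {}" by (auto simp: pcell_def)
qed

lemma pcell_partition:
  assumes S: "S \<subseteq> {1..K}" and "prob_space \<nu>" and sets: "sets \<nu> = sets (cube_space d S)"
  shows "(\<Sum>y\<in>PiE S B. measure \<nu> (pcell S y)) = 1"
proof -
  interpret prob_space \<nu> by fact
  have "(\<Sum>y\<in>PiE S B. measure \<nu> (pcell S y)) = measure \<nu> (\<Union>y\<in>PiE S B. pcell S y)"
    using pcell_sets[OF S] sets disjoint_pcell finite_PiE_B[OF S] by (intro finite_measure_finite_Union[symmetric]) auto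
  also have "(\<Union>y\<in>PiE S B. pcell S y) = space \<nu>"
  proof -
    have "x \<in> (\<Union>y\<in>PiE S B. pcell S y)" if "x \<in> space \<nu>" for x
    proof (rule UN_I)
      show "(\<lambda>k\<in>S. Zb k x) \<in> PiE S B" using Zb_B by auto
      show "x \<in> pcell S (\<lambda>k\<in>S. Zb k x)" using that sets_eq_imp_space_eq[OF sets] by (auto simp: pcell_def)
    qed
    then show ?thesis using sets_eq_imp_space_eq[OF sets] by (auto simp: pcell_def)
  qed
  finally show ?thesis by (simp add: prob_space)
qed

lemma reg_cond_cells:
  assumes "prob_space \<mu>" and sets: "sets \<mu> = sets (cube_space d {1..K})"
    and \<kappa>: "reg_cond_distr d \<mu> S Q \<kappa>" and ST: "S \<subseteq> {1..K}" "Q \<subseteq> {1..K}"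
  shows "measure \<mu> {x \<in> space \<mu>. proj d S x \<in> pcell S a \<and> proj d Q x \<in> pcell Q y} =
      (\<integral>x. indicator (pcell S a) (proj d S x) * measure (\<kappa> (proj d S x)) (pcell Q y) \<partial>\<mu>)"
    and "(\<lambda>x. measure (\<kappa> (proj d S x)) (pcell Q y)) \<in> borel_measurable \<mu>"
    and "(\<lambda>x. indicator (pcell S a) (proj d S x) :: real) \<in> borel_measurable \<mu>"
proof -
  interpret prob_space \<mu> by fact
  have pS: "proj d S \<in> \<mu> \<rightarrow>\<^sub>M cube_space d S"
    using measurable_proj[OF ST(1)] measurable_cong_sets[OF sets refl] by blast
  have \<kappa>m: "\<kappa> \<in> cube_space d S \<rightarrow>\<^sub>M prob_algebra (cube_space d Q)" using \<kappa> by (simp add: reg_cond_distr_def)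
  show m1: "(\<lambda>x. measure (\<kappa> (proj d S x)) (pcell Q y)) \<in> borel_measurable \<mu>"
    by (rule measurable_compose[OF measurable_compose[OF pS \<kappa>m] measurable_measure_prob_algebra[OF pcell_sets[OF ST(2)]]])
  show m2: "(\<lambda>x. indicator (pcell S a) (proj d S x) :: real) \<in> borel_measurable \<mu>"
    by (rule measurable_compose[OF pS borel_measurable_indicator[OF pcell_sets[OF ST(1)]]])
  have kfin: "emeasure (\<kappa> (proj d S x)) (pcell Q y) = ennreal (measure (\<kappa> (proj d S x)) (pcell Q y))" if "x \<in> space \<mu>" for x
  proof -
    have "prob_space (\<kappa> (proj d S x))"
      using measurable_space[OF \<kappa>m measurable_space[OF pS that]] by (simp add: space_prob_algebra)
    then interpret k: prob_space "\<kappa> (proj d S x)" .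
    show ?thesis by (rule k.emeasure_eq_measure)
  qed
  have "ennreal (measure \<mu> {x \<in> space \<mu>. proj d S x \<in> pcell S a \<and> proj d Q x \<in> pcell Q y}) =
      (\<integral>\<^sup>+x. indicator (pcell S a) (proj d S x) * emeasure (\<kappa> (proj d S x)) (pcell Q y) \<partial>\<mu>)"
    using \<kappa> pcell_sets ST unfolding emeasure_eq_measure[symmetric] by (simp add: reg_cond_distr_def)
  also have "\<dots> = (\<integral>\<^sup>+x. ennreal (indicator (pcell S a) (proj d S x) * measure (\<kappa> (proj d S x)) (pcell Q y)) \<partial>\<mu>)"
    using kfin by (intro nn_integral_cong) (auto simp: indicator_def)
  finally have eq: "ennreal (measure \<mu> {x \<in> space \<mu>. proj d S x \<in> pcell S a \<and> proj d Q x \<in> pcell Q y}) =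
      (\<integral>\<^sup>+x. ennreal (indicator (pcell S a) (proj d S x) * measure (\<kappa> (proj d S x)) (pcell Q y)) \<partial>\<mu>)" .
  have "(\<integral>x. indicator (pcell S a) (proj d S x) * measure (\<kappa> (proj d S x)) (pcell Q y) \<partial>\<mu>) =
      enn2real (\<integral>\<^sup>+x. ennreal (indicator (pcell S a) (proj d S x) * measure (\<kappa> (proj d S x)) (pcell Q y)) \<partial>\<mu>)"
    by (rule integral_eq_nn_integral) (use m1 m2 in auto)
  then show "measure \<mu> {x \<in> space \<mu>. proj d S x \<in> pcell S a \<and> proj d Q x \<in> pcell Q y} =
      (\<integral>x. indicator (pcell S a) (proj d S x) * measure (\<kappa> (proj d S x)) (pcell Q y) \<partial>\<mu>)"
    unfolding eq[symmetric] by simp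
qed

text \<open>A function of the finest cells is a finite combination of indicators of products of
  cells in \<open>S\<close> and \<open>Q\<close>, and for such products the claim is the definition
  of a regular conditional distribution.\<close>

lemma disintegration:
  assumes \<mu>: "prob_space \<mu>" and sets: "sets \<mu> = sets (cube_space d {1..K})"
    and \<kappa>: "reg_cond_distr d \<mu> S Q \<kappa>" and ST: "S \<subseteq> {1..K}" "Q \<subseteq> {1..K}" "S \<inter> Q = {}"
    and \<psi>: "dep (S \<union> Q) \<psi>"
  shows "(\<integral>x. \<psi> (Z x) \<partial>\<mu>) = (\<integral>x. (\<Sum>y\<in>PiE Q B. measure (\<kappa> (proj d S x)) (pcell Q y) * \<psi> (override Q y (Z x))) \<partial>\<mu>)"
proof -
  interpret prob_space \<mu> by fact
  note sp = sets_eq_imp_space_eq[OF sets]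
  obtain z1 where z1: "z1 \<in> X" using ne_X by auto
  note rc = reg_cond_cells[OF \<mu> sets \<kappa> ST(1,2)]
  \<comment> \<open>The value of \<psi> on the product of the cells \<open>a\<close> and
    \<open>y\<close>; \<open>z1\<close> supplies the coordinates outside \<open>S\<close> and
    \<open>Q\<close>.\<close>
  define F where "F = (\<lambda>a y. \<psi> (override Q y (override S a z1)))"
  have oX: "override Q y z \<in> X" if "z \<in> X" "y \<in> PiE Q B" for y z using X_override[OF that(1) ST(2) that(2)] .
  have oS: "override S a z1 \<in> X" if "a \<in> PiE S B" for a using X_override[OF z1 ST(1) that] .
  have F: "\<psi> (override Q y (Z x)) = (\<Sum>a\<in>PiE S B. indicator (pcell S a) (proj d S x) * F a y)"
    if x: "x \<in> space \<mu>" and y: "y \<in> PiE Q B" for x y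
  proof -
    define a0 where "a0 = (\<lambda>k\<in>S. Z x k)"
    have a0: "a0 \<in> PiE S B" using X_mem[OF Z_X] ST(1) by (auto simp: a0_def)
    have "(\<Sum>a\<in>PiE S B. indicator (pcell S a) (proj d S x) * F a y) = (\<Sum>a\<in>{a0}. indicator (pcell S a) (proj d S x) * F a y)"
    proof (rule sum.mono_neutral_right)
      show "\<forall>a\<in>PiE S B - {a0}. indicator (pcell S a) (proj d S x) * F a y = 0"
      proof
        fix a assume a: "a \<in> PiE S B - {a0}"
        then obtain k where "k \<in> S" "a k \<noteq> a0 k" using PiE_ext a0 by (metis DiffD1 DiffD2 singletonI)
        then have "proj d S x \<notin> pcell S a" using proj_pcell[OF ST(1), of x a] x sp by (auto simp: a0_def)
        then show "indicator (pcell S a) (proj d S x) * F a y = 0" by simp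
      qed
    qed (use a0 finite_PiE_B[OF ST(1)] in auto)
    also have "\<dots> = F a0 y" using proj_pcell[OF ST(1), of x a0] x sp by (simp add: a0_def)
    also have "\<dots> = \<psi> (override Q y (Z x))"
      unfolding F_def using ST(3) by (intro depD[OF \<psi>] oX oS a0 Z_X y) (auto simp: override_def a0_def)
    finally show ?thesis by simp
  qed
  have psi: "\<psi> (Z x) = (\<Sum>y\<in>PiE Q B. \<Sum>a\<in>PiE S B. indicator {x \<in> space \<mu>. proj d S x \<in> pcell S a \<and> proj d Q x \<in> pcell Q y} x * F a y)"
    if x: "x \<in> space \<mu>" for x
  proof -
    define y0 where "y0 = (\<lambda>k\<in>Q. Z x k)"
    have y0: "y0 \<in> PiE Q B" using X_mem[OF Z_X] ST(2) by (auto simp: y0_def)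
    have "(\<Sum>y\<in>PiE Q B. \<Sum>a\<in>PiE S B. indicator {x \<in> space \<mu>. proj d S x \<in> pcell S a \<and> proj d Q x \<in> pcell Q y} x * F a y) =
        (\<Sum>y\<in>PiE Q B. indicator (pcell Q y) (proj d Q x) * \<psi> (override Q y (Z x)))"
      using F[OF x] x by (intro sum.cong refl) (auto simp: sum_distrib_left indicator_def intro!: sum.cong)
    also have "\<dots> = (\<Sum>y\<in>{y0}. indicator (pcell Q y) (proj d Q x) * \<psi> (override Q y (Z x)))"
    proof (rule sum.mono_neutral_right)
      show "\<forall>y\<in>PiE Q B - {y0}. indicator (pcell Q y) (proj d Q x) * \<psi> (override Q y (Z x)) = 0"
      proof
        fix y assume y: "y \<in> PiE Q B - {y0}"
        then obtain k where "k \<in> Q" "y k \<noteq> y0 k" using PiE_ext y0 by (metis DiffD1 DiffD2 singletonI)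
        then have "proj d Q x \<notin> pcell Q y" using proj_pcell[OF ST(2), of x y] x sp by (auto simp: y0_def)
        then show "indicator (pcell Q y) (proj d Q x) * \<psi> (override Q y (Z x)) = 0" by simp
      qed
    qed (use y0 finite_PiE_B[OF ST(2)] in auto)
    also have "\<dots> = \<psi> (override Q y0 (Z x))" using proj_pcell[OF ST(2), of x y0] x sp by (simp add: y0_def)
    also have "override Q y0 (Z x) = Z x" by (auto simp: override_def y0_def)
    finally show ?thesis by simp
  qed
  define A where "A = (\<lambda>a y. {x \<in> space \<mu>. proj d S x \<in> pcell S a \<and> proj d Q x \<in> pcell Q y})"
  have Am: "A a y \<in> sets \<mu>" for a y
  proof -
    have "A a y = {x \<in> space \<mu>. (\<forall>k\<in>S. Z x k = a k) \<and> (\<forall>k\<in>Q. Z x k = y k)}"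
      unfolding A_def using proj_pcell ST sp by auto
    also have "\<dots> \<in> sets \<mu>"
      using measurable_Z[of "{1..K}"] measurable_cong_sets[OF sets refl] by (intro Pr_law(1)[OF \<mu>]) blast
    finally show ?thesis .
  qed
  have kb: "\<bar>indicator (pcell S a) (proj d S x) * measure (\<kappa> (proj d S x)) (pcell Q y)\<bar> \<le> (1::real)" if "x \<in> space \<mu>" for a x y
  proof -
    have "proj d S x \<in> space (cube_space d S)" using that sp measurable_space[OF measurable_proj[OF ST(1)]] by auto
    moreover have "\<kappa> \<in> cube_space d S \<rightarrow>\<^sub>M prob_algebra (cube_space d Q)"
      using \<kappa> unfolding reg_cond_distr_def by blast
    ultimately have "\<kappa> (proj d S x) \<in> space (prob_algebra (cube_space d Q))" by (rule measurable_space[rotated])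
    then have "prob_space (\<kappa> (proj d S x))" by (simp add: space_prob_algebra)
    then show ?thesis by (simp add: indicator_def prob_space.prob_le_1)
  qed
  have int1: "integrable \<mu> (\<lambda>x. indicator (A a y) x * F a y)" for a y
    using Am by (intro integrable_mult_left) (simp add: emeasure_eq_measure)
  have int2: "integrable \<mu> (\<lambda>x. indicator (pcell S a) (proj d S x) * measure (\<kappa> (proj d S x)) (pcell Q y) * F a y)" for a y
    using rc(2,3) kb by (intro integrable_mult_left integrable_const_bound[of _ 1]) auto
  have "(\<integral>x. \<psi> (Z x) \<partial>\<mu>) = (\<integral>x. (\<Sum>y\<in>PiE Q B. \<Sum>a\<in>PiE S B. indicator (A a y) x * F a y) \<partial>\<mu>)"
    unfolding A_def by (intro Bochner_Integration.integral_cong psi refl)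
  also have "\<dots> = (\<Sum>y\<in>PiE Q B. \<Sum>a\<in>PiE S B. measure \<mu> (A a y) * F a y)"
    using int1 Am by (subst Bochner_Integration.integral_sum, force, intro sum.cong refl, subst Bochner_Integration.integral_sum) auto
  also have "\<dots> = (\<Sum>y\<in>PiE Q B. \<Sum>a\<in>PiE S B. \<integral>x. indicator (pcell S a) (proj d S x) * measure (\<kappa> (proj d S x)) (pcell Q y) * F a y \<partial>\<mu>)"
    unfolding A_def rc(1) by simp
  also have "\<dots> = (\<integral>x. (\<Sum>y\<in>PiE Q B. \<Sum>a\<in>PiE S B. indicator (pcell S a) (proj d S x) * measure (\<kappa> (proj d S x)) (pcell Q y) * F a y) \<partial>\<mu>)"
    using int2 by (subst Bochner_Integration.integral_sum, force, intro sum.cong refl, subst Bochner_Integration.integral_sum) auto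
  also have "\<dots> = (\<integral>x. (\<Sum>y\<in>PiE Q B. measure (\<kappa> (proj d S x)) (pcell Q y) * \<psi> (override Q y (Z x))) \<partial>\<mu>)"
    using F by (intro Bochner_Integration.integral_cong refl sum.cong) (auto simp: sum_distrib_left intro!: sum.cong)
  finally show ?thesis .
qed

section \<open>Lipschitz kernels sampled at cell midpoints\<close>

definition mid :: "nat set \<Rightarrow> (nat \<Rightarrow> nat \<Rightarrow> nat) \<Rightarrow> point" where
  "mid S z = (\<lambda>i\<in>coords d S. (real (z (fst i) (snd i)) + 1 / 2) / 2 ^ J)"

lemma X_less: "z \<in> X \<Longrightarrow> k \<in> {1..K} \<Longrightarrow> i < d k \<Longrightarrow> z k i < 2 ^ J"
  using X_mem[of z k] by (auto simp: B_def)

lemma mid_space: "z \<in> X \<Longrightarrow> S \<subseteq> {1..K} \<Longrightarrow> mid S z \<in> space (cube_space d S)"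
proof -
  assume z: "z \<in> X" and S: "S \<subseteq> {1..K}"
  have "(real (z k i) + 1 / 2) / 2 ^ J \<in> {0..1}" if "k \<in> S" "i < d k" for k i
  proof -
    have "z k i + 1 \<le> 2 ^ J" using X_less[OF z _ that(2)] S that(1) by (auto simp: Suc_le_eq)
    then have "real (z k i + 1) \<le> 2 ^ J" by (metis of_nat_le_iff of_nat_numeral of_nat_power)
    then show ?thesis by simp
  qed
  then show ?thesis by (auto simp: space_cube mid_def coords_def)
qed

lemma finite_coords: "S \<subseteq> {1..K} \<Longrightarrow> finite (coords d S)"
  unfolding coords_def using finite_subset[of S "{1..K}"] by auto

lemma sup_dist_le:
  assumes "S \<subseteq> {1..K}" "0 \<le> b" "\<And>k i. k \<in> S \<Longrightarrow> i < d k \<Longrightarrow> \<bar>x (k, i) - y (k, i)\<bar> \<le> b"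
  shows "sup_dist d S x y \<le> b"
  unfolding sup_dist_def using assms finite_coords[OF assms(1)] by (intro Max.boundedI) (auto simp: coords_def)

lemma sup_dist_nonneg: "S \<subseteq> {1..K} \<Longrightarrow> 0 \<le> sup_dist d S x y"
  unfolding sup_dist_def using finite_coords by (intro Max_ge) auto

lemma sup_dist_mono:
  "S \<subseteq> S' \<Longrightarrow> S' \<subseteq> {1..K} \<Longrightarrow> sup_dist d S (proj d S x) (proj d S y) \<le> sup_dist d S' x y"
proof (rule sup_dist_le)
  assume *: "S \<subseteq> S'" "S' \<subseteq> {1..K}"
  show "0 \<le> sup_dist d S' x y" by (rule sup_dist_nonneg[OF *(2)])
  show "\<bar>proj d S x (k, i) - proj d S y (k, i)\<bar> \<le> sup_dist d S' x y" if "k \<in> S" "i < d k" for k i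
    unfolding sup_dist_def using * that finite_coords[OF *(2)]
    by (intro Max_ge) (auto simp: proj_def coords_def image_iff)
qed simp

lemma sup_dist_mid:
  assumes S: "S \<subseteq> {1..K}" shows "sup_dist d S (mid S z) (mid S z') \<le> (\<Sum>k\<in>S. bd k (z k) (z' k))"
proof (rule sup_dist_le[OF S])
  show "0 \<le> (\<Sum>k\<in>S. bd k (z k) (z' k))" by (intro sum_nonneg bd_nonneg)
  fix k i assume ki: "k \<in> S" "i < d k"
  have "\<bar>mid S z (k, i) - mid S z' (k, i)\<bar> = \<bar>real (z k i) - real (z' k i)\<bar> / 2 ^ J"
    using ki by (simp add: mid_def coords_def diff_divide_distrib[symmetric])
  also have "\<dots> \<le> bd k (z k) (z' k)"
    unfolding bd_def using ki by (intro member_le_sum[of i "{..<d k}" "\<lambda>i. \<bar>real (z k i) - real (z' k i)\<bar> / 2 ^ J"]) auto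
  also have "\<dots> \<le> (\<Sum>k\<in>S. bd k (z k) (z' k))"
    using ki S finite_subset[of S "{1..K}"] by (intro member_le_sum bd_nonneg) auto
  finally show "\<bar>mid S z (k, i) - mid S z' (k, i)\<bar> \<le> (\<Sum>k\<in>S. bd k (z k) (z' k))" .
qed

lemma sup_dist_Z:
  assumes S: "S \<subseteq> {1..K}" and x: "x \<in> space (cube_space d {1..K})"
  shows "sup_dist d S (proj d S x) (mid S (Z x)) \<le> 1 / 2 ^ J"
proof (rule sup_dist_le[OF S])
  fix k i assume ki: "k \<in> S" "i < d k"
  define t where "t = x (k, i)"
  have t: "0 \<le> t" "t \<le> 1" using x ki S by (auto simp: t_def space_cube coords_def)
  have "proj d S x (k, i) = t" "mid S (Z x) (k, i) = (real (grid_index J t) + 1 / 2) / 2 ^ J"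
    using ki S by (auto simp: proj_def mid_def coords_def Z_def Zb_def t_def)
  moreover have "\<bar>t - (real (grid_index J t) + 1 / 2) / 2 ^ J\<bar> \<le> 1 / 2 ^ J"
  proof -
    have "(real (grid_index J t) + 1 / 2) / 2 ^ J = real (grid_index J t) / 2 ^ J + 1 / 2 * (1 / 2 ^ J)"
      "(real (grid_index J t) + 1) / 2 ^ J = real (grid_index J t) / 2 ^ J + 1 / 2 ^ J"
      by (simp_all add: add_divide_distrib)
    moreover have "0 \<le> (1 :: real) / 2 ^ J" by simp
    ultimately show ?thesis using grid_index_bounds[OF t, of J] unfolding abs_le_iff by linarith
  qed
  ultimately show "\<bar>proj d S x (k, i) - mid S (Z x) (k, i)\<bar> \<le> 1 / 2 ^ J" by simp
qed simp

text \<open>The kernel is evaluated at the midpoint of the conditioning cell rather than averaged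
  over the cell: this avoids dividing by the mass of the cell, and the Lipschitz bound holds on
  cells without mass as well.\<close>

definition kd :: "(point \<Rightarrow> point measure) \<Rightarrow> nat set \<Rightarrow> nat set \<Rightarrow> (nat \<Rightarrow> nat \<Rightarrow> nat) \<Rightarrow> (nat \<Rightarrow> nat \<Rightarrow> nat) \<Rightarrow> real" where
  "kd \<kappa> S Q z y = measure (\<kappa> (mid S z)) (pcell Q y)"

definition lip_kernel :: "real \<Rightarrow> point measure \<Rightarrow> nat set \<Rightarrow> nat set \<Rightarrow> (point \<Rightarrow> point measure) \<Rightarrow> bool" where
  "lip_kernel L \<mu> S Q \<kappa> \<longleftrightarrow> reg_cond_distr d \<mu> S Q \<kappa> \<and>
     (\<forall>x\<in>space (cube_space d S). \<forall>y\<in>space (cube_space d S). tv_dist (\<kappa> x) (\<kappa> y) \<le> L * sup_dist d S x y)"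

context
  fixes L \<mu> S Q \<kappa>
  assumes \<kappa>: "lip_kernel L \<mu> S Q \<kappa>" and L0: "0 \<le> L" and ST: "S \<subseteq> {1..K}" "Q \<subseteq> {1..K}"
begin

lemma lk_space: "u \<in> space (cube_space d S) \<Longrightarrow> prob_space (\<kappa> u) \<and> sets (\<kappa> u) = sets (cube_space d Q)"
proof -
  assume u: "u \<in> space (cube_space d S)"
  have "\<kappa> \<in> cube_space d S \<rightarrow>\<^sub>M prob_algebra (cube_space d Q)"
    using \<kappa> unfolding lip_kernel_def reg_cond_distr_def by blast
  from measurable_space[OF this u] show ?thesis by (simp add: space_prob_algebra)
qed

lemma lk_diff:
  assumes u: "u \<in> space (cube_space d S)" "u' \<in> space (cube_space d S)"
  shows "(\<Sum>y\<in>PiE Q B. \<bar>measure (\<kappa> u) (pcell Q y) - measure (\<kappa> u') (pcell Q y)\<bar>) \<le> 2 * (L * sup_dist d S u u')"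
proof -
  have "(\<Sum>y\<in>PiE Q B. \<bar>measure (\<kappa> u) (pcell Q y) - measure (\<kappa> u') (pcell Q y)\<bar>) \<le> 2 * tv_dist (\<kappa> u) (\<kappa> u')"
    using lk_space[OF u(1)] lk_space[OF u(2)] pcell_sets[OF ST(2)] finite_PiE_B[OF ST(2)] disjoint_pcell
    by (intro tv_dist_partition) auto
  also have "\<dots> \<le> 2 * (L * sup_dist d S u u')" using \<kappa> u unfolding lip_kernel_def by simp
  finally show ?thesis .
qed

lemma kd_sum: "z \<in> X \<Longrightarrow> (\<Sum>y\<in>PiE Q B. kd \<kappa> S Q z y) = 1"
  unfolding kd_def using lk_space[OF mid_space[OF _ ST(1)]] by (intro pcell_partition ST(2)) auto

lemma kd_lip:
  assumes "z \<in> X" "z' \<in> X"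
  shows "(\<Sum>y\<in>PiE Q B. \<bar>kd \<kappa> S Q z y - kd \<kappa> S Q z' y\<bar>) \<le> 2 * L * (\<Sum>k\<in>S. bd k (z k) (z' k))"
proof -
  have "(\<Sum>y\<in>PiE Q B. \<bar>kd \<kappa> S Q z y - kd \<kappa> S Q z' y\<bar>) \<le> 2 * (L * sup_dist d S (mid S z) (mid S z'))"
    unfolding kd_def using assms ST(1) by (intro lk_diff mid_space)
  also have "\<dots> \<le> 2 * (L * (\<Sum>k\<in>S. bd k (z k) (z' k)))"
    using L0 sup_dist_mid[OF ST(1)] by (intro mult_left_mono) auto
  finally show ?thesis by simp
qed

text \<open>A point is within \<open>1 / 2 ^ J\<close> of the midpoint of its cell, so exchanging
  the conditional law at the point for that at the midpoint costs \<open>2 * L / 2 ^ J * b\<close>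
  pointwise. Letting \<open>b\<close> vary with the cell is what gives \<open>kap_cond\<close> its
  form.\<close>

lemma kd_cond:
  assumes \<mu>: "prob_space \<mu>" and sets: "sets \<mu> = sets (cube_space d {1..K})" and disj: "S \<inter> Q = {}"
    and \<psi>: "dep (S \<union> Q) \<psi>" and b: "\<And>z y. z \<in> X \<Longrightarrow> y \<in> PiE Q B \<Longrightarrow> \<bar>\<psi> (override Q y z)\<bar> \<le> b z"
  shows "\<bar>E (law \<mu>) \<psi> - E (law \<mu>) (TS Q (kd \<kappa> S Q) \<psi>)\<bar> \<le> 2 * L / 2 ^ J * E (law \<mu>) b"
proof -
  interpret prob_space \<mu> by fact
  note sp = sets_eq_imp_space_eq[OF sets]
  have Zm: "Z \<in> \<mu> \<rightarrow>\<^sub>M count_space X" using measurable_Z[of "{1..K}"] measurable_cong_sets[OF sets refl] by blast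
  have rc: "reg_cond_distr d \<mu> S Q \<kappa>" using \<kappa> by (simp add: lip_kernel_def)
  define g1 where "g1 = (\<lambda>x. \<Sum>y\<in>PiE Q B. measure (\<kappa> (proj d S x)) (pcell Q y) * \<psi> (override Q y (Z x)))"
  have E1: "E (law \<mu>) \<psi> = (\<integral>x. g1 x \<partial>\<mu>)"
    unfolding law_integral(2)[OF \<mu> Zm] g1_def by (rule disintegration[OF \<mu> sets rc ST disj \<psi>])
  have pS: "proj d S x \<in> space (cube_space d S)" if "x \<in> space \<mu>" for x
    using that sp measurable_space[OF measurable_proj[OF ST(1)]] by auto
  have diff: "\<bar>g1 x - TS Q (kd \<kappa> S Q) \<psi> (Z x)\<bar> \<le> 2 * L / 2 ^ J * b (Z x)" if x: "x \<in> space \<mu>" for x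
  proof -
    have "b (Z x) \<ge> 0"
    proof -
      have "(\<lambda>k\<in>Q. Z x k) \<in> PiE Q B" using X_mem[OF Z_X] ST(2) by auto
      from b[OF Z_X this] show ?thesis by (rule order_trans[OF abs_ge_zero])
    qed
    have "\<bar>g1 x - TS Q (kd \<kappa> S Q) \<psi> (Z x)\<bar> \<le> (\<Sum>y\<in>PiE Q B. \<bar>measure (\<kappa> (proj d S x)) (pcell Q y) - kd \<kappa> S Q (Z x) y\<bar> * b (Z x))"
      unfolding g1_def TS_def sum_subtractf[symmetric] left_diff_distrib[symmetric]
      by (rule order_trans[OF sum_abs], rule sum_mono) (use b[OF Z_X] in \<open>auto simp: abs_mult intro!: mult_left_mono\<close>)
    also have "\<dots> \<le> 2 * (L * sup_dist d S (proj d S x) (mid S (Z x))) * b (Z x)"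
      unfolding sum_distrib_right[symmetric] kd_def using \<open>b (Z x) \<ge> 0\<close>
      by (intro mult_right_mono lk_diff pS[OF x] mid_space Z_X ST)
    also have "\<dots> \<le> 2 * (L * (1 / 2 ^ J)) * b (Z x)"
      using \<open>b (Z x) \<ge> 0\<close> L0 sup_dist_Z[OF ST(1)] x sp by (intro mult_right_mono mult_left_mono) auto
    finally show ?thesis by simp
  qed
  have "integrable \<mu> g1"
  proof -
    have "(\<lambda>x. \<psi> (override Q y (Z x))) \<in> borel_measurable \<mu>" for y using law_integral(1)[OF \<mu> Zm, of "\<lambda>z. \<psi> (override Q y z)"] by auto
    then have "g1 \<in> borel_measurable \<mu>" unfolding g1_def using reg_cond_cells(2)[OF \<mu> sets rc ST] by measurable
    moreover have "integrable \<mu> (\<lambda>x. 2 * L / 2 ^ J * b (Z x) + \<bar>TS Q (kd \<kappa> S Q) \<psi> (Z x)\<bar>)"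
      using law_integral(1)[OF \<mu> Zm, of "\<lambda>z. 2 * L / 2 ^ J * b z + \<bar>TS Q (kd \<kappa> S Q) \<psi> z\<bar>"] .
    moreover have "AE x in \<mu>. norm (g1 x) \<le> norm (2 * L / 2 ^ J * b (Z x) + \<bar>TS Q (kd \<kappa> S Q) \<psi> (Z x)\<bar>)"
    proof (rule AE_I2)
      fix x assume "x \<in> space \<mu>"
      from diff[OF this] show "norm (g1 x) \<le> norm (2 * L / 2 ^ J * b (Z x) + \<bar>TS Q (kd \<kappa> S Q) \<psi> (Z x)\<bar>)"
        unfolding real_norm_def by linarith
    qed
    ultimately show ?thesis using Bochner_Integration.integrable_bound by blast
  qed
  note g1i = this
  then have g1: "E (law \<mu>) \<psi> - E (law \<mu>) (TS Q (kd \<kappa> S Q) \<psi>) = (\<integral>x. g1 x - TS Q (kd \<kappa> S Q) \<psi> (Z x) \<partial>\<mu>)"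
    unfolding E1 law_integral(2)[OF \<mu> Zm, of "TS Q (kd \<kappa> S Q) \<psi>"]
    by (rule Bochner_Integration.integral_diff[symmetric]) (rule law_integral(1)[OF \<mu> Zm])
  have "\<bar>E (law \<mu>) \<psi> - E (law \<mu>) (TS Q (kd \<kappa> S Q) \<psi>)\<bar> \<le> (\<integral>x. \<bar>g1 x - TS Q (kd \<kappa> S Q) \<psi> (Z x)\<bar> \<partial>\<mu>)"
    unfolding g1 by (rule integral_abs_bound)
  also have "\<dots> \<le> (\<integral>x. 2 * L / 2 ^ J * b (Z x) \<partial>\<mu>)"
    using g1i law_integral(1)[OF \<mu> Zm]
    by (intro integral_mono diff integrable_abs Bochner_Integration.integrable_diff) auto
  also have "\<dots> = 2 * L / 2 ^ J * E (law \<mu>) b"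
    unfolding law_integral(2)[OF \<mu> Zm] by simp
  finally show ?thesis .
qed

end

text \<open>If one index set is empty, the Lipschitz condition is void and a constant kernel serves:
  the unique law on the one-point space, or the marginal. Passing to \<open>max L 0\<close> makes
  the constant nonnegative, as the estimates require.\<close>

lemma lip_kernel_exists:
  assumes \<mu>: "prob_space \<mu>" and sets: "sets \<mu> = sets (cube_space d {1..K})"
    and S: "S \<subseteq> {1..K}" and Q: "Q \<subseteq> {1..K}" and tv: "tv_lipschitz_cond d L \<mu> S Q"
  shows "\<exists>\<kappa>. lip_kernel (max L 0) \<mu> S Q \<kappa>"
proof -
  interpret prob_space \<mu> by fact
  have pm: "proj d A \<in> \<mu> \<rightarrow>\<^sub>M cube_space d A" if "A \<subseteq> {1..K}" for A
    using measurable_proj[OF that] measurable_cong_sets[OF sets refl] by blast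
  consider "Q = {}" | "S = {}" | "S \<noteq> {}" "Q \<noteq> {}" by blast
  then show ?thesis
  proof cases
    case 1
    let ?\<kappa> = "\<lambda>_ :: point. return (cube_space d {}) (\<lambda>_. undefined)"
    have un: "(\<lambda>_. undefined) \<in> space (cube_space d {})" by (simp add: space_cube_empty)
    have pj: "proj d {} x = (\<lambda>_. undefined)" for x by (simp add: proj_def coords_def restrict_def)
    have "reg_cond_distr d \<mu> S Q ?\<kappa>"
      unfolding reg_cond_distr_def 1
    proof (intro conjI ballI)
      show "?\<kappa> \<in> cube_space d S \<rightarrow>\<^sub>M prob_algebra (cube_space d {})"
        using un by (intro measurable_const) (simp add: space_prob_algebra prob_space_return)
      fix A B assume A: "A \<in> sets (cube_space d S)" and B: "B \<in> sets (cube_space d {})"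
      have "emeasure \<mu> {x \<in> space \<mu>. proj d S x \<in> A \<and> proj d {} x \<in> B} =
          (\<integral>\<^sup>+x. indicator (proj d S -` A \<inter> space \<mu>) x * indicator B (\<lambda>_. undefined) \<partial>\<mu>)"
        using measurable_sets[OF pm[OF S] A]
        by (cases "(\<lambda>_. undefined) \<in> B") (auto simp: pj intro!: arg_cong[where f="emeasure \<mu>"])
      also have "\<dots> = (\<integral>\<^sup>+x. indicator A (proj d S x) * emeasure (return (cube_space d {}) (\<lambda>_. undefined)) B \<partial>\<mu>)"
        using B by (intro nn_integral_cong) (auto simp: indicator_def)
      finally show "emeasure \<mu> {x \<in> space \<mu>. proj d S x \<in> A \<and> proj d {} x \<in> B} =
          (\<integral>\<^sup>+x. indicator A (proj d S x) * emeasure (return (cube_space d {}) (\<lambda>_. undefined)) B \<partial>\<mu>)" .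
    qed
    then show ?thesis
      using sup_dist_nonneg[OF S] unfolding lip_kernel_def by (intro exI[of _ ?\<kappa>]) (simp add: tv_dist_self)
  next
    case 2
    let ?\<kappa> = "\<lambda>_ :: point. marginal d Q \<mu>"
    have pj: "proj d {} x = (\<lambda>_. undefined)" for x by (simp add: proj_def coords_def restrict_def)
    have "reg_cond_distr d \<mu> S Q ?\<kappa>"
      unfolding reg_cond_distr_def 2
    proof (intro conjI ballI)
      show "?\<kappa> \<in> cube_space d {} \<rightarrow>\<^sub>M prob_algebra (cube_space d Q)"
        using prob_space_distr[OF pm[OF Q]] by (intro measurable_const) (simp add: space_prob_algebra marginal_def)
      fix A B assume A: "A \<in> sets (cube_space d {})" and B: "B \<in> sets (cube_space d Q)"
      have "emeasure (marginal d Q \<mu>) B = emeasure \<mu> (proj d Q -` B \<inter> space \<mu>)"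
        unfolding marginal_def by (rule emeasure_distr[OF pm[OF Q] B])
      also have "proj d Q -` B \<inter> space \<mu> = {x \<in> space \<mu>. proj d Q x \<in> B}" by auto
      finally show "emeasure \<mu> {x \<in> space \<mu>. proj d {} x \<in> A \<and> proj d Q x \<in> B} =
          (\<integral>\<^sup>+x. indicator A (proj d {} x) * emeasure (marginal d Q \<mu>) B \<partial>\<mu>)"
        by (simp add: pj indicator_def emeasure_space_1)
    qed
    then show ?thesis
      using sup_dist_nonneg[OF S] unfolding lip_kernel_def by (intro exI[of _ ?\<kappa>]) (simp add: tv_dist_self)
  next
    case 3
    then obtain \<kappa> where \<kappa>: "reg_cond_distr d \<mu> S Q \<kappa>"
      "\<And>x y. x \<in> space (cube_space d S) \<Longrightarrow> y \<in> space (cube_space d S) \<Longrightarrow> tv_dist (\<kappa> x) (\<kappa> y) \<le> L * sup_dist d S x y"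
      using tv unfolding tv_lipschitz_cond_def by blast
    have "tv_dist (\<kappa> x) (\<kappa> y) \<le> max L 0 * sup_dist d S x y" if "x \<in> space (cube_space d S)" "y \<in> space (cube_space d S)" for x y
      using \<kappa>(2)[OF that] mult_right_mono[OF max.cobounded1[of L 0] sup_dist_nonneg[OF S, of x y]] by linarith
    then show ?thesis using \<kappa>(1) unfolding lip_kernel_def by blast
  qed
qed

lemma pre_eq: "pre G k = pred k" by (simp add: pre_def pred_def)

definition single :: "nat \<Rightarrow> (nat \<Rightarrow> nat) \<Rightarrow> nat \<Rightarrow> nat \<Rightarrow> nat" where "single k q = (\<lambda>i\<in>{k}. q)"

lemma override_single: "override {k} (single k q) z = z(k := q)"
  by (auto simp: override_def single_def fun_eq_iff)

lemma sum_single: "(\<Sum>y\<in>PiE {k} B. f y) = (\<Sum>q\<in>B k. f (single k q))"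
proof -
  have s: "single k (y k) = y" if "y \<in> PiE {k} B" for y
    using that by (auto simp: single_def PiE_iff extensional_def fun_eq_iff)
  show ?thesis
    by (rule sum.reindex_bij_witness[of _ "single k" "\<lambda>y. y k"]) (auto simp: s, auto simp: single_def)
qed

text \<open>The factor 2 converts total variation into l1 distances, by
  \<open>tv_dist_partition\<close>.\<close>

lemma blocks_law_exists:
  assumes \<mu>: "\<mu> \<in> graph_measures K d G" and tv: "tv_lipschitz K d G L \<mu>"
  shows "\<exists>kap \<pi> \<rho>. blocks_law K B lev bd J \<eta> m (pa G) (law \<mu>) (2 * max L 0) kap \<pi> \<rho>"
proof -
  have pr: "prob_space \<mu>" and sets: "sets \<mu> = sets (cube_space d {1..K})" using \<mu> by (auto simp: graph_measures_def)
  obtain \<kappa> where \<kappa>: "\<And>k. k \<in> {1..K} \<Longrightarrow> reg_cond_distr d \<mu> (pa G k) {k} (\<kappa> k)" and \<mu>_eq: "\<mu> = kernel_product d G \<kappa> K"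
    using \<mu> unfolding graph_measures_def mem_Collect_eq by blast
  interpret prob_space \<mu> by fact
  interpret kernels K d G \<kappa>
    using \<kappa> pa_sub by unfold_locales (auto simp: reg_cond_distr_def)
  define L' where "L' = max L 0"
  have L': "0 \<le> L'" by (simp add: L'_def)
  have Zm: "Z \<in> \<mu> \<rightarrow>\<^sub>M count_space X" using measurable_Z[of "{1..K}"] measurable_cong_sets[OF sets refl] by blast
  have tv': "tv_lipschitz_cond d L \<mu> (pa G k) {k}" "tv_lipschitz_cond d L \<mu> (pa G k) (pred k)" "tv_lipschitz_cond d L \<mu> {k} (pa G k)"
    if k: "k \<in> {1..K}" for k
  proof -
    have *: "tv_lipschitz_cond d L \<mu> (pa G k) {k} \<and> tv_lipschitz_cond d L \<mu> (pa G k) (pred k) \<and> tv_lipschitz_cond d L \<mu> {k} (pa G k)"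
    proof (cases "k = 1")
      case True
      then have "pa G k = {}" using pa_sub[of k] by auto
      then show ?thesis by (simp add: tv_lipschitz_cond_def)
    next
      case False
      then have "k \<in> {2..K}" using k by auto
      then show ?thesis using tv unfolding tv_lipschitz_def pre_eq by blast
    qed
    then show "tv_lipschitz_cond d L \<mu> (pa G k) {k}" "tv_lipschitz_cond d L \<mu> (pa G k) (pred k)" "tv_lipschitz_cond d L \<mu> {k} (pa G k)" by blast+
  qed
  have "\<exists>f. lip_kernel L' \<mu> (pa G k) {k} f" "\<exists>f. lip_kernel L' \<mu> (pa G k) (pred k) f" "\<exists>f. lip_kernel L' \<mu> {k} (pa G k) f"
    if k: "k \<in> {1..K}" for k
    unfolding L'_def using tv'[OF k] k par_K[OF k] pred_K[OF k] by (auto intro!: lip_kernel_exists[OF pr sets])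
  then obtain f1 f2 f3 where f: "\<And>k. k \<in> {1..K} \<Longrightarrow> lip_kernel L' \<mu> (pa G k) {k} (f1 k)"
    "\<And>k. k \<in> {1..K} \<Longrightarrow> lip_kernel L' \<mu> (pa G k) (pred k) (f2 k)"
    "\<And>k. k \<in> {1..K} \<Longrightarrow> lip_kernel L' \<mu> {k} (pa G k) (f3 k)" by metis
  define kap where "kap = (\<lambda>k z q. kd (f1 k) (pa G k) {k} z (single k q))"
  define \<pi> where "\<pi> = (\<lambda>k. kd (f2 k) (pa G k) (pred k))"
  define \<rho> where "\<rho> = (\<lambda>k. kd (f3 k) {k} (pa G k))"
  have "blocks_law K B lev bd J \<eta> m (pa G) (law \<mu>) (2 * L') kap \<pi> \<rho>"
  proof
    show "pmass (law \<mu>)" by (rule pmass_law[OF pr Zm])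
    show "0 \<le> 2 * L'" using L' by simp
  next
    fix k z q assume "k \<in> {1..K}" "z \<in> X" "q \<in> B k"
    show "0 \<le> kap k z q" by (simp add: kap_def kd_def)
  next
    fix k z y assume "k \<in> {1..K}" "z \<in> X" "y \<in> PiE (pred k) B"
    show "0 \<le> \<pi> k z y" by (simp add: \<pi>_def kd_def)
  next
    fix k z y assume "k \<in> {1..K}" "z \<in> X" "y \<in> PiE (pa G k) B"
    show "0 \<le> \<rho> k z y" by (simp add: \<rho>_def kd_def)
  next
    fix k z assume k: "k \<in> {1..K}" and z: "z \<in> X"
    then have kK: "{k} \<subseteq> {1..K}" by auto
    show "(\<Sum>q\<in>B k. kap k z q) = 1"
      using kd_sum[OF f(1)[OF k] L' par_K[OF k] kK z] unfolding kap_def sum_single .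
    show "(\<Sum>y\<in>PiE (pred k) B. \<pi> k z y) = 1"
      unfolding \<pi>_def by (rule kd_sum[OF f(2)[OF k] L' par_K[OF k] pred_K[OF k] z])
    show "(\<Sum>y\<in>PiE (pa G k) B. \<rho> k z y) = 1"
      unfolding \<rho>_def by (rule kd_sum[OF f(3)[OF k] L' kK par_K[OF k] z])
    fix z' assume z': "z' \<in> X"
    show "(\<Sum>q\<in>B k. \<bar>kap k z q - kap k z' q\<bar>) \<le> 2 * L' * (\<Sum>i\<in>pa G k. bd i (z i) (z' i))"
      using kd_lip[OF f(1)[OF k] L' par_K[OF k] kK z z'] unfolding kap_def sum_single .
    show "(\<Sum>y\<in>PiE (pred k) B. \<bar>\<pi> k z y - \<pi> k z' y\<bar>) \<le> 2 * L' * (\<Sum>i\<in>pa G k. bd i (z i) (z' i))"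
      unfolding \<pi>_def by (rule kd_lip[OF f(2)[OF k] L' par_K[OF k] pred_K[OF k] z z'])
    show "(\<Sum>y\<in>PiE (pa G k) B. \<bar>\<rho> k z y - \<rho> k z' y\<bar>) \<le> 2 * L' * bd k (z k) (z' k)"
      using kd_lip[OF f(3)[OF k] L' kK par_K[OF k] z z'] by (simp add: \<rho>_def)
  next
    fix k and \<phi> \<psi> :: "(nat \<Rightarrow> nat \<Rightarrow> nat) \<Rightarrow> real" assume k: "k \<in> {1..K}" and \<phi>: "dep {1..k} \<phi>" and \<psi>: "dep {1..<k} \<psi>" and le: "\<And>z. z \<in> X \<Longrightarrow> \<bar>\<phi> z\<bar> \<le> \<psi> z"
    let ?f = "\<lambda>x. f1 k (proj d (pa G k) x)"
    have kK: "{k} \<subseteq> {1..K}" "{1..<k} \<subseteq> {1..K}" using k by auto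
    \<comment> \<open>Conditioning has to be on all earlier blocks, since \<phi> may involve
      predecessors that are not parents. This is where the factorisation of \<mu> along the graph
      enters.\<close>
    have "lip_kernel L' \<mu> {1..<k} {k} ?f"
      unfolding lip_kernel_def
    proof (intro conjI ballI)
      show "reg_cond_distr d \<mu> {1..<k} {k} ?f"
        using f(1)[OF k] \<kappa>[OF k] unfolding \<mu>_eq lip_kernel_def by (intro reg_cond_markov[OF k]) auto
      fix x y assume xy: "x \<in> space (cube_space d {1..<k})" "y \<in> space (cube_space d {1..<k})"
      have "proj d (pa G k) x \<in> space (cube_space d (pa G k))" "proj d (pa G k) y \<in> space (cube_space d (pa G k))"
        using measurable_space[OF measurable_proj[OF pa_sub]] xy by auto
      then have "tv_dist (?f x) (?f y) \<le> L' * sup_dist d (pa G k) (proj d (pa G k) x) (proj d (pa G k) y)"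
        using f(1)[OF k] unfolding lip_kernel_def by blast
      also have "\<dots> \<le> L' * sup_dist d {1..<k} x y"
        using L' by (intro mult_left_mono sup_dist_mono[OF pa_sub kK(2)])
      finally show "tv_dist (?f x) (?f y) \<le> L' * sup_dist d {1..<k} x y" .
    qed
    from kd_cond[OF this L' kK(2,1) pr sets]
    have "\<bar>E (law \<mu>) \<phi> - E (law \<mu>) (TS {k} (kd ?f {1..<k} {k}) \<phi>)\<bar> \<le> 2 * L' / 2 ^ J * E (law \<mu>) \<psi>"
    proof -
      assume *: "\<And>\<psi> b. {1..<k} \<inter> {k} = {} \<Longrightarrow> dep ({1..<k} \<union> {k}) \<psi> \<Longrightarrow>
        (\<And>z y. z \<in> X \<Longrightarrow> y \<in> PiE {k} B \<Longrightarrow> \<bar>\<psi> (override {k} y z)\<bar> \<le> b z) \<Longrightarrow>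
        \<bar>E (law \<mu>) \<psi> - E (law \<mu>) (TS {k} (kd ?f {1..<k} {k}) \<psi>)\<bar> \<le> 2 * L' / 2 ^ J * E (law \<mu>) b"
      show ?thesis
      proof (rule *)
        have "{1..<k} \<union> {k} = {1..k}" using k by auto
        then show "dep ({1..<k} \<union> {k}) \<phi>" using \<phi> by simp
        fix z y assume z: "z \<in> X" and y: "y \<in> PiE {k} B"
        have o: "override {k} y z \<in> X" by (rule X_override[OF z kK(1) y])
        have "\<psi> (override {k} y z) = \<psi> z" by (intro depD[OF \<psi>] o z) (auto simp: override_def)
        then show "\<bar>\<phi> (override {k} y z)\<bar> \<le> \<psi> z" using le[OF o] by simp
      qed simp
    qed
    moreover have "TS {k} (kd ?f {1..<k} {k}) \<phi> z = T k (kap k) \<phi> z" if "z \<in> X" for z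
    proof -
      have "proj d (pa G k) (mid {1..<k} z) = mid (pa G k) z"
        using pa_sub[of k] by (auto simp: proj_def mid_def coords_def fun_eq_iff restrict_def)
      then show ?thesis unfolding TS_def T_def sum_single override_single kap_def kd_def by simp
    qed
    ultimately show "\<bar>E (law \<mu>) \<phi> - E (law \<mu>) (T k (kap k) \<phi>)\<bar> \<le> 2 * L' / 2 ^ J * E (law \<mu>) \<psi>"
      using E_cong[of "TS {k} (kd ?f {1..<k} {k}) \<phi>" "T k (kap k) \<phi>" "law \<mu>"] by simp
  next
    fix k and \<phi> :: "(nat \<Rightarrow> nat \<Rightarrow> nat) \<Rightarrow> real" and b assume k: "k \<in> {1..K}" and \<phi>: "dep {1..<k} \<phi>" and le: "\<And>z. z \<in> X \<Longrightarrow> \<bar>\<phi> z\<bar> \<le> b"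
    have "pa G k \<union> pred k = {1..<k}" "pa G k \<inter> pred k = {}" using pa_sub[of k] by (auto simp: pred_def)
    then show "\<bar>E (law \<mu>) \<phi> - E (law \<mu>) (TS (pred k) (\<pi> k) \<phi>)\<bar> \<le> 2 * L' / 2 ^ J * b"
      using kd_cond[OF f(2)[OF k] L' par_K[OF k] pred_K[OF k] pr sets, of \<phi> "\<lambda>_. b"] \<phi> le X_override[OF _ pred_K[OF k]]
        E_const[OF pmass_law[OF pr Zm], of b] by (simp add: \<pi>_def)
  next
    fix k and \<phi> :: "(nat \<Rightarrow> nat \<Rightarrow> nat) \<Rightarrow> real" and b assume k: "k \<in> {1..K}" and \<phi>: "dep (insert k (pa G k)) \<phi>" and le: "\<And>z. z \<in> X \<Longrightarrow> \<bar>\<phi> z\<bar> \<le> b"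
    have kK: "{k} \<subseteq> {1..K}" using k by auto
    have "{k} \<inter> pa G k = {}" using pa_sub[of k] by auto
    then show "\<bar>E (law \<mu>) \<phi> - E (law \<mu>) (TS (pa G k) (\<rho> k) \<phi>)\<bar> \<le> 2 * L' / 2 ^ J * b"
      using kd_cond[OF f(3)[OF k] L' kK par_K[OF k] pr sets, of \<phi> "\<lambda>_. b"] \<phi> le X_override[OF _ par_K[OF k]]
        E_const[OF pmass_law[OF pr Zm], of b] by (simp add: \<rho>_def)
  qed
  then show ?thesis unfolding L'_def by blast
qed

lemma kernel_product_integral:
  assumes "kernels K d G \<kappa>" and n: "Suc n \<le> K"
  shows "(\<integral>x. \<phi> (Z x) \<partial>kernel_product d G \<kappa> (Suc n)) =
    (\<integral>x. (\<Sum>q\<in>B (Suc n). measure (\<kappa> (Suc n) (proj d (pa G (Suc n)) x)) {y \<in> space (cube_space d {Suc n}). Zb (Suc n) y = q} *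
        \<phi> ((Z x)(Suc n := q))) \<partial>kernel_product d G \<kappa> n)"
proof -
  interpret kernels K d G \<kappa> by fact
  let ?P = "kernel_product d G \<kappa> n" and ?k = "Suc n"
  have k: "?k \<in> {1..K}" using n by auto
  interpret P: prob_space ?P by (rule kp_prob) (use n in simp)
  have sp: "space ?P = space (cube_space d {1..n})" by (rule sets_eq_imp_space_eq[OF kp_sets]) (use n in simp)
  have ks: "kstep d G \<kappa> n \<in> ?P \<rightarrow>\<^sub>M subprob_algebra (cube_space d {1..?k})"
    using n by (intro kp_measI measurable_prob_algebraD kstep_meas) auto
  have \<phi>n: "(\<lambda>x. \<phi> (Z x)) \<in> borel_measurable (cube_space d {1..?k})"
    by (rule measurable_compose[OF measurable_Z]) simp
  have "(\<integral>x. \<phi> (Z x) \<partial>(?P \<bind> kstep d G \<kappa> n)) = (\<integral>x. \<integral>y. \<phi> (Z y) \<partial>kstep d G \<kappa> n x \<partial>?P)"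
  proof (rule integral_bind[OF \<phi>n _ ks])
    show "\<bar>\<phi> (Z x)\<bar> \<le> (\<Sum>z\<in>X. \<bar>\<phi> z\<bar>)" for x by (rule member_le_sum[OF Z_X]) auto
    show "finite_measure ?P" by unfold_locales
    show "AE x in ?P. emeasure (kstep d G \<kappa> n x) (space (kstep d G \<kappa> n x)) \<le> ennreal 1"
    proof (rule AE_I2)
      fix x assume "x \<in> space ?P"
      then have "kstep d G \<kappa> n x \<in> space (subprob_algebra (cube_space d {1..?k}))" by (rule measurable_space[OF ks])
      then show "emeasure (kstep d G \<kappa> n x) (space (kstep d G \<kappa> n x)) \<le> ennreal 1"
        by (auto simp: space_subprob_algebra subprob_space.subprob_emeasure_le_1)
    qed
  qed
  also have "\<dots> = (\<integral>x. (\<Sum>q\<in>B ?k. measure (\<kappa> ?k (proj d (pa G ?k) x)) {y \<in> space (cube_space d {?k}). Zb ?k y = q} *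
        \<phi> ((Z x)(?k := q))) \<partial>?P)"
  proof (rule Bochner_Integration.integral_cong[OF refl])
    fix x assume "x \<in> space ?P"
    then have x: "x \<in> space (cube_space d {1..n})" by (simp add: sp)
    let ?\<kappa> = "\<kappa> ?k (proj d (pa G ?k) x)"
    let ?mg = "\<lambda>y. merge (coords d {1..n}) (coords d {?k}) (x, y)"
    have sk: "space ?\<kappa> = space (cube_space d {?k})" by (rule sets_eq_imp_space_eq[OF \<kappa>_at(2)[OF n x]])
    have Zbm: "Zb ?k \<in> ?\<kappa> \<rightarrow>\<^sub>M count_space (B ?k)"
      unfolding measurable_cong_sets[OF \<kappa>_at(2)[OF n x] refl] by (rule measurable_Zb)
    have Zmg: "Z (?mg y) = (Z x)(?k := Zb ?k y)" for y
    proof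
      fix l
      show "Z (?mg y) l = ((Z x)(?k := Zb ?k y)) l"
      proof (cases "l = ?k")
        case True
        then show ?thesis using k
          by (auto simp: Z_def Zb_def merge_def coords_def fun_eq_iff restrict_def)
      next
        case False
        have "merge (coords d {1..n}) (coords d {?k}) (x, y) (l, i) = x (l, i)" for i
          using PiE_arb[OF x[unfolded space_cube], of "(l, i)"] False
          by (cases "(l, i) \<in> coords d {1..n}") (auto simp: merge_def coords_def)
        then show ?thesis using False by (simp add: Z_def Zb_def)
      qed
    qed
    have "(\<integral>y. \<phi> (Z y) \<partial>kstep d G \<kappa> n x) = (\<integral>y. \<phi> (Z (?mg y)) \<partial>?\<kappa>)"
      unfolding kstep_def by (rule integral_distr[OF merge_meas[OF n x] \<phi>n])
    also have "\<dots> = (\<integral>y. \<phi> ((Z x)(?k := Zb ?k y)) \<partial>?\<kappa>)" by (simp only: Zmg)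
    also have "\<dots> = (\<Sum>q\<in>B ?k. measure ?\<kappa> {y \<in> space ?\<kappa>. Zb ?k y = q} * \<phi> ((Z x)(?k := q)))"
      by (rule integral_finite_range(2)[OF \<kappa>_at(1)[OF n x] fin_B[OF k] Zbm])
    finally show "(\<integral>y. \<phi> (Z y) \<partial>kstep d G \<kappa> n x) =
        (\<Sum>q\<in>B ?k. measure ?\<kappa> {y \<in> space (cube_space d {?k}). Zb ?k y = q} * \<phi> ((Z x)(?k := q)))"
      by (simp only: sk)
  qed
  finally show ?thesis by (simp only: kernel_product_Suc)
qed

end

section \<open>The smoothed empirical measure\<close>

text \<open>\<open>measure_of\<close> carries the given set function only if that is countably
  additive, which is checked here for finite combinations of measures.\<close>

lemma finite_mixture:
  fixes w :: "'i \<Rightarrow> ennreal" and M :: "'a measure"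
  assumes fin: "finite I" and N: "\<And>i. i \<in> I \<Longrightarrow> sets (N i) = sets M"
  defines "P \<equiv> measure_of (space M) (sets M) (\<lambda>B. \<Sum>i\<in>I. w i * emeasure (N i) B)"
  shows "sets P = sets M" and "A \<in> sets M \<Longrightarrow> emeasure P A = (\<Sum>i\<in>I. w i * emeasure (N i) A)"
proof -
  show s: "sets P = sets M" by (simp add: P_def)
  assume A: "A \<in> sets M"
  show "emeasure P A = (\<Sum>i\<in>I. w i * emeasure (N i) A)"
  proof (rule emeasure_measure_of[OF P_def[THEN meta_eq_to_obj_eq]])
    show "sets M \<subseteq> Pow (space M)" by (rule sets.space_closed)
    show "positive (sets P) (\<lambda>B. \<Sum>i\<in>I. w i * emeasure (N i) B)" by (simp add: positive_def)
    show "countably_additive (sets P) (\<lambda>B. \<Sum>i\<in>I. w i * emeasure (N i) B)"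
    proof (rule countably_additiveI)
      fix F :: "nat \<Rightarrow> 'a set" assume F: "range F \<subseteq> sets P" "disjoint_family F"
      have "(\<Sum>n. \<Sum>i\<in>I. w i * emeasure (N i) (F n)) = (\<Sum>i\<in>I. \<Sum>n. w i * emeasure (N i) (F n))"
        by (intro suminf_sum) simp
      also have "\<dots> = (\<Sum>i\<in>I. w i * emeasure (N i) (\<Union>n. F n))"
        using F N s by (intro sum.cong refl) (simp add: ennreal_suminf_cmult suminf_emeasure)
      finally show "(\<Sum>n. \<Sum>i\<in>I. w i * emeasure (N i) (F n)) = (\<Sum>i\<in>I. w i * emeasure (N i) (\<Union>n. F n))" .
    qed
    show "A \<in> sets P" using A s by simp
  qed
qed

section \<open>The smoothed kernels as functions of the finest cells\<close>

context grid
begin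

text \<open>Cell indices are functions of pairs \<open>(k, i)\<close>, addresses in a block are
  functions of \<open>i\<close>; this translates the former into the latter.\<close>

definition blk :: "nat \<Rightarrow> (nat \<times> nat \<Rightarrow> nat) \<Rightarrow> nat \<Rightarrow> nat" where "blk k q = (\<lambda>i\<in>{..<d k}. q (k, i))"

lemma lev_Zb: "lev k \<eta> (Zb k x) = (\<lambda>i\<in>{..<d k}. grid_index \<eta> (x (k, i)))"
  unfolding lev_def Zb_def using grid_index_div[OF level_le] by (auto simp: restrict_def fun_eq_iff)

lemma lev_Zb_eq: "lev k \<eta> (Zb k x) = lev k \<eta> (Zb k y) \<longleftrightarrow> (\<forall>i<d k. grid_index \<eta> (x (k, i)) = grid_index \<eta> (y (k, i)))"
  unfolding lev_Zb by (auto simp: restrict_def fun_eq_iff)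

lemma lev_Zb_blk: "lev k \<eta> (Zb k x) = blk k q \<longleftrightarrow> (\<forall>i<d k. grid_index \<eta> (x (k, i)) = q (k, i))"
  unfolding lev_Zb blk_def by (auto simp: restrict_def fun_eq_iff)

lemma key_Z: "k \<in> {1..K} \<Longrightarrow> key k (Z x) = key k (Z y) \<longleftrightarrow> (\<forall>l\<in>pa G k. \<forall>i<d l. grid_index \<eta> (x (l, i)) = grid_index \<eta> (y (l, i)))"
  unfolding key_eq using par_K[of k] by (auto simp: Z_apply lev_Zb_eq subset_iff)

lemma key_proj: "k \<in> {1..K} \<Longrightarrow> key k (Z (proj d (pa G k) x)) = key k (Z x)"
  by (subst key_Z) (auto simp: proj_def coords_def)

context
  fixes \<nu> k
  assumes \<nu>: "prob_space \<nu>" and sets: "sets \<nu> = sets (cube_space d {1..K})" and k: "k \<in> {1..K}"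
begin

lemma proj_in: "S \<subseteq> {1..K} \<Longrightarrow> x \<in> space \<nu> \<Longrightarrow> proj d S x \<in> space (cube_space d S)"
  using measurable_space[OF measurable_proj] sets_eq_imp_space_eq[OF sets] by auto

lemma k_sub: "{k} \<subseteq> {1..K}" using k by auto

lemma cell_event:
  assumes "x \<in> space \<nu>" shows "proj d {k} x \<in> cell d {k} \<eta> q \<longleftrightarrow> c k (Z x k) = blk k q"
  using proj_in[OF k_sub assms] k unfolding cell_def
  by (auto simp: Z_apply lev_Zb_blk coords_def proj_def)

lemma cell_of_event:
  assumes "x \<in> space \<nu>"
  shows "proj d (pa G k) x \<in> cell_of d (pa G k) \<eta> u \<longleftrightarrow> key k (Z x) = key k (Z u)"
  using proj_in[OF par_K[OF k] assms] k unfolding cell_of_def cell_def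
  by (auto simp: key_Z coords_def proj_def)

lemma Z_meas: "Z \<in> \<nu> \<rightarrow>\<^sub>M count_space X"
  using measurable_Z[of "{1..K}"] measurable_cong_sets[OF sets refl] by blast

lemma Pr_event: "(\<And>x. x \<in> space \<nu> \<Longrightarrow> Q x \<longleftrightarrow> R (Z x)) \<Longrightarrow> measure \<nu> {x \<in> space \<nu>. Q x} = Pr (law \<nu>) R"
  unfolding Pr_law(2)[OF \<nu> Z_meas] by (intro arg_cong[where f="measure \<nu>"]) auto

text \<open>Both sides fall back to the marginal on parent cells without mass, so the equality has
  no exceptional cells.\<close>

lemma transition_eq: "cell_transition d G \<nu> k (cell d {k} \<eta> q) (cell_of d (pa G k) \<eta> u) = wt (law \<nu>) k (key k (Z u)) (blk k q)"
  unfolding cell_transition_def wt_def cond_prob_def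
  using Pr_event[of "\<lambda>x. proj d (pa G k) x \<in> cell_of d (pa G k) \<eta> u" "\<lambda>z. key k z = key k (Z u)"]
    Pr_event[of "\<lambda>x. proj d {k} x \<in> cell d {k} \<eta> q" "\<lambda>z. c k (z k) = blk k q"]
    Pr_event[of "\<lambda>x. proj d {k} x \<in> cell d {k} \<eta> q \<and> proj d (pa G k) x \<in> cell_of d (pa G k) \<eta> u" "\<lambda>z. key k z = key k (Z u) \<and> c k (z k) = blk k q"]
  by (simp add: cell_event cell_of_event conj_commute)

lemma cell_sets: "cell d {k} \<eta> q \<in> sets (cube_space d {k})"
proof -
  have "cell d {k} \<eta> q = {x \<in> space (cube_space d {k}). \<forall>i\<in>coords d {k}. grid_index \<eta> (x i) = q i}" by (simp add: cell_def)
  also have "\<dots> \<in> sets (cube_space d {k})"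
    using finite_coords[OF k_sub]
    by (intro sets.sets_Collect_finite_All measurable_fibre[OF measurable_compose[OF measurable_coord measurable_grid_index]])
  finally show ?thesis .
qed

lemma pm: "proj d {k} \<in> \<nu> \<rightarrow>\<^sub>M cube_space d {k}"
  using measurable_proj[OF k_sub] measurable_cong_sets[OF sets refl] by blast

lemma marginal_props: "prob_space (marginal d {k} \<nu>)" "sets (marginal d {k} \<nu>) = sets (cube_space d {k})"
  using prob_space.prob_space_distr[OF \<nu> pm] by (auto simp: marginal_def)

lemma marginal_measure: "A \<in> sets (cube_space d {k}) \<Longrightarrow> measure (marginal d {k} \<nu>) A = measure \<nu> {x \<in> space \<nu>. proj d {k} x \<in> A}"
  unfolding marginal_def by (subst measure_distr[OF pm]) (auto intro!: arg_cong[where f="measure \<nu>"])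

lemma marginal_cell: "measure (marginal d {k} \<nu>) (cell d {k} \<eta> q) = Pr (law \<nu>) (\<lambda>z. c k (z k) = blk k q)"
  unfolding marginal_measure[OF cell_sets] by (rule Pr_event) (rule cell_event)

lemma midpoint_space: "q \<in> cell_indices d {k} \<eta> \<Longrightarrow> midpoint_of_cell d {k} \<eta> q \<in> space (cube_space d {k})"
proof -
  assume q: "q \<in> cell_indices d {k} \<eta>"
  have "(real (q i) + 1 / 2) / 2 ^ \<eta> \<in> {0..1}" if "i \<in> coords d {k}" for i
  proof -
    have "q i + 1 \<le> 2 ^ \<eta>" using q that unfolding cell_indices_def by (auto simp: PiE_iff Suc_le_eq)
    then have "real (q i + 1) \<le> 2 ^ \<eta>" by (metis of_nat_le_iff of_nat_numeral of_nat_power)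
    then show ?thesis by simp
  qed
  then show ?thesis by (auto simp: midpoint_of_cell_def space_cube)
qed

lemma in_cell:
  assumes q: "q \<in> cell_indices d {k} \<eta>"
  shows "prob_space (marginal_in_cell d \<eta> \<nu> k q)" "sets (marginal_in_cell d \<eta> \<nu> k q) = sets (cube_space d {k})"
proof -
  interpret M: prob_space "marginal d {k} \<nu>" by (rule marginal_props)
  show "sets (marginal_in_cell d \<eta> \<nu> k q) = sets (cube_space d {k})"
    unfolding marginal_in_cell_def using marginal_props(2) by simp
  show "prob_space (marginal_in_cell d \<eta> \<nu> k q)"
    unfolding marginal_in_cell_def
    using prob_space_return[OF midpoint_space[OF q]] by (auto intro!: prob_space_uniform_measure)
qed

lemma in_cell_measure:
  assumes q: "q' \<in> B k" and nz: "Pr (law \<nu>) (\<lambda>z. c k (z k) = blk k q) \<noteq> 0"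
  shows "measure (marginal_in_cell d \<eta> \<nu> k q) {y \<in> space (cube_space d {k}). Zb k y = q'} =
     (if blk k q = c k q' then mm (law \<nu>) k q' else 0)"
proof -
  interpret M: prob_space "marginal d {k} \<nu>" by (rule marginal_props)
  let ?F = "{y \<in> space (cube_space d {k}). Zb k y = q'}"
  have F: "?F \<in> sets (cube_space d {k})" by (rule measurable_fibre[OF measurable_Zb])
  have CF: "cell d {k} \<eta> q \<inter> ?F \<in> sets (cube_space d {k})" using F cell_sets by auto
  have e: "emeasure (marginal d {k} \<nu>) (cell d {k} \<eta> q) = ennreal (Pr (law \<nu>) (\<lambda>z. c k (z k) = blk k q))"
    by (simp add: M.emeasure_eq_measure marginal_cell)
  have "measure (marginal_in_cell d \<eta> \<nu> k q) ?F = measure (marginal d {k} \<nu>) (cell d {k} \<eta> q \<inter> ?F) / measure (marginal d {k} \<nu>) (cell d {k} \<eta> q)"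
    unfolding marginal_in_cell_def using nz e Pr_nonneg[OF pmass_law[OF \<nu> Z_meas], of "\<lambda>z. c k (z k) = blk k q"] F marginal_props(2)
    by (auto simp: measure_uniform_measure)
  also have "measure (marginal d {k} \<nu>) (cell d {k} \<eta> q \<inter> ?F) = Pr (law \<nu>) (\<lambda>z. c k (z k) = blk k q \<and> z k = q')"
    unfolding marginal_measure[OF CF]
  proof (rule Pr_event)
    fix x assume x: "x \<in> space \<nu>"
    show "(proj d {k} x \<in> cell d {k} \<eta> q \<inter> ?F) = (c k (Z x k) = blk k q \<and> Z x k = q')"
      using cell_event[OF x] proj_in[OF k_sub x] k by (auto simp: Zb_proj Z_apply)
  qed
  also have "\<dots> / measure (marginal d {k} \<nu>) (cell d {k} \<eta> q) = (if blk k q = c k q' then mm (law \<nu>) k q' else 0)"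
  proof (cases "blk k q = c k q'")
    case True
    have "Pr (law \<nu>) (\<lambda>z. c k (z k) = blk k q \<and> z k = q') = Pr (law \<nu>) (\<lambda>z. z k = q')"
      by (rule Pr_cong) (use True in auto)
    then show ?thesis using True by (simp add: mm_def marginal_cell)
  next
    case False
    have "Pr (law \<nu>) (\<lambda>z. c k (z k) = blk k q \<and> z k = q') = Pr (law \<nu>) (\<lambda>z. False)"
      by (rule Pr_cong) (use False in auto)
    then show ?thesis using False by (simp add: Pr_def)
  qed
  finally show ?thesis .
qed

lemma finite_cell_indices: "finite (cell_indices d {k} \<eta>)"
  unfolding cell_indices_def using finite_coords[OF k_sub] by (intro finite_PiE) auto

lemma smoothed_sets: "sets (smoothed_kernel d G \<eta> \<nu> k u) = sets (cube_space d {k})"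
  unfolding smoothed_kernel_def by (rule finite_mixture(1)[OF finite_cell_indices in_cell(2)])

lemma smoothed_measure:
  assumes q: "q \<in> B k"
  shows "emeasure (smoothed_kernel d G \<eta> \<nu> k u) {y \<in> space (cube_space d {k}). Zb k y = q} = ennreal (smk (law \<nu>) k (Z u) q)"
proof -
  let ?F = "{y \<in> space (cube_space d {k}). Zb k y = q}" and ?I = "cell_indices d {k} \<eta>"
  have F: "?F \<in> sets (cube_space d {k})" by (rule measurable_fibre[OF measurable_Zb])
  note pmr = pmass_law[OF \<nu> Z_meas]
  let ?w = "\<lambda>s. wt (law \<nu>) k (key k (Z u)) s"
  \<comment> \<open>The unique index of a coarse cell containing \<open>q\<close>. In the mixture,
    every other index contributes nothing to the mass of \<open>q\<close>.\<close>
  define q0 where "q0 = (\<lambda>i\<in>coords d {k}. c k q (snd i))"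
  have q0: "q0 \<in> ?I" "blk k q0 = c k q"
  proof -
    have "q i div 2 ^ (J - \<eta>) < 2 ^ \<eta>" if "i < d k" for i
    proof -
      have "q i < 2 ^ \<eta> * 2 ^ (J - \<eta>)" using q that level_le by (auto simp: B_def simp flip: power_add)
      then show ?thesis by (simp add: div_less_iff_less_mult)
    qed
    then show "q0 \<in> ?I" by (auto simp: q0_def cell_indices_def coords_def lev_def)
    show "blk k q0 = c k q" by (auto simp: blk_def q0_def coords_def lev_def restrict_def fun_eq_iff)
  qed
  have inj: "q' = q0" if "q' \<in> ?I" "blk k q' = c k q" for q'
  proof -
    have "q' i = q0 i" if "i \<in> coords d {k}" for i
      using \<open>blk k q' = c k q\<close> q0(2) that by (auto simp: blk_def coords_def restrict_def fun_eq_iff) metis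
    then show ?thesis using that(1) q0(1) unfolding cell_indices_def by (intro PiE_ext[of q' _ _ q0]) auto
  qed
  have "emeasure (smoothed_kernel d G \<eta> \<nu> k u) ?F =
      (\<Sum>q'\<in>?I. ennreal (?w (blk k q')) * emeasure (marginal_in_cell d \<eta> \<nu> k q') ?F)"
    unfolding smoothed_kernel_def transition_eq by (rule finite_mixture(2)[OF finite_cell_indices in_cell(2) F])
  also have "\<dots> = (\<Sum>q'\<in>?I. if q' = q0 then ennreal (?w (c k q)) * ennreal (mm (law \<nu>) k q) else 0)"
  proof (rule sum.cong[OF refl])
    fix q' assume q': "q' \<in> ?I"
    interpret N: prob_space "marginal_in_cell d \<eta> \<nu> k q'" by (rule in_cell[OF q'])
    show "ennreal (?w (blk k q')) * emeasure (marginal_in_cell d \<eta> \<nu> k q') ?F =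
        (if q' = q0 then ennreal (?w (c k q)) * ennreal (mm (law \<nu>) k q) else 0)"
    proof (cases "Pr (law \<nu>) (\<lambda>z. c k (z k) = blk k q') = 0")
      \<comment> \<open>A coarse cell without marginal mass has weight zero, so both sides
        vanish.\<close>
      case True
      then have "?w (blk k q') = 0" by (rule wt_zero[OF pmr])
      then show ?thesis by (cases "q' = q0") (simp_all add: q0(2))
    next
      case False
      have "blk k q' = c k q \<longleftrightarrow> q' = q0" using inj[OF q'] q0(2) by blast
      then show ?thesis
        unfolding N.emeasure_eq_measure in_cell_measure[OF q False] by (cases "q' = q0") (simp_all add: q0(2))
    qed
  qed
  also have "\<dots> = ennreal (?w (c k q)) * ennreal (mm (law \<nu>) k q)"
    using q0(1) finite_cell_indices by simp
  also have "\<dots> = ennreal (smk (law \<nu>) k (Z u) q)"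
    using mm_nonneg[OF pmr] by (simp add: smk_def ennreal_mult'')
  finally show ?thesis .
qed

lemma smoothed_prob: "prob_space (smoothed_kernel d G \<eta> \<nu> k u)"
proof
  let ?S = "smoothed_kernel d G \<eta> \<nu> k u"
  note pmr = pmass_law[OF \<nu> Z_meas]
  have Zbm: "Zb k \<in> ?S \<rightarrow>\<^sub>M count_space (B k)"
    unfolding measurable_cong_sets[OF smoothed_sets refl] by (rule measurable_Zb)
  have sp: "space ?S = space (cube_space d {k})" by (rule sets_eq_imp_space_eq[OF smoothed_sets])
  have "emeasure ?S (space ?S) = (\<Sum>q\<in>B k. emeasure ?S {y \<in> space (cube_space d {k}). Zb k y = q})"
    using nn_integral_finite_range[OF fin_B[OF k] Zbm, of "\<lambda>_. 1"] sp by simp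
  also have "\<dots> = ennreal (\<Sum>q\<in>B k. smk (law \<nu>) k (Z u) q)"
    using condD(1)[OF cond_smk[OF pmr k] Z_X] by (simp add: smoothed_measure sum_ennreal)
  also have "\<dots> = 1" using condD(2)[OF cond_smk[OF pmr k] Z_X] by simp
  finally show "emeasure ?S (space ?S) = 1" .
qed

lemma smoothed_meas: "smoothed_kernel d G \<eta> \<nu> k \<in> cube_space d (pa G k) \<rightarrow>\<^sub>M prob_algebra (cube_space d {k})"
proof -
  let ?S = "smoothed_kernel d G \<eta> \<nu> k"
  have eq: "?S u = ?S u'" if "key k (Z u) = key k (Z u')" for u u'
    unfolding smoothed_kernel_def transition_eq that ..
  \<comment> \<open>The kernel depends on \<open>u\<close> through \<open>key k (Z u)\<close>, hence
    factors through the finite-valued map \<open>Z\<close>, and measurability follows from that of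
    \<open>Z\<close>.\<close>
  define g where "g = (\<lambda>z. ?S (SOME u. Z u = z))"
  have "?S u = g (Z u)" for u
    unfolding g_def using someI[of "\<lambda>u'. Z u' = Z u" u] by (intro eq) simp
  then have "?S = (\<lambda>u. g (Z u))" by (rule ext)
  moreover have "(\<lambda>u. g (Z u)) \<in> cube_space d (pa G k) \<rightarrow>\<^sub>M prob_algebra (cube_space d {k})"
    by (rule measurable_compose[OF measurable_Z]) (auto simp: space_prob_algebra g_def smoothed_prob smoothed_sets)
  ultimately show ?thesis by simp
qed

end

lemma kernels_smoothed:
  assumes "prob_space \<nu>" "sets \<nu> = sets (cube_space d {1..K})"
  shows "kernels K d G (smoothed_kernel d G \<eta> \<nu>)"
  using pa_sub smoothed_meas[OF assms] by unfold_locales auto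

text \<open>Successive integration over the last block turns the kernel product into
  \<open>N\<close>. The starting point is the image of the single point of the space over the empty
  index set, where the kernel product starts.\<close>

lemma smoothed_integral:
  assumes \<nu>: "prob_space \<nu>" "sets \<nu> = sets (cube_space d {1..K})"
  shows "n \<le> K \<Longrightarrow> (\<integral>x. \<phi> (Z x) \<partial>kernel_product d G (smoothed_kernel d G \<eta> \<nu>) n) = N (smk (law \<nu>)) (Z (\<lambda>_. undefined)) n \<phi>"
proof (induction n arbitrary: \<phi>)
  case 0
  have "(\<lambda>x. \<phi> (Z x)) \<in> borel_measurable (cube_space d {})" by (rule measurable_compose[OF measurable_Z]) simp
  then show ?case by (simp add: integral_return space_cube_empty)
next
  case (Suc n)
  have k: "Suc n \<in> {1..K}" using Suc.prems by auto
  let ?S = "smoothed_kernel d G \<eta> \<nu>"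
  have "(\<integral>x. \<phi> (Z x) \<partial>kernel_product d G ?S (Suc n)) =
    (\<integral>x. (\<Sum>q\<in>B (Suc n). measure (?S (Suc n) (proj d (pa G (Suc n)) x)) {y \<in> space (cube_space d {Suc n}). Zb (Suc n) y = q} *
        \<phi> ((Z x)(Suc n := q))) \<partial>kernel_product d G ?S n)"
    by (rule kernel_product_integral[OF kernels_smoothed[OF \<nu>] Suc.prems])
  also have "\<dots> = (\<integral>x. T (Suc n) (smk (law \<nu>) (Suc n)) \<phi> (Z x) \<partial>kernel_product d G ?S n)"
  proof (rule Bochner_Integration.integral_cong[OF refl])
    fix x
    have "measure (?S (Suc n) (proj d (pa G (Suc n)) x)) {y \<in> space (cube_space d {Suc n}). Zb (Suc n) y = q} = smk (law \<nu>) (Suc n) (Z x) q"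
      if q: "q \<in> B (Suc n)" for q
      using smoothed_measure[OF \<nu> k q, of "proj d (pa G (Suc n)) x"]
        condD(1)[OF cond_smk[OF pmass_law[OF \<nu>(1) Z_meas[OF \<nu> k]] k] Z_X q, of x]
      by (simp add: measure_def smk_def key_proj[OF k])
    then show "(\<Sum>q\<in>B (Suc n). measure (?S (Suc n) (proj d (pa G (Suc n)) x)) {y \<in> space (cube_space d {Suc n}). Zb (Suc n) y = q} *
        \<phi> ((Z x)(Suc n := q))) = T (Suc n) (smk (law \<nu>) (Suc n)) \<phi> (Z x)"
      unfolding T_def by (intro sum.cong) auto
  qed
  also have "\<dots> = N (smk (law \<nu>)) (Z (\<lambda>_. undefined)) (Suc n) \<phi>"
    using Suc.IH Suc.prems by simp
  finally show ?case .
qed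

end

section \<open>The expected Wasserstein distance\<close>

lemma empirical_props:
  assumes \<mu>: "prob_space \<mu>" and n: "1 \<le> n" and \<omega>: "\<omega> \<in> space (\<Pi>\<^sub>M i\<in>{..<n}. \<mu>)"
  shows "prob_space (empirical n \<mu> \<omega>)" and "sets (empirical n \<mu> \<omega>) = sets \<mu>"
    and "A \<in> sets \<mu> \<Longrightarrow> measure (empirical n \<mu> \<omega>) A = (\<Sum>i<n. indicator A (\<omega> i)) / real n"
proof -
  have \<omega>m: "\<omega> \<in> uniform_count_measure {..<n} \<rightarrow>\<^sub>M \<mu>"
    using \<omega> by (auto simp: measurable_def space_PiM space_uniform_count_measure sets_uniform_count_measure)
  have ne: "{..<n} \<noteq> {}" using n by (simp add: lessThan_empty_iff)
  interpret U: prob_space "uniform_count_measure {..<n}" by (rule prob_space_uniform_count_measure) (use ne in auto)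
  show "prob_space (empirical n \<mu> \<omega>)" unfolding empirical_def by (rule U.prob_space_distr[OF \<omega>m])
  show "sets (empirical n \<mu> \<omega>) = sets \<mu>" by (simp add: empirical_def)
  assume A: "A \<in> sets \<mu>"
  have "measure (empirical n \<mu> \<omega>) A = measure (uniform_count_measure {..<n}) (\<omega> -` A \<inter> {..<n})"
    unfolding empirical_def by (subst measure_distr[OF \<omega>m A]) (simp add: space_uniform_count_measure)
  also have "\<dots> = real (card (\<omega> -` A \<inter> {..<n})) / real n"
    by (subst measure_uniform_count_measure) auto
  also have "real (card (\<omega> -` A \<inter> {..<n})) = (\<Sum>i<n. indicator A (\<omega> i))"
    by (simp add: indicator_def sum.If_cases Int_def vimage_def conj_commute)
  finally show "measure (empirical n \<mu> \<omega>) A = (\<Sum>i<n. indicator A (\<omega> i)) / real n" .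
qed

lemma sum_half_tail: "\<eta> \<le> J \<Longrightarrow> (\<Sum>j\<in>{Suc \<eta>..J}. 1 / 2 ^ j) = 1 / 2 ^ \<eta> - 1 / (2 :: real) ^ J"
proof (induction J rule: dec_induct)
  case (step i)
  have "(\<Sum>j\<in>{Suc \<eta>..Suc i}. 1 / 2 ^ j) = (\<Sum>j\<in>{Suc \<eta>..i}. 1 / 2 ^ j) + 1 / (2 :: real) ^ Suc i"
    using step.hyps by (intro sum.cl_ivl_Suc[THEN trans]) simp
  then show ?case unfolding step.IH by simp
qed simp

context grid
begin

definition cost :: "(nat \<Rightarrow> nat \<Rightarrow> nat) \<Rightarrow> (nat \<Rightarrow> nat \<Rightarrow> nat) \<Rightarrow> real" where
  "cost z z' = (\<Sum>k\<in>{1..K}. bd k (z k) (z' k))"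

lemma cost_sym: "cost z z' = cost z' z"
  unfolding cost_def bd_def by (simp add: abs_minus_commute)

lemma cost_triangle: "cost x z \<le> cost x y + cost y z"
  unfolding cost_def bd_def sum.distrib[symmetric] add_divide_distrib[symmetric]
  by (intro sum_mono divide_right_mono) auto

lemma cost_nonneg: "0 \<le> cost x y"
  unfolding cost_def by (intro sum_nonneg bd_nonneg)

lemma sup_dist_cost:
  assumes x: "x \<in> space (cube_space d {1..K})" "y \<in> space (cube_space d {1..K})"
  shows "sup_dist d {1..K} x y \<le> cost (Z x) (Z y) + 1 / 2 ^ J"
proof (rule sup_dist_le)
  show "0 \<le> cost (Z x) (Z y) + 1 / 2 ^ J" using cost_nonneg by simp
  fix k i assume ki: "k \<in> {1..K}" "i < d k"
  define s t where "s = x (k, i)" and "t = y (k, i)"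
  have st: "0 \<le> s" "s \<le> 1" "0 \<le> t" "t \<le> 1" using x ki by (auto simp: s_def t_def space_cube coords_def)
  let ?g = "\<lambda>t. real (grid_index J t) / 2 ^ J"
  have "\<bar>?g s - ?g t\<bar> \<le> bd k (Z x k) (Z y k)"
    unfolding bd_def using ki member_le_sum[of i "{..<d k}" "\<lambda>i. \<bar>real (Z x k i) - real (Z y k i)\<bar> / 2 ^ J"]
    by (simp add: Z_def Zb_def s_def t_def diff_divide_distrib[symmetric])
  also have "\<dots> \<le> cost (Z x) (Z y)"
    unfolding cost_def by (rule member_le_sum[OF ki(1), of "\<lambda>k. bd k (Z x k) (Z y k)"]) (auto intro: bd_nonneg)
  finally have "\<bar>?g s - ?g t\<bar> \<le> cost (Z x) (Z y)" .
  moreover have "?g s \<le> s" "s \<le> ?g s + 1 / 2 ^ J" "?g t \<le> t" "t \<le> ?g t + 1 / 2 ^ J"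
    using grid_index_bounds[of s J] grid_index_bounds[of t J] st by (simp_all add: add_divide_distrib)
  ultimately show "\<bar>x (k, i) - y (k, i)\<bar> \<le> cost (Z x) (Z y) + 1 / 2 ^ J" unfolding s_def[symmetric] t_def[symmetric] by linarith
qed simp

text \<open>\<open>gam\<close> and \<open>bias_const\<close> are \<Gamma> and \<open>Cb\<close> with
  the Lipschitz constant as an argument. The final constant has to be named before \<mu> and
  \<open>n\<close> are fixed, and these versions depend on \<open>K\<close>, \<open>d\<close> and
  \<open>L\<close> only.\<close>

definition gam :: "real \<Rightarrow> real" where "gam L = 1 + (m + 1) * (L * (3 + 2 * K * m))"
definition bias_const :: "real \<Rightarrow> real" where
  "bias_const L = 4 * L * (K * (m + 1)) + K * m * (1 + L * (K * (m + 1))) * (L * (4 + m + K * m))"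

text \<open>The bracket is \<open>law_difference\<close> for dual test functions, which have
  Lipschitz constant 1. The final \<open>1 / 2 ^ J\<close> pays for the passage from cells to
  points.\<close>

lemma wasserstein_bound:
  assumes \<mu>: "\<mu> \<in> graph_measures K d G" and tv: "tv_lipschitz K d G L \<mu>"
    and \<nu>: "prob_space \<nu>" "sets \<nu> = sets (cube_space d {1..K})"
  shows "wasserstein (sup_dist d {1..K}) \<mu> (smoothed K d G \<eta> \<nu>) \<le>
    ennreal (real K * gam (2 * max L 0) ^ K * (bias_const (2 * max L 0) * (h\<^sup>2 + 1 / 2 ^ J) + (\<Sum>k\<in>{1..K}. err (law \<mu>) (law \<nu>) k)) + 1 / 2 ^ J)"
proof -
  have pr: "prob_space \<mu>" and sets: "sets \<mu> = sets (cube_space d {1..K})" using \<mu> by (auto simp: graph_measures_def)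
  obtain kap \<pi> \<rho> where "blocks_law K B lev bd J \<eta> m (pa G) (law \<mu>) (2 * max L 0) kap \<pi> \<rho>"
    using blocks_law_exists[OF \<mu> tv] by blast
  then interpret bl: blocks_law K B lev bd J \<eta> m "pa G" "law \<mu>" "2 * max L 0" kap \<pi> \<rho> .
  define Q where "Q = smoothed K d G \<eta> \<nu>"
  interpret ks: kernels K d G "smoothed_kernel d G \<eta> \<nu>" by (rule kernels_smoothed[OF \<nu>])
  have Qp: "prob_space Q" and Qs: "sets Q = sets (cube_space d {1..K})"
    unfolding Q_def smoothed_def by (rule ks.kp_prob ks.kp_sets; simp)+
  have Zm: "Z \<in> \<mu> \<rightarrow>\<^sub>M count_space X" using measurable_Z[of "{1..K}"] measurable_cong_sets[OF sets refl] by blast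
  have ZQ: "Z \<in> Q \<rightarrow>\<^sub>M count_space X" using measurable_Z[of "{1..K}"] measurable_cong_sets[OF Qs refl] by blast
  have Z\<nu>: "Z \<in> \<nu> \<rightarrow>\<^sub>M count_space X" using measurable_Z[of "{1..K}"] measurable_cong_sets[OF \<nu>(2) refl] by blast
  define b where "b = real K * gam (2 * max L 0) ^ K * (bias_const (2 * max L 0) * (h\<^sup>2 + 1 / 2 ^ J) + (\<Sum>k\<in>{1..K}. err (law \<mu>) (law \<nu>) k))"
  have dual: "(\<Sum>z\<in>X. law \<mu> z * f z) - (\<Sum>z\<in>X. law Q z * f z) \<le> b"
    if f: "\<And>x y. x \<in> X \<Longrightarrow> y \<in> X \<Longrightarrow> f x - f y \<le> cost x y" for f
  proof -
    have "lip K 1 f"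
      unfolding lip_def
    proof (intro ballI)
      fix x y assume xy: "x \<in> X" "y \<in> X"
      have "\<bar>f x - f y\<bar> \<le> cost x y" using f[OF xy] f[OF xy(2,1)] cost_sym[of x y] by linarith
      also have "\<dots> \<le> dd {1..K} x y" unfolding cost_def dd_def by (intro sum_mono bd_le_ed)
      finally show "\<bar>f x - f y\<bar> \<le> 1 * dd {1..K} x y" by simp
    qed
    from bl.law_difference[OF pmass_law[OF \<nu>(1) Z\<nu>] Z_X order_refl this, of "\<lambda>_. undefined"]
    have "E (law \<mu>) f - N (smk (law \<nu>)) (Z (\<lambda>_. undefined)) K f \<le> b"
      by (simp add: b_def gam_def bias_const_def bl.\<Gamma>_def bl.Cb_def)
    also have "N (smk (law \<nu>)) (Z (\<lambda>_. undefined)) K f = E (law Q) f"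
      using smoothed_integral[OF \<nu> order_refl, of f] law_integral(2)[OF Qp ZQ, of f] by (simp add: Q_def smoothed_def)
    finally show ?thesis by (simp add: E_def)
  qed
  have "\<exists>g. (\<forall>x\<in>X. \<forall>y\<in>X. 0 \<le> g x y) \<and> (\<forall>x\<in>X. (\<Sum>y\<in>X. g x y) = law \<mu> x) \<and>
      (\<forall>y\<in>X. (\<Sum>x\<in>X. g x y) = law Q y) \<and> (\<Sum>x\<in>X. \<Sum>y\<in>X. g x y * cost x y) \<le> b"
    by (rule finite_kantorovich[OF finite_X ne_X _ _ _ cost_triangle cost_nonneg dual])
      (auto simp: law_def cost_def)
  then obtain g where g: "\<And>x y. x \<in> X \<Longrightarrow> y \<in> X \<Longrightarrow> 0 \<le> g x y" "\<And>x. x \<in> X \<Longrightarrow> (\<Sum>y\<in>X. g x y) = law \<mu> x"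
    "\<And>y. y \<in> X \<Longrightarrow> (\<Sum>x\<in>X. g x y) = law Q y" "(\<Sum>x\<in>X. \<Sum>y\<in>X. g x y * cost x y) \<le> b" by blast
  have "wasserstein (sup_dist d {1..K}) \<mu> Q \<le> ennreal (b + 1 / 2 ^ J)"
  proof (rule wasserstein_le_coupling[OF pr Qp _ finite_X Zm g(1) _ _ cost_nonneg _ _ g(4)])
    show "sets Q = sets \<mu>" by (simp add: sets Qs)
    show "sup_dist d {1..K} x y \<le> cost (Z x) (Z y) + 1 / 2 ^ J" if "x \<in> space \<mu>" "y \<in> space \<mu>" for x y
      using sup_dist_cost that sets_eq_imp_space_eq[OF sets] by simp
  qed (use g(2,3) in \<open>auto simp: law_def\<close>)
  then show ?thesis by (simp add: b_def Q_def)
qed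

section \<open>Numbers of cells and expected deviations\<close>

lemma card_lev: "k \<in> {1..K} \<Longrightarrow> j \<le> J \<Longrightarrow> card (lev k j ` B k) \<le> 2 ^ (j * d k)"
proof -
  assume j: "j \<le> J"
  have "lev k j ` B k \<subseteq> PiE {..<d k} (\<lambda>_. {..<2 ^ j})"
  proof
    fix s assume "s \<in> lev k j ` B k"
    then obtain q where q: "q \<in> B k" "s = lev k j q" by auto
    have "q i div 2 ^ (J - j) < 2 ^ j" if "i < d k" for i
    proof -
      have "q i < 2 ^ j * 2 ^ (J - j)" using q(1) that j by (auto simp: B_def simp flip: power_add)
      then show ?thesis by (simp add: div_less_iff_less_mult)
    qed
    then show "s \<in> PiE {..<d k} (\<lambda>_. {..<2 ^ j})" by (auto simp: q(2) lev_def)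
  qed
  then have "card (lev k j ` B k) \<le> card (PiE {..<d k} (\<lambda>_. {..<(2::nat) ^ j}))"
    by (intro card_mono finite_PiE) auto
  then show ?thesis by (simp add: card_PiE power_mult)
qed

lemma card_key:
  assumes k: "k \<in> {1..K}" shows "card (key k ` X) \<le> 2 ^ (\<eta> * d_pa d G k)"
proof -
  have fin: "finite (pa G k)" using finite_par[OF k] .
  have "key k ` X \<subseteq> PiE (pa G k) (\<lambda>i. lev i \<eta> ` B i)"
    using X_mem par_K[OF k] by (auto simp: key_def subset_iff)
  then have "card (key k ` X) \<le> card (PiE (pa G k) (\<lambda>i. lev i \<eta> ` B i))"
    using fin par_K[OF k] by (intro card_mono finite_PiE finite_imageI fin_B) auto
  also have "\<dots> = (\<Prod>i\<in>pa G k. card (lev i \<eta> ` B i))" by (rule card_PiE[OF fin])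
  also have "\<dots> \<le> (\<Prod>i\<in>pa G k. 2 ^ (\<eta> * d i))"
    using par_K[OF k] level_le by (intro prod_mono) (auto intro!: card_lev)
  also have "\<dots> = 2 ^ (\<eta> * d_pa d G k)" by (simp add: d_pa_def sum_distrib_left power_sum)
  finally show ?thesis .
qed

context
  fixes \<mu> and n :: nat
  assumes \<mu>: "prob_space \<mu>" and sets: "sets \<mu> = sets (cube_space d {1..K})" and n: "1 \<le> n"
begin

lemma Z_meas_\<mu>: "Z \<in> \<mu> \<rightarrow>\<^sub>M count_space X"
  using measurable_Z[of "{1..K}"] measurable_cong_sets[OF sets refl] by blast

text \<open>\<open>S\<close> is written with indicator sums over the sample, which makes its
  measurability evident. It is identified with the deviation of the empirical law on the sample
  space, where the empirical measure is a probability measure on the right sigma-algebra.\<close>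

lemma deviation_bound:
  assumes fin: "finite C" and g: "\<And>z. z \<in> X \<Longrightarrow> g z \<in> C"
  shows "\<exists>S. integrable (\<Pi>\<^sub>M i\<in>{..<n}. \<mu>) S \<and> (\<integral>\<omega>. S \<omega> \<partial>(\<Pi>\<^sub>M i\<in>{..<n}. \<mu>)) \<le> sqrt (real (card C) / real n) \<and>
    (\<forall>\<omega>\<in>space (\<Pi>\<^sub>M i\<in>{..<n}. \<mu>). S \<omega> = (\<Sum>a\<in>C. \<bar>Pr (law \<mu>) (\<lambda>z. g z = a) - Pr (law (empirical n \<mu> \<omega>)) (\<lambda>z. g z = a)\<bar>))"
proof -
  define A where "A = (\<lambda>a. {x \<in> space \<mu>. g (Z x) = a})"
  have A: "A a \<in> sets \<mu>" for a unfolding A_def by (rule Pr_law(1)[OF \<mu> Z_meas_\<mu>])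
  have PA: "Pr (law \<mu>) (\<lambda>z. g z = a) = measure \<mu> (A a)" for a unfolding A_def by (rule Pr_law(2)[OF \<mu> Z_meas_\<mu>])
  have "(\<Sum>a\<in>C. Pr (law \<mu>) (\<lambda>z. g z = a)) = 1"
    using Pr_split[OF fin, of "\<lambda>_. True" g "law \<mu>"] g Pr_UNIV[OF pmass_law[OF \<mu> Z_meas_\<mu>]] by simp
  then have le1: "(\<Sum>a\<in>C. measure \<mu> (A a)) \<le> 1" by (simp add: PA)
  define S where "S = (\<lambda>\<omega>. \<Sum>a\<in>C. \<bar>measure \<mu> (A a) - (\<Sum>i<n. indicator (A a) (\<omega> i)) / real n\<bar>)"
  have "S \<omega> = (\<Sum>a\<in>C. \<bar>Pr (law \<mu>) (\<lambda>z. g z = a) - Pr (law (empirical n \<mu> \<omega>)) (\<lambda>z. g z = a)\<bar>)"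
    if \<omega>: "\<omega> \<in> space (\<Pi>\<^sub>M i\<in>{..<n}. \<mu>)" for \<omega>
  proof -
    note ep = empirical_props[OF \<mu> n \<omega>]
    have "Z \<in> empirical n \<mu> \<omega> \<rightarrow>\<^sub>M count_space X" using Z_meas_\<mu> measurable_cong_sets[OF ep(2) refl] by blast
    then have "Pr (law (empirical n \<mu> \<omega>)) (\<lambda>z. g z = a) = measure (empirical n \<mu> \<omega>) (A a)" for a
      using Pr_law(2)[OF ep(1), of "\<lambda>z. g z = a"] sets_eq_imp_space_eq[OF ep(2)] by (simp add: A_def)
    then show ?thesis by (simp add: S_def PA ep(3)[OF A])
  qed
  moreover have "integrable (\<Pi>\<^sub>M i\<in>{..<n}. \<mu>) S" "(\<integral>\<omega>. S \<omega> \<partial>(\<Pi>\<^sub>M i\<in>{..<n}. \<mu>)) \<le> sqrt (real (card C) / real n)"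
    unfolding S_def using empirical_deviation[OF \<mu> fin A le1 n] by auto
  ultimately show ?thesis by blast
qed

lemma V_bound:
  assumes k: "k \<in> {1..K}" and j: "j \<le> J"
  shows "\<exists>S. integrable (\<Pi>\<^sub>M i\<in>{..<n}. \<mu>) S \<and> (\<integral>\<omega>. S \<omega> \<partial>(\<Pi>\<^sub>M i\<in>{..<n}. \<mu>)) \<le> sqrt (2 ^ (\<eta> * d_pa d G k) / real n) * sqrt (2 ^ (j * d k)) \<and>
    (\<forall>\<omega>\<in>space (\<Pi>\<^sub>M i\<in>{..<n}. \<mu>). S \<omega> = V (law \<mu>) (law (empirical n \<mu> \<omega>)) k j)"
proof -
  let ?C = "key k ` X \<times> lev k j ` B k"
  have fin: "finite ?C" using k by simp
  obtain S where S: "integrable (\<Pi>\<^sub>M i\<in>{..<n}. \<mu>) S" "(\<integral>\<omega>. S \<omega> \<partial>(\<Pi>\<^sub>M i\<in>{..<n}. \<mu>)) \<le> sqrt (real (card ?C) / real n)"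
    "\<And>\<omega>. \<omega> \<in> space (\<Pi>\<^sub>M i\<in>{..<n}. \<mu>) \<Longrightarrow> S \<omega> = (\<Sum>a\<in>?C. \<bar>Pr (law \<mu>) (\<lambda>z. (key k z, lev k j (z k)) = a) - Pr (law (empirical n \<mu> \<omega>)) (\<lambda>z. (key k z, lev k j (z k)) = a)\<bar>)"
    using deviation_bound[OF fin, of "\<lambda>z. (key k z, lev k j (z k))"] X_mem[OF _ k] by blast
  have "card ?C \<le> 2 ^ (\<eta> * d_pa d G k) * 2 ^ (j * d k)"
    unfolding card_cartesian_product by (intro mult_mono card_key card_lev k j) auto
  then have "real (card ?C) \<le> real (2 ^ (\<eta> * d_pa d G k) * 2 ^ (j * d k))" by (simp only: of_nat_le_iff)
  then have "real (card ?C) \<le> 2 ^ (\<eta> * d_pa d G k) * 2 ^ (j * d k)"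
    by (simp only: of_nat_mult of_nat_power of_nat_numeral)
  then have "sqrt (real (card ?C) / real n) \<le> sqrt (2 ^ (\<eta> * d_pa d G k) * 2 ^ (j * d k) / real n)"
    by (intro real_sqrt_le_mono divide_right_mono) auto
  also have "\<dots> = sqrt (2 ^ (\<eta> * d_pa d G k) / real n) * sqrt (2 ^ (j * d k))" by (simp add: real_sqrt_mult real_sqrt_divide)
  finally have "(\<integral>\<omega>. S \<omega> \<partial>(\<Pi>\<^sub>M i\<in>{..<n}. \<mu>)) \<le> sqrt (2 ^ (\<eta> * d_pa d G k) / real n) * sqrt (2 ^ (j * d k))" using S(2) by simp
  moreover have "S \<omega> = V (law \<mu>) (law (empirical n \<mu> \<omega>)) k j" if "\<omega> \<in> space (\<Pi>\<^sub>M i\<in>{..<n}. \<mu>)" for \<omega>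
  proof -
    define g where "g = (\<lambda>u a. \<bar>Pr (law \<mu>) (\<lambda>z. key k z = u \<and> lev k j (z k) = a) -
      Pr (law (empirical n \<mu> \<omega>)) (\<lambda>z. key k z = u \<and> lev k j (z k) = a)\<bar>)"
    have "S \<omega> = (\<Sum>p\<in>?C. g (fst p) (snd p))"
      unfolding S(3)[OF that] g_def by (simp only: prod_eq_iff fst_conv snd_conv)
    also have "\<dots> = (\<Sum>u\<in>key k ` X. \<Sum>a\<in>lev k j ` B k. g u a)"
      by (simp only: sum.cartesian_product case_prod_unfold)
    finally show ?thesis by (simp only: V_def g_def)
  qed
  ultimately show ?thesis using S(1) by blast
qed

lemma Y_bound:
  assumes k: "k \<in> {1..K}" and j: "j \<le> J"
  shows "\<exists>S. integrable (\<Pi>\<^sub>M i\<in>{..<n}. \<mu>) S \<and> (\<integral>\<omega>. S \<omega> \<partial>(\<Pi>\<^sub>M i\<in>{..<n}. \<mu>)) \<le> sqrt (1 / real n) * sqrt (2 ^ (j * d k)) \<and>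
    (\<forall>\<omega>\<in>space (\<Pi>\<^sub>M i\<in>{..<n}. \<mu>). S \<omega> = Y (law \<mu>) (law (empirical n \<mu> \<omega>)) k j)"
proof -
  let ?C = "lev k j ` B k"
  have fin: "finite ?C" using k by simp
  obtain S where S: "integrable (\<Pi>\<^sub>M i\<in>{..<n}. \<mu>) S" "(\<integral>\<omega>. S \<omega> \<partial>(\<Pi>\<^sub>M i\<in>{..<n}. \<mu>)) \<le> sqrt (real (card ?C) / real n)"
    "\<And>\<omega>. \<omega> \<in> space (\<Pi>\<^sub>M i\<in>{..<n}. \<mu>) \<Longrightarrow> S \<omega> = (\<Sum>a\<in>?C. \<bar>Pr (law \<mu>) (\<lambda>z. lev k j (z k) = a) - Pr (law (empirical n \<mu> \<omega>)) (\<lambda>z. lev k j (z k) = a)\<bar>)"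
    using deviation_bound[OF fin, of "\<lambda>z. lev k j (z k)"] X_mem[OF _ k] by blast
  have "real (card ?C) \<le> real (2 ^ (j * d k))" using card_lev[OF k j] by (simp only: of_nat_le_iff)
  then have "real (card ?C) \<le> 2 ^ (j * d k)" by (simp only: of_nat_power of_nat_numeral)
  then have "sqrt (real (card ?C) / real n) \<le> sqrt (2 ^ (j * d k) / real n)"
    by (intro real_sqrt_le_mono divide_right_mono) auto
  also have "\<dots> = sqrt (1 / real n) * sqrt (2 ^ (j * d k))" by (simp add: real_sqrt_divide)
  finally have "(\<integral>\<omega>. S \<omega> \<partial>(\<Pi>\<^sub>M i\<in>{..<n}. \<mu>)) \<le> sqrt (1 / real n) * sqrt (2 ^ (j * d k))" using S(2) by simp
  then show ?thesis using S(1,3) unfolding Y_def by blast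
qed

lemma err_bound:
  assumes k: "k \<in> {1..K}"
  shows "\<exists>S. integrable (\<Pi>\<^sub>M i\<in>{..<n}. \<mu>) S \<and>
    (\<integral>\<omega>. S \<omega> \<partial>(\<Pi>\<^sub>M i\<in>{..<n}. \<mu>)) \<le> 8 * m * (2 * (sqrt (2 ^ (\<eta> * d_pa d G k) / real n) * geo (d k) \<eta>) + sqrt (1 / real n) * geo (d k) J) \<and>
    (\<forall>\<omega>\<in>space (\<Pi>\<^sub>M i\<in>{..<n}. \<mu>). S \<omega> = err (law \<mu>) (law (empirical n \<mu> \<omega>)) k)"
proof -
  let ?P = "\<Pi>\<^sub>M i\<in>{..<n}. \<mu>"
  define a where "a = sqrt (2 ^ (\<eta> * d_pa d G k) / real n)"
  define b where "b = sqrt (1 / real n)"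
  define s where "s = (\<lambda>j. sqrt (2 ^ (j * d k)))"
  have ab: "0 \<le> a" "0 \<le> b" "\<And>j. 0 \<le> s j" by (auto simp: a_def b_def s_def)
  obtain SV where SV: "\<And>j. j \<le> J \<Longrightarrow> integrable ?P (SV j)" "\<And>j. j \<le> J \<Longrightarrow> (\<integral>\<omega>. SV j \<omega> \<partial>?P) \<le> a * s j"
    "\<And>j \<omega>. j \<le> J \<Longrightarrow> \<omega> \<in> space ?P \<Longrightarrow> SV j \<omega> = V (law \<mu>) (law (empirical n \<mu> \<omega>)) k j"
    using V_bound[OF k] unfolding a_def s_def by metis
  obtain SY where SY: "\<And>j. j \<le> J \<Longrightarrow> integrable ?P (SY j)" "\<And>j. j \<le> J \<Longrightarrow> (\<integral>\<omega>. SY j \<omega> \<partial>?P) \<le> b * s j"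
    "\<And>j \<omega>. j \<le> J \<Longrightarrow> \<omega> \<in> space ?P \<Longrightarrow> SY j \<omega> = Y (law \<mu>) (law (empirical n \<mu> \<omega>)) k j"
    using Y_bound[OF k] unfolding b_def s_def by metis
  define S where "S = (\<lambda>\<omega>. \<Sum>j\<in>{1..J}. 4 * m / 2 ^ j * (if j \<le> \<eta> then 2 * SV j \<omega> else 2 * SV \<eta> \<omega> + 2 * SY j \<omega>))"
  have int: "integrable ?P (\<lambda>\<omega>. if j \<le> \<eta> then 2 * SV j \<omega> else 2 * SV \<eta> \<omega> + 2 * SY j \<omega>)" if "j \<le> J" for j
    using SV(1) SY(1) that level_le by (cases "j \<le> \<eta>") auto
  have "integrable ?P S" unfolding S_def using int by (intro Bochner_Integration.integrable_sum integrable_mult_right) auto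
  moreover have "S \<omega> = err (law \<mu>) (law (empirical n \<mu> \<omega>)) k" if "\<omega> \<in> space ?P" for \<omega>
    unfolding S_def err_def using SV(3) SY(3) that level_le by (intro sum.cong) auto
  moreover have "(\<integral>\<omega>. S \<omega> \<partial>?P) \<le> 8 * m * (2 * (a * geo (d k) \<eta>) + b * geo (d k) J)"
  proof -
    have "(\<integral>\<omega>. S \<omega> \<partial>?P) = (\<Sum>j\<in>{1..J}. 4 * m / 2 ^ j * (\<integral>\<omega>. (if j \<le> \<eta> then 2 * SV j \<omega> else 2 * SV \<eta> \<omega> + 2 * SY j \<omega>) \<partial>?P))"
      unfolding S_def using int by (subst Bochner_Integration.integral_sum) (auto intro!: sum.cong)
    also have "\<dots> \<le> (\<Sum>j\<in>{1..J}. 4 * m / 2 ^ j * (if j \<le> \<eta> then 2 * (a * s j) else 2 * (a * s \<eta>) + 2 * (b * s j)))"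
    proof (intro sum_mono mult_left_mono)
      fix j assume j: "j \<in> {1..J}"
      show "(\<integral>\<omega>. (if j \<le> \<eta> then 2 * SV j \<omega> else 2 * SV \<eta> \<omega> + 2 * SY j \<omega>) \<partial>?P) \<le> (if j \<le> \<eta> then 2 * (a * s j) else 2 * (a * s \<eta>) + 2 * (b * s j))"
        using SV(1,2)[of j] SV(1,2)[OF level_le] SY(1,2)[of j] j by auto
    qed (use m1 in auto)
    also have "\<dots> \<le> (\<Sum>j\<in>{1..J}. 8 * m * ((if j \<le> \<eta> then a * (s j / 2 ^ j) else 0) + (if j \<le> \<eta> then 0 else a * s \<eta> * (1 / 2 ^ j)) + b * (s j / 2 ^ j)))"
    proof (rule sum_mono)
      fix j
      have "0 \<le> 8 * m * (b * (s j / 2 ^ j))" using m1 ab by simp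
      then show "4 * m / 2 ^ j * (if j \<le> \<eta> then 2 * (a * s j) else 2 * (a * s \<eta>) + 2 * (b * s j)) \<le>
          8 * m * ((if j \<le> \<eta> then a * (s j / 2 ^ j) else 0) + (if j \<le> \<eta> then 0 else a * s \<eta> * (1 / 2 ^ j)) + b * (s j / 2 ^ j))"
        by (simp add: algebra_simps add_divide_distrib)
    qed
    also have "\<dots> = 8 * m * ((\<Sum>j\<in>{1..J}. if j \<le> \<eta> then a * (s j / 2 ^ j) else 0) +
        (\<Sum>j\<in>{1..J}. if j \<le> \<eta> then 0 else a * s \<eta> * (1 / 2 ^ j)) + (\<Sum>j\<in>{1..J}. b * (s j / 2 ^ j)))"
      by (simp only: sum_distrib_left[symmetric] sum.distrib)
    also have "\<dots> \<le> 8 * m * (a * geo (d k) \<eta> + a * geo (d k) \<eta> + b * geo (d k) J)"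
    proof (intro mult_left_mono add_mono)
      have "(\<Sum>j\<in>{1..J}. if j \<le> \<eta> then a * (s j / 2 ^ j) else 0) = (\<Sum>j\<in>{1..J} \<inter> {..\<eta>}. a * (s j / 2 ^ j))"
        by (simp add: sum.If_cases atMost_def)
      also have "\<dots> \<le> (\<Sum>j\<in>{..\<eta>}. a * (s j / 2 ^ j))" using ab by (intro sum_mono2) auto
      finally show "(\<Sum>j\<in>{1..J}. if j \<le> \<eta> then a * (s j / 2 ^ j) else 0) \<le> a * geo (d k) \<eta>"
        by (simp add: geo_def s_def sum_distrib_left)
      \<comment> \<open>Beyond \<eta> the joint deviation stays at level \<eta> and the weights sum
        to at most \<open>1 / 2 ^ \<eta>\<close>. The tail thus costs no more than the last term of
        \<open>geo (d k) \<eta>\<close>, whence the factor 2 in front of the joint part.\<close>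
      have "(\<Sum>j\<in>{1..J}. if j \<le> \<eta> then 0 else a * s \<eta> * (1 / 2 ^ j)) = (\<Sum>j\<in>{Suc \<eta>..J}. a * s \<eta> * (1 / 2 ^ j))"
        by (intro sum.mono_neutral_cong_right) auto
      also have "\<dots> = a * s \<eta> * (1 / 2 ^ \<eta> - 1 / 2 ^ J)" unfolding sum_distrib_left[symmetric] sum_half_tail[OF level_le] ..
      also have "\<dots> \<le> a * s \<eta> * (1 / 2 ^ \<eta>)" using ab by (intro mult_left_mono) auto
      also have "\<dots> = a * (s \<eta> / 2 ^ \<eta>)" by simp
      also have "\<dots> \<le> a * geo (d k) \<eta>"
        unfolding geo_def s_def using ab by (intro mult_left_mono member_le_sum) auto
      finally show "(\<Sum>j\<in>{1..J}. if j \<le> \<eta> then 0 else a * s \<eta> * (1 / 2 ^ j)) \<le> a * geo (d k) \<eta>" .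
      have "(\<Sum>j\<in>{1..J}. b * (s j / 2 ^ j)) \<le> (\<Sum>j\<in>{..J}. b * (s j / 2 ^ j))" using ab by (intro sum_mono2) auto
      then show "(\<Sum>j\<in>{1..J}. b * (s j / 2 ^ j)) \<le> b * geo (d k) J" by (simp add: geo_def s_def sum_distrib_left)
    qed (use m1 in auto)
    finally show ?thesis by simp
  qed
  ultimately show ?thesis unfolding a_def b_def by blast
qed

end

lemma gam_ge1: "0 \<le> L \<Longrightarrow> 1 \<le> gam L" unfolding gam_def using m1 by simp
lemma bias_const_nonneg: "0 \<le> L \<Longrightarrow> 0 \<le> bias_const L"
  unfolding bias_const_def using m1 by (intro add_nonneg_nonneg mult_nonneg_nonneg) auto

lemma expected_wasserstein_bound:
  assumes \<mu>: "\<mu> \<in> graph_measures K d G" and tv: "tv_lipschitz K d G L \<mu>" and n: "1 \<le> n"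
    and x: "h\<^sup>2 \<le> x" "1 / 2 ^ J \<le> x"
      "\<And>k. k \<in> {1..K} \<Longrightarrow> sqrt (2 ^ (\<eta> * d_pa d G k) / real n) * geo (d k) \<eta> \<le> x"
      "\<And>k. k \<in> {1..K} \<Longrightarrow> sqrt (1 / real n) * geo (d k) J \<le> x"
  shows "(\<integral>\<^sup>+\<omega>. wasserstein (sup_dist d {1..K}) \<mu> (smoothed K d G \<eta> (empirical n \<mu> \<omega>)) \<partial>(\<Pi>\<^sub>M i\<in>{..<n}. \<mu>))
    \<le> ennreal ((real K * gam (2 * max L 0) ^ K * (2 * bias_const (2 * max L 0) + 24 * real K * m) + 1) * x)"
proof -
  let ?P = "\<Pi>\<^sub>M i\<in>{..<n}. \<mu>"
  have pr: "prob_space \<mu>" and sets: "sets \<mu> = sets (cube_space d {1..K})" using \<mu> by (auto simp: graph_measures_def)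
  interpret prob_space \<mu> by fact
  interpret P: product_prob_space "\<lambda>_. \<mu>" "{..<n}" by unfold_locales
  define \<gamma> \<beta> where "\<gamma> = real K * gam (2 * max L 0) ^ K" and "\<beta> = bias_const (2 * max L 0)"
  have \<gamma>: "0 \<le> \<gamma>" using gam_ge1[of "2 * max L 0"] by (simp add: \<gamma>_def)
  have \<beta>: "0 \<le> \<beta>" unfolding \<beta>_def by (rule bias_const_nonneg) simp
  have "\<exists>S. integrable ?P S \<and> (\<integral>\<omega>. S \<omega> \<partial>?P) \<le> 24 * m * x \<and> (\<forall>\<omega>\<in>space ?P. S \<omega> = err (law \<mu>) (law (empirical n \<mu> \<omega>)) k)"
    if k: "k \<in> {1..K}" for k
  proof -
    obtain S where S: "integrable ?P S" "(\<integral>\<omega>. S \<omega> \<partial>?P) \<le> 8 * m * (2 * (sqrt (2 ^ (\<eta> * d_pa d G k) / real n) * geo (d k) \<eta>) + sqrt (1 / real n) * geo (d k) J)"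
      "\<forall>\<omega>\<in>space ?P. S \<omega> = err (law \<mu>) (law (empirical n \<mu> \<omega>)) k"
      using err_bound[OF pr sets n k] by blast
    have "8 * m * (2 * (sqrt (2 ^ (\<eta> * d_pa d G k) / real n) * geo (d k) \<eta>) + sqrt (1 / real n) * geo (d k) J) \<le> 8 * m * (2 * x + x)"
      using x(3,4)[OF k] m1 by (intro mult_left_mono add_mono) auto
    also have "\<dots> = 24 * m * x" by simp
    finally have "(\<integral>\<omega>. S \<omega> \<partial>?P) \<le> 24 * m * x" by (rule order_trans[OF S(2)])
    then show ?thesis using S(1,3) by blast
  qed
  then obtain S where S: "\<And>k. k \<in> {1..K} \<Longrightarrow> integrable ?P (S k)" "\<And>k. k \<in> {1..K} \<Longrightarrow> (\<integral>\<omega>. S k \<omega> \<partial>?P) \<le> 24 * m * x"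
    "\<And>k \<omega>. k \<in> {1..K} \<Longrightarrow> \<omega> \<in> space ?P \<Longrightarrow> S k \<omega> = err (law \<mu>) (law (empirical n \<mu> \<omega>)) k" by metis
  define \<Phi> where "\<Phi> = (\<lambda>\<omega>. \<gamma> * (\<beta> * (h\<^sup>2 + 1 / 2 ^ J) + (\<Sum>k\<in>{1..K}. S k \<omega>)) + 1 / 2 ^ J)"
  have int: "integrable ?P (\<lambda>\<omega>. \<Sum>k\<in>{1..K}. S k \<omega>)" using S(1) by (intro Bochner_Integration.integrable_sum) auto
  have \<Phi>i: "integrable ?P \<Phi>" unfolding \<Phi>_def using int by (intro Bochner_Integration.integrable_add integrable_mult_right) auto
  have S0: "0 \<le> (\<Sum>k\<in>{1..K}. S k \<omega>)" if "\<omega> \<in> space ?P" for \<omega>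
    using S(3)[OF _ that] err_nonneg by (intro sum_nonneg) simp
  have \<Phi>0: "0 \<le> \<Phi> \<omega>" if "\<omega> \<in> space ?P" for \<omega>
    unfolding \<Phi>_def using S0[OF that] \<gamma> \<beta> by (intro add_nonneg_nonneg mult_nonneg_nonneg) auto
  have "(\<integral>\<^sup>+\<omega>. wasserstein (sup_dist d {1..K}) \<mu> (smoothed K d G \<eta> (empirical n \<mu> \<omega>)) \<partial>?P) \<le> (\<integral>\<^sup>+\<omega>. ennreal (\<Phi> \<omega>) \<partial>?P)"
  \<comment> \<open>Monotonicity of \<open>nn_integral\<close> holds for arbitrary integrands, so an
    integrable majorant is enough and the measurability of the Wasserstein distance in \<omega> need
    not be settled.\<close>
  proof (rule nn_integral_mono)
    fix \<omega> assume \<omega>: "\<omega> \<in> space ?P"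
    note ep = empirical_props[OF pr n \<omega>]
    have "sets (empirical n \<mu> \<omega>) = sets (cube_space d {1..K})" using ep(2) sets by simp
    from wasserstein_bound[OF \<mu> tv ep(1) this]
    show "wasserstein (sup_dist d {1..K}) \<mu> (smoothed K d G \<eta> (empirical n \<mu> \<omega>)) \<le> ennreal (\<Phi> \<omega>)"
      using S(3)[OF _ \<omega>] by (simp add: \<Phi>_def \<gamma>_def \<beta>_def)
  qed
  also have "\<dots> = ennreal (\<integral>\<omega>. \<Phi> \<omega> \<partial>?P)" by (rule nn_integral_eq_integral[OF \<Phi>i]) (use \<Phi>0 in auto)
  also have "(\<integral>\<omega>. \<Phi> \<omega> \<partial>?P) = \<gamma> * (\<beta> * (h\<^sup>2 + 1 / 2 ^ J) + (\<Sum>k\<in>{1..K}. \<integral>\<omega>. S k \<omega> \<partial>?P)) + 1 / 2 ^ J"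
    unfolding \<Phi>_def using int S(1) by (simp add: P.P.prob_space Bochner_Integration.integral_sum)
  also have "\<dots> \<le> \<gamma> * (\<beta> * (x + x) + (\<Sum>k\<in>{1..K}. 24 * m * x)) + x"
    using x(1,2) \<gamma> \<beta> S(2) by (intro add_mono mult_left_mono sum_mono) auto
  also have "\<dots> = (\<gamma> * (2 * \<beta> + 24 * real K * m) + 1) * x" by (simp add: algebra_simps)
  finally show ?thesis by (simp add: \<gamma>_def \<beta>_def ennreal_leI)
qed

end

theorem theorem3p2:
  fixes K :: nat and d :: "nat \<Rightarrow> nat" and E :: "(nat \<times> nat) set" and L :: real
  assumes "K \<ge> 1"
    and "\<And>k. k \<in> {1..K} \<Longrightarrow> d k \<ge> 1"
    and "sorted_dag K E"
    and "\<And>k. k \<in> {1..K} \<Longrightarrow> fully_connected E (pa E k)"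
  shows "\<exists>C :: real. \<forall>\<mu> n.
    \<mu> \<in> graph_measures K d E \<and> tv_lipschitz K d E L \<mu> \<and> n \<ge> 1 \<longrightarrow>
      (\<integral>\<^sup>+\<omega>. wasserstein (sup_dist d {1..K}) \<mu>
               (smoothed K d E (grid_level K d E n) (empirical n \<mu> \<omega>))
         \<partial>(\<Pi>\<^sub>M i\<in>{..<n}. \<mu>))
      \<le> ennreal (C * log_factor K d E n * (rate_loc K d E n + rate_max K d n))"
proof -
  \<comment> \<open>The grid constants are taken outside the locale, whose levels vary with
    \<open>n\<close>; they depend on \<open>K\<close>, \<open>d\<close> and \<open>L\<close> alone,
    and \<open>rate_const\<close> adds the exponents.\<close>
  define C where "C = (real K * grid.gam K d (2 * max L 0) ^ K *
      (2 * grid.bias_const K d (2 * max L 0) + 24 * real K * grid.m K d) + 1) * rate_const K d E"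
  show ?thesis
  proof (intro exI[of _ C] allI impI)
    fix \<mu> :: "point measure" and n :: nat
    assume *: "\<mu> \<in> graph_measures K d E \<and> tv_lipschitz K d E L \<mu> \<and> n \<ge> 1"
    then have n: "1 \<le> n" by blast
    have d1: "\<forall>k\<in>{1..K}. 1 \<le> d k" using assms(2) by blast
    interpret grid K d E "fine_level K d n" "grid_level K d E n"
      using assms(3,4) grid_le_fine[OF assms(1) d1 n] by unfold_locales auto
    note rb = rate_bounds[where E=E, OF assms(1) d1 n]
    from expected_wasserstein_bound[OF _ _ n rb(1)[folded h_def] rb(2-4)] *
    show "(\<integral>\<^sup>+\<omega>. wasserstein (sup_dist d {1..K}) \<mu>
               (smoothed K d E (grid_level K d E n) (empirical n \<mu> \<omega>))
         \<partial>(\<Pi>\<^sub>M i\<in>{..<n}. \<mu>))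
      \<le> ennreal (C * log_factor K d E n * (rate_loc K d E n + rate_max K d n))"
      by (simp add: C_def mult.assoc)
  qed
qed

end
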